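(* Let $\theta,\gamma,\omega,\nu,\beta$ be real with $\theta\neq0$, $\beta>0$, $\beta-\nu^2\neq0$, and let $q=\gamma+\frac{\nu(\gamma\nu-1)}{2(\beta-\nu^2)}$. Consider the Zakharov-Rubenchik system $$(\mathrm{ZR})\quad\begin{cases} i\partial_t B + \omega\partial_x^2 B = \gamma\left(\sqrt{\beta}-\frac{\nu}{2}\right)\psi_1 B - \gamma\left(\sqrt{\beta}+\frac{\nu}{2}\right)\psi_2 B + \gamma q|B|^2 B,\\ \theta\partial_{t}\psi_1 + (\sqrt{\beta}-\nu)\partial_{x}\psi_1 = \frac{\gamma}{2}\left(-1+\frac{\nu}{2\sqrt{\beta}}\right)\partial_{x}(|B|^2),\\ \theta\partial_t\psi_2 - (\nu+\sqrt{\beta})\partial_x\psi_2 = \frac{\gamma}{2}\left(-1-\frac{\nu}{2\sqrt{\beta}}\right)\partial_x(|B|^2), \end{cases}\qquad x\in\mathbb{R}.$$ (i) Assume that either $0<k<1$ and $l>2k-\tfrac12$, or $k\le 0$ and $l>-\tfrac12$. Then there are constants $T>0$, $\alpha=\alpha(k,l)>0$ and a sequence $f_N\in\mathcal{S}(\mathbb{R})$ with $\|f_N\|_{H^k}\le 1$ for all $N\in\mathbb{N}$ such that the solution $(B_N,\psi_{1,N},\psi_{2,N})$ of (ZR) on $[0,T]$ with initial data $(f_N,0,0)$ satisfies $$\|\psi_{1,N}(t)\|_{H^l}\gtrsim t\cdot N^{\alpha}\quad\text{for } 0<t\le T \text{ and } N\gtrsim \tfrac1t .$$ (ii) Similarly,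 if either $0<k<1$ and $s>2k-\tfrac12$, or $k\le 0$ and $s>-\tfrac12$, then there are constants $T>0$, $\alpha=\alpha(k,s)>0$ and a sequence $g_N\in\mathcal{S}(\mathbb{R})$ with $\|g_N\|_{H^k}\le 1$ for all $N$ such that the solution $(B_N,\psi_{1,N},\psi_{2,N})$ of (ZR) on $[0,T]$ with initial data $(g_N,0,0)$ satisfies $$\|\psi_{2,N}(t)\|_{H^s}\gtrsim t\cdot N^{\alpha}\quad\text{for } 0<t\le T \text{ and } N\gtrsim\tfrac1t .$$
   Context: $B$ is complex-valued; $\psi_1,\psi_2$ are real-valued. Initial data are listed in the order $(B,\psi_1,\psi_2)|_{t=0}$. $\mathcal{S}(\mathbb{R})$ is the Schwartz class and $H^s=H^s(\mathbb{R})$ the usual $L^2$-based Sobolev space. The notation "$X\gtrsim t N^\alpha$ for $0<t\le T$ and $N\gtrsim 1/t$" means: there are constants $c,C>0$ independent of $t$ and $N$ such that $X\ge c\,tN^\alpha$ whenever $0<t\le T$ and $N\ge C/t$.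
   Formalization: The formal statement adds γ≠0, and ν≠2√β in (i), ν≠−2√β in (ii): in the excluded cases the forcing in the equation for ψ_1 (resp. ψ_2) vanishes, so that component is identically zero and the claimed lower bound fails. *)

theory Defs
  imports "HOL-Analysis.Analysis"
begin

definition vderiv :: "(real \<Rightarrow> 'a::real_normed_vector) \<Rightarrow> real \<Rightarrow> 'a" where
  "vderiv f x = vector_derivative f (at x)"

definition schwartz :: "(real \<Rightarrow> complex) set" where
  "schwartz = {f. (\<forall>n x. ((vderiv ^^ n) f) differentiable (at x)) \<and>
                  (\<forall>m n. bounded (range (\<lambda>x. x ^ m *\<^sub>R (vderiv ^^ n) f x)))}"

(* Unitary normalization, so that the H^0 norm below is the L^2 norm. *)
definition fourier :: "(real \<Rightarrow> complex) \<Rightarrow> real \<Rightarrow> complex" where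
  "fourier f \<xi> =
     complex_of_real (1 / sqrt (2 * pi)) * (LINT x|lborel. cis (- (x * \<xi>)) * f x)"

(* g is the Fourier transform of u in the sense of tempered distributions, for u and g
   given by functions. This covers every u in L^2, integrable or not; g is unique up to
   null sets. *)
definition has_fourier :: "(real \<Rightarrow> complex) \<Rightarrow> (real \<Rightarrow> complex) \<Rightarrow> bool" where
  "has_fourier u g \<longleftrightarrow>
     (\<forall>\<phi>\<in>schwartz. integrable lborel (\<lambda>x. u x * fourier \<phi> x) \<and>
                   integrable lborel (\<lambda>\<xi>. g \<xi> * \<phi> \<xi>) \<and>
                   (LINT x|lborel. u x * fourier \<phi> x) = (LINT \<xi>|lborel. g \<xi> * \<phi> \<xi>))"

(* Those elements of H^s(R) that are functions; for s < 0 the full space also contains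
   tempered distributions that are not functions. *)
definition sobolev :: "real \<Rightarrow> (real \<Rightarrow> complex) set" where
  "sobolev s = {u. \<exists>g. has_fourier u g \<and>
                  integrable lborel (\<lambda>\<xi>. (1 + \<xi>\<^sup>2) powr s * (cmod (g \<xi>))\<^sup>2)}"

(* Meaningful on sobolev s only; the value does not depend on the choice of g. *)
definition sobolev_norm :: "real \<Rightarrow> (real \<Rightarrow> complex) \<Rightarrow> real" where
  "sobolev_norm s u =
     (let g = (SOME g. has_fourier u g)
      in sqrt (LINT \<xi>|lborel. (1 + \<xi>\<^sup>2) powr s * (cmod (g \<xi>))\<^sup>2))"

(* u belongs to C([0,T]; H^s) *)
definition sobolev_path :: "real \<Rightarrow> real \<Rightarrow> (real \<Rightarrow> real \<Rightarrow> complex) \<Rightarrow> bool" where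
  "sobolev_path s T u \<longleftrightarrow>
     (\<forall>t\<in>{0..T}. u t \<in> sobolev s \<and>
        ((\<lambda>t'. sobolev_norm s (\<lambda>x. u t' x - u t x)) \<longlongrightarrow> 0) (at t within {0..T}))"

(* Solutions for Schwartz data: the system holds pointwise on [0,T] x R (with one-sided time
   derivatives at the endpoints), and all components lie in C([0,T]; H^s) for every s, a class
   in which solutions are unique. The first argument of B, psi1, psi2 is time. *)
definition ZR_solution ::
  "real \<Rightarrow> real \<Rightarrow> real \<Rightarrow> real \<Rightarrow> real \<Rightarrow> real \<Rightarrow> real \<Rightarrow>
   (real \<Rightarrow> real \<Rightarrow> complex) \<Rightarrow> (real \<Rightarrow> real \<Rightarrow> real) \<Rightarrow> (real \<Rightarrow> real \<Rightarrow> real) \<Rightarrow> bool" where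
  "ZR_solution \<theta> \<gamma> \<omega> \<nu> \<beta> q T B \<psi>1 \<psi>2 \<longleftrightarrow>
     (\<forall>s. sobolev_path s T B \<and>
          sobolev_path s T (\<lambda>t x. complex_of_real (\<psi>1 t x)) \<and>
          sobolev_path s T (\<lambda>t x. complex_of_real (\<psi>2 t x))) \<and>
     (\<forall>t\<in>{0..T}. \<forall>x.
        (\<lambda>\<tau>. B \<tau> x) differentiable (at t within {0..T}) \<and>
        (\<lambda>\<tau>. \<psi>1 \<tau> x) differentiable (at t within {0..T}) \<and>
        (\<lambda>\<tau>. \<psi>2 \<tau> x) differentiable (at t within {0..T}) \<and>
        B t differentiable (at x) \<and> vderiv (B t) differentiable (at x) \<and>
        \<psi>1 t differentiable (at x) \<and> \<psi>2 t differentiable (at x) \<and>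
        \<i> * vector_derivative (\<lambda>\<tau>. B \<tau> x) (at t within {0..T})
            + complex_of_real \<omega> * vderiv (vderiv (B t)) x
          = complex_of_real (\<gamma> * (sqrt \<beta> - \<nu> / 2) * \<psi>1 t x) * B t x
            - complex_of_real (\<gamma> * (sqrt \<beta> + \<nu> / 2) * \<psi>2 t x) * B t x
            + complex_of_real (\<gamma> * q * (cmod (B t x))\<^sup>2) * B t x \<and>
        \<theta> * vector_derivative (\<lambda>\<tau>. \<psi>1 \<tau> x) (at t within {0..T})
            + (sqrt \<beta> - \<nu>) * vderiv (\<psi>1 t) x
          = \<gamma> / 2 * (- 1 + \<nu> / (2 * sqrt \<beta>)) * vderiv (\<lambda>y. (cmod (B t y))\<^sup>2) x \<and>
        \<theta> * vector_derivative (\<lambda>\<tau>. \<psi>2 \<tau> x) (at t within {0..T})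
            - (\<nu> + sqrt \<beta>) * vderiv (\<psi>2 t) x
          = \<gamma> / 2 * (- 1 - \<nu> / (2 * sqrt \<beta>)) * vderiv (\<lambda>y. (cmod (B t y))\<^sup>2) x)"

definition ZR_ivp ::
  "real \<Rightarrow> real \<Rightarrow> real \<Rightarrow> real \<Rightarrow> real \<Rightarrow> real \<Rightarrow> real \<Rightarrow> (real \<Rightarrow> complex) \<Rightarrow>
   (real \<Rightarrow> real \<Rightarrow> complex) \<Rightarrow> (real \<Rightarrow> real \<Rightarrow> real) \<Rightarrow> (real \<Rightarrow> real \<Rightarrow> real) \<Rightarrow> bool" where
  "ZR_ivp \<theta> \<gamma> \<omega> \<nu> \<beta> q T f B \<psi>1 \<psi>2 \<longleftrightarrow>
     ZR_solution \<theta> \<gamma> \<omega> \<nu> \<beta> q T B \<psi>1 \<psi>2 \<and>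
     B 0 = f \<and> \<psi>1 0 = (\<lambda>_. 0) \<and> \<psi>2 0 = (\<lambda>_. 0)"

end

theory Submission
  imports Defs "HOL-Probability.Probability"
begin

text \<open>
  Let \<open>c\<close> be the speed of the wave component and \<open>\<kappa> = c / (2 \<omega>)\<close>. For data whose spectrum consists of two
  narrow Gaussian bumps at \<open>\<kappa> \<plusminus> N\<close>, the frequency \<open>2 N\<close> of \<open>|B|\<^sup>2\<close> is in resonance with the wave equation, so
  that the wave component grows linearly in time there; the width of the bumps balances the \<open>H\<^sup>k\<close> norm
  of the data against the \<open>H\<^sup>l\<close> norm of the wave.

  The bumps are analytic of width \<open>1 / N\<close>, and in Fourier variables the system can be solved on a time
  interval of fixed length by a contraction with weights \<open>exp (- r(t) |\<xi>|)\<close> of decreasing width \<open>r(t)\<close>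
  (Cauchy-Kovalevskaya); the smallness of the data also keeps \<open>B\<close> close to the free evolution. That
  every solution is the one constructed follows from an energy estimate for the difference of two
  solutions.

  If \<open>\<omega> = 0\<close>, then \<open>|B|\<close> is constant in time, the wave component is explicit, and a Gaussian
  concentrated at the scale \<open>1 / N\<close> in space serves as initial datum.
\<close>

text \<open>A bound for every solution, without being vacuous, needs existence and uniqueness on a
  time interval that does not depend on N. The obstacle to existence is the derivative in the wave
  equations: at analyticity radius 1/N, recovering it costs a factor of order N, so the contraction
  on [0,1] closes when \<open>N * A\<^sup>2\<close> is small, \<open>A\<close> being the L1 size of
  the transform of the data. With \<open>1 / L\<close> the width of the bumps, the data have norm of
  order \<open>A * L powr (1/2) * N powr k\<close>, the resonant phase drifts by order
  \<open>N / L\<close>, and the wave reaches the norm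
  \<open>t * N powr (l + 1) * A\<^sup>2 * L powr (1/2)\<close>. Normalised data with
  \<open>L = N powr (1 + e)\<close> and \<open>e = l - 2 * k + 1/2 > 0\<close> make both
  \<open>N / L\<close> and \<open>N * A\<^sup>2\<close> at most \<open>N powr (- e)\<close> and
  leave the growth \<open>t * N powr (e / 2)\<close>. Orders \<open>k \<le> 0\<close> reduce to
  order 0, since the Sobolev norm increases with its order.\<close>

definition ift :: "(real \<Rightarrow> complex) \<Rightarrow> real \<Rightarrow> complex" where
  "ift g x = fourier g (- x)"

lemma ift_eq: "ift g x = complex_of_real (1 / sqrt (2 * pi)) * (LINT \<xi>|lborel. cis (x * \<xi>) * g \<xi>)"
  by (simp add: ift_def fourier_def mult.commute)

lemma vderiv_eqI: "(f has_vector_derivative f') (at x) \<Longrightarrow> vderiv f x = f'"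
  by (simp add: vderiv_def vector_derivative_at)

lemma differentiable_vderiv:
  "f differentiable (at x) \<Longrightarrow> (f has_vector_derivative vderiv f x) (at x)"
  by (simp add: vderiv_def vector_derivative_works)

lemma cis_measurable [measurable]: "cis \<in> borel_measurable borel"
  by (intro borel_measurable_continuous_onI) (auto intro!: continuous_intros)

section \<open>Integrability tests and differentiation under the integral sign\<close>

lemma integrable_inverse_1_plus_sq: "integrable lborel (\<lambda>x::real. inverse (1 + x\<^sup>2))"
  using integrable_inverse_1_plus_square by (simp add: set_integrable_def einterval_def)

lemma integrable_inv_sq_bound:
  fixes f :: "real \<Rightarrow> 'a::{banach, second_countable_topology}"
  assumes "f \<in> borel_measurable borel" "\<And>x. norm (f x) \<le> C / (1 + x\<^sup>2)"
  shows "integrable lborel f"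
proof (rule Bochner_Integration.integrable_bound)
  show "integrable lborel (\<lambda>x::real. C * inverse (1 + x\<^sup>2))"
    using integrable_inverse_1_plus_sq by simp
  show "AE x in lborel. norm (f x) \<le> norm (C * inverse (1 + x\<^sup>2))"
    using assms(2) by (auto simp: divide_inverse intro: order_trans[OF _ abs_ge_self])
qed (use assms in auto)

lemma integrable_pair_lborel:
  fixes f :: "real \<Rightarrow> real \<Rightarrow> 'a::{banach, second_countable_topology}"
  assumes "case_prod f \<in> borel_measurable (borel \<Otimes>\<^sub>M borel)"
    and "integrable lborel g" "integrable lborel h"
    and "\<And>x y. norm (f x y) \<le> g x * h y"
  shows "integrable (lborel \<Otimes>\<^sub>M lborel) (case_prod f)"
proof (rule Bochner_Integration.integrable_bound)
  show "integrable (lborel \<Otimes>\<^sub>M lborel) (\<lambda>(x, y). g x * h y)"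
    by (rule lborel_pair.Fubini_integrable)
       (use assms(2,3) in \<open>auto simp: abs_mult split_beta intro!: borel_measurable_times
          measurable_compose[OF measurable_fst] measurable_compose[OF measurable_snd]\<close>)
qed (use assms in \<open>auto intro!: order_trans[OF assms(4)]\<close>)

text \<open>Averaging replaces decay of \<open>F\<close> at infinity: \<open>F (x + 1) - F x\<close>
  is the integral of \<open>F' (x + s)\<close> over \<open>s\<close> in [0,1]. Integrating in
  \<open>x\<close>, translation invariance makes the difference vanish, and Fubini turns the other
  side into the integral of \<open>F'\<close>. This is the integration by parts behind
  \<open>fourier_vderiv\<close> and the energy estimate.\<close>

lemma integral_deriv_eq_0:
  fixes F :: "real \<Rightarrow> 'a::euclidean_space"
  assumes d: "\<And>x. (F has_vector_derivative F' x) (at x)"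
    and c: "continuous_on UNIV F'" and i: "integrable lborel F" "integrable lborel F'"
  shows "(LINT x|lborel. F' x) = 0"
proof -
  have m: "F' \<in> borel_measurable borel" using c by (rule borel_measurable_continuous_onI)
  have aff: "integrable lborel (\<lambda>x. G (x + s))" "(LINT x|lborel. G (x + s)) = (LINT x|lborel. G x)"
    if "integrable lborel G" for G :: "real \<Rightarrow> 'b::euclidean_space" and s
    using lborel_integrable_real_affine[OF that, of 1 s] lborel_integral_real_affine[of 1 G s]
    by (simp_all add: add.commute)
  have step: "(LINT s|lborel. indicator {0..1} s *\<^sub>R F' (x + s)) = F (x + 1) - F x" for x
  proof -
    have "(LBINT s. indicator {0..1} s *\<^sub>R F' (x + s)) = F (x + 1) - F (x + 0)"
    proof (rule integral_FTC_Icc)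
      show "((\<lambda>s. F (x + s)) has_vector_derivative F' (x + s)) (at s within {0..1})" for s
      proof -
        have "(F \<circ> (\<lambda>s. x + s) has_vector_derivative 1 *\<^sub>R F' (x + s)) (at s)"
          by (rule vector_diff_chain_at) (use d in \<open>auto intro!: derivative_eq_intros\<close>)
        then show ?thesis by (auto simp: o_def intro: has_vector_derivative_at_within)
      qed
      show "continuous_on {0..1} (\<lambda>s. F' (x + s))"
        by (rule continuous_on_compose2[OF c]) (auto intro!: continuous_intros)
    qed auto
    then show ?thesis by simp
  qed
  have I: "integrable (lborel \<Otimes>\<^sub>M lborel) (\<lambda>(s, x). indicator {0..1} s *\<^sub>R F' (x + s))"
  proof (rule lborel_pair.Fubini_integrable)
    show "(\<lambda>(s, x). indicator {0..1} s *\<^sub>R F' (x + s)) \<in> borel_measurable (lborel \<Otimes>\<^sub>M lborel)"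
      using m by measurable
    have "(LINT y|lborel. norm (indicator {0..1} s *\<^sub>R F' (y + s)))
        = indicator {0..1} s * (LINT y|lborel. norm (F' y))" for s :: real
      using aff(2)[OF integrable_norm[OF i(2)], of s] by (simp add: abs_mult)
    then show "integrable lborel (\<lambda>x. LINT y|lborel. norm (case (x, y) of (s, x) \<Rightarrow> indicator {0..1} s *\<^sub>R F' (x + s)))"
      by (simp only: prod.case) simp
    show "AE x in lborel. integrable lborel (\<lambda>y. case (x, y) of (s, x) \<Rightarrow> indicator {0..1} s *\<^sub>R F' (x + s))"
      using aff(1)[OF i(2)] by (auto intro!: AE_I2 integrable_scaleR_right)
  qed
  have "(LINT x|lborel. LINT s|lborel. indicator {0..1} s *\<^sub>R F' (x + s))
      = (LINT s|lborel. LINT x|lborel. indicator {0..1} s *\<^sub>R F' (x + s))"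
    by (rule lborel_pair.Fubini_integral[OF I])
  also have "\<dots> = (LINT s|lborel. indicator {0..1::real} s *\<^sub>R (LINT x|lborel. F' x))"
    using aff(2)[OF i(2)] by simp
  also have "\<dots> = (LINT x|lborel. F' x)" by simp
  finally have "(LINT x|lborel. F' x) = (LINT x|lborel. F (x + 1) - F x)"
    by (simp add: step)
  also have "\<dots> = 0" using aff[OF i(1), of 1] i(1) by simp
  finally show ?thesis .
qed

lemma has_vector_derivative_iff_quotient:
  fixes f :: "real \<Rightarrow> 'a::real_normed_vector"
  shows "(f has_vector_derivative f') (at t within S) \<longleftrightarrow>
    ((\<lambda>s. (f s - f t) /\<^sub>R (s - t)) \<longlongrightarrow> f') (at t within S)"
proof -
  have "(f has_vector_derivative f') (at t within S) \<longleftrightarrow>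
    ((\<lambda>y. norm ((f y - f t) - (y - t) *\<^sub>R f') / norm (y - t)) \<longlongrightarrow> 0) (at t within S)"
    by (simp add: has_vector_derivative_def has_derivative_iff_norm bounded_linear_scaleR_left)
  also have "\<dots> \<longleftrightarrow> ((\<lambda>y. norm ((f y - f t) /\<^sub>R (y - t) - f')) \<longlongrightarrow> 0) (at t within S)"
  proof (rule filterlim_cong[OF refl refl])
    show "eventually (\<lambda>y. norm ((f y - f t) - (y - t) *\<^sub>R f') / norm (y - t)
        = norm ((f y - f t) /\<^sub>R (y - t) - f')) (at t within S)"
      unfolding eventually_at_filter
    proof (intro always_eventually allI impI)
      fix y assume "y \<noteq> t" "y \<in> S"
      then have "(f y - f t) /\<^sub>R (y - t) - f' = ((f y - f t) - (y - t) *\<^sub>R f') /\<^sub>R (y - t)"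
        by (simp add: scaleR_diff_right)
      then show "norm ((f y - f t) - (y - t) *\<^sub>R f') / norm (y - t)
        = norm ((f y - f t) /\<^sub>R (y - t) - f')"
        by (simp only: norm_scaleR) (simp add: divide_inverse)
    qed
  qed
  finally show ?thesis by (simp add: tendsto_norm_zero_iff LIM_zero_iff)
qed

text \<open>The mean value inequality on the convex set \<open>S\<close> makes \<open>g\<close> a
  majorant of all difference quotients, so dominated convergence applies. Derivatives are taken
  within \<open>S\<close> in order to cover the one-sided time derivatives at 0 and
  \<open>T\<close>.\<close>

lemma has_vector_derivative_integral:
  fixes F :: "real \<Rightarrow> 'b \<Rightarrow> 'a::euclidean_space"
  assumes S: "convex S" "t \<in> S"
    and d: "\<And>s x. s \<in> S \<Longrightarrow> ((\<lambda>\<tau>. F \<tau> x) has_vector_derivative F' s x) (at s within S)"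
    and b: "\<And>s x. s \<in> S \<Longrightarrow> norm (F' s x) \<le> g x"
    and g: "integrable M g" and F: "\<And>s. s \<in> S \<Longrightarrow> integrable M (F s)"
    and m: "F' t \<in> borel_measurable M"
  shows "((\<lambda>s. LINT x|M. F s x) has_vector_derivative (LINT x|M. F' t x)) (at t within S)"
proof -
  have lip: "norm (F s x - F t x) \<le> g x * \<bar>s - t\<bar>" if "s \<in> S" for s x
  proof -
    have "norm (F s x - F t x) \<le> g x * norm (s - t)"
    proof (rule differentiable_bound[OF S(1)])
      show "((\<lambda>\<tau>. F \<tau> x) has_derivative (\<lambda>h. h *\<^sub>R F' r x)) (at r within S)" if "r \<in> S" for r
        using d[OF that] by (simp add: has_vector_derivative_def)
      show "onorm (\<lambda>h. h *\<^sub>R F' r x) \<le> g x" if "r \<in> S" for r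
        by (rule onorm_le) (use b[OF that, of x] in \<open>auto simp: mult.commute[of _ "\<bar>_\<bar>"] intro!: mult_left_mono\<close>)
    qed (use S that in auto)
    then show ?thesis by simp
  qed
  have "((\<lambda>s. LINT x|M. (F s x - F t x) /\<^sub>R (s - t)) \<longlongrightarrow> (LINT x|M. F' t x)) (at t within S)"
    unfolding tendsto_at_iff_sequentially comp_def
  proof (intro allI impI)
    fix X assume X: "\<forall>i. X i \<in> S - {t}" "X \<longlonglongrightarrow> t"
    show "(\<lambda>i. LINT x|M. (F (X i) x - F t x) /\<^sub>R (X i - t)) \<longlonglongrightarrow> (LINT x|M. F' t x)"
    proof (rule integral_dominated_convergence[where w = g])
      show "AE x in M. (\<lambda>i. (F (X i) x - F t x) /\<^sub>R (X i - t)) \<longlonglongrightarrow> F' t x"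
      proof (rule AE_I2)
        fix x
        have "((\<lambda>s. (F s x - F t x) /\<^sub>R (s - t)) \<longlongrightarrow> F' t x) (at t within S)"
          using d[OF S(2), of x] by (simp add: has_vector_derivative_iff_quotient)
        then show "(\<lambda>i. (F (X i) x - F t x) /\<^sub>R (X i - t)) \<longlonglongrightarrow> F' t x"
          using X unfolding tendsto_at_iff_sequentially comp_def by blast
      qed
      show "AE x in M. norm ((F (X i) x - F t x) /\<^sub>R (X i - t)) \<le> g x" for i
      proof (rule AE_I2)
        fix x
        show "norm ((F (X i) x - F t x) /\<^sub>R (X i - t)) \<le> g x"
          using lip[of "X i" x] X(1)[rule_format, of i]
          by (simp add: abs_inverse inverse_eq_divide pos_divide_le_eq)
      qed
    qed (use m g F X S in \<open>auto intro!: borel_measurable_integrable\<close>)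
  qed
  moreover have "eventually (\<lambda>s. (LINT x|M. (F s x - F t x) /\<^sub>R (s - t)) = ((LINT x|M. F s x) - (LINT x|M. F t x)) /\<^sub>R (s - t)) (at t within S)"
    using F S(2) by (auto simp: eventually_at_filter)
  ultimately have "((\<lambda>s. ((LINT x|M. F s x) - (LINT x|M. F t x)) /\<^sub>R (s - t)) \<longlongrightarrow> (LINT x|M. F' t x)) (at t within S)"
    by (rule Lim_transform_eventually)
  then show ?thesis
    by (simp add: has_vector_derivative_iff_quotient)
qed


subsection \<open>Gaussians and the Schwartz class\<close>

text \<open>Polynomials times Gaussians with a complex linear exponent are closed under
  differentiation: the derivative only changes the polynomial. One decay bound for the class
  therefore yields the whole Schwartz property.\<close>

definition pgauss :: "complex poly \<Rightarrow> real \<Rightarrow> complex \<Rightarrow> real \<Rightarrow> complex" where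
  "pgauss p a b x = poly p (of_real x) * exp (- of_real a * (of_real x)\<^sup>2 + b * of_real x)"

lemma has_vector_derivative_pgauss:
  "(pgauss p a b has_vector_derivative pgauss (pderiv p + [:b, - 2 * of_real a:] * p) a b x) (at x)"
proof -
  have "((\<lambda>z. poly p z * exp (- of_real a * z\<^sup>2 + b * z)) has_field_derivative
     poly (pderiv p + [:b, - 2 * of_real a:] * p) (of_real x) * exp (- of_real a * (of_real x)\<^sup>2 + b * of_real x))
     (at (of_real x))"
    by (auto intro!: derivative_eq_intros simp: algebra_simps)
  from has_vector_derivative_real_field[OF this] show ?thesis
    by (simp add: pgauss_def[abs_def])
qed

lemma vderiv_funpow_pgauss:
  "(vderiv ^^ n) (pgauss p a b) = pgauss (((\<lambda>p. pderiv p + [:b, - 2 * of_real a:] * p) ^^ n) p) a b"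
proof (induction n)
  case (Suc n)
  show ?case unfolding funpow.simps o_def Suc fun_eq_iff
    by (intro allI vderiv_eqI has_vector_derivative_pgauss)
qed simp

lemma power_le_fact_exp:
  fixes x :: real assumes "0 \<le> x" shows "x ^ j \<le> fact j * exp x"
proof -
  have "(\<Sum>n\<in>{j}. x ^ n /\<^sub>R fact n) \<le> (\<Sum>n. x ^ n /\<^sub>R fact n)"
    by (rule sum_le_suminf) (use assms summable_exp_generic[of x] in auto)
  then show ?thesis by (simp add: exp_def divide_simps mult.commute)
qed

text \<open>The power is absorbed by \<open>fact j * exp |x|\<close>, after which the exponent is at
  most a downward parabola in \<open>|x|\<close>, bounded by completing the square.\<close>

lemma bounded_power_gauss:
  assumes "a > 0"
  shows "\<exists>C. \<forall>x. \<bar>x\<bar> ^ j * norm (exp (- of_real a * (of_real x)\<^sup>2 + b * of_real x :: complex)) \<le> C"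
proof (intro exI allI)
  fix x :: real
  let ?\<beta> = "\<bar>Re b\<bar> + 1"
  have "\<bar>x\<bar> ^ j * norm (exp (- of_real a * (of_real x)\<^sup>2 + b * of_real x :: complex))
      = \<bar>x\<bar> ^ j * exp (- a * x\<^sup>2 + Re b * x)"
    by (simp add: power2_eq_square)
  also have "\<dots> \<le> (fact j * exp \<bar>x\<bar>) * exp (- a * x\<^sup>2 + Re b * x)"
    by (intro mult_right_mono power_le_fact_exp) auto
  also have "\<dots> = fact j * exp (\<bar>x\<bar> - a * x\<^sup>2 + Re b * x)"
    by (simp add: exp_add exp_diff exp_minus field_simps)
  also have "\<bar>x\<bar> - a * x\<^sup>2 + Re b * x \<le> ?\<beta>\<^sup>2 / (4 * a)"
  proof -
    have "Re b * x \<le> \<bar>Re b\<bar> * \<bar>x\<bar>" by (metis abs_ge_self abs_mult)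
    moreover have "0 \<le> (2 * a * \<bar>x\<bar> - ?\<beta>)\<^sup>2 / (4 * a)" using assms by simp
    moreover have "(2 * a * \<bar>x\<bar> - ?\<beta>)\<^sup>2 / (4 * a) = a * x\<^sup>2 - ?\<beta> * \<bar>x\<bar> + ?\<beta>\<^sup>2 / (4 * a)"
    proof -
      have "(2 * a * \<bar>x\<bar> - ?\<beta>)\<^sup>2 = 4 * a * (a * x\<^sup>2 - ?\<beta> * \<bar>x\<bar>) + ?\<beta>\<^sup>2"
        by (simp add: power2_diff power_mult_distrib) (simp add: power2_eq_square algebra_simps)
      then show ?thesis using assms by (simp add: add_divide_distrib)
    qed
    ultimately show ?thesis by (simp add: algebra_simps)
  qed
  finally show "\<bar>x\<bar> ^ j * norm (exp (- of_real a * (of_real x)\<^sup>2 + b * of_real x :: complex))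
     \<le> fact j * exp (?\<beta>\<^sup>2 / (4 * a))" by simp
qed

lemma bounded_power_pgauss:
  assumes "a > 0" shows "\<exists>C. \<forall>x. \<bar>x\<bar> ^ m * norm (pgauss p a b x) \<le> C"
proof -
  have "\<forall>j. \<exists>C. \<forall>x. \<bar>x\<bar> ^ j * norm (exp (- of_real a * (of_real x)\<^sup>2 + b * of_real x :: complex)) \<le> C"
    using bounded_power_gauss[OF assms] by blast
  then obtain C where C: "\<And>j x. \<bar>x\<bar> ^ j * norm (exp (- of_real a * (of_real x)\<^sup>2 + b * of_real x :: complex)) \<le> C j"
    by metis
  have "\<bar>x\<bar> ^ m * norm (pgauss p a b x) \<le> (\<Sum>i\<le>degree p. norm (coeff p i) * C (m + i))" for x
  proof -
    have "norm (pgauss p a b x) \<le> (\<Sum>i\<le>degree p. norm (coeff p i) * \<bar>x\<bar> ^ i) *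
        norm (exp (- of_real a * (of_real x)\<^sup>2 + b * of_real x :: complex))"
      unfolding pgauss_def norm_mult poly_altdef
      by (intro mult_right_mono order_trans[OF norm_sum]) (auto simp: norm_mult norm_power)
    then have "\<bar>x\<bar> ^ m * norm (pgauss p a b x) \<le> \<bar>x\<bar> ^ m * ((\<Sum>i\<le>degree p. norm (coeff p i) * \<bar>x\<bar> ^ i) *
        norm (exp (- of_real a * (of_real x)\<^sup>2 + b * of_real x :: complex)))"
      by (intro mult_left_mono) auto
    also have "\<dots> = (\<Sum>i\<le>degree p. norm (coeff p i) * (\<bar>x\<bar> ^ (m + i) *
        norm (exp (- of_real a * (of_real x)\<^sup>2 + b * of_real x :: complex))))"
      by (simp only: sum_distrib_left sum_distrib_right power_add mult_ac)
    also have "\<dots> \<le> (\<Sum>i\<le>degree p. norm (coeff p i) * C (m + i))"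
      by (intro sum_mono mult_left_mono C) auto
    finally show ?thesis .
  qed
  then show ?thesis by blast
qed

lemma schwartz_pgauss:
  assumes "a > 0" shows "pgauss p a b \<in> schwartz"
  unfolding schwartz_def
proof (clarify, intro conjI allI)
  fix n x show "((vderiv ^^ n) (pgauss p a b)) differentiable at x"
    unfolding vderiv_funpow_pgauss
    using has_vector_derivative_pgauss by (rule differentiableI_vector)
next
  fix m n
  obtain C where "\<And>x. \<bar>x\<bar> ^ m * norm ((vderiv ^^ n) (pgauss p a b) x) \<le> C"
    using bounded_power_pgauss[OF assms] unfolding vderiv_funpow_pgauss by metis
  then show "bounded (range (\<lambda>x. x ^ m *\<^sub>R (vderiv ^^ n) (pgauss p a b) x))"
    by (auto simp: bounded_iff power_abs intro!: exI[of _ C])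
qed

lemma schwartz_funpow_vderiv:
  assumes "f \<in> schwartz"
  shows "((vderiv ^^ n) f has_vector_derivative (vderiv ^^ Suc n) f x) (at x)"
    and "\<exists>C. \<forall>x. norm (x ^ m *\<^sub>R (vderiv ^^ n) f x) \<le> C"
  using assms unfolding schwartz_def by (auto intro!: differentiable_vderiv simp: bounded_iff)

lemma schwartz_add:
  assumes f: "f \<in> schwartz" and g: "g \<in> schwartz"
  shows "(\<lambda>x. f x + g x) \<in> schwartz"
proof -
  have eq: "(vderiv ^^ n) (\<lambda>x. f x + g x) = (\<lambda>x. (vderiv ^^ n) f x + (vderiv ^^ n) g x)" for n
  proof (induction n)
    case (Suc n)
    show ?case
      unfolding funpow.simps o_def Suc fun_eq_iff
      using schwartz_funpow_vderiv(1)[OF f, of n] schwartz_funpow_vderiv(1)[OF g, of n]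
      by (intro allI vderiv_eqI) (auto intro!: has_vector_derivative_add)
  qed simp
  show ?thesis unfolding schwartz_def
  proof (clarify, intro conjI allI)
    fix n x show "((vderiv ^^ n) (\<lambda>x. f x + g x)) differentiable at x"
      unfolding eq using f g by (intro differentiable_add) (auto simp: schwartz_def)
  next
    fix m n
    show "bounded (range (\<lambda>x. x ^ m *\<^sub>R (vderiv ^^ n) (\<lambda>x. f x + g x) x))"
      unfolding eq scaleR_add_right using f g
      by (intro bounded_plus_comp) (auto simp: schwartz_def)
  qed
qed

lemma schwartz_continuous: "f \<in> schwartz \<Longrightarrow> continuous_on UNIV f"
  using schwartz_funpow_vderiv(1)[of f 0]
  by (auto intro!: continuous_at_imp_continuous_on has_vector_derivative_continuous)

lemma schwartz_vderiv: "f \<in> schwartz \<Longrightarrow> vderiv f \<in> schwartz"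
  unfolding schwartz_def
proof (clarify, intro conjI allI)
  assume *: "\<forall>n x. (vderiv ^^ n) f differentiable at x"
    "\<forall>m n. bounded (range (\<lambda>x. x ^ m *\<^sub>R (vderiv ^^ n) f x))"
  show "(vderiv ^^ n) (vderiv f) differentiable at x" for n x
    using *(1)[rule_format, of "Suc n" x] by (simp add: funpow_swap1)
  show "bounded (range (\<lambda>x. x ^ m *\<^sub>R (vderiv ^^ n) (vderiv f) x))" for m n
    using *(2)[rule_format, of m "Suc n"] by (simp add: funpow_swap1)
qed

lemma schwartz_measurable: "f \<in> schwartz \<Longrightarrow> f \<in> borel_measurable borel"
  by (intro borel_measurable_continuous_onI schwartz_continuous)

lemma schwartz_bounded: "f \<in> schwartz \<Longrightarrow> \<exists>C. \<forall>x. norm (f x) \<le> C"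
  using schwartz_funpow_vderiv(2)[of f 0 0] by simp

lemma schwartz_decay:
  assumes "f \<in> schwartz" shows "\<exists>C. \<forall>x. norm (f x) \<le> C / (1 + x\<^sup>2)"
proof -
  obtain C D where "\<And>x. norm (f x) \<le> C" "\<And>x. norm (x\<^sup>2 *\<^sub>R f x) \<le> D"
    using schwartz_funpow_vderiv(2)[OF assms, of 0 0] schwartz_funpow_vderiv(2)[OF assms, of 2 0]
    by (auto simp only: funpow_0 power_0 scaleR_one)
  then have "norm (f x) * (1 + x\<^sup>2) \<le> C + D" for x
    by (simp add: distrib_left mult.commute add_mono)
  then have "norm (f x) \<le> (C + D) / (1 + x\<^sup>2)" for x
    by (subst pos_le_divide_eq) (auto intro: add_pos_nonneg)
  then show ?thesis by blast
qed

lemma schwartz_integrable: "f \<in> schwartz \<Longrightarrow> integrable lborel f"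
  using schwartz_decay integrable_inv_sq_bound schwartz_measurable by metis

subsection \<open>Fourier inversion\<close>

lemma fourier_bounded:
  assumes "integrable lborel f"
  shows "norm (fourier f \<xi>) \<le> 1 / sqrt (2 * pi) * (LINT x|lborel. norm (f x))"
proof -
  have "norm (LINT x|lborel. cis (- (x * \<xi>)) * f x) \<le> (LINT x|lborel. norm (cis (- (x * \<xi>)) * f x))"
    by (rule integral_norm_bound)
  then have "norm (LINT x|lborel. cis (- (x * \<xi>)) * f x) \<le> (LINT x|lborel. norm (f x))"
    by (simp add: norm_mult)
  then show ?thesis
    by (simp add: fourier_def norm_mult norm_divide mult_left_mono divide_right_mono)
qed

lemma ift_bounded:
  assumes "integrable lborel f"
  shows "norm (ift f \<xi>) \<le> 1 / sqrt (2 * pi) * (LINT x|lborel. norm (f x))"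
  using fourier_bounded[OF assms] by (simp add: ift_def)

lemma integrable_cis_mult:
  assumes "integrable lborel f"
  shows "integrable lborel (\<lambda>x. cis (c * x) * f x)"
  by (rule Bochner_Integration.integrable_bound[OF assms])
     (use assms in \<open>auto simp: norm_mult\<close>)

lemma integrable_cis_mult':
  assumes "integrable lborel f"
  shows "integrable lborel (\<lambda>x. cis (- (x * c)) * f x)"
  using integrable_cis_mult[OF assms, of "-c"] by (simp add: mult.commute)

lemma continuous_fourier:
  assumes "integrable lborel f"
  shows "continuous_on UNIV (fourier f)"
proof -
  have "continuous_on UNIV (\<lambda>\<xi>. LINT x|lborel. cis (- (x * \<xi>)) * f x)"
    unfolding continuous_on_sequentially comp_def
  proof (intro allI ballI impI)
    fix X and a :: real assume "(\<forall>n. X n \<in> UNIV) \<and> X \<longlonglongrightarrow> a"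
    then have X: "X \<longlonglongrightarrow> a" by simp
    show "(\<lambda>n. LINT x|lborel. cis (- (x * X n)) * f x) \<longlonglongrightarrow> (LINT x|lborel. cis (- (x * a)) * f x)"
    proof (rule integral_dominated_convergence[where w = "\<lambda>x. norm (f x)"])
      show "AE x in lborel. (\<lambda>n. cis (- (x * X n)) * f x) \<longlonglongrightarrow> cis (- (x * a)) * f x"
        using X by (intro AE_I2 tendsto_intros) (auto intro!: tendsto_intros)
    qed (use assms in \<open>auto simp: norm_mult\<close>)
  qed
  then show ?thesis unfolding fourier_def[abs_def] by (intro continuous_intros)
qed

lemma continuous_ift:
  assumes "integrable lborel f"
  shows "continuous_on UNIV (ift f)"
  unfolding ift_def[abs_def]
  by (rule continuous_on_compose2[OF continuous_fourier[OF assms]]) (auto intro!: continuous_intros)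

text \<open>Product rule for \<open>cis (- (x * \<xi>)) * f x\<close>, whose derivative has integral
  zero.\<close>

lemma fourier_vderiv:
  assumes "f \<in> schwartz"
  shows "fourier (vderiv f) \<xi> = \<i> * of_real \<xi> * fourier f \<xi>"
proof -
  note int = schwartz_integrable[OF assms] schwartz_integrable[OF schwartz_vderiv[OF assms]]
  note cont = schwartz_continuous[OF assms] schwartz_continuous[OF schwartz_vderiv[OF assms]]
  have "(LINT x|lborel. cis (- (x * \<xi>)) * vderiv f x + (- \<i> * of_real \<xi> * cis (- (x * \<xi>))) * f x) = 0"
  proof (rule integral_deriv_eq_0[where F = "\<lambda>x. cis (- (x * \<xi>)) * f x"])
    fix x
    have "((\<lambda>x. cis (- (x * \<xi>))) has_vector_derivative (- \<i> * of_real \<xi> * cis (- (x * \<xi>)))) (at x)"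
    proof -
      have e: "cis (- (x * \<xi>)) = exp (- (\<i> * of_real \<xi>) * of_real x)" for x
        by (simp add: cis_conv_exp mult_ac)
      have "((\<lambda>z. exp (- (\<i> * of_real \<xi>) * z)) has_field_derivative
          - \<i> * of_real \<xi> * exp (- (\<i> * of_real \<xi>) * of_real x)) (at (of_real x))"
        by (auto intro!: derivative_eq_intros)
      from has_vector_derivative_real_field[OF this] show ?thesis unfolding e .
    qed
    then show "((\<lambda>x. cis (- (x * \<xi>)) * f x) has_vector_derivative
       cis (- (x * \<xi>)) * vderiv f x + (- \<i> * of_real \<xi> * cis (- (x * \<xi>))) * f x) (at x)"
      using schwartz_funpow_vderiv(1)[OF assms, of 0 x] by (intro has_vector_derivative_mult) auto
  qed (use cont int integrable_cis_mult' in \<open>auto intro!: continuous_intros Bochner_Integration.integrable_add simp: mult.assoc\<close>)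
  also have "(LINT x|lborel. cis (- (x * \<xi>)) * vderiv f x + (- \<i> * of_real \<xi> * cis (- (x * \<xi>))) * f x)
     = (LINT x|lborel. cis (- (x * \<xi>)) * vderiv f x) - \<i> * of_real \<xi> * (LINT x|lborel. cis (- (x * \<xi>)) * f x)"
    using int integrable_cis_mult' by (subst Bochner_Integration.integral_add) (auto simp: mult.assoc)
  finally show ?thesis by (simp add: fourier_def)
qed

text \<open>The second derivative has a bounded transform, which gives decay like
  \<open>1 / (1 + \<xi>\<^sup>2)\<close>. This makes Fourier inversion available for every Schwartz
  function.\<close>

lemma fourier_schwartz_integrable:
  assumes "f \<in> schwartz" shows "integrable lborel (fourier f)"
proof -
  let ?I = "\<lambda>f::real \<Rightarrow> complex. 1 / sqrt (2 * pi) * (LINT x|lborel. norm (f x))"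
  have "norm (fourier f \<xi>) \<le> (?I f + ?I (vderiv (vderiv f))) / (1 + \<xi>\<^sup>2)" for \<xi>
  proof -
    have "norm (fourier (vderiv (vderiv f)) \<xi>) = \<xi>\<^sup>2 * norm (fourier f \<xi>)"
      by (simp add: fourier_vderiv assms schwartz_vderiv norm_mult power2_eq_square abs_mult_self_eq mult.assoc[symmetric])
    moreover have "norm (fourier (vderiv (vderiv f)) \<xi>) \<le> ?I (vderiv (vderiv f))"
      "norm (fourier f \<xi>) \<le> ?I f"
      by (intro fourier_bounded schwartz_integrable schwartz_vderiv assms)+
    ultimately have "norm (fourier f \<xi>) * (1 + \<xi>\<^sup>2) \<le> ?I f + ?I (vderiv (vderiv f))"
      by (simp add: distrib_left mult.commute add_mono)
    then show ?thesis by (subst pos_le_divide_eq) (auto intro: add_pos_nonneg)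
  qed
  then show ?thesis
    using continuous_fourier[OF schwartz_integrable[OF assms]]
    by (intro integrable_inv_sq_bound borel_measurable_continuous_onI)
qed

text \<open>All three facts are read off from the standard normal density; the last one is its
  characteristic function, \<open>char_std_normal_distribution\<close>.\<close>

lemma gauss_integrable: "integrable lborel (\<lambda>x::real. exp (- (x\<^sup>2 / 2)))"
  and gauss_integral: "(LINT x|lborel. exp (- (x\<^sup>2 / 2)) :: real) = sqrt (2 * pi)"
  and gauss_cis: "(LINT x|lborel. cis (t * x) * of_real (exp (- (x\<^sup>2 / 2)))) = of_real (sqrt (2 * pi) * exp (- (t\<^sup>2 / 2)))"
proof -
  have e: "std_normal_density x = exp (- (x\<^sup>2 / 2)) / sqrt (2 * pi)" for x
    by (simp add: std_normal_density_def)
  have "integrable lborel (\<lambda>x. sqrt (2 * pi) * std_normal_density x)"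
    using integrable_normal_density[of 1 0] by simp
  then show "integrable lborel (\<lambda>x::real. exp (- (x\<^sup>2 / 2)))" by (simp add: e)
  have "(LINT x|lborel. sqrt (2 * pi) * std_normal_density x) = sqrt (2 * pi)"
    using integral_normal_density[of 1 0] by simp
  then show "(LINT x|lborel. exp (- (x\<^sup>2 / 2)) :: real) = sqrt (2 * pi)" by (simp add: e)
  have "of_real (exp (- (t\<^sup>2 / 2))) = char std_normal_distribution t"
    by (simp add: char_std_normal_distribution)
  also have "\<dots> = (LINT x|lborel. std_normal_density x *\<^sub>R iexp (t * x))"
    unfolding char_def by (subst integral_density) auto
  also have "\<dots> = (LINT x|lborel. (cis (t * x) * of_real (exp (- (x\<^sup>2 / 2)))) / of_real (sqrt (2 * pi)))"
    by (simp add: e cis_conv_exp scaleR_conv_of_real mult_ac)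
  finally show "(LINT x|lborel. cis (t * x) * of_real (exp (- (x\<^sup>2 / 2)))) = of_real (sqrt (2 * pi) * exp (- (t\<^sup>2 / 2)))"
    by (simp add: field_simps)
qed

lemma gauss_cis_scaled:
  assumes "L > 0"
  shows "(LINT \<xi>|lborel. cis (x * \<xi>) * of_real (exp (- ((L * (\<xi> - \<xi>0))\<^sup>2 / 2))))
     = cis (x * \<xi>0) * of_real (sqrt (2 * pi) / L * exp (- ((x / L)\<^sup>2 / 2)))"
proof -
  have "(LINT \<xi>|lborel. cis (x * \<xi>) * of_real (exp (- ((L * (\<xi> - \<xi>0))\<^sup>2 / 2))))
     = \<bar>1 / L\<bar> *\<^sub>R (LINT y|lborel. cis (x * (\<xi>0 + 1 / L * y)) * of_real (exp (- ((L * (\<xi>0 + 1 / L * y - \<xi>0))\<^sup>2 / 2))))"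
    by (rule lborel_integral_real_affine) (use assms in simp)
  also have "\<dots> = \<bar>1 / L\<bar> *\<^sub>R (LINT y|lborel. cis (x * \<xi>0) * (cis (x / L * y) * of_real (exp (- (y\<^sup>2 / 2)))))"
    using assms by (simp add: cis_mult[symmetric] distrib_left mult.assoc)
  also have "\<dots> = \<bar>1 / L\<bar> *\<^sub>R (cis (x * \<xi>0) * of_real (sqrt (2 * pi) * exp (- ((x / L)\<^sup>2 / 2))))"
    by (simp only: integral_mult_right_zero gauss_cis)
  finally show ?thesis using assms by (simp add: scaleR_conv_of_real)
qed

lemma gauss_scaled_integrable:
  assumes "L > 0"
  shows "integrable lborel (\<lambda>\<xi>::real. exp (- ((L * (\<xi> - \<xi>0))\<^sup>2 / 2)))"
    and "(LINT \<xi>|lborel. exp (- ((L * (\<xi> - \<xi>0))\<^sup>2 / 2)) :: real) = sqrt (2 * pi) / L"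
proof -
  have "integrable lborel (\<lambda>\<xi>::real. exp (- ((- L * \<xi>0 + L * \<xi>)\<^sup>2 / 2)))"
    by (rule lborel_integrable_real_affine[OF gauss_integrable]) (use assms in simp)
  then show "integrable lborel (\<lambda>\<xi>::real. exp (- ((L * (\<xi> - \<xi>0))\<^sup>2 / 2)))"
    by (simp add: algebra_simps)
  have "(LINT \<xi>|lborel. exp (- ((L * (\<xi> - \<xi>0))\<^sup>2 / 2)) :: real)
     = \<bar>1 / L\<bar> *\<^sub>R (LINT y|lborel. exp (- ((L * (\<xi>0 + 1 / L * y - \<xi>0))\<^sup>2 / 2)))"
    by (rule lborel_integral_real_affine) (use assms in simp)
  then show "(LINT \<xi>|lborel. exp (- ((L * (\<xi> - \<xi>0))\<^sup>2 / 2)) :: real) = sqrt (2 * pi) / L"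
    using assms gauss_integral by simp
qed

text \<open>The convergence factor \<open>exp (- (e x)\<^sup>2 / 2)\<close> turns the inversion integral into the
  convolution of \<open>f\<close> with an approximate identity.\<close>

lemma fourier_inversion:
  assumes f: "continuous_on UNIV f" "integrable lborel f" "\<And>x. norm (f x) \<le> C"
    and F: "integrable lborel (fourier f)"
  shows "ift (fourier f) \<xi> = f \<xi>"
proof -
  define G where "G e = (LINT x|lborel. cis (\<xi> * x) * fourier f x * of_real (exp (- ((e * x)\<^sup>2 / 2))))" for e :: real
  define H where "H e = (LINT y|lborel. f (\<xi> + e * y) * of_real (exp (- (y\<^sup>2 / 2))))" for e :: real
  have fm [measurable]: "f \<in> borel_measurable borel" using f(1) by (rule borel_measurable_continuous_onI)
  have GH: "G e = H e" if e: "e > 0" for e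
  proof -
    have "G e = (LINT x|lborel. LINT y|lborel. of_real (1 / sqrt (2 * pi)) *
        (cis (x * (\<xi> - y)) * of_real (exp (- ((e * x)\<^sup>2 / 2))) * f y))"
    proof -
      have "of_real (1 / sqrt (2 * pi)) * (cis (x * (\<xi> - y)) * of_real (exp (- ((e * x)\<^sup>2 / 2))) * f y)
        = (of_real (1 / sqrt (2 * pi)) * cis (\<xi> * x) * of_real (exp (- ((e * x)\<^sup>2 / 2)))) * (cis (- (y * x)) * f y)" for x y
      proof -
        have "cis (x * (\<xi> - y)) = cis (\<xi> * x) * cis (- (y * x))"
          by (simp add: cis_mult algebra_simps)
        then show ?thesis by (simp only: mult_ac)
      qed
      then show ?thesis unfolding G_def fourier_def
        by (simp only: integral_mult_right_zero) (simp only: mult_ac)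
    qed
    also have "\<dots> = (LINT y|lborel. LINT x|lborel. of_real (1 / sqrt (2 * pi)) *
        (cis (x * (\<xi> - y)) * of_real (exp (- ((e * x)\<^sup>2 / 2))) * f y))"
    proof (rule lborel_pair.Fubini_integral[symmetric], rule integrable_pair_lborel[where h = "\<lambda>y. norm (f y)"
          and g = "\<lambda>x. 1 / sqrt (2 * pi) * exp (- ((e * x)\<^sup>2 / 2))"])
      show "integrable lborel (\<lambda>x. 1 / sqrt (2 * pi) * exp (- ((e * x)\<^sup>2 / 2)))"
        using gauss_scaled_integrable(1)[OF e, of 0] by simp
    qed (use f in \<open>auto simp: norm_mult norm_divide\<close>)
    also have "\<dots> = (LINT y|lborel. of_real (1 / sqrt (2 * pi)) * of_real (sqrt (2 * pi) / e * exp (- (((\<xi> - y) / e)\<^sup>2 / 2))) * f y)"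
    proof (rule Bochner_Integration.integral_cong[OF refl])
      fix y
      show "(LINT x|lborel. of_real (1 / sqrt (2 * pi)) * (cis (x * (\<xi> - y)) * of_real (exp (- ((e * x)\<^sup>2 / 2))) * f y))
         = of_real (1 / sqrt (2 * pi)) * of_real (sqrt (2 * pi) / e * exp (- (((\<xi> - y) / e)\<^sup>2 / 2))) * f y"
        using gauss_cis_scaled[OF e, of "\<xi> - y" 0] by (simp add: mult.commute[of _ "\<xi> - y"])
    qed
    also have "\<dots> = (LINT y|lborel. of_real (1 / e * exp (- (((\<xi> - y) / e)\<^sup>2 / 2))) * f y)"
      by simp
    also have "\<dots> = \<bar>e\<bar> *\<^sub>R (LINT y|lborel. of_real (1 / e * exp (- (((\<xi> - (\<xi> + e * y)) / e)\<^sup>2 / 2))) * f (\<xi> + e * y))"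
      by (rule lborel_integral_real_affine) (use e in simp)
    also have "\<dots> = H e"
      unfolding H_def integral_scaleR_right[symmetric] using e
      by (intro Bochner_Integration.integral_cong) (auto simp: scaleR_conv_of_real)
    finally show ?thesis .
  qed
  let ?X = "\<lambda>n. 1 / real (Suc n)"
  have X: "?X \<longlonglongrightarrow> 0" by (rule LIMSEQ_Suc[OF lim_1_over_n])
  have "(\<lambda>n. G (?X n)) \<longlonglongrightarrow> (LINT x|lborel. cis (\<xi> * x) * fourier f x)"
    unfolding G_def
  proof (rule integral_dominated_convergence[where w = "\<lambda>x. norm (fourier f x)"])
    show "AE x in lborel. (\<lambda>n. cis (\<xi> * x) * fourier f x * of_real (exp (- ((?X n * x)\<^sup>2 / 2)))) \<longlonglongrightarrow> cis (\<xi> * x) * fourier f x"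
    proof (rule AE_I2)
      fix x
      have "(\<lambda>n. cis (\<xi> * x) * fourier f x * of_real (exp (- ((?X n * x)\<^sup>2 / 2)))) \<longlonglongrightarrow>
         cis (\<xi> * x) * fourier f x * of_real (exp (- ((0 * x)\<^sup>2 / 2)))"
        by (intro tendsto_intros X) auto
      then show "(\<lambda>n. cis (\<xi> * x) * fourier f x * of_real (exp (- ((?X n * x)\<^sup>2 / 2)))) \<longlonglongrightarrow> cis (\<xi> * x) * fourier f x"
        by simp
    qed
    show "AE x in lborel. norm (cis (\<xi> * x) * fourier f x * of_real (exp (- ((?X n * x)\<^sup>2 / 2)))) \<le> norm (fourier f x)" for n
      by (rule AE_I2) (auto simp: norm_mult intro!: mult_left_le)
  qed (use F in \<open>auto intro!: borel_measurable_times\<close>)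
  moreover have "(\<lambda>n. H (?X n)) \<longlonglongrightarrow> (LINT y|lborel. f \<xi> * of_real (exp (- (y\<^sup>2 / 2))))"
    unfolding H_def
  proof (rule integral_dominated_convergence[where w = "\<lambda>y. C * exp (- (y\<^sup>2 / 2))"])
    show "AE y in lborel. (\<lambda>n. f (\<xi> + ?X n * y) * of_real (exp (- (y\<^sup>2 / 2)))) \<longlonglongrightarrow> f \<xi> * of_real (exp (- (y\<^sup>2 / 2)))"
    proof (rule AE_I2)
      fix y
      have "(\<lambda>n. \<xi> + ?X n * y) \<longlonglongrightarrow> \<xi> + 0 * y" by (intro tendsto_intros X)
      then have "(\<lambda>n. f (\<xi> + ?X n * y)) \<longlonglongrightarrow> f \<xi>"
        using f(1) by (auto simp: continuous_on_sequentially o_def)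
      then show "(\<lambda>n. f (\<xi> + ?X n * y) * of_real (exp (- (y\<^sup>2 / 2)))) \<longlonglongrightarrow> f \<xi> * of_real (exp (- (y\<^sup>2 / 2)))"
        by (intro tendsto_intros)
    qed
  qed (use f(3) gauss_integrable in \<open>auto simp: norm_mult intro!: mult_right_mono\<close>)
  moreover have "(LINT y|lborel. f \<xi> * of_real (exp (- (y\<^sup>2 / 2)))) = f \<xi> * of_real (sqrt (2 * pi))"
    using gauss_cis[of 0] by simp
  ultimately have "(LINT x|lborel. cis (\<xi> * x) * fourier f x) = f \<xi> * of_real (sqrt (2 * pi))"
    using GH by (auto intro: LIMSEQ_unique)
  then show ?thesis by (simp add: ift_eq)
qed

lemma fourier_inversion_schwartz: "f \<in> schwartz \<Longrightarrow> ift (fourier f) \<xi> = f \<xi>"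
  using schwartz_bounded[of f] fourier_inversion schwartz_continuous schwartz_integrable fourier_schwartz_integrable
  by metis

text \<open>Fubini with the kernel \<open>cis (x * \<xi>)\<close>, which is symmetric in the two
  variables. Moving the transform from one factor to the other is what the distributional definition
  of \<open>has_fourier\<close> asks for.\<close>

lemma ift_duality:
  assumes u: "integrable lborel u" and v: "integrable lborel v"
  shows "(LINT x|lborel. ift u x * v x) = (LINT x|lborel. u x * ift v x)"
proof -
  have [measurable]: "u \<in> borel_measurable borel" "v \<in> borel_measurable borel"
    using u v by auto
  have "(LINT x|lborel. ift u x * v x)
     = (LINT x|lborel. LINT \<xi>|lborel. (of_real (1 / sqrt (2 * pi)) * (cis (x * \<xi>) * u \<xi>)) * v x)"
    unfolding ift_eq by (simp only: integral_mult_right_zero integral_mult_left_zero)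
  also have "\<dots> = (LINT \<xi>|lborel. LINT x|lborel. (of_real (1 / sqrt (2 * pi)) * (cis (x * \<xi>) * u \<xi>)) * v x)"
    by (rule lborel_pair.Fubini_integral[symmetric], rule integrable_pair_lborel[where h = "\<lambda>y. 1 / sqrt (2 * pi) * norm (u y)"
          and g = "\<lambda>x. norm (v x)"])
       (use u v in \<open>auto simp: norm_mult norm_divide mult.commute[of "norm (v _)"]\<close>)
  also have "\<dots> = (LINT x|lborel. u x * ift v x)"
  proof -
    have "(of_real (1 / sqrt (2 * pi)) * (cis (x * \<xi>) * u \<xi>)) * v x
      = (of_real (1 / sqrt (2 * pi)) * u \<xi>) * (cis (\<xi> * x) * v x)" for x \<xi>
      by (simp only: mult_ac)
    then show ?thesis unfolding ift_eq
      by (simp only: integral_mult_right_zero) (intro Bochner_Integration.integral_cong refl, simp only: mult_ac)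
  qed
  finally show ?thesis .
qed

lemma ift_mult_integrable:
  assumes u: "integrable lborel u" and v: "integrable lborel v"
  shows "integrable lborel (\<lambda>x. ift u x * v x)"
proof (rule Bochner_Integration.integrable_bound)
  define K where "K = 1 / sqrt (2 * pi) * (LINT x|lborel. norm (u x))"
  have K: "norm (ift u x) \<le> \<bar>K\<bar>" for x
    using ift_bounded[OF u, of x] unfolding K_def by (rule order_trans) (rule abs_ge_self)
  show "integrable lborel (\<lambda>x. \<bar>K\<bar> * norm (v x))" using v by simp
  show "AE x in lborel. norm (ift u x * v x) \<le> norm (\<bar>K\<bar> * norm (v x))"
    using K by (auto simp: norm_mult abs_mult intro!: mult_right_mono)
qed (use v borel_measurable_continuous_onI[OF continuous_ift[OF u]] in \<open>auto intro!: borel_measurable_times\<close>)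

text \<open>Duality applied to \<open>fourier \<phi>\<close>, whose inverse transform is
  \<open>\<phi>\<close> again. Solutions are built as inverse transforms of known functions, and
  this makes their Sobolev norms computable.\<close>

lemma has_fourier_ift:
  assumes g: "integrable lborel g"
  shows "has_fourier (ift g) g"
  unfolding has_fourier_def
proof (intro ballI conjI)
  fix \<phi> assume \<phi>: "\<phi> \<in> schwartz"
  note F = fourier_schwartz_integrable[OF \<phi>]
  show "integrable lborel (\<lambda>x. ift g x * fourier \<phi> x)"
    by (rule ift_mult_integrable[OF g F])
  show "integrable lborel (\<lambda>\<xi>. g \<xi> * \<phi> \<xi>)"
    using ift_mult_integrable[OF F g] by (simp add: fourier_inversion_schwartz[OF \<phi>] mult.commute)
  show "(LINT x|lborel. ift g x * fourier \<phi> x) = (LINT \<xi>|lborel. g \<xi> * \<phi> \<xi>)"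
    using ift_duality[OF g F] by (simp add: fourier_inversion_schwartz[OF \<phi>])
qed

text \<open>The positive and negative parts of \<open>r\<close> have equal mass and equal Fourier
  transforms. Normalised to probability densities they share a characteristic function, and Levy's
  uniqueness theorem identifies them.\<close>

lemma AE_eq_0_if_char_0:
  fixes r :: "real \<Rightarrow> real"
  assumes r: "integrable lborel r"
    and z: "\<And>\<eta>. (LINT x|lborel. cis (\<eta> * x) * of_real (r x)) = 0"
  shows "AE x in lborel. r x = 0"
proof -
  define P where "P x = max (r x) 0" for x
  define N where "N x = max (- r x) 0" for x
  have [measurable]: "r \<in> borel_measurable borel" using r by auto
  have PN: "integrable lborel P" "integrable lborel N" "r = (\<lambda>x. P x - N x)"
    unfolding P_def[abs_def] N_def[abs_def] using r by (auto intro!: integrable_max)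
  have [measurable]: "P \<in> borel_measurable borel" "N \<in> borel_measurable borel" using PN by auto
  have eq: "(LINT x|lborel. cis (\<eta> * x) * of_real (P x)) = (LINT x|lborel. cis (\<eta> * x) * of_real (N x))" for \<eta>
  proof -
    have "(LINT x|lborel. cis (\<eta> * x) * of_real (P x)) - (LINT x|lborel. cis (\<eta> * x) * of_real (N x))
       = (LINT x|lborel. cis (\<eta> * x) * of_real (P x) - cis (\<eta> * x) * of_real (N x))"
      by (rule Bochner_Integration.integral_diff[symmetric]) (intro integrable_cis_mult integrable_of_real PN)+
    also have "\<dots> = 0" using z[of \<eta>] by (simp add: PN(3) algebra_simps)
    finally show ?thesis by simp
  qed
  define m where "m = (LINT x|lborel. P x)"
  have mN: "(LINT x|lborel. N x) = m" using eq[of 0] by (simp add: m_def)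
  have m0: "m \<ge> 0" unfolding m_def by (rule integral_nonneg_AE) (auto simp: P_def)
  have pos: "P x \<ge> 0" "N x \<ge> 0" for x by (auto simp: P_def N_def)
  show ?thesis
  proof (cases "m = 0")
    \<comment> \<open>Mass zero cannot be normalised, but then both parts vanish almost
      everywhere.\<close>
    case True
    have "AE x in lborel. P x = 0"
      using integral_nonneg_eq_0_iff_AE[OF PN(1)] True pos by (simp add: m_def)
    moreover have "AE x in lborel. N x = 0"
      using integral_nonneg_eq_0_iff_AE[OF PN(2)] True pos mN by simp
    ultimately show ?thesis by eventually_elim (simp add: PN(3))
  next
    case False
    with m0 have m: "m > 0" by simp
    have rd: "real_distribution (density lborel (\<lambda>x. ennreal (Q x / m)))"
      if [measurable]: "Q \<in> borel_measurable borel" and Q: "integrable lborel Q" "(LINT x|lborel. Q x) = m" "\<And>x. Q x \<ge> 0" for Q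
    proof -
      have "(\<integral>\<^sup>+ x. ennreal (Q x / m) \<partial>lborel) = ennreal (LINT x|lborel. Q x / m)"
        by (rule nn_integral_eq_integral) (use Q m in auto)
      also have "\<dots> = 1" using Q m by simp
      finally have "prob_space (density lborel (\<lambda>x. ennreal (Q x / m)))"
        by (intro prob_spaceI) (simp add: emeasure_density)
      then show ?thesis by (simp add: real_distribution_def real_distribution_axioms_def)
    qed
    have ch: "char (density lborel (\<lambda>x. ennreal (Q x / m))) t = (LINT x|lborel. cis (t * x) * of_real (Q x)) / of_real m"
      if [measurable]: "Q \<in> borel_measurable borel" and Q: "\<And>x. Q x \<ge> 0" for Q t
    proof -
      have "char (density lborel (\<lambda>x. ennreal (Q x / m))) t = (LINT x|lborel. (Q x / m) *\<^sub>R iexp (t * x))"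
        unfolding char_def by (subst integral_density) (use Q m in auto)
      also have "\<dots> = (LINT x|lborel. (cis (t * x) * of_real (Q x)) / of_real m)"
        by (intro Bochner_Integration.integral_cong) (auto simp: cis_conv_exp scaleR_conv_of_real)
      finally show ?thesis by simp
    qed
    have "density lborel (\<lambda>x. ennreal (P x / m)) = density lborel (\<lambda>x. ennreal (N x / m))"
      by (rule Levy_uniqueness) (use rd PN pos mN in \<open>auto simp: ch eq fun_eq_iff m_def[symmetric]\<close>)
    then have "AE x in lborel. ennreal (P x / m) = ennreal (N x / m)"
      by (subst (asm) sigma_finite_measure.density_unique_iff[OF sigma_finite_lborel]) auto
    then show ?thesis
      by eventually_elim (use pos m in \<open>auto simp: PN(3)\<close>)
  qed
qed

text \<open>The transform of the conjugate vanishes as well, since conjugation reflects frequencies.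
  Half-sum and half-difference reduce the claim to the real and imaginary parts.\<close>

lemma AE_eq_0_if_fourier_0:
  fixes k :: "real \<Rightarrow> complex"
  assumes k: "integrable lborel k"
    and z: "\<And>\<eta>. (LINT x|lborel. cis (\<eta> * x) * k x) = 0"
  shows "AE x in lborel. k x = 0"
proof -
  have z': "(LINT x|lborel. cis (\<eta> * x) * cnj (k x)) = 0" for \<eta>
  proof -
    have "(LINT x|lborel. cis (\<eta> * x) * cnj (k x)) = (LINT x|lborel. cnj (cis (- \<eta> * x) * k x))"
      by (simp add: cis_cnj)
    also have "\<dots> = cnj (LINT x|lborel. cis (- \<eta> * x) * k x)" by (rule Bochner_Integration.integral_cnj)
    finally show ?thesis using z[of "- \<eta>"] by simp
  qed
  have ki: "integrable lborel (\<lambda>x. cnj (k x))" using k by simp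
  have "(LINT x|lborel. cis (\<eta> * x) * of_real (Re (k x))) = 0" for \<eta>
  proof -
    have "(LINT x|lborel. cis (\<eta> * x) * of_real (Re (k x))) = (LINT x|lborel. (cis (\<eta> * x) * k x + cis (\<eta> * x) * cnj (k x)) / 2)"
      by (intro Bochner_Integration.integral_cong) (auto simp: complex_eq_iff field_simps)
    also have "\<dots> = 0" using integrable_cis_mult[OF k] integrable_cis_mult[OF ki] by (simp add: z z')
    finally show ?thesis .
  qed
  then have R: "AE x in lborel. Re (k x) = 0" using k by (intro AE_eq_0_if_char_0) auto
  have "(LINT x|lborel. cis (\<eta> * x) * of_real (Im (k x))) = 0" for \<eta>
  proof -
    have "(LINT x|lborel. cis (\<eta> * x) * of_real (Im (k x))) = (LINT x|lborel. (cis (\<eta> * x) * k x - cis (\<eta> * x) * cnj (k x)) * (- \<i> / 2))"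
      by (intro Bochner_Integration.integral_cong) (auto simp: complex_eq_iff field_simps)
    also have "\<dots> = 0" using integrable_cis_mult[OF k] integrable_cis_mult[OF ki] by (simp add: z z')
    finally show ?thesis .
  qed
  then have I: "AE x in lborel. Im (k x) = 0" using k by (intro AE_eq_0_if_char_0) auto
  from R I show ?thesis by eventually_elim (simp add: complex_eq_iff)
qed

subsection \<open>Uniqueness of Fourier transforms\<close>

text \<open>Modulated Gaussians serve as test functions on both sides of \<open>has_fourier\<close>:
  they are Schwartz, they are transforms of Schwartz functions, they have no zeros, and
  \<open>\<eta>\<close> runs through all frequencies.\<close>

definition gmod :: "real \<Rightarrow> real \<Rightarrow> complex" where
  "gmod \<eta> = pgauss 1 (1 / 2) (\<i> * of_real \<eta>)"

lemma gmod_eq: "gmod \<eta> x = cis (\<eta> * x) * gmod 0 x"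
  by (simp add: gmod_def pgauss_def cis_conv_exp exp_add[symmetric] algebra_simps)

lemma gmod_nonzero: "gmod \<eta> x \<noteq> 0"
  by (simp add: gmod_def pgauss_def)

lemma gmod_schwartz: "gmod \<eta> \<in> schwartz"
  unfolding gmod_def by (rule schwartz_pgauss) simp

lemma gmod_fourier: "\<exists>\<phi>\<in>schwartz. fourier \<phi> = gmod \<eta>"
proof
  \<comment> \<open>A Gaussian centred at \<open>- \<eta>\<close>, whose transform is a modulated
    Gaussian; the constant coefficient completes the square.\<close>
  let ?\<phi> = "pgauss [:exp (- (of_real \<eta>)\<^sup>2 / 2):] (1 / 2) (of_real (- \<eta>))"
  show "?\<phi> \<in> schwartz" by (rule schwartz_pgauss) simp
  have e: "?\<phi> x = of_real (exp (- ((1 * (x - (- \<eta>)))\<^sup>2 / 2)))" for x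
  proof -
    have "- (of_real \<eta>)\<^sup>2 / 2 + (- of_real (1 / 2) * (of_real x)\<^sup>2 + of_real (- \<eta>) * of_real x)
      = (of_real (- ((1 * (x - (- \<eta>)))\<^sup>2 / 2)) :: complex)"
      by (simp add: power2_eq_square algebra_simps add_divide_distrib)
    then show ?thesis unfolding pgauss_def
      by (simp only: poly_pCons poly_0 mult_zero_right add_0_right exp_add[symmetric] exp_of_real)
  qed
  have "fourier ?\<phi> x = gmod \<eta> x" for x
    using gauss_cis_scaled[of 1 "- x" "- \<eta>"]
    unfolding fourier_def e gmod_eq[of \<eta>]
    by (simp add: mult.commute[of _ x] gmod_def pgauss_def exp_of_real[symmetric] mult.commute[of \<eta>])
  then show "fourier ?\<phi> = gmod \<eta>" by (rule ext)
qed

text \<open>\<open>h\<close> itself need not be integrable, but \<open>h * gmod 0\<close> is, and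
  pairing \<open>h\<close> with all modulations says that the transform of this product vanishes.
  The Gaussian has no zeros and can be divided out.\<close>

lemma AE_eq_0_gmod:
  assumes "\<And>\<eta>. integrable lborel (\<lambda>x. h x * gmod \<eta> x)" "\<And>\<eta>. (LINT x|lborel. h x * gmod \<eta> x) = 0"
  shows "AE x in lborel. h x = 0"
proof -
  have "cis (\<eta> * x) * (h x * gmod 0 x) = h x * gmod \<eta> x" for \<eta> x
    by (subst gmod_eq[of \<eta>]) (simp only: mult_ac)
  then have "AE x in lborel. h x * gmod 0 x = 0"
    by (intro AE_eq_0_if_fourier_0[OF assms(1)]) (simp only: assms(2))
  then show ?thesis by eventually_elim (simp add: gmod_nonzero)
qed

lemma has_fourier_unique:
  assumes "has_fourier u g" "has_fourier u g'"
  shows "AE \<xi> in lborel. g \<xi> = g' \<xi>"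
proof -
  have "AE \<xi> in lborel. g \<xi> - g' \<xi> = 0"
    using assms gmod_schwartz unfolding has_fourier_def
    by (intro AE_eq_0_gmod) (auto simp: left_diff_distrib)
  then show ?thesis by simp
qed

lemma has_fourier_unique_left:
  assumes "has_fourier u g" "has_fourier u' g"
  shows "AE x in lborel. u x = u' x"
proof -
  have *: "integrable lborel (\<lambda>x. u x * gmod \<eta> x)" "integrable lborel (\<lambda>x. u' x * gmod \<eta> x)"
    "(LINT x|lborel. u x * gmod \<eta> x) = (LINT x|lborel. u' x * gmod \<eta> x)" for \<eta>
    using assms gmod_fourier[of \<eta>] unfolding has_fourier_def by fastforce+
  have "AE x in lborel. u x - u' x = 0"
    by (intro AE_eq_0_gmod) (auto simp: left_diff_distrib *)
  then show ?thesis by simp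
qed

lemma has_fourier_diff:
  "has_fourier u g \<Longrightarrow> has_fourier u' g' \<Longrightarrow> has_fourier (\<lambda>x. u x - u' x) (\<lambda>x. g x - g' x)"
  unfolding has_fourier_def by (auto simp: left_diff_distrib)

text \<open>Only the products of \<open>g\<close> with Schwartz functions are known to be
  measurable; dividing by a Gaussian without zeros recovers \<open>g\<close>.\<close>

lemma has_fourier_measurable:
  assumes "has_fourier u g" shows "g \<in> borel_measurable borel"
proof -
  have "(\<lambda>\<xi>. g \<xi> * gmod 0 \<xi>) \<in> borel_measurable borel"
    using assms gmod_schwartz[of 0] borel_measurable_integrable[of lborel "\<lambda>\<xi>. g \<xi> * gmod 0 \<xi>"]
    unfolding has_fourier_def by auto
  then have "(\<lambda>\<xi>. g \<xi> * gmod 0 \<xi> / gmod 0 \<xi>) \<in> borel_measurable borel"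
    using schwartz_measurable[OF gmod_schwartz[of 0]] by (rule borel_measurable_divide)
  then show ?thesis by (simp add: gmod_nonzero)
qed

text \<open>Removes the choice operator in \<open>sobolev_norm\<close>: by uniqueness up to null
  sets, any transform at hand computes the norm.\<close>

lemma sobolev_norm_eq:
  assumes "has_fourier u g"
  shows "sobolev_norm s u = sqrt (LINT \<xi>|lborel. (1 + \<xi>\<^sup>2) powr s * (cmod (g \<xi>))\<^sup>2)"
proof -
  define g' where "g' = (SOME g. has_fourier u g)"
  have g': "has_fourier u g'" unfolding g'_def using assms by (rule someI[of "has_fourier u"])
  have [measurable]: "g \<in> borel_measurable borel" "g' \<in> borel_measurable borel"
    using has_fourier_measurable assms g' by auto
  have "(LINT \<xi>|lborel. (1 + \<xi>\<^sup>2) powr s * (cmod (g' \<xi>))\<^sup>2) = (LINT \<xi>|lborel. (1 + \<xi>\<^sup>2) powr s * (cmod (g \<xi>))\<^sup>2)"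
    by (rule integral_cong_AE) (use has_fourier_unique[OF g' assms] in auto)
  then show ?thesis unfolding sobolev_norm_def g'_def[symmetric] Let_def by simp
qed

text \<open>The set where the two functions differ is open and null, hence empty.\<close>

lemma AE_eq_imp_eq_continuous:
  fixes u v :: "real \<Rightarrow> complex"
  assumes "continuous_on UNIV u" "continuous_on UNIV v" "AE x in lborel. u x = v x"
  shows "u = v"
proof (rule ccontr)
  assume ne: "u \<noteq> v"
  let ?S = "{x. u x \<noteq> v x}"
  have "open ?S" using assms(1,2) by (intro open_Collect_neq)
  moreover have "?S \<noteq> {}" using ne by auto
  ultimately have "\<not> negligible ?S" using open_not_negligible by blast
  moreover have "?S \<in> null_sets lborel"
    using assms(3) \<open>open ?S\<close> by (subst AE_iff_null_sets) auto
  then have "negligible ?S"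
    unfolding negligible_iff_null_sets by (rule null_sets_completionI)
  ultimately show False by blast
qed

text \<open>One half of Plancherel's identity, enough for upper bounds. With a Gaussian factor of
  scale \<open>e\<close>, duality rewrites the square integral of \<open>ift g\<close> as a pairing
  of \<open>g\<close> with a function bounded by the convolution of \<open>|g|\<close> with a
  probability density \<open>\<gamma>\<close>. The bound \<open>2ab \<le> a^2 + b^2\<close> removes
  the density, which has mass one in either variable, and Fatou's lemma lets \<open>e\<close> tend
  to 0.\<close>

lemma ift_L2:
  assumes g: "integrable lborel g" and g2: "integrable lborel (\<lambda>\<xi>. (cmod (g \<xi>))\<^sup>2)"
  shows "integrable lborel (\<lambda>x. (cmod (ift g x))\<^sup>2)"
    and "(LINT x|lborel. (cmod (ift g x))\<^sup>2) \<le> (LINT \<xi>|lborel. (cmod (g \<xi>))\<^sup>2)"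
proof -
  have gm [measurable]: "g \<in> borel_measurable borel" using g by auto
  have im [measurable]: "ift g \<in> borel_measurable borel"
    by (intro borel_measurable_continuous_onI continuous_ift g)
  let ?E = "\<lambda>e x::real. exp (- ((e * (x - 0))\<^sup>2 / 2))"
  let ?I = "\<integral>\<^sup>+ \<xi>. ennreal ((cmod (g \<xi>))\<^sup>2) \<partial>lborel"
  have bound: "(\<integral>\<^sup>+ x. ennreal ((cmod (ift g x))\<^sup>2 * ?E e x) \<partial>lborel) \<le> ?I" if e: "e > 0" for e
  proof -
    \<comment> \<open>Chosen so that \<open>ift g x * h x\<close> is the damped square
      \<open>(cmod (ift g x))\<^sup>2 * ?E e x\<close>.\<close>
    define h where "h x = cnj (ift g x) * of_real (?E e x)" for x
    define \<gamma> where "\<gamma> y = 1 / (e * sqrt (2 * pi)) * exp (- ((1 / e * (y - 0))\<^sup>2 / 2))" for y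
    have Ei: "integrable lborel (\<lambda>x. complex_of_real (?E e x))"
      using gauss_scaled_integrable(1)[OF e, of 0] by simp
    have "integrable lborel (\<lambda>x. ift g x * of_real (?E e x))" by (rule ift_mult_integrable[OF g Ei])
    then have hi: "integrable lborel h" unfolding h_def[abs_def]
      using integrable_cnj by fastforce
    have \<gamma>i: "integrable lborel \<gamma>" and \<gamma>1: "(LINT y|lborel. \<gamma> y) = 1"
      using gauss_scaled_integrable[of "1 / e" 0] e by (auto simp: \<gamma>_def[abs_def])
    have \<gamma>0: "\<gamma> y \<ge> 0" for y using e by (simp add: \<gamma>_def)
    have [measurable]: "\<gamma> \<in> borel_measurable borel" using \<gamma>i by auto
    have \<gamma>n: "(\<integral>\<^sup>+ \<xi>. ennreal (\<gamma> (\<eta> - \<xi>)) \<partial>lborel) = 1" "(\<integral>\<^sup>+ \<xi>. ennreal (\<gamma> (\<xi> - \<eta>)) \<partial>lborel) = 1" for \<eta>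
    proof -
      have "integrable lborel (\<lambda>\<xi>. \<gamma> (- \<eta> + 1 * \<xi>))" "(LINT \<xi>|lborel. \<gamma> (- \<eta> + 1 * \<xi>)) = 1"
        using lborel_integrable_real_affine[OF \<gamma>i, of 1 "- \<eta>"] lborel_integral_real_affine[of 1 \<gamma> "- \<eta>"] \<gamma>1 by auto
      then show "(\<integral>\<^sup>+ \<xi>. ennreal (\<gamma> (\<xi> - \<eta>)) \<partial>lborel) = 1"
        using nn_integral_eq_integral[of lborel "\<lambda>\<xi>. \<gamma> (\<xi> - \<eta>)"] \<gamma>0 by auto
      moreover have "\<gamma> (\<eta> - \<xi>) = \<gamma> (\<xi> - \<eta>)" for \<xi>
        by (simp add: \<gamma>_def power_mult_distrib power2_commute[of \<eta>] power_divide)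
      ultimately show "(\<integral>\<^sup>+ \<xi>. ennreal (\<gamma> (\<eta> - \<xi>)) \<partial>lborel) = 1" by simp
    qed
    have ifth: "cmod (ift h \<xi>) \<le> (LINT \<eta>|lborel. norm (g \<eta>) * \<gamma> (\<eta> - \<xi>))" for \<xi>
    proof -
      have iE: "ift (\<lambda>x. cis (- \<xi> * x) * of_real (?E e x)) \<eta> = of_real (sqrt (2 * pi) * \<gamma> (\<eta> - \<xi>))" for \<eta>
      proof -
        have "(LINT x|lborel. cis (\<eta> * x) * (cis (- \<xi> * x) * of_real (?E e x))) = (LINT x|lborel. cis ((\<eta> - \<xi>) * x) * of_real (?E e x))"
          by (simp add: cis_mult mult.assoc[symmetric] left_diff_distrib)
        also have "\<dots> = of_real (sqrt (2 * pi) / e * exp (- (((\<eta> - \<xi>) / e)\<^sup>2 / 2)))"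
          using gauss_cis_scaled[OF e, of "\<eta> - \<xi>" 0] by simp
        finally show ?thesis unfolding ift_eq by (simp add: \<gamma>_def field_simps)
      qed
      have "ift h \<xi> = cnj (of_real (1 / sqrt (2 * pi)) * (LINT x|lborel. ift g x * (cis (- \<xi> * x) * of_real (?E e x))))"
        unfolding ift_eq[of h] h_def complex_cnj_mult Bochner_Integration.integral_cnj[symmetric]
        by (simp add: cis_cnj mult_ac del: Bochner_Integration.integral_cnj)
      then have "cmod (ift h \<xi>) = 1 / sqrt (2 * pi) * cmod (LINT x|lborel. ift g x * (cis (- \<xi> * x) * of_real (?E e x)))"
        by (simp add: norm_mult norm_divide)
      also have "(LINT x|lborel. ift g x * (cis (- \<xi> * x) * of_real (?E e x))) = (LINT x|lborel. g x * ift (\<lambda>x. cis (- \<xi> * x) * of_real (?E e x)) x)"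
        by (rule ift_duality[OF g integrable_cis_mult[OF Ei]])
      also have "\<dots> = (LINT x|lborel. g x * of_real (sqrt (2 * pi) * \<gamma> (x - \<xi>)))" unfolding iE ..
      also have "cmod (LINT x|lborel. g x * of_real (sqrt (2 * pi) * \<gamma> (x - \<xi>))) \<le> (LINT x|lborel. norm (g x * of_real (sqrt (2 * pi) * \<gamma> (x - \<xi>))))"
        by (rule integral_norm_bound)
      also have "(LINT x|lborel. norm (g x * of_real (sqrt (2 * pi) * \<gamma> (x - \<xi>)))) = (LINT x|lborel. sqrt (2 * pi) * (norm (g x) * \<gamma> (x - \<xi>)))"
        using \<gamma>0 by (simp add: norm_mult abs_mult mult_ac)
      finally show ?thesis by (simp add: mult_left_mono divide_right_mono)
    qed
    have gi: "integrable lborel (\<lambda>\<eta>. norm (g \<eta>) * \<gamma> (\<eta> - \<xi>))" for \<xi>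
    proof (rule Bochner_Integration.integrable_bound)
      show "integrable lborel (\<lambda>\<eta>. norm (g \<eta>) * (1 / (e * sqrt (2 * pi))))" using g by simp
      show "AE \<eta> in lborel. norm (norm (g \<eta>) * \<gamma> (\<eta> - \<xi>)) \<le> norm (norm (g \<eta>) * (1 / (e * sqrt (2 * pi))))"
        using e \<gamma>0 by (auto simp: abs_mult \<gamma>_def divide_simps intro!: AE_I2 mult_left_le)
    qed measurable
    have "(\<integral>\<^sup>+ x. ennreal ((cmod (ift g x))\<^sup>2 * ?E e x) \<partial>lborel) = ennreal (LINT x|lborel. (cmod (ift g x))\<^sup>2 * ?E e x)"
    proof (rule nn_integral_eq_integral)
      have "integrable lborel (\<lambda>x. cmod (ift g x * h x))" by (intro integrable_norm ift_mult_integrable g hi)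
      then show "integrable lborel (\<lambda>x. (cmod (ift g x))\<^sup>2 * ?E e x)"
        by (simp add: h_def norm_mult power2_eq_square mult_ac)
    qed auto
    also have "(LINT x|lborel. (cmod (ift g x))\<^sup>2 * ?E e x) = cmod (LINT x|lborel. ift g x * h x)"
    proof -
      have "ift g x * h x = of_real ((cmod (ift g x))\<^sup>2 * ?E e x)" for x
        using complex_norm_square[of "ift g x"] by (simp add: h_def)
      moreover have "0 \<le> (LINT x|lborel. (cmod (ift g x))\<^sup>2 * ?E e x)" by (rule integral_nonneg_AE) auto
      ultimately show ?thesis by (simp only: integral_complex_of_real norm_of_real abs_of_nonneg)
    qed
    also have "(LINT x|lborel. ift g x * h x) = (LINT x|lborel. g x * ift h x)" by (rule ift_duality[OF g hi])
    also have "ennreal (cmod \<dots>) \<le> (\<integral>\<^sup>+ \<xi>. ennreal (cmod (g \<xi> * ift h \<xi>)) \<partial>lborel)"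
      using ift_mult_integrable[OF hi g] by (intro integral_norm_bound_ennreal) (simp add: mult.commute)
    also have "\<dots> \<le> (\<integral>\<^sup>+ \<xi>. \<integral>\<^sup>+ \<eta>. ennreal (((cmod (g \<xi>))\<^sup>2 / 2) * \<gamma> (\<eta> - \<xi>)) + ennreal ((cmod (g \<eta>))\<^sup>2 / 2 * \<gamma> (\<eta> - \<xi>)) \<partial>lborel \<partial>lborel)"
    proof (rule nn_integral_mono)
      fix \<xi>
      have "ennreal (cmod (g \<xi> * ift h \<xi>)) \<le> ennreal (cmod (g \<xi>) * (LINT \<eta>|lborel. norm (g \<eta>) * \<gamma> (\<eta> - \<xi>)))"
        using ifth[of \<xi>] by (auto simp: norm_mult intro!: ennreal_leI mult_left_mono)
      also have "\<dots> = ennreal (LINT \<eta>|lborel. cmod (g \<xi>) * (norm (g \<eta>) * \<gamma> (\<eta> - \<xi>)))" by simp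
      also have "\<dots> = (\<integral>\<^sup>+ \<eta>. ennreal (cmod (g \<xi>) * (norm (g \<eta>) * \<gamma> (\<eta> - \<xi>))) \<partial>lborel)"
        by (rule nn_integral_eq_integral[symmetric]) (use gi \<gamma>0 in auto)
      also have "\<dots> \<le> (\<integral>\<^sup>+ \<eta>. ennreal (((cmod (g \<xi>))\<^sup>2 / 2) * \<gamma> (\<eta> - \<xi>)) + ennreal ((cmod (g \<eta>))\<^sup>2 / 2 * \<gamma> (\<eta> - \<xi>)) \<partial>lborel)"
      proof (rule nn_integral_mono)
        fix \<eta>
        have "cmod (g \<xi>) * norm (g \<eta>) \<le> (cmod (g \<xi>))\<^sup>2 / 2 + (cmod (g \<eta>))\<^sup>2 / 2"
          using sum_squares_bound[of "cmod (g \<xi>)" "cmod (g \<eta>)"] by simp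
        then have "cmod (g \<xi>) * norm (g \<eta>) * \<gamma> (\<eta> - \<xi>) \<le> ((cmod (g \<xi>))\<^sup>2 / 2 + (cmod (g \<eta>))\<^sup>2 / 2) * \<gamma> (\<eta> - \<xi>)"
          using \<gamma>0 by (intro mult_right_mono)
        then show "ennreal (cmod (g \<xi>) * (norm (g \<eta>) * \<gamma> (\<eta> - \<xi>))) \<le> ennreal (((cmod (g \<xi>))\<^sup>2 / 2) * \<gamma> (\<eta> - \<xi>)) + ennreal ((cmod (g \<eta>))\<^sup>2 / 2 * \<gamma> (\<eta> - \<xi>))"
          using \<gamma>0[of "\<eta> - \<xi>"]
          by (subst ennreal_plus[symmetric]) (simp_all only: distrib_right mult.assoc ennreal_leI, simp_all)
      qed
      finally show "ennreal (cmod (g \<xi> * ift h \<xi>)) \<le> \<dots>" .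
    qed
    also have "\<dots> = (\<integral>\<^sup>+ \<xi>. \<integral>\<^sup>+ \<eta>. ennreal ((cmod (g \<xi>))\<^sup>2 / 2) * ennreal (\<gamma> (\<eta> - \<xi>)) \<partial>lborel \<partial>lborel)
       + (\<integral>\<^sup>+ \<xi>. \<integral>\<^sup>+ \<eta>. ennreal ((cmod (g \<eta>))\<^sup>2 / 2) * ennreal (\<gamma> (\<eta> - \<xi>)) \<partial>lborel \<partial>lborel)"
      unfolding ennreal_mult''[OF \<gamma>0] by (simp add: nn_integral_add)
    also have "(\<integral>\<^sup>+ \<xi>. \<integral>\<^sup>+ \<eta>. ennreal ((cmod (g \<eta>))\<^sup>2 / 2) * ennreal (\<gamma> (\<eta> - \<xi>)) \<partial>lborel \<partial>lborel)
        = (\<integral>\<^sup>+ \<eta>. \<integral>\<^sup>+ \<xi>. ennreal ((cmod (g \<eta>))\<^sup>2 / 2) * ennreal (\<gamma> (\<eta> - \<xi>)) \<partial>lborel \<partial>lborel)"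
      by (rule lborel_pair.Fubini') measurable
    also have "(\<integral>\<^sup>+ \<xi>. \<integral>\<^sup>+ \<eta>. ennreal ((cmod (g \<xi>))\<^sup>2 / 2) * ennreal (\<gamma> (\<eta> - \<xi>)) \<partial>lborel \<partial>lborel) + \<dots>
        = (\<integral>\<^sup>+ \<xi>. ennreal ((cmod (g \<xi>))\<^sup>2 / 2) \<partial>lborel) + (\<integral>\<^sup>+ \<xi>. ennreal ((cmod (g \<xi>))\<^sup>2 / 2) \<partial>lborel)"
      by (simp add: nn_integral_cmult \<gamma>n)
    also have "\<dots> = ?I"
      by (subst nn_integral_add[symmetric]) (auto simp: ennreal_plus[symmetric] simp del: ennreal_plus)
    finally show ?thesis .
  qed
  let ?X = "\<lambda>n. 1 / real (Suc n)"
  have X: "?X \<longlonglongrightarrow> 0" by (rule LIMSEQ_Suc[OF lim_1_over_n])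
  \<comment> \<open>Fatou rather than dominated convergence: integrability of the limit is part of
    the claim.\<close>
  have "(\<integral>\<^sup>+ x. ennreal ((cmod (ift g x))\<^sup>2) \<partial>lborel) = (\<integral>\<^sup>+ x. liminf (\<lambda>n. ennreal ((cmod (ift g x))\<^sup>2 * ?E (?X n) x)) \<partial>lborel)"
  proof (rule nn_integral_cong)
    fix x
    have "(\<lambda>n. ennreal ((cmod (ift g x))\<^sup>2 * ?E (?X n) x)) \<longlonglongrightarrow> ennreal ((cmod (ift g x))\<^sup>2 * ?E 0 x)"
      by (intro tendsto_intros X) auto
    then show "ennreal ((cmod (ift g x))\<^sup>2) = liminf (\<lambda>n. ennreal ((cmod (ift g x))\<^sup>2 * ?E (?X n) x))"
      using lim_imp_Liminf[OF trivial_limit_sequentially] by fastforce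
  qed
  also have "\<dots> \<le> liminf (\<lambda>n. \<integral>\<^sup>+ x. ennreal ((cmod (ift g x))\<^sup>2 * ?E (?X n) x) \<partial>lborel)"
    by (rule nn_integral_liminf) measurable
  also have "\<dots> \<le> ?I"
    by (intro Liminf_le always_eventually allI bound) auto
  finally have le: "(\<integral>\<^sup>+ x. ennreal ((cmod (ift g x))\<^sup>2) \<partial>lborel) \<le> ?I" .
  have I: "?I = ennreal (LINT \<xi>|lborel. (cmod (g \<xi>))\<^sup>2)"
    by (rule nn_integral_eq_integral[OF g2]) auto
  show *: "integrable lborel (\<lambda>x. (cmod (ift g x))\<^sup>2)"
  proof (rule integrableI_bounded)
    have "(\<integral>\<^sup>+ x. ennreal ((cmod (ift g x))\<^sup>2) \<partial>lborel) < \<infinity>"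
      using le unfolding I by (rule le_less_trans) simp
    then show "(\<integral>\<^sup>+ x. ennreal (norm ((cmod (ift g x))\<^sup>2)) \<partial>lborel) < \<infinity>" by simp
  qed simp
  show "(LINT x|lborel. (cmod (ift g x))\<^sup>2) \<le> (LINT \<xi>|lborel. (cmod (g \<xi>))\<^sup>2)"
    using le unfolding I by (subst (asm) nn_integral_eq_integral[OF *]) (auto simp: integral_nonneg_AE)
qed

subsection \<open>Sobolev paths\<close>

definition jcont :: "(real \<Rightarrow> real \<Rightarrow> 'a::topological_space) \<Rightarrow> bool" where
  "jcont u \<longleftrightarrow> continuous_on UNIV (\<lambda>(t, x). u t x)"

text \<open>Exponential decay in frequency, uniform in time. It puts the inverse transform into
  every Sobolev space at once and justifies derivatives under the integral. All functions are
  defined and continuous for every real time, so that no time domain has to be carried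
  along.\<close>

definition expdec :: "real \<Rightarrow> real \<Rightarrow> (real \<Rightarrow> real \<Rightarrow> complex) \<Rightarrow> bool" where
  "expdec r C u \<longleftrightarrow> jcont u \<and> (\<forall>t \<xi>. norm (u t \<xi>) \<le> C * exp (- r * \<bar>\<xi>\<bar>))"

lemma jcont_compose:
  assumes "jcont u" "continuous_on A f" "continuous_on A g"
  shows "continuous_on A (\<lambda>z. u (f z) (g z))"
proof -
  have "continuous_on A ((\<lambda>(t, x). u t x) \<circ> (\<lambda>z. (f z, g z)))"
    using assms unfolding jcont_def
    by (intro continuous_on_compose continuous_on_Pair) (auto intro: continuous_on_subset)
  then show ?thesis by (simp add: o_def)
qed

lemma jcont_slice: "jcont u \<Longrightarrow> continuous_on A (u t)" "jcont u \<Longrightarrow> continuous_on A (\<lambda>t. u t x)"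
  by (auto intro!: jcont_compose continuous_intros)

lemma jcont_measurable:
  fixes u :: "real \<Rightarrow> real \<Rightarrow> 'a::topological_space"
  shows "jcont u \<Longrightarrow> u t \<in> borel_measurable borel"
  by (intro borel_measurable_continuous_onI jcont_slice)

lemma one_plus_square_le: "(1 + \<xi>\<^sup>2) \<le> (1 + \<bar>\<xi>\<bar>)\<^sup>2" for \<xi> :: real
  by (simp add: power2_sum)

text \<open>Polynomial growth against an exponential: an even power of \<open>1 + |\<xi>|\<close> is
  bounded by means of the matching term of the exponential series.\<close>

lemma weight_exp_bound:
  assumes "r > 0" shows "\<exists>K\<ge>0. \<forall>\<xi>::real. (1 + \<xi>\<^sup>2) powr s \<le> K * exp (r * \<bar>\<xi>\<bar>)"
proof -
  define n where "n = nat \<lceil>s\<rceil>"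
  define K where "K = fact (2 * n) / r ^ (2 * n) * exp r"
  have "(1 + \<xi>\<^sup>2) powr s \<le> K * exp (r * \<bar>\<xi>\<bar>)" for \<xi> :: real
  proof -
    have "(1 + \<xi>\<^sup>2) powr s \<le> (1 + \<xi>\<^sup>2) powr (real n)"
      by (rule powr_mono) (auto simp: n_def real_nat_ceiling_ge)
    also have "\<dots> = (1 + \<xi>\<^sup>2) ^ n" by (rule powr_realpow) (auto intro: add_pos_nonneg)
    also have "\<dots> \<le> ((1 + \<bar>\<xi>\<bar>)\<^sup>2) ^ n" by (intro power_mono one_plus_square_le) auto
    also have "\<dots> = (r * (1 + \<bar>\<xi>\<bar>)) ^ (2 * n) / r ^ (2 * n)"
      using assms by (simp add: power_mult_distrib power_mult)
    also have "\<dots> \<le> fact (2 * n) * exp (r * (1 + \<bar>\<xi>\<bar>)) / r ^ (2 * n)"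
      using assms by (intro divide_right_mono power_le_fact_exp) auto
    also have "\<dots> = K * exp (r * \<bar>\<xi>\<bar>)" by (simp add: K_def distrib_left exp_add)
    finally show ?thesis .
  qed
  moreover have "K \<ge> 0" using assms by (simp add: K_def)
  ultimately show ?thesis by blast
qed

lemma integrable_exp_abs:
  assumes "r > 0" shows "integrable lborel (\<lambda>\<xi>::real. exp (- r * \<bar>\<xi>\<bar>))"
proof -
  obtain K where K: "\<And>\<xi>::real. (1 + \<xi>\<^sup>2) powr 1 \<le> K * exp (r * \<bar>\<xi>\<bar>)"
    using weight_exp_bound[OF assms, of 1] by blast
  show ?thesis
  proof (rule integrable_inv_sq_bound)
    fix x :: real
    have "(1 + x\<^sup>2) * exp (- r * \<bar>x\<bar>) \<le> K * exp (r * \<bar>x\<bar>) * exp (- r * \<bar>x\<bar>)"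
      using K[of x] by (intro mult_right_mono) auto
    then have "(1 + x\<^sup>2) * exp (- r * \<bar>x\<bar>) \<le> K" by (simp add: mult.assoc exp_add[symmetric])
    then show "norm (exp (- r * \<bar>x\<bar>)) \<le> K / (1 + x\<^sup>2)"
      by (subst pos_le_divide_eq) (auto intro: add_pos_nonneg simp: mult.commute)
  qed measurable
qed

lemma integrable_weight_exp:
  assumes "r > 0" shows "integrable lborel (\<lambda>\<xi>::real. (1 + \<xi>\<^sup>2) powr s * exp (- r * \<bar>\<xi>\<bar>))"
proof -
  obtain K where K: "\<And>\<xi>::real. (1 + \<xi>\<^sup>2) powr s \<le> K * exp (r / 2 * \<bar>\<xi>\<bar>)"
    using weight_exp_bound[of "r / 2" s] assms by auto
  have i: "integrable lborel (\<lambda>\<xi>::real. K * exp (- (r / 2) * \<bar>\<xi>\<bar>))"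
    using integrable_exp_abs[of "r / 2"] assms by simp
  show ?thesis
  proof (rule Bochner_Integration.integrable_bound[OF i])
    show "AE \<xi> in lborel. norm ((1 + \<xi>\<^sup>2) powr s * exp (- r * \<bar>\<xi>\<bar>)) \<le> norm (K * exp (- (r / 2) * \<bar>\<xi>\<bar>))"
    proof (rule AE_I2)
      fix \<xi> :: real
      have "(1 + \<xi>\<^sup>2) powr s * exp (- r * \<bar>\<xi>\<bar>) \<le> K * exp (r / 2 * \<bar>\<xi>\<bar>) * exp (- r * \<bar>\<xi>\<bar>)"
        by (intro mult_right_mono K) auto
      also have "\<dots> = K * exp (- (r / 2) * \<bar>\<xi>\<bar>)" by (simp add: mult.assoc exp_add[symmetric])
      finally show "norm ((1 + \<xi>\<^sup>2) powr s * exp (- r * \<bar>\<xi>\<bar>)) \<le> norm (K * exp (- (r / 2) * \<bar>\<xi>\<bar>))"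
        by (auto intro: order_trans[OF _ abs_ge_self])
    qed
  qed measurable
qed

lemma expdec_integrable_weight:
  assumes u: "expdec r C u" and r: "r > 0"
  shows "integrable lborel (\<lambda>\<xi>. of_real ((1 + \<xi>\<^sup>2) powr s) * u t \<xi>)"
proof (rule Bochner_Integration.integrable_bound)
  show "integrable lborel (\<lambda>\<xi>. C * ((1 + \<xi>\<^sup>2) powr s * exp (- r * \<bar>\<xi>\<bar>)))"
    using integrable_weight_exp[OF r] by simp
  show "AE \<xi> in lborel. norm (of_real ((1 + \<xi>\<^sup>2) powr s) * u t \<xi>) \<le> norm (C * ((1 + \<xi>\<^sup>2) powr s * exp (- r * \<bar>\<xi>\<bar>)))"
  proof (rule AE_I2)
    fix \<xi>
    have "(1 + \<xi>\<^sup>2) powr s * cmod (u t \<xi>) \<le> (1 + \<xi>\<^sup>2) powr s * (C * exp (- r * \<bar>\<xi>\<bar>))"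
      using u by (intro mult_left_mono) (auto simp: expdec_def)
    also have "\<dots> \<le> \<bar>C * ((1 + \<xi>\<^sup>2) powr s * exp (- r * \<bar>\<xi>\<bar>))\<bar>"
      by (simp add: mult.left_commute)
    finally show "norm (of_real ((1 + \<xi>\<^sup>2) powr s) * u t \<xi>) \<le> norm (C * ((1 + \<xi>\<^sup>2) powr s * exp (- r * \<bar>\<xi>\<bar>)))"
      by (simp add: norm_mult)
  qed
next
  have [measurable]: "u t \<in> borel_measurable borel" using u by (auto simp: expdec_def intro: jcont_measurable)
  show "(\<lambda>\<xi>. of_real ((1 + \<xi>\<^sup>2) powr s) * u t \<xi>) \<in> borel_measurable lborel" by measurable
qed

lemma expdec_integrable:
  assumes u: "expdec r C u" and r: "r > 0" shows "integrable lborel (u t)"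
  using expdec_integrable_weight[OF assms, of 0 t] by (simp add: add_nonneg_eq_0_iff cong: if_cong)

lemma expdec_square_integrable:
  assumes u: "expdec r C u" and r: "r > 0"
  shows "integrable lborel (\<lambda>\<xi>. (1 + \<xi>\<^sup>2) powr s * (cmod (u t \<xi>))\<^sup>2)"
proof (rule Bochner_Integration.integrable_bound)
  show "integrable lborel (\<lambda>\<xi>. C\<^sup>2 * ((1 + \<xi>\<^sup>2) powr s * exp (- (2 * r) * \<bar>\<xi>\<bar>)))"
    using integrable_weight_exp[of "2 * r"] r by simp
  show "AE \<xi> in lborel. norm ((1 + \<xi>\<^sup>2) powr s * (cmod (u t \<xi>))\<^sup>2) \<le> norm (C\<^sup>2 * ((1 + \<xi>\<^sup>2) powr s * exp (- (2 * r) * \<bar>\<xi>\<bar>)))"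
  proof (rule AE_I2)
    fix \<xi>
    have "(cmod (u t \<xi>))\<^sup>2 \<le> (C * exp (- r * \<bar>\<xi>\<bar>))\<^sup>2"
      using u by (intro power_mono) (auto simp: expdec_def)
    also have "\<dots> = C\<^sup>2 * exp (- (2 * r) * \<bar>\<xi>\<bar>)" by (simp add: power_mult_distrib exp_double[symmetric] mult.assoc)
    finally have "(1 + \<xi>\<^sup>2) powr s * (cmod (u t \<xi>))\<^sup>2 \<le> (1 + \<xi>\<^sup>2) powr s * (C\<^sup>2 * exp (- (2 * r) * \<bar>\<xi>\<bar>))"
      by (intro mult_left_mono) auto
    then show "norm ((1 + \<xi>\<^sup>2) powr s * (cmod (u t \<xi>))\<^sup>2) \<le> norm (C\<^sup>2 * ((1 + \<xi>\<^sup>2) powr s * exp (- (2 * r) * \<bar>\<xi>\<bar>)))"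
      by (simp add: mult_ac)
  qed
next
  have [measurable]: "u t \<in> borel_measurable borel" using u by (auto simp: expdec_def intro: jcont_measurable)
  show "(\<lambda>\<xi>. (1 + \<xi>\<^sup>2) powr s * (cmod (u t \<xi>))\<^sup>2) \<in> borel_measurable lborel" by measurable
qed

lemma expdec_sobolev_path:
  assumes u: "expdec r C u" and r: "r > 0"
  shows "sobolev_path s T (\<lambda>t. ift (u t))"
  unfolding sobolev_path_def
proof (intro ballI conjI)
  note i = expdec_integrable[OF u r]
  fix t
  show "ift (u t) \<in> sobolev s"
    unfolding sobolev_def using has_fourier_ift[OF i] expdec_square_integrable[OF u r] by blast
  have eq: "sobolev_norm s (\<lambda>x. ift (u t') x - ift (u t) x) = sqrt (LINT \<xi>|lborel. (1 + \<xi>\<^sup>2) powr s * (cmod (u t' \<xi> - u t \<xi>))\<^sup>2)" for t'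
    by (rule sobolev_norm_eq[OF has_fourier_diff[OF has_fourier_ift[OF i] has_fourier_ift[OF i]]])
  have jc: "jcont u" and b: "\<And>t \<xi>. norm (u t \<xi>) \<le> C * exp (- r * \<bar>\<xi>\<bar>)" using u by (auto simp: expdec_def)
  have "((\<lambda>t'. LINT \<xi>|lborel. (1 + \<xi>\<^sup>2) powr s * (cmod (u t' \<xi> - u t \<xi>))\<^sup>2) \<longlongrightarrow> (LINT \<xi>|(lborel::real measure). (0::real))) (at t within {0..T})"
    unfolding tendsto_at_iff_sequentially comp_def
  proof (intro allI impI)
    fix X assume X: "X \<longlonglongrightarrow> t"
    show "(\<lambda>n. LINT \<xi>|lborel. (1 + \<xi>\<^sup>2) powr s * (cmod (u (X n) \<xi> - u t \<xi>))\<^sup>2) \<longlonglongrightarrow> (LINT \<xi>|(lborel::real measure). (0::real))"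
    proof (rule integral_dominated_convergence[where f = "\<lambda>_. 0" and w = "\<lambda>\<xi>. 4 * C\<^sup>2 * ((1 + \<xi>\<^sup>2) powr s * exp (- (2 * r) * \<bar>\<xi>\<bar>))"])
      show "integrable lborel (\<lambda>\<xi>. 4 * C\<^sup>2 * ((1 + \<xi>\<^sup>2) powr s * exp (- (2 * r) * \<bar>\<xi>\<bar>)))"
        using integrable_weight_exp[of "2 * r"] r by simp
      show "AE \<xi> in lborel. (\<lambda>n. (1 + \<xi>\<^sup>2) powr s * (cmod (u (X n) \<xi> - u t \<xi>))\<^sup>2) \<longlonglongrightarrow> 0"
      proof (rule AE_I2)
        fix \<xi>
        have "(\<lambda>n. u (X n) \<xi>) \<longlonglongrightarrow> u t \<xi>"
          using jcont_slice(2)[OF jc, of UNIV \<xi>] X by (auto simp: continuous_on_sequentially o_def)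
        then have "(\<lambda>n. (1 + \<xi>\<^sup>2) powr s * (cmod (u (X n) \<xi> - u t \<xi>))\<^sup>2) \<longlonglongrightarrow> (1 + \<xi>\<^sup>2) powr s * (cmod (u t \<xi> - u t \<xi>))\<^sup>2"
          by (intro tendsto_intros)
        then show "(\<lambda>n. (1 + \<xi>\<^sup>2) powr s * (cmod (u (X n) \<xi> - u t \<xi>))\<^sup>2) \<longlonglongrightarrow> 0" by simp
      qed
      show "AE \<xi> in lborel. norm ((1 + \<xi>\<^sup>2) powr s * (cmod (u (X n) \<xi> - u t \<xi>))\<^sup>2) \<le> 4 * C\<^sup>2 * ((1 + \<xi>\<^sup>2) powr s * exp (- (2 * r) * \<bar>\<xi>\<bar>))" for n
      proof (rule AE_I2)
        fix \<xi>
        have "cmod (u (X n) \<xi> - u t \<xi>) \<le> 2 * (C * exp (- r * \<bar>\<xi>\<bar>))"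
          using norm_triangle_ineq4[of "u (X n) \<xi>" "u t \<xi>"] b[of "X n" \<xi>] b[of t \<xi>] by linarith
        then have "(cmod (u (X n) \<xi> - u t \<xi>))\<^sup>2 \<le> (2 * (C * exp (- r * \<bar>\<xi>\<bar>)))\<^sup>2"
          by (intro power_mono) auto
        also have "\<dots> = 4 * C\<^sup>2 * exp (- (2 * r) * \<bar>\<xi>\<bar>)" by (simp add: power_mult_distrib exp_double[symmetric] mult.assoc)
        finally have "(1 + \<xi>\<^sup>2) powr s * (cmod (u (X n) \<xi> - u t \<xi>))\<^sup>2 \<le> (1 + \<xi>\<^sup>2) powr s * (4 * C\<^sup>2 * exp (- (2 * r) * \<bar>\<xi>\<bar>))"
          by (intro mult_left_mono) auto
        then show "norm ((1 + \<xi>\<^sup>2) powr s * (cmod (u (X n) \<xi> - u t \<xi>))\<^sup>2) \<le> 4 * C\<^sup>2 * ((1 + \<xi>\<^sup>2) powr s * exp (- (2 * r) * \<bar>\<xi>\<bar>))"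
          by (simp add: mult_ac)
      qed
    qed (use jcont_measurable[OF jc] in \<open>auto intro!: borel_measurable_times borel_measurable_power borel_measurable_norm borel_measurable_diff\<close>)
  qed
  then have "((\<lambda>t'. sqrt (LINT \<xi>|lborel. (1 + \<xi>\<^sup>2) powr s * (cmod (u t' \<xi> - u t \<xi>))\<^sup>2)) \<longlongrightarrow> sqrt (LINT \<xi>|(lborel::real measure). (0::real))) (at t within {0..T})"
    by (rule tendsto_real_sqrt)
  then show "((\<lambda>t'. sobolev_norm s (\<lambda>x. ift (u t') x - ift (u t) x)) \<longlongrightarrow> 0) (at t within {0..T})"
    by (simp add: eq)
qed

section \<open>From continuity in a Sobolev space to classical regularity\<close>

lemma locally_bounded_Icc:
  fixes F :: "real \<Rightarrow> real"
  assumes "a \<le> b" and loc: "\<And>t. t \<in> {a..b} \<Longrightarrow> \<exists>B. eventually (\<lambda>s. F s \<le> B) (at t within {a..b})"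
  shows "\<exists>B. \<forall>t\<in>{a..b}. F t \<le> B"
proof -
  let ?P = "\<lambda>c d. a \<le> c \<and> d \<le> b \<longrightarrow> (\<exists>B. \<forall>t\<in>{c..d}. F t \<le> B)"
  have "?P a b"
  proof (rule Bolzano[where P = ?P, OF assms(1)])
    fix c d e assume "?P c d" "?P d e" "c \<le> d" "d \<le> e"
    then show "?P c e"
    proof (intro impI)
      assume "a \<le> c \<and> e \<le> b"
      then obtain B B' where "\<forall>t\<in>{c..d}. F t \<le> B" "\<forall>t\<in>{d..e}. F t \<le> B'"
        using \<open>?P c d\<close> \<open>?P d e\<close> \<open>c \<le> d\<close> \<open>d \<le> e\<close> by force
      then have "\<forall>t\<in>{c..e}. F t \<le> max B B'" by (auto simp: le_max_iff_disj)
      then show "\<exists>B. \<forall>t\<in>{c..e}. F t \<le> B" by blast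
    qed
  next
    fix x assume "a \<le> x" "x \<le> b"
    then obtain B where "eventually (\<lambda>s. F s \<le> B) (at x within {a..b})" using loc by auto
    then obtain d where d: "d > 0" "\<And>s. s \<in> {a..b} \<Longrightarrow> s \<noteq> x \<Longrightarrow> dist s x < d \<Longrightarrow> F s \<le> B"
      unfolding eventually_at by auto
    show "\<exists>d>0. \<forall>c e. c \<le> x \<and> x \<le> e \<and> e - c < d \<longrightarrow> ?P c e"
    proof (rule exI[of _ d], intro conjI allI impI d(1))
      fix c e assume *: "c \<le> x \<and> x \<le> e \<and> e - c < d" "a \<le> c \<and> e \<le> b"
      \<comment> \<open>The bound near \<open>x\<close> holds on a punctured neighbourhood, so the
        value at \<open>x\<close> enters separately.\<close>
      have "F s \<le> max B (F x)" if "s \<in> {c..e}" for s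
        using d(2)[of s] that * by (cases "s = x") (auto simp: dist_real_def le_max_iff_disj abs_less_iff)
      then show "\<exists>B. \<forall>t\<in>{c..e}. F t \<le> B" by blast
    qed
  qed
  then show ?thesis by simp
qed

text \<open>With \<open>q = sqrt (1 + \<xi>\<^sup>2)\<close> and \<open>j \<le> 3\<close>, the
  product \<open>q ^ 3 * cmod h\<close> splits into \<open>sqrt \<delta> / q\<close>, which is
  square integrable, and \<open>q ^ 4 * cmod h / sqrt \<delta>\<close>, which the hypothesis
  controls. The free \<open>\<delta>\<close> plays the part of the square root in Cauchy-Schwarz: it
  lets the bound become small when \<open>h\<close> is small.\<close>

lemma weighted_moment_bound:
  fixes h :: "real \<Rightarrow> complex"
  assumes [measurable]: "h \<in> borel_measurable borel"
    and i: "integrable lborel (\<lambda>\<xi>. (1 + \<xi>\<^sup>2) powr 4 * (cmod (h \<xi>))\<^sup>2)" and j: "j \<le> 3"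
  shows "integrable lborel (\<lambda>\<xi>. (\<i> * of_real \<xi>) ^ j * h \<xi>)"
    and "\<delta> > 0 \<Longrightarrow> (LINT \<xi>|lborel. cmod ((\<i> * of_real \<xi>) ^ j * h \<xi>)) \<le>
      \<delta> / 2 * (LINT \<xi>|lborel. inverse (1 + \<xi>\<^sup>2)) + (LINT \<xi>|lborel. (1 + \<xi>\<^sup>2) powr 4 * (cmod (h \<xi>))\<^sup>2) / (2 * \<delta>)"
    and "integrable lborel (\<lambda>\<xi>. (cmod ((\<i> * of_real \<xi>) ^ j * h \<xi>))\<^sup>2)"
    and "(LINT \<xi>|lborel. (cmod ((\<i> * of_real \<xi>) ^ j * h \<xi>))\<^sup>2) \<le> (LINT \<xi>|lborel. (1 + \<xi>\<^sup>2) powr 4 * (cmod (h \<xi>))\<^sup>2)"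
proof -
  have p4: "(1 + \<xi>\<^sup>2) powr 4 = (1 + \<xi>\<^sup>2) ^ 4" for \<xi> :: real
    using powr_realpow[of "1 + \<xi>\<^sup>2" 4] by (simp add: add_pos_nonneg)
  have n: "cmod ((\<i> * of_real \<xi>) ^ j * h \<xi>) = \<bar>\<xi>\<bar> ^ j * cmod (h \<xi>)" for \<xi>
    by (simp add: norm_mult norm_power)
  have amgm: "cmod ((\<i> * of_real \<xi>) ^ j * h \<xi>) \<le> \<delta> / 2 * inverse (1 + \<xi>\<^sup>2) + (1 + \<xi>\<^sup>2) powr 4 * (cmod (h \<xi>))\<^sup>2 / (2 * \<delta>)"
    if "\<delta> > 0" for \<delta> \<xi>
  proof -
    define q where "q = sqrt (1 + \<xi>\<^sup>2)"
    have q: "q \<ge> 1" "q\<^sup>2 = 1 + \<xi>\<^sup>2" "\<bar>\<xi>\<bar> \<le> q" by (auto simp: q_def real_le_rsqrt)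
    have "\<bar>\<xi>\<bar> ^ j \<le> q ^ j" using q by (intro power_mono) auto
    also have "\<dots> \<le> q ^ 3" using q j by (intro power_increasing) auto
    finally have "\<bar>\<xi>\<bar> ^ j * cmod (h \<xi>) \<le> q ^ 3 * cmod (h \<xi>)" by (intro mult_right_mono) auto
    also have "\<dots> = (sqrt \<delta> / q) * (q ^ 4 * cmod (h \<xi>) / sqrt \<delta>)"
    proof -
      have "q \<noteq> 0" using q by auto
      then show ?thesis using that by (simp add: field_simps power_numeral_reduce)
    qed
    also have "\<dots> \<le> ((sqrt \<delta> / q)\<^sup>2 + (q ^ 4 * cmod (h \<xi>) / sqrt \<delta>)\<^sup>2) / 2"
    proof -
      have "x * y \<le> (x\<^sup>2 + y\<^sup>2) / 2" for x y :: real using sum_squares_bound[of x y] by simp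
      then show ?thesis by blast
    qed
    also have "\<dots> = \<delta> / 2 * inverse (q\<^sup>2) + (q\<^sup>2) ^ 4 * (cmod (h \<xi>))\<^sup>2 / (2 * \<delta>)"
      using that by (simp add: power_divide power_mult_distrib power_mult[symmetric] inverse_eq_divide add_divide_distrib)
    finally show ?thesis unfolding n p4 q(2) .
  qed
  have i': "integrable lborel (\<lambda>\<xi>. \<delta> / 2 * inverse (1 + \<xi>\<^sup>2) + (1 + \<xi>\<^sup>2) powr 4 * (cmod (h \<xi>))\<^sup>2 / (2 * \<delta>))" for \<delta> :: real
    using i integrable_inverse_1_plus_sq by simp
  show *: "integrable lborel (\<lambda>\<xi>. (\<i> * of_real \<xi>) ^ j * h \<xi>)"
    by (rule Bochner_Integration.integrable_bound[OF i'[of 1]])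
       (use amgm[of 1] in \<open>auto intro!: AE_I2 order_trans[OF _ abs_ge_self]\<close>)
  show "(LINT \<xi>|lborel. cmod ((\<i> * of_real \<xi>) ^ j * h \<xi>)) \<le>
      \<delta> / 2 * (LINT \<xi>|lborel. inverse (1 + \<xi>\<^sup>2)) + (LINT \<xi>|lborel. (1 + \<xi>\<^sup>2) powr 4 * (cmod (h \<xi>))\<^sup>2) / (2 * \<delta>)" if "\<delta> > 0"
  proof -
    have "(LINT \<xi>|lborel. cmod ((\<i> * of_real \<xi>) ^ j * h \<xi>)) \<le> (LINT \<xi>|lborel. \<delta> / 2 * inverse (1 + \<xi>\<^sup>2) + (1 + \<xi>\<^sup>2) powr 4 * (cmod (h \<xi>))\<^sup>2 / (2 * \<delta>))"
      by (intro integral_mono integrable_norm * i' amgm that)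
    also have "\<dots> = \<delta> / 2 * (LINT \<xi>|lborel. inverse (1 + \<xi>\<^sup>2)) + (LINT \<xi>|lborel. (1 + \<xi>\<^sup>2) powr 4 * (cmod (h \<xi>))\<^sup>2) / (2 * \<delta>)"
      using i integrable_inverse_1_plus_sq by (subst Bochner_Integration.integral_add) auto
    finally show ?thesis .
  qed
  have sq: "(cmod ((\<i> * of_real \<xi>) ^ j * h \<xi>))\<^sup>2 \<le> (1 + \<xi>\<^sup>2) powr 4 * (cmod (h \<xi>))\<^sup>2" for \<xi>
  proof -
    have "(\<bar>\<xi>\<bar> ^ j)\<^sup>2 = (\<xi>\<^sup>2) ^ j" by (simp add: power_mult[symmetric] mult.commute power_even_abs)
    also have "\<dots> \<le> (1 + \<xi>\<^sup>2) ^ j" by (intro power_mono) auto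
    also have "\<dots> \<le> (1 + \<xi>\<^sup>2) ^ 4" using j by (intro power_increasing) auto
    finally show ?thesis unfolding n p4 unfolding power_mult_distrib by (intro mult_right_mono) auto
  qed
  show **: "integrable lborel (\<lambda>\<xi>. (cmod ((\<i> * of_real \<xi>) ^ j * h \<xi>))\<^sup>2)"
    by (rule Bochner_Integration.integrable_bound[OF i])
       (use sq in \<open>auto intro!: AE_I2 order_trans[OF _ abs_ge_self]\<close>)
  show "(LINT \<xi>|lborel. (cmod ((\<i> * of_real \<xi>) ^ j * h \<xi>))\<^sup>2) \<le> (LINT \<xi>|lborel. (1 + \<xi>\<^sup>2) powr 4 * (cmod (h \<xi>))\<^sup>2)"
    by (intro integral_mono ** i sq)
qed

lemma ift_has_vector_derivative:
  assumes "integrable lborel g" "integrable lborel (\<lambda>\<xi>. \<i> * of_real \<xi> * g \<xi>)"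
  shows "(ift g has_vector_derivative ift (\<lambda>\<xi>. \<i> * of_real \<xi> * g \<xi>) x) (at x)"
proof -
  have "((\<lambda>x. LINT \<xi>|lborel. cis (x * \<xi>) * g \<xi>) has_vector_derivative (LINT \<xi>|lborel. cis (x * \<xi>) * (\<i> * of_real \<xi> * g \<xi>))) (at x within UNIV)"
  proof (rule has_vector_derivative_integral[where g = "\<lambda>\<xi>. norm (\<i> * of_real \<xi> * g \<xi>)"])
    fix s \<xi> :: real
    have e: "cis (s * \<xi>) = exp ((\<i> * of_real \<xi>) * of_real s)" for s
      by (simp add: cis_conv_exp mult_ac)
    have "((\<lambda>z. exp (\<i> * of_real \<xi> * z)) has_field_derivative
          \<i> * of_real \<xi> * exp (\<i> * of_real \<xi> * of_real s)) (at (of_real s))"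
      by (auto intro!: derivative_eq_intros)
    from has_vector_derivative_real_field[OF this]
    have "((\<lambda>s. cis (s * \<xi>)) has_vector_derivative \<i> * of_real \<xi> * cis (s * \<xi>)) (at s)" unfolding e .
    then show "((\<lambda>s. cis (s * \<xi>) * g \<xi>) has_vector_derivative cis (s * \<xi>) * (\<i> * of_real \<xi> * g \<xi>)) (at s within UNIV)"
    proof -
      assume d: "((\<lambda>s. cis (s * \<xi>)) has_vector_derivative \<i> * of_real \<xi> * cis (s * \<xi>)) (at s)"
      have "cis (s * \<xi>) * (\<i> * of_real \<xi> * g \<xi>) = (\<i> * of_real \<xi> * cis (s * \<xi>)) * g \<xi>"
        by (simp only: mult_ac)
      then show ?thesis using has_vector_derivative_mult_left[OF d, of "g \<xi>"] by (simp only:)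
    qed
  next
    show "integrable lborel (\<lambda>\<xi>. norm (\<i> * of_real \<xi> * g \<xi>))" using assms(2) by (rule integrable_norm)
    show "(\<lambda>\<xi>. cis (x * \<xi>) * (\<i> * of_real \<xi> * g \<xi>)) \<in> borel_measurable lborel"
      by (intro borel_measurable_integrable integrable_cis_mult assms(2))
  qed (auto simp: norm_mult intro!: integrable_cis_mult assms(1))
  then show ?thesis unfolding ift_eq
    by (intro has_vector_derivative_mult_right) simp
qed


text \<open>Four derivatives in L2 control three in the supremum norm, uniformly in time, by
  \<open>weighted_moment_bound\<close>. Pointwise continuity of \<open>u t\<close> is assumed
  because a transform determines a function only almost everywhere.\<close>

lemma sobolev_path_regular:
  assumes u: "sobolev_path 4 T u" and T: "0 \<le> T" and c: "\<And>t. t \<in> {0..T} \<Longrightarrow> continuous_on UNIV (u t)"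
  obtains D :: "nat \<Rightarrow> real \<Rightarrow> real \<Rightarrow> complex" and M where
    "\<And>t. t \<in> {0..T} \<Longrightarrow> D 0 t = u t"
    "\<And>j t x. j < 3 \<Longrightarrow> t \<in> {0..T} \<Longrightarrow> (D j t has_vector_derivative D (Suc j) t x) (at x)"
    "\<And>j. j \<le> 3 \<Longrightarrow> continuous_on ({0..T} \<times> UNIV) (\<lambda>(t, x). D j t x)"
    "\<And>j t x. j \<le> 3 \<Longrightarrow> t \<in> {0..T} \<Longrightarrow> cmod (D j t x) \<le> M"
    "\<And>j t. j \<le> 3 \<Longrightarrow> t \<in> {0..T} \<Longrightarrow> integrable lborel (\<lambda>x. (cmod (D j t x))\<^sup>2)"
    "\<And>j t. j \<le> 3 \<Longrightarrow> t \<in> {0..T} \<Longrightarrow> (LINT x|lborel. (cmod (D j t x))\<^sup>2) \<le> M"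
proof -
  let ?W = "\<lambda>h \<xi>. (1 + \<xi>\<^sup>2) powr 4 * (cmod (h \<xi>))\<^sup>2"
  define J where "J h = (LINT \<xi>|lborel. ?W h \<xi>)" for h :: "real \<Rightarrow> complex"
  have J0: "J h \<ge> 0" for h unfolding J_def by (rule integral_nonneg_AE) auto
  have "\<forall>t\<in>{0..T}. \<exists>g. has_fourier (u t) g \<and> integrable lborel (?W g)"
    using u unfolding sobolev_path_def sobolev_def by auto
  then obtain g where g: "\<And>t. t \<in> {0..T} \<Longrightarrow> has_fourier (u t) (g t)"
      "\<And>t. t \<in> {0..T} \<Longrightarrow> integrable lborel (?W (g t))"
    by metis
  have gm: "g t \<in> borel_measurable borel" if "t \<in> {0..T}" for t using has_fourier_measurable[OF g(1)[OF that]] .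
  define G where "G j t \<xi> = (\<i> * of_real \<xi>) ^ j * g t \<xi>" for j :: nat and t \<xi>
  have Gi: "integrable lborel (G j t)" if "t \<in> {0..T}" "j \<le> 3" for j t
    unfolding G_def[abs_def] by (rule weighted_moment_bound(1)[OF gm g(2)]) (use that in auto)
  define D where "D j t = ift (G j t)" for j t
  have p0: "0 \<le> (LINT \<xi>|lborel. inverse (1 + \<xi>\<^sup>2 :: real))" by (rule integral_nonneg_AE) auto
  define P where "P = (LINT \<xi>|lborel. inverse (1 + \<xi>\<^sup>2 :: real))"
  have Wd: "integrable lborel (?W (\<lambda>\<xi>. g t' \<xi> - g t \<xi>))" "J (g t') \<le> 2 * J (g t) + 2 * J (\<lambda>\<xi>. g t' \<xi> - g t \<xi>)"
    if t: "t \<in> {0..T}" "t' \<in> {0..T}" for t t'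
  proof -
    note [measurable] = gm[OF t(1)] gm[OF t(2)]
    have sq: "(cmod (a + b))\<^sup>2 \<le> 2 * (cmod a)\<^sup>2 + 2 * (cmod b)\<^sup>2" for a b
    proof -
      have "(cmod (a + b))\<^sup>2 \<le> (cmod a + cmod b)\<^sup>2" by (intro power_mono norm_triangle_ineq) auto
      also have "\<dots> \<le> 2 * (cmod a)\<^sup>2 + 2 * (cmod b)\<^sup>2"
        using sum_squares_bound[of "cmod a" "cmod b"] by (simp add: power2_sum)
      finally show ?thesis .
    qed
    have i: "integrable lborel (\<lambda>\<xi>. 2 * ?W (g t') \<xi> + 2 * ?W (g t) \<xi>)" using g(2) t by simp
    show d: "integrable lborel (?W (\<lambda>\<xi>. g t' \<xi> - g t \<xi>))"
    proof (rule Bochner_Integration.integrable_bound[OF i])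
      show "AE \<xi> in lborel. norm (?W (\<lambda>\<xi>. g t' \<xi> - g t \<xi>) \<xi>) \<le> norm (2 * ?W (g t') \<xi> + 2 * ?W (g t) \<xi>)"
      proof (rule AE_I2)
        fix \<xi>
        have "?W (\<lambda>\<xi>. g t' \<xi> - g t \<xi>) \<xi> \<le> (1 + \<xi>\<^sup>2) powr 4 * (2 * (cmod (g t' \<xi>))\<^sup>2 + 2 * (cmod (g t \<xi>))\<^sup>2)"
          using sq[of "g t' \<xi>" "- g t \<xi>"] by (intro mult_left_mono) auto
        then show "norm (?W (\<lambda>\<xi>. g t' \<xi> - g t \<xi>) \<xi>) \<le> norm (2 * ?W (g t') \<xi> + 2 * ?W (g t) \<xi>)"
          by (simp add: distrib_left mult.left_commute)
      qed
    qed measurable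
    have "J (g t') \<le> (LINT \<xi>|lborel. 2 * ?W (g t) \<xi> + 2 * ?W (\<lambda>\<xi>. g t' \<xi> - g t \<xi>) \<xi>)"
      unfolding J_def
    proof (rule integral_mono)
      show "?W (g t') \<xi> \<le> 2 * ?W (g t) \<xi> + 2 * ?W (\<lambda>\<xi>. g t' \<xi> - g t \<xi>) \<xi>" for \<xi>
      proof -
        have "?W (g t') \<xi> \<le> (1 + \<xi>\<^sup>2) powr 4 * (2 * (cmod (g t \<xi>))\<^sup>2 + 2 * (cmod (g t' \<xi> - g t \<xi>))\<^sup>2)"
          using sq[of "g t \<xi>" "g t' \<xi> - g t \<xi>"] by (intro mult_left_mono) auto
        then show ?thesis by (simp add: distrib_left mult.left_commute)
      qed
    qed (use g(2) t d in auto)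
    also have "\<dots> = 2 * J (g t) + 2 * J (\<lambda>\<xi>. g t' \<xi> - g t \<xi>)"
      unfolding J_def using g(2) t d by (subst Bochner_Integration.integral_add) auto
    finally show "J (g t') \<le> 2 * J (g t) + 2 * J (\<lambda>\<xi>. g t' \<xi> - g t \<xi>)" .
  qed
  have Jt: "((\<lambda>t'. J (\<lambda>\<xi>. g t' \<xi> - g t \<xi>)) \<longlongrightarrow> 0) (at t within {0..T})" if t: "t \<in> {0..T}" for t
  proof -
    have "((\<lambda>t'. sobolev_norm 4 (\<lambda>x. u t' x - u t x)) \<longlongrightarrow> 0) (at t within {0..T})"
      using u t unfolding sobolev_path_def by auto
    then have "((\<lambda>t'. (sobolev_norm 4 (\<lambda>x. u t' x - u t x))\<^sup>2) \<longlongrightarrow> 0\<^sup>2) (at t within {0..T})"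
      by (rule tendsto_power)
    moreover have "eventually (\<lambda>t'. (sobolev_norm 4 (\<lambda>x. u t' x - u t x))\<^sup>2 = J (\<lambda>\<xi>. g t' \<xi> - g t \<xi>)) (at t within {0..T})"
      unfolding eventually_at_filter
    proof (intro always_eventually allI impI)
      fix t' assume "t' \<in> {0..T}"
      then show "(sobolev_norm 4 (\<lambda>x. u t' x - u t x))\<^sup>2 = J (\<lambda>\<xi>. g t' \<xi> - g t \<xi>)"
        using sobolev_norm_eq[OF has_fourier_diff[OF g(1) g(1)], of t' t 4] t J0[of "\<lambda>\<xi>. g t' \<xi> - g t \<xi>"]
        by (simp add: J_def)
    qed
    ultimately have "((\<lambda>t'. J (\<lambda>\<xi>. g t' \<xi> - g t \<xi>)) \<longlongrightarrow> 0\<^sup>2) (at t within {0..T})"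
      by (rule Lim_transform_eventually)
    then show ?thesis by simp
  qed
  have Db: "cmod (D j t x) \<le> P / 2 + J (g t) / 2" if "t \<in> {0..T}" "j \<le> 3" for j t x
  proof -
    have "cmod (D j t x) \<le> 1 / sqrt (2 * pi) * (LINT \<xi>|lborel. cmod (G j t \<xi>))"
      unfolding D_def by (rule ift_bounded[OF Gi[OF that]])
    also have "\<dots> \<le> 1 * (LINT \<xi>|lborel. cmod (G j t \<xi>))"
      using pi_ge_two by (intro mult_right_mono) (auto simp: real_le_rsqrt)
    also have "\<dots> \<le> P / 2 + J (g t) / 2"
      using weighted_moment_bound(2)[OF gm[OF that(1)] g(2)[OF that(1)], of j 1] that by (simp add: G_def P_def J_def)
    finally show ?thesis .
  qed
  have Dd: "cmod (D j t' x - D j t x) \<le> \<delta> / 2 * P + J (\<lambda>\<xi>. g t' \<xi> - g t \<xi>) / (2 * \<delta>)"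
    if "t \<in> {0..T}" "t' \<in> {0..T}" "j \<le> 3" "\<delta> > 0" for j t t' x \<delta>
  proof -
    note [measurable] = gm[OF that(1)] gm[OF that(2)]
    have i: "integrable lborel (\<lambda>\<xi>. G j t' \<xi> - G j t \<xi>)" using Gi that by simp
    have "D j t' x - D j t x = ift (\<lambda>\<xi>. G j t' \<xi> - G j t \<xi>) x"
      using integrable_cis_mult[OF Gi[OF that(2,3)], of x] integrable_cis_mult[OF Gi[OF that(1,3)], of x]
      unfolding D_def ift_eq by (simp add: right_diff_distrib)
    then have "cmod (D j t' x - D j t x) \<le> 1 / sqrt (2 * pi) * (LINT \<xi>|lborel. cmod (G j t' \<xi> - G j t \<xi>))"
      using ift_bounded[OF i] by simp
    also have "\<dots> \<le> 1 * (LINT \<xi>|lborel. cmod (G j t' \<xi> - G j t \<xi>))"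
      using pi_ge_two by (intro mult_right_mono) (auto simp: real_le_rsqrt)
    also have "\<dots> \<le> \<delta> / 2 * P + J (\<lambda>\<xi>. g t' \<xi> - g t \<xi>) / (2 * \<delta>)"
      using weighted_moment_bound(2)[OF _ Wd(1)[OF that(1,2)] that(3,4)]
      by (simp add: G_def P_def J_def right_diff_distrib)
    finally show ?thesis .
  qed
  \<comment> \<open>Continuity in the norm bounds \<open>J (g t)\<close> near each time; compactness
    of the interval makes the bound uniform.\<close>
  have "\<exists>B. \<forall>t\<in>{0..T}. J (g t) \<le> B"
  proof (rule locally_bounded_Icc[OF T])
    fix t assume t: "t \<in> {0..T}"
    have "eventually (\<lambda>t'. J (\<lambda>\<xi>. g t' \<xi> - g t \<xi>) < 1) (at t within {0..T})"
      using order_tendstoD(2)[OF Jt[OF t], of 1] by simp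
    then have "eventually (\<lambda>t'. J (g t') \<le> 2 * J (g t) + 2) (at t within {0..T})"
      unfolding eventually_at_filter by eventually_elim (use Wd(2)[OF t] in force)
    then show "\<exists>B. eventually (\<lambda>t'. J (g t') \<le> B) (at t within {0..T})" by blast
  qed
  then obtain B where B: "\<And>t. t \<in> {0..T} \<Longrightarrow> J (g t) \<le> B" by blast
  have B0: "B \<ge> 0" using B[of 0] J0[of "g 0"] T by simp
  show thesis
  proof (rule that[of D "P + B"])
    show "D 0 t = u t" if t: "t \<in> {0..T}" for t
    proof (rule AE_eq_imp_eq_continuous)
      have "G 0 t = g t" by (simp add: G_def fun_eq_iff)
      then have i: "integrable lborel (g t)" and D0: "D 0 t = ift (g t)" using Gi[OF t, of 0] by (auto simp: D_def)
      show "continuous_on UNIV (D 0 t)" unfolding D0 by (rule continuous_ift[OF i])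
      show "AE x in lborel. D 0 t x = u t x" unfolding D0
        by (rule has_fourier_unique_left[OF has_fourier_ift[OF i] g(1)[OF t]])
    qed (rule c[OF t])
    show "(D j t has_vector_derivative D (Suc j) t x) (at x)" if "j < 3" "t \<in> {0..T}" for j t x
    proof -
      have "G (Suc j) t = (\<lambda>\<xi>. \<i> * of_real \<xi> * G j t \<xi>)" by (simp add: G_def fun_eq_iff)
      then show ?thesis
        using ift_has_vector_derivative[OF Gi[of t j], of x] Gi[of t "Suc j"] that by (simp add: D_def)
    qed
    show "cmod (D j t x) \<le> P + B" if "j \<le> 3" "t \<in> {0..T}" for j t x
      using Db[OF that(2,1), of x] B[OF that(2)] B0 p0 unfolding P_def[symmetric] by linarith
    show "integrable lborel (\<lambda>x. (cmod (D j t x))\<^sup>2)" "(LINT x|lborel. (cmod (D j t x))\<^sup>2) \<le> P + B"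
      if "j \<le> 3" "t \<in> {0..T}" for j t
    proof -
      have sq: "integrable lborel (\<lambda>\<xi>. (cmod (G j t \<xi>))\<^sup>2)" "(LINT \<xi>|lborel. (cmod (G j t \<xi>))\<^sup>2) \<le> J (g t)"
        using weighted_moment_bound(3,4)[OF gm[OF that(2)] g(2)[OF that(2)], of j] that by (auto simp: G_def J_def)
      show "integrable lborel (\<lambda>x. (cmod (D j t x))\<^sup>2)" unfolding D_def by (rule ift_L2(1)[OF Gi sq(1)]) (use that in auto)
      have "(LINT x|lborel. (cmod (D j t x))\<^sup>2) \<le> (LINT \<xi>|lborel. (cmod (G j t \<xi>))\<^sup>2)"
        unfolding D_def by (rule ift_L2(2)[OF Gi sq(1)]) (use that in auto)
      then show "(LINT x|lborel. (cmod (D j t x))\<^sup>2) \<le> P + B"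
        using sq(2) B[OF that(2)] p0 unfolding P_def[symmetric] by linarith
    qed
    show "continuous_on ({0..T} \<times> UNIV) (\<lambda>(t, x). D j t x)" if j: "j \<le> 3" for j
      unfolding continuous_on_sequentially comp_def
    proof (intro allI ballI impI)
      fix X and a :: "real \<times> real"
      assume a: "a \<in> {0..T} \<times> UNIV" and X: "(\<forall>n. X n \<in> {0..T} \<times> UNIV) \<and> X \<longlonglongrightarrow> a"
      obtain t x where tx: "a = (t, x)" "t \<in> {0..T}" using a by auto
      have X1: "fst (X n) \<in> {0..T}" for n using X by (auto simp: mem_Times_iff)
      have lim1: "(\<lambda>n. fst (X n)) \<longlonglongrightarrow> t" and lim2: "(\<lambda>n. snd (X n)) \<longlonglongrightarrow> x"
        using X tendsto_fst[of X a] tendsto_snd[of X a] tx by auto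
      have Jn: "(\<lambda>n. J (\<lambda>\<xi>. g (fst (X n)) \<xi> - g t \<xi>)) \<longlonglongrightarrow> 0"
      proof (rule LIMSEQ_I)
        fix e :: real assume e: "e > 0"
        \<comment> \<open>The limit within the interval excludes the point \<open>t\<close> itself,
          which the sequence may hit.\<close>
        have Jtt: "J (\<lambda>\<xi>. g t \<xi> - g t \<xi>) = 0" by (simp add: J_def)
        obtain d where d: "d > 0" "\<And>s. s \<in> {0..T} \<Longrightarrow> s \<noteq> t \<Longrightarrow> dist s t < d \<Longrightarrow> dist (J (\<lambda>\<xi>. g s \<xi> - g t \<xi>)) 0 < e"
          using tendstoD[OF Jt[OF tx(2)] e] unfolding eventually_at by auto
        obtain N where N: "\<And>n. n \<ge> N \<Longrightarrow> dist (fst (X n)) t < d"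
          using lim1 d(1) unfolding lim_sequentially by blast
        have "norm (J (\<lambda>\<xi>. g (fst (X n)) \<xi> - g t \<xi>) - 0) < e" if "n \<ge> N" for n
          using d(2)[OF X1, of n] N[OF that] Jtt e by (cases "fst (X n) = t") auto
        then show "\<exists>N. \<forall>n\<ge>N. norm (J (\<lambda>\<xi>. g (fst (X n)) \<xi> - g t \<xi>) - 0) < e" by blast
      qed
      have "(\<lambda>n. D j (fst (X n)) (snd (X n)) - D j t (snd (X n))) \<longlonglongrightarrow> 0"
      proof (rule LIMSEQ_I)
        fix e :: real assume e: "e > 0"
        \<comment> \<open>Makes the first term of \<open>Dd\<close> smaller than
          \<open>e / 2\<close>; then \<open>J < \<delta> * e\<close> does the same for the second
          term.\<close>
        define \<delta> where "\<delta> = e / (P + 1)"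
        have \<delta>: "\<delta> > 0" "\<delta> / 2 * P < e / 2 + 0"
          using e p0 unfolding P_def[symmetric] by (auto simp: \<delta>_def field_simps)
        obtain N where N: "\<And>n. n \<ge> N \<Longrightarrow> norm (J (\<lambda>\<xi>. g (fst (X n)) \<xi> - g t \<xi>) - 0) < \<delta> * e"
          using LIMSEQ_D[OF Jn, of "\<delta> * e"] \<delta> e by auto
        have "norm (D j (fst (X n)) (snd (X n)) - D j t (snd (X n)) - 0) < e" if "n \<ge> N" for n
        proof -
          have "J (\<lambda>\<xi>. g (fst (X n)) \<xi> - g t \<xi>) / (2 * \<delta>) < e / 2"
            using N[OF that] \<delta>(1) by (auto simp: divide_simps mult.commute)
          then show ?thesis
            using Dd[OF tx(2) X1 j \<delta>(1), of n "snd (X n)"] \<delta>(2) by simp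
        qed
        then show "\<exists>N. \<forall>n\<ge>N. norm (D j (fst (X n)) (snd (X n)) - D j t (snd (X n)) - 0) < e" by blast
      qed
      moreover have "(\<lambda>n. D j t (snd (X n))) \<longlonglongrightarrow> D j t x"
        using continuous_ift[OF Gi[OF tx(2) j]] lim2 unfolding D_def[symmetric]
        by (auto simp: continuous_on_sequentially o_def)
      ultimately have "(\<lambda>n. (D j (fst (X n)) (snd (X n)) - D j t (snd (X n))) + D j t (snd (X n))) \<longlonglongrightarrow> 0 + D j t x"
        by (rule tendsto_add)
      then show "(\<lambda>n. case X n of (t, x) \<Rightarrow> D j t x) \<longlonglongrightarrow> (case a of (t, x) \<Rightarrow> D j t x)"
        by (simp add: split_beta tx)
    qed
  qed
qed

subsection \<open>An abstract energy estimate\<close>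

lemma integral_power_Icc:
  fixes t :: real assumes "t \<ge> 0"
  shows "(LINT s|lborel. indicator {0..t} s * s ^ n) = t ^ Suc n / Suc n"
    and "integrable lborel (\<lambda>s. indicator {0..t} s * s ^ n)"
proof -
  have d: "((\<lambda>s. s ^ Suc n / Suc n) has_vector_derivative s ^ n) (at s within {0..t})" for s :: real
    unfolding has_real_derivative_iff_has_vector_derivative[symmetric]
    by (rule DERIV_cong, rule DERIV_cdivide, rule DERIV_power, rule DERIV_ident) (simp del: of_nat_Suc)
  have "(LBINT s. indicator {0..t} s *\<^sub>R s ^ n) = t ^ Suc n / Suc n - 0 ^ Suc n / Suc n"
    by (rule integral_FTC_Icc[OF assms d]) (auto intro!: continuous_intros)
  then show "(LINT s|lborel. indicator {0..t} s * s ^ n) = t ^ Suc n / Suc n" by simp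
  have "integrable lborel (\<lambda>s. indicator {0..t} s *\<^sub>R s ^ n)"
    by (rule borel_integrable_compact) (auto intro!: continuous_intros)
  then show "integrable lborel (\<lambda>s. indicator {0..t} s * s ^ n)" by simp
qed

text \<open>Iterating the integral inequality gives
  \<open>D t \<le> M * (C * t) ^ n / fact n\<close>, which tends to 0. This form of Gronwall's lemma
  works with integrability and an upper bound in place of continuity of \<open>D\<close>.\<close>

lemma gronwall_zero:
  fixes D :: "real \<Rightarrow> real"
  assumes m: "\<And>t. t \<in> {0..T} \<Longrightarrow> integrable lborel (\<lambda>s. indicator {0..t} s * D s)"
    and b: "\<And>t. t \<in> {0..T} \<Longrightarrow> D t \<le> M" and C: "C \<ge> 0"
    and le: "\<And>t. t \<in> {0..T} \<Longrightarrow> D t \<le> C * (LINT s|lborel. indicator {0..t} s * D s)"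
    and t: "t \<in> {0..T}"
  shows "D t \<le> 0"
proof -
  have it: "\<forall>t\<in>{0..T}. D t \<le> M * ((C * t) ^ n / fact n)" for n
  proof (induction n)
    case 0 then show ?case using b by simp
  next
    case (Suc n)
    show ?case
    proof
      fix t assume t: "t \<in> {0..T}"
      have i: "integrable lborel (\<lambda>s. (M * C ^ n / fact n) * (indicator {0..t} s * s ^ n))"
        using integral_power_Icc(2)[of t n] t by simp
      have "(LINT s|lborel. indicator {0..t} s * D s) \<le> (LINT s|lborel. (M * C ^ n / fact n) * (indicator {0..t} s * s ^ n))"
      proof (rule integral_mono[OF m[OF t] i])
        fix s
        show "indicator {0..t} s * D s \<le> (M * C ^ n / fact n) * (indicator {0..t} s * s ^ n)"
          using Suc[rule_format, of s] t by (cases "s \<in> {0..t}") (auto simp: power_mult_distrib field_simps)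
      qed
      also have "\<dots> = (M * C ^ n / fact n) * (t ^ Suc n / Suc n)"
        using integral_power_Icc(1)[of t n] t by simp
      finally have "C * (LINT s|lborel. indicator {0..t} s * D s) \<le> C * ((M * C ^ n / fact n) * (t ^ Suc n / Suc n))"
        using C by (intro mult_left_mono)
      with le[OF t] have "D t \<le> C * ((M * C ^ n / fact n) * (t ^ Suc n / Suc n))" by linarith
      also have "\<dots> = M * ((C * t) ^ Suc n / fact (Suc n))"
        by (simp add: power_mult_distrib field_simps)
      finally show "D t \<le> M * ((C * t) ^ Suc n / fact (Suc n))" .
    qed
  qed
  have "(\<lambda>n. (C * t) ^ n / fact n) \<longlonglongrightarrow> 0"
    using summable_LIMSEQ_zero[OF summable_exp_generic[of "C * t"]] by (simp add: divide_inverse mult.commute)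
  then have "(\<lambda>n. M * ((C * t) ^ n / fact n)) \<longlonglongrightarrow> M * 0" by (intro tendsto_intros)
  then show ?thesis
    using it t by (intro LIMSEQ_le_const[of _ "M * 0", simplified]) auto
qed

text \<open>The local balance law becomes Gronwall's inequality after integration in
  \<open>x\<close>, since the flux derivative \<open>F'\<close> has integral zero. The time
  derivative is not moved through the x-integral; instead \<open>e\<close> is written as the time
  integral of \<open>e'\<close> and the two integrals are exchanged, for which the common majorant
  \<open>\<sigma>\<close> suffices.\<close>

lemma energy_zero:
  fixes e e' F F' :: "real \<Rightarrow> real \<Rightarrow> real"
  assumes T: "0 \<le> T" and e0: "\<And>x. e 0 x = 0"
    and et: "\<And>t x. t \<in> {0..T} \<Longrightarrow> ((\<lambda>\<tau>. e \<tau> x) has_vector_derivative e' t x) (at t within {0..T})"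
    and Fx: "\<And>t x. t \<in> {0..T} \<Longrightarrow> (F t has_vector_derivative F' t x) (at x)"
    and ce: "continuous_on ({0..T} \<times> UNIV) (\<lambda>z. e (fst z) (snd z))"
    and ce': "continuous_on ({0..T} \<times> UNIV) (\<lambda>z. e' (fst z) (snd z))"
    and cF': "\<And>t. t \<in> {0..T} \<Longrightarrow> continuous_on UNIV (F' t)"
    and bd: "\<And>t x. t \<in> {0..T} \<Longrightarrow> \<bar>e t x\<bar> \<le> \<sigma> t x" "\<And>t x. t \<in> {0..T} \<Longrightarrow> \<bar>e' t x\<bar> \<le> \<sigma> t x"
      "\<And>t x. t \<in> {0..T} \<Longrightarrow> \<bar>F t x\<bar> \<le> \<sigma> t x" "\<And>t x. t \<in> {0..T} \<Longrightarrow> \<bar>F' t x\<bar> \<le> \<sigma> t x"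
    and \<sigma>: "\<And>t. t \<in> {0..T} \<Longrightarrow> integrable lborel (\<sigma> t)" "\<And>t. t \<in> {0..T} \<Longrightarrow> (LINT x|lborel. \<sigma> t x) \<le> M"
    and R: "\<And>t x. t \<in> {0..T} \<Longrightarrow> e' t x - F' t x \<le> C * e t x" and C: "C \<ge> 0"
    and pos: "\<And>t x. t \<in> {0..T} \<Longrightarrow> 0 \<le> e t x"
    and t: "t \<in> {0..T}"
  shows "e t x = 0"
proof -
  have slice: "continuous_on UNIV (f t)" if "continuous_on ({0..T} \<times> UNIV) (\<lambda>z. f (fst z) (snd z))" "t \<in> {0..T}"
    for f :: "real \<Rightarrow> real \<Rightarrow> real" and t
  proof -
    have "continuous_on UNIV ((\<lambda>z. f (fst z) (snd z)) \<circ> (\<lambda>x. (t, x)))"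
      by (rule continuous_on_compose) (use that in \<open>auto intro!: continuous_intros elim!: continuous_on_subset\<close>)
    then show ?thesis by (simp add: o_def)
  qed
  have slice': "continuous_on {0..T} (\<lambda>t. f t x)" if "continuous_on ({0..T} \<times> UNIV) (\<lambda>z. f (fst z) (snd z))"
    for f :: "real \<Rightarrow> real \<Rightarrow> real" and x
  proof -
    have "continuous_on {0..T} ((\<lambda>z. f (fst z) (snd z)) \<circ> (\<lambda>t. (t, x)))"
      by (rule continuous_on_compose) (use that in \<open>auto intro!: continuous_intros elim!: continuous_on_subset\<close>)
    then show ?thesis by (simp add: o_def)
  qed
  have int: "integrable lborel (f t)"
    if "t \<in> {0..T}" "continuous_on UNIV (f t)" "\<And>x. \<bar>f t x\<bar> \<le> \<sigma> t x" for f :: "real \<Rightarrow> real \<Rightarrow> real" and t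
    by (rule Bochner_Integration.integrable_bound[OF \<sigma>(1)[OF that(1)]])
       (use that in \<open>auto intro!: borel_measurable_continuous_onI AE_I2 order_trans[OF _ abs_ge_self]\<close>)
  have ei: "integrable lborel (e t)" and e'i: "integrable lborel (e' t)" and Fi: "integrable lborel (F t)"
    and F'i: "integrable lborel (F' t)" if "t \<in> {0..T}" for t
    using int[where f = e, OF that slice[where f = e, OF ce that] bd(1)[OF that]]
      int[where f = e', OF that slice[where f = e', OF ce' that] bd(2)[OF that]]
      int[where f = F', OF that cF'[OF that] bd(4)[OF that]]
      int[where f = F, OF that _ bd(3)[OF that]] Fx[OF that]
    by (auto intro!: continuous_at_imp_continuous_on has_vector_derivative_continuous)
  define D where "D t = (LINT x|lborel. e t x)" for t
  have M0: "0 \<le> M"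
  proof -
    have "0 \<le> \<sigma> 0 x" for x using bd(1)[of 0 x] T by simp
    then have "0 \<le> (LINT x|lborel. \<sigma> 0 x)" by (intro integral_nonneg_AE) simp
    then show ?thesis using \<sigma>(2)[of 0] T by simp
  qed
  have joint: "integrable (lborel \<Otimes>\<^sub>M lborel) (\<lambda>(s, x). indicator {0..t} s *\<^sub>R f s x)"
    if t: "t \<in> {0..T}" and c: "continuous_on ({0..T} \<times> UNIV) (\<lambda>z. f (fst z) (snd z))"
      and b: "\<And>t x. t \<in> {0..T} \<Longrightarrow> \<bar>f t x\<bar> \<le> \<sigma> t x" for f :: "real \<Rightarrow> real \<Rightarrow> real" and t
  proof (rule lborel_pair.Fubini_integrable)
    have sub: "{0..t} \<times> UNIV \<subseteq> {0..T} \<times> (UNIV :: real set)" using t by auto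
    have "(\<lambda>z. indicator ({0..t} \<times> UNIV) z *\<^sub>R f (fst z) (snd z)) \<in> borel_measurable borel"
      by (rule borel_measurable_continuous_on_indicator)
         (use continuous_on_subset[OF c sub] in \<open>auto intro!: borel_closed closed_Times\<close>)
    then show m: "(\<lambda>(s, x). indicator {0..t} s *\<^sub>R f s x) \<in> borel_measurable (lborel \<Otimes>\<^sub>M lborel)"
      by (simp add: split_beta' indicator_times lborel_prod)
    have fi: "integrable lborel (f s)" if "s \<in> {0..T}" for s by (rule int[where f = f, OF that slice[where f = f, OF c that] b[OF that]])
    show "integrable lborel (\<lambda>s. LINT x|lborel. norm (case (s, x) of (s, x) \<Rightarrow> indicator {0..t} s *\<^sub>R f s x))"
    proof (rule Bochner_Integration.integrable_bound)
      show "integrable lborel (\<lambda>s. M * indicator {0..t} s :: real)"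
        using integral_power_Icc(2)[of t 0] t by simp
      show "(\<lambda>s. LINT x|lborel. norm (case (s, x) of (s, x) \<Rightarrow> indicator {0..t} s *\<^sub>R f s x)) \<in> borel_measurable lborel"
        using m by (intro lborel.borel_measurable_lebesgue_integral) (simp add: split_beta')
      show "AE s in lborel. norm (LINT x|lborel. norm (case (s, x) of (s, x) \<Rightarrow> indicator {0..t} s *\<^sub>R f s x)) \<le> norm (M * indicator {0..t} s :: real)"
      proof (rule AE_I2)
        fix s
        show "norm (LINT x|lborel. norm (case (s, x) of (s, x) \<Rightarrow> indicator {0..t} s *\<^sub>R f s x)) \<le> norm (M * indicator {0..t} s :: real)"
        proof (cases "s \<in> {0..t}")
          case True
          then have s: "s \<in> {0..T}" using t by auto
          have "(LINT x|lborel. \<bar>f s x\<bar>) \<le> (LINT x|lborel. \<sigma> s x)"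
            using fi[OF s] \<sigma>(1)[OF s] b[OF s] by (intro integral_mono) auto
          also have "\<dots> \<le> M" by (rule \<sigma>(2)[OF s])
          finally show ?thesis using True M0 by simp
        qed simp
      qed
    qed
    show "AE s in lborel. integrable lborel (\<lambda>x. case (s, x) of (s, x) \<Rightarrow> indicator {0..t} s *\<^sub>R f s x)"
    proof (rule AE_I2)
      fix s show "integrable lborel (\<lambda>x. case (s, x) of (s, x) \<Rightarrow> indicator {0..t} s *\<^sub>R f s x)"
        using fi[of s] t by (cases "s \<in> {0..t}") auto
    qed
  qed
  have le: "D t \<le> C * (LINT s|lborel. indicator {0..t} s * D s)" if t: "t \<in> {0..T}" for t
  proof -
    have "e t x = (LINT s|lborel. indicator {0..t} s *\<^sub>R e' s x)" for x
    proof -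
      have "(LBINT s. indicator {0..t} s *\<^sub>R e' s x) = e t x - e 0 x"
      proof (rule integral_FTC_Icc)
        show "((\<lambda>s. e s x) has_vector_derivative e' s x) (at s within {0..t})" if "0 \<le> s" "s \<le> t" for s
          by (rule has_vector_derivative_within_subset[OF et]) (use that t in auto)
        show "continuous_on {0..t} (\<lambda>s. e' s x)"
          by (rule continuous_on_subset[OF slice'[where f = e', OF ce']]) (use t in auto)
      qed (use t in auto)
      then show ?thesis by (simp add: e0)
    qed
    then have "D t = (LINT x|lborel. LINT s|lborel. indicator {0..t} s *\<^sub>R e' s x)"
      by (simp add: D_def)
    also have "\<dots> = (LINT s|lborel. LINT x|lborel. indicator {0..t} s *\<^sub>R e' s x)"
      by (rule lborel_pair.Fubini_integral[OF joint[where f = e', OF t ce' bd(2)]])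
    also have "\<dots> \<le> (LINT s|lborel. C * (indicator {0..t} s * D s))"
    proof (rule integral_mono)
      show "integrable lborel (\<lambda>s. LINT x|lborel. indicator {0..t} s *\<^sub>R e' s x)"
        using lborel_pair.integrable_fst'[OF joint[where f = e', OF t ce' bd(2)]] by simp
      show "integrable lborel (\<lambda>s. C * (indicator {0..t} s * D s))"
        using lborel_pair.integrable_fst'[OF joint[where f = e, OF t ce bd(1)]] by (simp add: D_def)
      fix s
      show "(LINT x|lborel. indicator {0..t} s *\<^sub>R e' s x) \<le> C * (indicator {0..t} s * D s)"
      proof (cases "s \<in> {0..t}")
        case True
        then have s: "s \<in> {0..T}" using t by auto
        have "(LINT x|lborel. F' s x) = 0"
          by (rule integral_deriv_eq_0[OF Fx[OF s] cF'[OF s] Fi[OF s] F'i[OF s]])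
        then have "(LINT x|lborel. e' s x) = (LINT x|lborel. e' s x - F' s x)"
          using e'i[OF s] F'i[OF s] by simp
        also have "\<dots> \<le> (LINT x|lborel. C * e s x)"
          using e'i[OF s] F'i[OF s] ei[OF s] R[OF s] by (intro integral_mono) auto
        finally show ?thesis using True by (simp add: D_def)
      qed simp
    qed
    finally show ?thesis by simp
  qed
  have "D t \<le> 0"
  proof (rule gronwall_zero[OF _ _ C le t])
    show "integrable lborel (\<lambda>s. indicator {0..t} s * D s)" if "t \<in> {0..T}" for t
      using lborel_pair.integrable_fst'[OF joint[where f = e, OF that ce bd(1)]] by (simp add: D_def)
    show "D t \<le> M" if "t \<in> {0..T}" for t
    proof -
      have "D t \<le> (LINT x|lborel. \<sigma> t x)" unfolding D_def
        using ei[OF that] \<sigma>(1)[OF that] bd(1)[OF that] by (intro integral_mono) (auto intro: order_trans[OF abs_ge_self])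
      then show ?thesis using \<sigma>(2)[OF that] by simp
    qed
  qed
  moreover have "0 \<le> D t" unfolding D_def by (rule integral_nonneg_AE) (use pos[OF t] in auto)
  ultimately have "D t = 0" by simp
  then have "AE x in lborel. e t x = 0"
    using integral_nonneg_eq_0_iff_AE[OF ei[OF t]] pos[OF t] by (simp add: D_def)
  then have "(\<lambda>x. complex_of_real (e t x)) = (\<lambda>x. 0)"
    using slice[where f = e, OF ce t] by (intro AE_eq_imp_eq_continuous) (auto intro!: continuous_intros)
  then show ?thesis by (metis of_real_eq_0_iff)
qed

subsection \<open>Growth and continuity bookkeeping on a space-time strip\<close>

text \<open>Landau symbol on the strip. Weight 1 marks bounded coefficients, a weight built from the
  difference of two solutions marks linear terms, and its square marks quadratic ones; the rules
  below read off the order of a long expression from its shape.\<close>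

definition strip_O :: "real \<Rightarrow> (real \<Rightarrow> real \<Rightarrow> real) \<Rightarrow> (real \<Rightarrow> real \<Rightarrow> 'a::real_normed_vector) \<Rightarrow> bool" where
  "strip_O T \<sigma> f \<longleftrightarrow> (\<exists>C\<ge>0. \<forall>t\<in>{0..T}. \<forall>x. norm (f t x) \<le> C * \<sigma> t x)"

lemma strip_OI: "(\<And>t x. t \<in> {0..T} \<Longrightarrow> norm (f t x) \<le> C * \<sigma> t x) \<Longrightarrow> C \<ge> 0 \<Longrightarrow> strip_O T \<sigma> f"
  unfolding strip_O_def by blast

lemma strip_O_add:
  assumes "strip_O T \<sigma> f" "strip_O T \<sigma> g" shows "strip_O T \<sigma> (\<lambda>t x. f t x + g t x)"
proof -
  obtain C C' where "C \<ge> 0" "C' \<ge> 0" and *: "\<forall>t\<in>{0..T}. \<forall>x. norm (f t x) \<le> C * \<sigma> t x" "\<forall>t\<in>{0..T}. \<forall>x. norm (g t x) \<le> C' * \<sigma> t x"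
    using assms unfolding strip_O_def by blast
  then show ?thesis
    by (intro strip_OI[where C = "C + C'"]) (auto simp: distrib_right intro!: norm_triangle_mono)
qed

lemma strip_O_minus: "strip_O T \<sigma> f \<Longrightarrow> strip_O T \<sigma> (\<lambda>t x. - f t x)"
  by (simp add: strip_O_def)

lemma strip_O_diff: "strip_O T \<sigma> f \<Longrightarrow> strip_O T \<sigma> g \<Longrightarrow> strip_O T \<sigma> (\<lambda>t x. f t x - g t x)"
  using strip_O_add[of T \<sigma> f "\<lambda>t x. - g t x"] strip_O_minus[of T \<sigma> g] by simp

lemma strip_O_mult_gen:
  fixes f g :: "real \<Rightarrow> real \<Rightarrow> 'a::real_normed_algebra"
  assumes "strip_O T \<sigma> f" "strip_O T \<tau> g" shows "strip_O T (\<lambda>t x. \<sigma> t x * \<tau> t x) (\<lambda>t x. f t x * g t x)"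
proof -
  obtain C C' where "C \<ge> 0" "C' \<ge> 0" and *: "\<And>t x. t\<in>{0..T} \<Longrightarrow> norm (f t x) \<le> C * \<sigma> t x" "\<And>t x. t\<in>{0..T} \<Longrightarrow> norm (g t x) \<le> C' * \<tau> t x"
    using assms unfolding strip_O_def by blast
  have "norm (f t x * g t x) \<le> (C * C') * (\<sigma> t x * \<tau> t x)" if "t \<in> {0..T}" for t x
  proof -
    have "norm (f t x * g t x) \<le> norm (f t x) * norm (g t x)" by (rule norm_mult_ineq)
    also have "\<dots> \<le> (C * \<sigma> t x) * (C' * \<tau> t x)"
      by (intro mult_mono *[OF that] order_trans[OF norm_ge_zero *(1)[OF that]] norm_ge_zero)
    finally show ?thesis by (simp add: mult_ac)
  qed
  then show ?thesis using \<open>C \<ge> 0\<close> \<open>C' \<ge> 0\<close> by (intro strip_OI[where C = "C * C'"]) auto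
qed

lemma strip_O_mult_right:
  fixes f g :: "real \<Rightarrow> real \<Rightarrow> 'a::real_normed_algebra"
  shows "strip_O T (\<lambda>_ _. 1) f \<Longrightarrow> strip_O T \<sigma> g \<Longrightarrow> strip_O T \<sigma> (\<lambda>t x. f t x * g t x)"
  using strip_O_mult_gen[of T "\<lambda>_ _. 1" f \<sigma> g] by simp

lemma strip_O_mult_left:
  fixes f g :: "real \<Rightarrow> real \<Rightarrow> 'a::real_normed_algebra"
  shows "strip_O T \<sigma> f \<Longrightarrow> strip_O T (\<lambda>_ _. 1) g \<Longrightarrow> strip_O T \<sigma> (\<lambda>t x. f t x * g t x)"
  using strip_O_mult_gen[of T \<sigma> f "\<lambda>_ _. 1" g] by simp

lemma strip_O_mult:
  fixes f g :: "real \<Rightarrow> real \<Rightarrow> 'a::real_normed_algebra"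
  shows "strip_O T \<sigma> f \<Longrightarrow> strip_O T \<sigma> g \<Longrightarrow> strip_O T (\<lambda>t x. (\<sigma> t x)\<^sup>2) (\<lambda>t x. f t x * g t x)"
  using strip_O_mult_gen[of T \<sigma> f \<sigma> g] by (simp add: power2_eq_square)

lemma strip_O_const: "strip_O T (\<lambda>_ _. 1) (\<lambda>_ _. c)"
  by (rule strip_OI[where C = "norm c"]) auto

lemma strip_O_Re: "strip_O T \<sigma> f \<Longrightarrow> strip_O T \<sigma> (\<lambda>t x. Re (f t x))"
  unfolding strip_O_def by (auto intro: order_trans[OF abs_Re_le_cmod])

lemma strip_O_cnj: "strip_O T \<sigma> f \<Longrightarrow> strip_O T \<sigma> (\<lambda>t x. cnj (f t x))"
  unfolding strip_O_def by simp

lemma strip_O_of_real: "strip_O T \<sigma> f \<Longrightarrow> strip_O T \<sigma> (\<lambda>t x. complex_of_real (f t x))"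
  unfolding strip_O_def by simp

lemma strip_O_mono:
  assumes "strip_O T \<sigma> f" "\<And>t x. \<sigma> t x \<le> \<tau> t x" shows "strip_O T \<tau> f"
proof -
  obtain C where "C \<ge> 0" and *: "\<And>t x. t \<in> {0..T} \<Longrightarrow> norm (f t x) \<le> C * \<sigma> t x"
    using assms(1) unfolding strip_O_def by blast
  then show ?thesis
    by (intro strip_OI[of T f C] order_trans[OF *] mult_left_mono assms(2))
qed

lemma strip_O_mono_norm:
  assumes "\<And>t x. norm (f t x) \<le> \<tau> t x" shows "strip_O T \<tau> f"
  using assms by (intro strip_OI[where C = 1]) auto

lemmas strip_O_lin = strip_O_add strip_O_minus strip_O_diff strip_O_Re strip_O_cnj strip_O_of_real

definition strip_cont :: "real \<Rightarrow> (real \<Rightarrow> real \<Rightarrow> 'a::topological_space) \<Rightarrow> bool" where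
  "strip_cont T f \<longleftrightarrow> continuous_on ({0..T} \<times> UNIV) (\<lambda>z. f (fst z) (snd z))"

lemma strip_cont_intros:
  fixes f g :: "real \<Rightarrow> real \<Rightarrow> 'a::{real_normed_algebra}" and u v :: "real \<Rightarrow> real \<Rightarrow> complex" and h :: "real \<Rightarrow> real \<Rightarrow> real"
  shows "strip_cont T f \<Longrightarrow> strip_cont T g \<Longrightarrow> strip_cont T (\<lambda>t x. f t x + g t x)"
    "strip_cont T f \<Longrightarrow> strip_cont T g \<Longrightarrow> strip_cont T (\<lambda>t x. f t x - g t x)"
    "strip_cont T f \<Longrightarrow> strip_cont T g \<Longrightarrow> strip_cont T (\<lambda>t x. f t x * g t x)"
    "strip_cont T f \<Longrightarrow> strip_cont T (\<lambda>t x. - f t x)"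
    "strip_cont T u \<Longrightarrow> strip_cont T (\<lambda>t x. Re (u t x))"
    "strip_cont T u \<Longrightarrow> strip_cont T (\<lambda>t x. cnj (u t x))"
    "strip_cont T h \<Longrightarrow> strip_cont T (\<lambda>t x. complex_of_real (h t x))"
    "strip_cont T (\<lambda>t x. c)"
  unfolding strip_cont_def by (auto intro!: continuous_intros)

lemma strip_cont_slice:
  assumes "strip_cont T f" "t \<in> {0..T}" shows "continuous_on UNIV (f t)"
proof -
  have "continuous_on UNIV ((\<lambda>z. f (fst z) (snd z)) \<circ> (\<lambda>x. (t, x)))"
    by (intro continuous_on_compose continuous_intros continuous_on_subset[OF assms(1)[unfolded strip_cont_def]])
       (use assms(2) in auto)
  then show ?thesis by (simp add: o_def)
qed

lemma strip_cont_slice':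
  assumes "strip_cont T f" shows "continuous_on {0..T} (\<lambda>t. f t x)"
proof -
  have "continuous_on {0..T} ((\<lambda>z. f (fst z) (snd z)) \<circ> (\<lambda>t. (t, x)))"
    by (intro continuous_on_compose continuous_intros continuous_on_subset[OF assms[unfolded strip_cont_def]]) auto
  then show ?thesis by (simp add: o_def)
qed

text \<open>Equality of mixed derivatives without presupposing that \<open>fx\<close> is
  differentiable in time: integrate \<open>ft\<close> in time, differentiate in \<open>x\<close> by
  the Leibniz rule, and differentiate the resulting integral in time. It supplies the time
  derivative of \<open>b_x\<close>, about which the system says nothing directly.\<close>

lemma strip_mixed_derivative:
  fixes f ft fx ftx :: "real \<Rightarrow> real \<Rightarrow> complex"
  assumes ft: "\<And>t x. t \<in> {0..T} \<Longrightarrow> ((\<lambda>\<tau>. f \<tau> x) has_vector_derivative ft t x) (at t within {0..T})"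
    and fx: "\<And>t x. t \<in> {0..T} \<Longrightarrow> (f t has_vector_derivative fx t x) (at x)"
    and ftx: "\<And>t x. t \<in> {0..T} \<Longrightarrow> (ft t has_vector_derivative ftx t x) (at x)"
    and c: "strip_cont T ft" "strip_cont T ftx" and t: "t \<in> {0..T}"
  shows "((\<lambda>\<tau>. fx \<tau> x) has_vector_derivative ftx t x) (at t within {0..T})"
proof -
  have eq: "fx t x = fx 0 x + integral {0..t} (\<lambda>\<tau>. ftx \<tau> x)" if t: "t \<in> {0..T}" for t
  proof -
    have sub: "{0..t} \<subseteq> {0..T}" using t by auto
    have f: "f t x = f 0 x + integral {0..t} (\<lambda>\<tau>. ft \<tau> x)" for x
    proof -
      have "((\<lambda>\<tau>. ft \<tau> x) has_integral f t x - f 0 x) {0..t}"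
        by (rule fundamental_theorem_of_calculus)
           (use t sub in \<open>auto intro!: has_vector_derivative_within_subset[OF ft]\<close>)
      then show ?thesis by (simp add: integral_unique)
    qed
    have "((\<lambda>x. integral (cbox 0 t) (\<lambda>\<tau>. ft \<tau> x)) has_vector_derivative integral (cbox 0 t) (\<lambda>\<tau>. ftx \<tau> x)) (at x within UNIV)"
    proof (rule leibniz_rule_vector_derivative)
      show "(\<lambda>\<tau>. ft \<tau> x) integrable_on cbox 0 t" for x
        using continuous_on_subset[OF strip_cont_slice'[OF c(1)] sub] by (intro integrable_continuous) simp
      have "continuous_on (UNIV \<times> cbox 0 t) ((\<lambda>z. ftx (fst z) (snd z)) \<circ> (\<lambda>(x, \<tau>). (\<tau>, x)))"
        unfolding split_beta
        by (intro continuous_on_compose continuous_intros continuous_on_subset[OF c(2)[unfolded strip_cont_def]])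
           (use sub in auto)
      then show "continuous_on (UNIV \<times> cbox 0 t) (\<lambda>(x, \<tau>). ftx \<tau> x)" by (simp add: o_def split_beta)
    next
      fix x \<tau> :: real assume "\<tau> \<in> cbox 0 t"
      then have "\<tau> \<in> {0..T}" using sub by auto
      then show "((\<lambda>x. ft \<tau> x) has_vector_derivative ftx \<tau> x) (at x within UNIV)" by (rule ftx)
    qed simp_all
    then have L: "((\<lambda>x. integral {0..t} (\<lambda>\<tau>. ft \<tau> x)) has_vector_derivative integral {0..t} (\<lambda>\<tau>. ftx \<tau> x)) (at x)"
      by simp
    have ft_eq: "f t = (\<lambda>x. f 0 x + integral {0..t} (\<lambda>\<tau>. ft \<tau> x))" by (rule ext) (rule f)
    have "0 \<in> {0..T}" using t by auto
    from has_vector_derivative_add[OF fx[OF this, of x] L]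
    have "(f t has_vector_derivative fx 0 x + integral {0..t} (\<lambda>\<tau>. ftx \<tau> x)) (at x)"
      unfolding ft_eq[symmetric] .
    from vector_derivative_at[OF this] show ?thesis using vector_derivative_at[OF fx[OF t, of x]] by simp
  qed
  have "((\<lambda>\<tau>. fx 0 x + integral {0..\<tau>} (\<lambda>\<tau>. ftx \<tau> x)) has_vector_derivative 0 + ftx t x) (at t within {0..T})"
    by (rule has_vector_derivative_add[OF has_vector_derivative_const
        integral_has_vector_derivative[OF strip_cont_slice'[OF c(2)] t]])
  from has_vector_derivative_transform[OF t eq this] show ?thesis by simp
qed

subsection \<open>Uniqueness for the general quadratic system\<close>

text \<open>The system with free coefficients:
  \<open>i B_t + \<omega> B_xx = (A1 p1 + A2 p2 + Q |B|^2) B\<close>, and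
  \<open>p_t + c p_x = a (|B|^2)_x\<close> for each wave. Its shape is symmetric under exchange of
  the two waves, so one estimate for \<open>p1\<close> serves both parts of the theorem.\<close>

definition zk_solution ::
  "real \<Rightarrow> real \<Rightarrow> real \<Rightarrow> real \<Rightarrow> real \<Rightarrow> real \<Rightarrow> real \<Rightarrow> real \<Rightarrow> real \<Rightarrow>
   (real \<Rightarrow> real \<Rightarrow> complex) \<Rightarrow> (real \<Rightarrow> real \<Rightarrow> real) \<Rightarrow> (real \<Rightarrow> real \<Rightarrow> real) \<Rightarrow> bool" where
  "zk_solution \<omega> A1 A2 Q c1 a1 c2 a2 T B p1 p2 \<longleftrightarrow>
     (\<forall>s. sobolev_path s T B \<and>
          sobolev_path s T (\<lambda>t x. complex_of_real (p1 t x)) \<and>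
          sobolev_path s T (\<lambda>t x. complex_of_real (p2 t x))) \<and>
     (\<forall>t\<in>{0..T}. \<forall>x.
        B t differentiable (at x) \<and> vderiv (B t) differentiable (at x) \<and>
        p1 t differentiable (at x) \<and> p2 t differentiable (at x) \<and>
        ((\<lambda>\<tau>. B \<tau> x) has_vector_derivative
          \<i> * (of_real \<omega> * vderiv (vderiv (B t)) x
             - of_real (A1 * p1 t x + A2 * p2 t x + Q * (cmod (B t x))\<^sup>2) * B t x)) (at t within {0..T}) \<and>
        ((\<lambda>\<tau>. p1 \<tau> x) has_vector_derivative
          a1 * vderiv (\<lambda>y. (cmod (B t y))\<^sup>2) x - c1 * vderiv (p1 t) x) (at t within {0..T}) \<and>
        ((\<lambda>\<tau>. p2 \<tau> x) has_vector_derivative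
          a2 * vderiv (\<lambda>y. (cmod (B t y))\<^sup>2) x - c2 * vderiv (p2 t) x) (at t within {0..T}))"

text \<open>Balance law for the modified energy density \<open>|b\<^sub>x|\<^sup>2 + (2 / \<omega>) Re (cnj b w B) + K (|b|\<^sup>2 + q\<^sub>1\<^sup>2 + q\<^sub>2\<^sup>2)\<close> with
  \<open>w = A\<^sub>1 q\<^sub>1 + A\<^sub>2 q\<^sub>2\<close>, written pointwise: \<open>b1\<close>, \<open>b2\<close>, \<open>r1\<close>, \<open>r2\<close>, \<open>g1\<close>, \<open>B1\<close> stand for spatial and \<open>bt\<close>, \<open>bt1\<close>, \<open>Bt\<close> for
  time derivatives, and the second bracket is the derivative of the flux. Thanks to the mixed term the
  right-hand side contains neither \<open>b2\<close> nor a derivative of \<open>q1\<close>, \<open>q2\<close>.\<close>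

lemma energy_identity:
  fixes b b1 b2 bt bt1 g g1 B B1 Bt :: complex and w n q1 q2 r1 r2 :: real
  assumes "\<omega> \<noteq> 0" and bt: "bt = \<i> * (of_real \<omega> * b2 - of_real (A1 * q1 + A2 * q2) * B - g)"
  shows "(2 * Re (cnj b1 * bt1) + 2 / \<omega> * Re (cnj bt * of_real (A1 * q1 + A2 * q2) * B
       + cnj b * of_real (A1 * (a1 * n - c1 * r1) + A2 * (a2 * n - c2 * r2)) * B + cnj b * of_real (A1 * q1 + A2 * q2) * Bt)
     + 2 * K * Re (cnj b * bt) + 2 * K * (q1 * (a1 * n - c1 * r1) + q2 * (a2 * n - c2 * r2)))
   - (2 * Re (cnj b2 * bt + cnj b1 * bt1) + 2 * Re (\<i> * (cnj b2 * g + cnj b1 * g1))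
      - 2 / \<omega> * ((c1 * A1 * r1 + c2 * A2 * r2) * Re (cnj b * B) + (c1 * A1 * q1 + c2 * A2 * q2) * Re (cnj b1 * B + cnj b * B1))
      + 2 * K * \<omega> * Re (\<i> * (cnj b1 * b1 + cnj b * b2)) - 2 * K * (c1 * q1 * r1 + c2 * q2 * r2))
   = 2 / \<omega> * Re (\<i> * cnj g * of_real (A1 * q1 + A2 * q2) * B) - 2 * Re (\<i> * (cnj b1 * g1))
     + 2 / \<omega> * (A1 * a1 + A2 * a2) * n * Re (cnj b * B)
     + 2 / \<omega> * (c1 * A1 * q1 + c2 * A2 * q2) * Re (cnj b1 * B + cnj b * B1)
     + 2 / \<omega> * Re (cnj b * of_real (A1 * q1 + A2 * q2) * Bt)
     - 2 * K * Re (\<i> * (cnj b * (of_real (A1 * q1 + A2 * q2) * B + g))) + 2 * K * (q1 * a1 + q2 * a2) * n"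
proof -
  define w where "w = A1 * q1 + A2 * q2"
  have i1: "2 / \<omega> * Re (cnj bt * of_real w * B) = 2 / \<omega> * Re (\<i> * cnj g * of_real w * B) + 2 * Re (cnj b2 * bt) + 2 * Re (\<i> * (cnj b2 * g))"
    unfolding bt w_def[symmetric] using assms(1) by (simp add: field_simps)
  have i2: "2 * K * Re (cnj b * bt) = 2 * K * \<omega> * Re (\<i> * (cnj b1 * b1 + cnj b * b2)) - 2 * K * Re (\<i> * (cnj b * (of_real w * B + g)))"
    unfolding bt w_def[symmetric] by (simp add: algebra_simps)
  have r: "Re (cnj b * of_real r * B) = r * Re (cnj b * B)" for r by (simp add: algebra_simps)
  have i3: "2 / \<omega> * Re (cnj b * of_real (A1 * (a1 * n - c1 * r1) + A2 * (a2 * n - c2 * r2)) * B)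
     = 2 / \<omega> * (A1 * a1 + A2 * a2) * n * Re (cnj b * B) - 2 / \<omega> * (c1 * A1 * r1 + c2 * A2 * r2) * Re (cnj b * B)"
    unfolding r using assms(1) by (simp add: field_simps del: times_complex.sel)
  have e1: "2 / \<omega> * Re (x + y + z) = 2 / \<omega> * Re x + 2 / \<omega> * Re y + 2 / \<omega> * Re z"
    and e2: "2 * Re (x + y) = 2 * Re x + 2 * Re y"
    and e3: "2 * Re (\<i> * (x + y)) = 2 * Re (\<i> * x) + 2 * Re (\<i> * y)" for x y z
    by (simp_all only: plus_complex.sel distrib_left)
  define d where "d = 2 / \<omega>"
  show ?thesis
    unfolding w_def[symmetric] e1 e2[of "cnj b2 * bt"] e3 i1 i2 i3 unfolding d_def[symmetric]
    by (simp add: algebra_simps del: times_complex.sel plus_complex.sel)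
qed

lemma strip_O_cmult:
  fixes f :: "real \<Rightarrow> real \<Rightarrow> 'a::real_normed_algebra_1"
  shows "strip_O T \<sigma> f \<Longrightarrow> strip_O T \<sigma> (\<lambda>t x. c * f t x)"
  by (rule strip_O_mult_right[OF strip_O_const])

lemmas strip_O_rules = strip_O_cmult strip_O_lin strip_O_mult strip_O_mult_left strip_O_const

text \<open>The products are regrouped into the shape in which the rules for \<open>strip_O\<close> apply.\<close>

lemma energy_identity':
  fixes b b1 b2 bt bt1 g g1 B B1 Bt :: complex and n q1 q2 r1 r2 :: real
  assumes "\<omega> \<noteq> 0" and bt: "bt = \<i> * (of_real \<omega> * b2 - of_real (A1 * q1 + A2 * q2) * B - g)"
  shows "(2 * Re (cnj b1 * bt1) + 2 / \<omega> * Re (cnj bt * (of_real (A1 * q1 + A2 * q2) * B)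
       + cnj b * (of_real (A1 * (a1 * n - c1 * r1) + A2 * (a2 * n - c2 * r2)) * B) + cnj b * (of_real (A1 * q1 + A2 * q2) * Bt))
     + 2 * K * Re (cnj b * bt) + 2 * K * (q1 * (a1 * n - c1 * r1) + q2 * (a2 * n - c2 * r2)))
   - (2 * Re (cnj b2 * bt + cnj b1 * bt1) + 2 * Re (\<i> * (cnj b2 * g + cnj b1 * g1))
      - 2 / \<omega> * ((c1 * A1 * r1 + c2 * A2 * r2) * Re (cnj b * B) + (c1 * A1 * q1 + c2 * A2 * q2) * Re (cnj b1 * B + cnj b * B1))
      + 2 * K * \<omega> * Re (\<i> * (cnj b1 * b1 + cnj b * b2)) - 2 * K * (c1 * (q1 * r1) + c2 * (q2 * r2)))
   = 2 / \<omega> * Re (\<i> * (cnj g * (of_real (A1 * q1 + A2 * q2) * B))) - 2 * Re (\<i> * (cnj b1 * g1))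
     + 2 / \<omega> * (A1 * a1 + A2 * a2) * (n * Re (cnj b * B))
     + 2 / \<omega> * ((c1 * A1 * q1 + c2 * A2 * q2) * Re (cnj b1 * B + cnj b * B1))
     + 2 / \<omega> * Re (cnj b * (of_real (A1 * q1 + A2 * q2) * Bt))
     - 2 * K * Re (\<i> * (cnj b * (of_real (A1 * q1 + A2 * q2) * B + g))) + 2 * K * ((a1 * q1 + a2 * q2) * n)"
  using energy_identity[OF assms, of b1 bt1 b a1 n c1 r1 a2 c2 r2 Bt K g1 B1]
  by (simp only: mult.assoc mult.commute[of q1 a1] mult.commute[of q2 a2])

text \<open>Three x-derivatives are recorded because the x-derivative of the Schroedinger equation
  contains \<open>B_xxx\<close>. A family \<open>D\<close> indexed by the order replaces iterated
  use of \<open>vderiv\<close>.\<close>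

definition regular_strip :: "real \<Rightarrow> (real \<Rightarrow> real \<Rightarrow> 'a::real_normed_vector) \<Rightarrow> (nat \<Rightarrow> real \<Rightarrow> real \<Rightarrow> 'a) \<Rightarrow> real \<Rightarrow> bool" where
  "regular_strip T u D M \<longleftrightarrow>
     (\<forall>t\<in>{0..T}. D 0 t = u t) \<and>
     (\<forall>j<3. \<forall>t\<in>{0..T}. \<forall>x. (D j t has_vector_derivative D (Suc j) t x) (at x)) \<and>
     (\<forall>j\<le>3. strip_cont T (D j) \<and> strip_O T (\<lambda>_ _. 1) (D j) \<and>
        (\<forall>t\<in>{0..T}. integrable lborel (\<lambda>x. (norm (D j t x))\<^sup>2) \<and> (LINT x|lborel. (norm (D j t x))\<^sup>2) \<le> M))"

lemma regular_stripD:
  assumes "regular_strip T u D M"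
  shows "t \<in> {0..T} \<Longrightarrow> D 0 t = u t"
    and "j < 3 \<Longrightarrow> t \<in> {0..T} \<Longrightarrow> (D j t has_vector_derivative D (Suc j) t x) (at x)"
    and "j \<le> 3 \<Longrightarrow> strip_cont T (D j)"
    and "j \<le> 3 \<Longrightarrow> strip_O T (\<lambda>_ _. 1) (D j)"
  using assms unfolding regular_strip_def by auto

lemma regular_strip_mono: "regular_strip T u D M \<Longrightarrow> M \<le> M' \<Longrightarrow> regular_strip T u D M'"
  unfolding regular_strip_def by (meson order_trans)

lemma sobolev_path_regular_strip:
  assumes "sobolev_path 4 T u" "0 \<le> T" "\<And>t. t \<in> {0..T} \<Longrightarrow> continuous_on UNIV (u t)"
  obtains D M where "regular_strip T u D M"
proof -
  obtain D M where D: "\<And>t. t \<in> {0..T} \<Longrightarrow> D 0 t = u t"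
    "\<And>j t x. j < 3 \<Longrightarrow> t \<in> {0..T} \<Longrightarrow> (D j t has_vector_derivative D (Suc j) t x) (at x)"
    "\<And>j. j \<le> 3 \<Longrightarrow> continuous_on ({0..T} \<times> UNIV) (\<lambda>(t, x). D j t x)"
    "\<And>j t x. j \<le> 3 \<Longrightarrow> t \<in> {0..T} \<Longrightarrow> cmod (D j t x) \<le> M"
    "\<And>j t. j \<le> 3 \<Longrightarrow> t \<in> {0..T} \<Longrightarrow> integrable lborel (\<lambda>x. (cmod (D j t x))\<^sup>2)"
    "\<And>j t. j \<le> 3 \<Longrightarrow> t \<in> {0..T} \<Longrightarrow> (LINT x|lborel. (cmod (D j t x))\<^sup>2) \<le> M"
    by (rule sobolev_path_regular[OF assms]) blast+
  have "M \<ge> 0" using D(4)[of 0 0 0] assms(2) by (auto intro: order_trans[OF norm_ge_zero])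
  then have "strip_O T (\<lambda>_ _. 1) (D j)" if "j \<le> 3" for j
    using D(4)[OF that] by (intro strip_OI[where C = M]) auto
  then have "regular_strip T u D M"
    unfolding regular_strip_def using D by (auto simp: strip_cont_def split_beta)
  then show ?thesis by (rule that)
qed

lemma sobolev_path_regular_strip_real:
  fixes u :: "real \<Rightarrow> real \<Rightarrow> real"
  assumes "sobolev_path 4 T (\<lambda>t x. complex_of_real (u t x))" "0 \<le> T" "\<And>t. t \<in> {0..T} \<Longrightarrow> continuous_on UNIV (u t)"
  obtains P M where "regular_strip T u P M"
proof -
  obtain D M where D: "regular_strip T (\<lambda>t x. complex_of_real (u t x)) D M"
    by (rule sobolev_path_regular_strip[OF assms(1,2)]) (auto intro!: continuous_intros assms(3))
  have le: "(Re z)\<^sup>2 \<le> (cmod z)\<^sup>2" for z by (simp add: cmod_def)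
  have P: "regular_strip T u (\<lambda>j t x. Re (D j t x)) M"
    unfolding regular_strip_def
  proof (intro conjI ballI allI impI)
    show "(\<lambda>x. Re (D 0 t x)) = u t" if "t \<in> {0..T}" for t using D that by (simp add: regular_strip_def)
    show "((\<lambda>x. Re (D j t x)) has_vector_derivative Re (D (Suc j) t x)) (at x)" if "j < 3" "t \<in> {0..T}" for j t x
      using D that by (intro bounded_linear.has_vector_derivative[OF bounded_linear_Re]) (simp add: regular_strip_def)
    fix j :: nat assume j: "j \<le> 3"
    show "strip_cont T (\<lambda>t x. Re (D j t x))" using D j by (intro strip_cont_intros) (simp add: regular_strip_def)
    show "strip_O T (\<lambda>_ _. 1) (\<lambda>t x. Re (D j t x))" using D j by (intro strip_O_Re) (simp add: regular_strip_def)
    fix t assume t: "t \<in> {0..T}"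
    have c: "continuous_on UNIV (D j t)" using D j t by (intro strip_cont_slice) (auto simp: regular_strip_def)
    have i: "integrable lborel (\<lambda>x. (cmod (D j t x))\<^sup>2)" "(LINT x|lborel. (cmod (D j t x))\<^sup>2) \<le> M"
      using D j t by (auto simp: regular_strip_def)
    show r: "integrable lborel (\<lambda>x. (norm (Re (D j t x)))\<^sup>2)"
    proof (rule Bochner_Integration.integrable_bound[OF i(1)])
      show "(\<lambda>x. (norm (Re (D j t x)))\<^sup>2) \<in> borel_measurable lborel"
        using c by (auto intro!: borel_measurable_continuous_onI continuous_intros)
    qed (simp add: le)
    have "(LINT x|lborel. (norm (Re (D j t x)))\<^sup>2) \<le> (LINT x|lborel. (cmod (D j t x))\<^sup>2)"
      by (intro integral_mono r i) (simp add: le)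
    then show "(LINT x|lborel. (norm (Re (D j t x)))\<^sup>2) \<le> M" using i(2) by simp
  qed
  then show ?thesis by (rule that)
qed

lemma vderiv_cmod_square:
  assumes "(f has_vector_derivative f') (at x within S)"
  shows "((\<lambda>y. (cmod (f y))\<^sup>2) has_vector_derivative 2 * Re (cnj (f x) * f')) (at x within S)"
proof -
  have "((\<lambda>y. Re (f y * cnj (f y))) has_vector_derivative Re (f x * cnj f' + f' * cnj (f x))) (at x within S)"
    by (intro bounded_linear.has_vector_derivative[OF bounded_linear_Re] has_vector_derivative_mult
        has_vector_derivative_cnj assms)
  moreover have "Re (f y * cnj (f y)) = (cmod (f y))\<^sup>2" for y by (simp only: cmod_power2) (simp add: power2_eq_square)
  ultimately show ?thesis by (simp add: algebra_simps)
qed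

text \<open>Rewrites the equations in terms of the families \<open>D\<close>, \<open>P1\<close>,
  \<open>P2\<close>, whose continuity and bounds are known.\<close>

lemma zk_solution_regular:
  assumes sol: "zk_solution \<omega> A1 A2 Q c1 a1 c2 a2 T B p1 p2" and T: "0 \<le> T"
  obtains D P1 P2 M where "regular_strip T B D M" "regular_strip T p1 P1 M" "regular_strip T p2 P2 M"
    "\<And>t x. t \<in> {0..T} \<Longrightarrow> ((\<lambda>\<tau>. D 0 \<tau> x) has_vector_derivative \<i> * (of_real \<omega> * D 2 t x
       - of_real (A1 * P1 0 t x + A2 * P2 0 t x + Q * (cmod (D 0 t x))\<^sup>2) * D 0 t x)) (at t within {0..T})"
    "\<And>t x. t \<in> {0..T} \<Longrightarrow> ((\<lambda>\<tau>. P1 0 \<tau> x) has_vector_derivative a1 * (2 * Re (cnj (D 0 t x) * D 1 t x)) - c1 * P1 1 t x) (at t within {0..T})"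
    "\<And>t x. t \<in> {0..T} \<Longrightarrow> ((\<lambda>\<tau>. P2 0 \<tau> x) has_vector_derivative a2 * (2 * Re (cnj (D 0 t x) * D 1 t x)) - c2 * P2 1 t x) (at t within {0..T})"
proof -
  have c: "continuous_on UNIV (B t)" "continuous_on UNIV (p1 t)" "continuous_on UNIV (p2 t)" if "t \<in> {0..T}" for t
    using sol that unfolding zk_solution_def
    by (auto intro!: continuous_at_imp_continuous_on differentiable_imp_continuous_within)
  obtain D M1 where D: "regular_strip T B D M1"
    by (rule sobolev_path_regular_strip[OF _ T c(1)]) (use sol in \<open>auto simp: zk_solution_def\<close>)
  obtain P1 M2 where P1: "regular_strip T p1 P1 M2"
    by (rule sobolev_path_regular_strip_real[OF _ T c(2)]) (use sol in \<open>auto simp: zk_solution_def\<close>)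
  obtain P2 M3 where P2: "regular_strip T p2 P2 M3"
    by (rule sobolev_path_regular_strip_real[OF _ T c(3)]) (use sol in \<open>auto simp: zk_solution_def\<close>)
  define M where "M = max M1 (max M2 M3)"
  have M: "regular_strip T B D M" "regular_strip T p1 P1 M" "regular_strip T p2 P2 M"
    by (rule regular_strip_mono[OF D] regular_strip_mono[OF P1] regular_strip_mono[OF P2], simp add: M_def)+
  have v: "vderiv (B t) = D 1 t" "vderiv (p1 t) = P1 1 t" "vderiv (p2 t) = P2 1 t" "vderiv (D 1 t) = D 2 t" if "t \<in> {0..T}" for t
  proof -
    note z = regular_stripD(1)[OF M(1) that, symmetric] regular_stripD(1)[OF M(2) that, symmetric] regular_stripD(1)[OF M(3) that, symmetric]
    have "(D 0 t has_vector_derivative D 1 t x) (at x)" "(D 1 t has_vector_derivative D 2 t x) (at x)"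
      "(P1 0 t has_vector_derivative P1 1 t x) (at x)" "(P2 0 t has_vector_derivative P2 1 t x) (at x)" for x
      using regular_stripD(2)[OF M(1) _ that, of 0 x] regular_stripD(2)[OF M(1) _ that, of 1 x]
        regular_stripD(2)[OF M(2) _ that, of 0 x] regular_stripD(2)[OF M(3) _ that, of 0 x]
      by (simp_all add: numeral_2_eq_2)
    then show "vderiv (B t) = D 1 t" "vderiv (p1 t) = P1 1 t" "vderiv (p2 t) = P2 1 t" "vderiv (D 1 t) = D 2 t"
      unfolding z by (blast intro!: ext vderiv_eqI)+
  qed
  have z: "D 0 t = B t" "P1 0 t = p1 t" "P2 0 t = p2 t" if "t \<in> {0..T}" for t
    using M that unfolding regular_strip_def by auto
  have n: "vderiv (\<lambda>y. (cmod (B t y))\<^sup>2) x = 2 * Re (cnj (D 0 t x) * D 1 t x)" if "t \<in> {0..T}" for t x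
  proof -
    have "(D 0 t has_vector_derivative D (Suc 0) t x) (at x)" by (rule regular_stripD(2)[OF M(1) _ that]) simp
    from vderiv_eqI[OF vderiv_cmod_square[OF this]] show ?thesis using z[OF that] by simp
  qed
  show thesis
  proof (rule that[OF M])
    fix t x assume t: "t \<in> {0..T}"
    have s: "((\<lambda>\<tau>. B \<tau> x) has_vector_derivative
          \<i> * (of_real \<omega> * vderiv (vderiv (B t)) x
             - of_real (A1 * p1 t x + A2 * p2 t x + Q * (cmod (B t x))\<^sup>2) * B t x)) (at t within {0..T})"
      "((\<lambda>\<tau>. p1 \<tau> x) has_vector_derivative
          a1 * vderiv (\<lambda>y. (cmod (B t y))\<^sup>2) x - c1 * vderiv (p1 t) x) (at t within {0..T})"
      "((\<lambda>\<tau>. p2 \<tau> x) has_vector_derivative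
          a2 * vderiv (\<lambda>y. (cmod (B t y))\<^sup>2) x - c2 * vderiv (p2 t) x) (at t within {0..T})"
      using sol t unfolding zk_solution_def by blast+
    show "((\<lambda>\<tau>. D 0 \<tau> x) has_vector_derivative \<i> * (of_real \<omega> * D 2 t x
       - of_real (A1 * P1 0 t x + A2 * P2 0 t x + Q * (cmod (D 0 t x))\<^sup>2) * D 0 t x)) (at t within {0..T})"
      by (rule has_vector_derivative_transform[OF t _ s(1)[unfolded v[OF t], unfolded z[OF t, symmetric]]]) (simp add: z)
    show "((\<lambda>\<tau>. P1 0 \<tau> x) has_vector_derivative a1 * (2 * Re (cnj (D 0 t x) * D 1 t x)) - c1 * P1 1 t x) (at t within {0..T})"
      by (rule has_vector_derivative_transform[OF t _ s(2)[unfolded v[OF t] n[OF t]]]) (simp add: z)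
    show "((\<lambda>\<tau>. P2 0 \<tau> x) has_vector_derivative a2 * (2 * Re (cnj (D 0 t x) * D 1 t x)) - c2 * P2 1 t x) (at t within {0..T})"
      by (rule has_vector_derivative_transform[OF t _ s(3)[unfolded v[OF t] n[OF t]]]) (simp add: z)
  qed
qed

section \<open>The difference of two solutions\<close>

lemma cubic_difference:
  "of_real ((cmod x)\<^sup>2) * x - of_real ((cmod y)\<^sup>2) * y
   = (x - y) * (x * cnj x) + ((x - y) * cnj x + cnj (x - y) * y) * y"
  unfolding complex_norm_square by (simp add: algebra_simps)

text \<open>Splits the difference of the right-hand sides into the dispersion, the product of the
  wave difference with \<open>D\<close>, and a remainder that is linear in \<open>D - D'\<close> and
  its conjugate with bounded coefficients. Differentiating the middle term puts a derivative on the
  wave difference; this is the term that the mixed part of the energy cancels.\<close>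

lemma schroedinger_difference:
  fixes D D2 D' D2' :: complex
  shows "\<i> * (of_real \<omega> * D2 - of_real (A1 * x1 + A2 * x2 + Q * (cmod D)\<^sup>2) * D)
      - \<i> * (of_real \<omega> * D2' - of_real (A1 * y1 + A2 * y2 + Q * (cmod D')\<^sup>2) * D')
    = \<i> * (of_real \<omega> * (D2 - D2') - of_real (A1 * (x1 - y1) + A2 * (x2 - y2)) * D
      - ((D - D') * of_real (A1 * y1 + A2 * y2)
         + of_real Q * ((D - D') * (D * cnj D) + ((D - D') * cnj D + cnj (D - D') * D') * D')))"
  unfolding cubic_difference[symmetric] by (simp add: algebra_simps)

lemmas has_vector_derivative_Re' = bounded_linear.has_vector_derivative[OF bounded_linear_Re]
lemmas has_vector_derivative_of_real' = bounded_linear.has_vector_derivative[OF bounded_linear_of_real]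

lemma four_square_sum_le: "(a + b + c + d)\<^sup>2 \<le> 4 * (a\<^sup>2 + b\<^sup>2 + c\<^sup>2 + d\<^sup>2)" for a b c d :: real
  using sum_squares_bound[of a b] sum_squares_bound[of a c] sum_squares_bound[of a d]
    sum_squares_bound[of b c] sum_squares_bound[of b d] sum_squares_bound[of c d]
  by (simp add: power2_eq_square algebra_simps)

lemma square_sum_le:
  fixes a b :: "'a::real_normed_vector"
  shows "(norm (a - b))\<^sup>2 \<le> 2 * (norm a)\<^sup>2 + 2 * (norm b)\<^sup>2"
proof -
  have "(norm (a - b))\<^sup>2 \<le> (norm a + norm b)\<^sup>2" by (intro power_mono norm_triangle_ineq4) auto
  also have "\<dots> \<le> 2 * (norm a)\<^sup>2 + 2 * (norm b)\<^sup>2"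
    using sum_squares_bound[of "norm a" "norm b"] by (simp add: power2_sum)
  finally show ?thesis .
qed

lemma regular_strip_diff_integrable:
  assumes "regular_strip T u D M" "regular_strip T u' D' M" "j \<le> 3" "t \<in> {0..T}"
  shows "integrable lborel (\<lambda>x. (norm (D j t x - D' j t x))\<^sup>2)" "(LINT x|lborel. (norm (D j t x - D' j t x))\<^sup>2) \<le> 4 * M"
proof -
  have i: "integrable lborel (\<lambda>x. (norm (D j t x))\<^sup>2)" "(LINT x|lborel. (norm (D j t x))\<^sup>2) \<le> M"
    "integrable lborel (\<lambda>x. (norm (D' j t x))\<^sup>2)" "(LINT x|lborel. (norm (D' j t x))\<^sup>2) \<le> M"
    using assms by (auto simp: regular_strip_def)
  have c: "continuous_on UNIV (D j t)" "continuous_on UNIV (D' j t)"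
    using assms by (auto intro!: strip_cont_slice simp: regular_strip_def)
  have i2: "integrable lborel (\<lambda>x. 2 * (norm (D j t x))\<^sup>2 + 2 * (norm (D' j t x))\<^sup>2)" using i by simp
  show d: "integrable lborel (\<lambda>x. (norm (D j t x - D' j t x))\<^sup>2)"
  proof (rule Bochner_Integration.integrable_bound[OF i2])
    show "(\<lambda>x. (norm (D j t x - D' j t x))\<^sup>2) \<in> borel_measurable lborel"
      using c by (auto intro!: borel_measurable_continuous_onI continuous_intros)
  qed (auto intro!: AE_I2 order_trans[OF square_sum_le])
  have "(LINT x|lborel. (norm (D j t x - D' j t x))\<^sup>2) \<le> (LINT x|lborel. 2 * (norm (D j t x))\<^sup>2 + 2 * (norm (D' j t x))\<^sup>2)"
    by (intro integral_mono d i2 square_sum_le)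
  then show "(LINT x|lborel. (norm (D j t x - D' j t x))\<^sup>2) \<le> 4 * M" using i by simp
qed


text \<open>Combines the pointwise balance law with \<open>energy_zero\<close>. What has to be
  checked is that the energy dominates the squares of \<open>b\<close>, \<open>b_x\<close> and the
  wave differences, that the source \<open>R\<close> is quadratic in exactly these, and that energy
  and flux have an integrable majorant, which may use higher derivatives.\<close>

lemma zk_unique:
  assumes \<omega>: "\<omega> \<noteq> 0" and T: "0 \<le> T"
    and sol: "zk_solution \<omega> A1 A2 Q c1 a1 c2 a2 T B p1 p2" and sol': "zk_solution \<omega> A1 A2 Q c1 a1 c2 a2 T B' p1' p2'"
    and init: "B 0 = B' 0" "p1 0 = p1' 0" "p2 0 = p2' 0" and t: "t \<in> {0..T}"
  shows "p1 t = p1' t"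
proof -
  obtain D P1 P2 M where reg: "regular_strip T B D M" "regular_strip T p1 P1 M" "regular_strip T p2 P2 M"
    and Dt: "\<And>t x. t \<in> {0..T} \<Longrightarrow> ((\<lambda>\<tau>. D 0 \<tau> x) has_vector_derivative \<i> * (of_real \<omega> * D 2 t x
       - of_real (A1 * P1 0 t x + A2 * P2 0 t x + Q * (cmod (D 0 t x))\<^sup>2) * D 0 t x)) (at t within {0..T})"
    and P1t: "\<And>t x. t \<in> {0..T} \<Longrightarrow> ((\<lambda>\<tau>. P1 0 \<tau> x) has_vector_derivative a1 * (2 * Re (cnj (D 0 t x) * D 1 t x)) - c1 * P1 1 t x) (at t within {0..T})"
    and P2t: "\<And>t x. t \<in> {0..T} \<Longrightarrow> ((\<lambda>\<tau>. P2 0 \<tau> x) has_vector_derivative a2 * (2 * Re (cnj (D 0 t x) * D 1 t x)) - c2 * P2 1 t x) (at t within {0..T})"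
    by (rule zk_solution_regular[OF sol T]) blast
  obtain D' P1' P2' M' where reg': "regular_strip T B' D' M'" "regular_strip T p1' P1' M'" "regular_strip T p2' P2' M'"
    and Dt': "\<And>t x. t \<in> {0..T} \<Longrightarrow> ((\<lambda>\<tau>. D' 0 \<tau> x) has_vector_derivative \<i> * (of_real \<omega> * D' 2 t x
       - of_real (A1 * P1' 0 t x + A2 * P2' 0 t x + Q * (cmod (D' 0 t x))\<^sup>2) * D' 0 t x)) (at t within {0..T})"
    and P1t': "\<And>t x. t \<in> {0..T} \<Longrightarrow> ((\<lambda>\<tau>. P1' 0 \<tau> x) has_vector_derivative a1 * (2 * Re (cnj (D' 0 t x) * D' 1 t x)) - c1 * P1' 1 t x) (at t within {0..T})"
    and P2t': "\<And>t x. t \<in> {0..T} \<Longrightarrow> ((\<lambda>\<tau>. P2' 0 \<tau> x) has_vector_derivative a2 * (2 * Re (cnj (D' 0 t x) * D' 1 t x)) - c2 * P2' 1 t x) (at t within {0..T})"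
    by (rule zk_solution_regular[OF sol' T]) blast
  define MM where "MM = max M M'"
  have regM: "regular_strip T B D MM" "regular_strip T p1 P1 MM" "regular_strip T p2 P2 MM"
    "regular_strip T B' D' MM" "regular_strip T p1' P1' MM" "regular_strip T p2' P2' MM"
    by (rule regular_strip_mono[OF reg(1)] regular_strip_mono[OF reg(2)] regular_strip_mono[OF reg(3)]
      regular_strip_mono[OF reg'(1)] regular_strip_mono[OF reg'(2)] regular_strip_mono[OF reg'(3)], simp add: MM_def)+
  define b where "b j t x = D j t x - D' j t x" for j t x
  define q1 where "q1 j t x = P1 j t x - P1' j t x" for j t x
  define q2 where "q2 j t x = P2 j t x - P2' j t x" for j t x
  define w where "w j t x = A1 * q1 j t x + A2 * q2 j t x" for j t x
  define W where "W j t x = A1 * P1' j t x + A2 * P2' j t x" for j t x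
  \<comment> \<open>The part of the nonlinearity without wave differences: linear in
    \<open>b\<close> and its conjugate, so that \<open>g1\<close>, its x-derivative, involves
    \<open>b\<close> and \<open>b_x\<close> only.\<close>
  define g where "g t x = b 0 t x * of_real (W 0 t x)
    + of_real Q * (b 0 t x * (D 0 t x * cnj (D 0 t x)) + (b 0 t x * cnj (D 0 t x) + cnj (b 0 t x) * D' 0 t x) * D' 0 t x)" for t x
  define g1 where "g1 t x = (b 1 t x * of_real (W 0 t x) + b 0 t x * of_real (W 1 t x))
    + of_real Q * ((b 1 t x * (D 0 t x * cnj (D 0 t x)) + b 0 t x * (D 1 t x * cnj (D 0 t x) + D 0 t x * cnj (D 1 t x)))
      + ((b 1 t x * cnj (D 0 t x) + b 0 t x * cnj (D 1 t x) + (cnj (b 1 t x) * D' 0 t x + cnj (b 0 t x) * D' 1 t x)) * D' 0 t x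
         + (b 0 t x * cnj (D 0 t x) + cnj (b 0 t x) * D' 0 t x) * D' 1 t x))" for t x
  define bt where "bt t x = \<i> * (of_real \<omega> * b 2 t x - of_real (w 0 t x) * D 0 t x - g t x)" for t x
  define bt1 where "bt1 t x = \<i> * (of_real \<omega> * b 3 t x - (of_real (w 1 t x) * D 0 t x + of_real (w 0 t x) * D 1 t x) - g1 t x)" for t x
  define n where "n t x = 2 * Re (cnj (b 0 t x) * D 1 t x + b 1 t x * cnj (D' 0 t x))" for t x
  \<comment> \<open>The square of the modulus is written as a real part so that the rules for
    \<open>strip_O\<close> and \<open>strip_cont\<close> apply.\<close>
  define Bt where "Bt t x = \<i> * (of_real \<omega> * D 2 t x - of_real (A1 * P1 0 t x + A2 * P2 0 t x + Q * Re (D 0 t x * cnj (D 0 t x))) * D 0 t x)" for t x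
  define q1t where "q1t t x = a1 * n t x - c1 * q1 1 t x" for t x
  define q2t where "q2t t x = a2 * n t x - c2 * q2 1 t x" for t x
  define wt where "wt t x = A1 * q1t t x + A2 * q2t t x" for t x

  have le3: "(0::nat) \<le> 3" "(1::nat) \<le> 3" "(2::nat) \<le> 3" "(3::nat) \<le> 3" by auto
  have cont: "strip_cont T (D j)" "strip_cont T (D' j)" "strip_cont T (P1 j)" "strip_cont T (P2 j)"
     "strip_cont T (P1' j)" "strip_cont T (P2' j)" if "j \<le> 3" for j
    using regM that by (auto dest: regular_stripD(3))
  have cb: "strip_cont T (b j)" "strip_cont T (q1 j)" "strip_cont T (q2 j)" "strip_cont T (w j)" "strip_cont T (W j)" if "j \<le> 3" for j
    unfolding b_def[abs_def] q1_def[abs_def] q2_def[abs_def] w_def[abs_def] W_def[abs_def]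
    by (intro strip_cont_intros cont that)+
  note c0 = cb[OF le3(1)] cb[OF le3(2)] cb[OF le3(3)] cb[OF le3(4)]
    cont[OF le3(1)] cont[OF le3(2)] cont[OF le3(3)] cont[OF le3(4)]
  have cg: "strip_cont T g" "strip_cont T g1" "strip_cont T n"
    unfolding g_def[abs_def] g1_def[abs_def] n_def[abs_def]
    by (intro strip_cont_intros c0)+
  have cbt: "strip_cont T bt" "strip_cont T bt1" "strip_cont T Bt" "strip_cont T q1t" "strip_cont T q2t"
    unfolding bt_def[abs_def] bt1_def[abs_def] Bt_def[abs_def] q1t_def[abs_def] q2t_def[abs_def]
    by (intro strip_cont_intros c0 cg)+
  have cwt: "strip_cont T wt"
    unfolding wt_def[abs_def] by (intro strip_cont_intros cbt)
  note cc = c0 cg cbt cwt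

  have bd: "strip_O T (\<lambda>_ _. 1) (D j)" "strip_O T (\<lambda>_ _. 1) (D' j)" "strip_O T (\<lambda>_ _. 1) (P1 j)" "strip_O T (\<lambda>_ _. 1) (P2 j)"
     "strip_O T (\<lambda>_ _. 1) (P1' j)" "strip_O T (\<lambda>_ _. 1) (P2' j)" if "j \<le> 3" for j
    using regM that by (auto dest: regular_stripD(4))
  have bdW: "strip_O T (\<lambda>_ _. 1) (W j)" if "j \<le> 3" for j
    unfolding W_def[abs_def] by (intro strip_O_rules bd that)
  note bd0 = bdW[OF le3(1)] bdW[OF le3(2)]
    bd[OF le3(1)] bd[OF le3(2)] bd[OF le3(3)] bd[OF le3(4)]
  have bdBt: "strip_O T (\<lambda>_ _. 1) Bt"
    unfolding Bt_def[abs_def] by (intro strip_O_rules bd0)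

  \<comment> \<open>\<open>\<rho>\<close> collects what the energy controls and has to bound the
    source; \<open>s\<close> adds the higher derivatives, which enter only the integrable
    majorant.\<close>
  define \<rho> where "\<rho> t x = norm (b 0 t x) + norm (b 1 t x) + norm (q1 0 t x) + norm (q2 0 t x)" for t x
  define s where "s t x = \<rho> t x + (norm (b 2 t x) + norm (b 3 t x) + norm (q1 1 t x) + norm (q2 1 t x))" for t x
  have lin\<rho>: "strip_O T \<rho> (b 0)" "strip_O T \<rho> (b 1)" "strip_O T \<rho> (q1 0)" "strip_O T \<rho> (q2 0)"
    by (intro strip_O_mono_norm; simp add: \<rho>_def)+
  have lin\<rho>w: "strip_O T \<rho> (w 0)" unfolding w_def[abs_def] by (intro strip_O_rules lin\<rho>)
  have lin\<rho>g: "strip_O T \<rho> g" "strip_O T \<rho> g1" "strip_O T \<rho> n"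
    unfolding g_def[abs_def] g1_def[abs_def] n_def[abs_def] by (intro strip_O_rules lin\<rho> bd0)+
  note l\<rho> = lin\<rho> lin\<rho>w lin\<rho>g
  have \<rho>s: "\<rho> t x \<le> s t x" for t x by (simp add: s_def)
  note l\<rho>s = l\<rho>[THEN strip_O_mono, OF \<rho>s]
  have lins: "strip_O T s (b 2)" "strip_O T s (b 3)" "strip_O T s (q1 1)" "strip_O T s (q2 1)"
    by (intro strip_O_mono_norm; simp add: s_def \<rho>_def)+
  have linsw: "strip_O T s (w 1)" unfolding w_def[abs_def] by (intro strip_O_rules lins)
  have linsb: "strip_O T s bt" "strip_O T s bt1" "strip_O T s q1t" "strip_O T s q2t"
    unfolding bt_def[abs_def] bt1_def[abs_def] q1t_def[abs_def] q2t_def[abs_def]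
    by (intro strip_O_rules lins linsw l\<rho>s bd0)+
  have linswt: "strip_O T s wt" unfolding wt_def[abs_def] by (intro strip_O_rules linsb)
  note ls = l\<rho>s lins linsw linsb linswt

  have btd: "((\<lambda>\<tau>. b 0 \<tau> x) has_vector_derivative bt t x) (at t within {0..T})" if "t \<in> {0..T}" for t x
    unfolding b_def
    by (rule has_vector_derivative_eq_rhs[OF has_vector_derivative_diff[OF Dt[OF that] Dt'[OF that]]])
       (simp only: schroedinger_difference bt_def g_def w_def W_def b_def q1_def q2_def)
  have Dx: "(D j t has_vector_derivative D (Suc j) t x) (at x)" "(D' j t has_vector_derivative D' (Suc j) t x) (at x)"
     "(P1 j t has_vector_derivative P1 (Suc j) t x) (at x)" "(P2 j t has_vector_derivative P2 (Suc j) t x) (at x)"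
     "(P1' j t has_vector_derivative P1' (Suc j) t x) (at x)" "(P2' j t has_vector_derivative P2' (Suc j) t x) (at x)"
     if "j < 3" "t \<in> {0..T}" for j t x
    using that regM by (auto intro!: regular_stripD(2))
  have bx: "(b j t has_vector_derivative b (Suc j) t x) (at x)" "(q1 j t has_vector_derivative q1 (Suc j) t x) (at x)"
     "(q2 j t has_vector_derivative q2 (Suc j) t x) (at x)"
     if "j < 3" "t \<in> {0..T}" for j t x
    unfolding b_def[abs_def] q1_def[abs_def] q2_def[abs_def]
    by (intro has_vector_derivative_diff Dx that)+
  have lx: "((\<lambda>x. A1 * h j t x + A2 * k j t x) has_vector_derivative A1 * h (Suc j) t x + A2 * k (Suc j) t x) (at x)"
    if "(h j t has_vector_derivative h (Suc j) t x) (at x)" "(k j t has_vector_derivative k (Suc j) t x) (at x)"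
    for h k :: "nat \<Rightarrow> real \<Rightarrow> real \<Rightarrow> real" and j t x
    by (intro has_vector_derivative_add has_vector_derivative_mult_right that)
  have wx: "(w j t has_vector_derivative w (Suc j) t x) (at x)" "(W j t has_vector_derivative W (Suc j) t x) (at x)"
     if "j < 3" "t \<in> {0..T}" for j t x
    unfolding w_def[abs_def] W_def[abs_def] by (intro lx bx Dx that)+
  have gx: "(g t has_vector_derivative g1 t x) (at x)" if t: "t \<in> {0..T}" for t x
  proof -
    have 1: "(b 0 t has_vector_derivative b 1 t x) (at x)" "(D 0 t has_vector_derivative D 1 t x) (at x)"
      "(D' 0 t has_vector_derivative D' 1 t x) (at x)" "(W 0 t has_vector_derivative W 1 t x) (at x)"
      using bx(1)[of 0 t x] Dx(1,2)[of 0 t x] wx(2)[of 0 t x] t by auto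
    show ?thesis unfolding g_def[abs_def]
      by (rule has_vector_derivative_eq_rhs, (rule has_vector_derivative_add has_vector_derivative_mult_right has_vector_derivative_mult
        has_vector_derivative_cnj has_vector_derivative_of_real' 1)+)
         (simp add: g1_def algebra_simps)
  qed
  have btx: "(bt t has_vector_derivative bt1 t x) (at x)" if t: "t \<in> {0..T}" for t x
  proof -
    have 1: "(b 2 t has_vector_derivative b 3 t x) (at x)" "(D 0 t has_vector_derivative D 1 t x) (at x)"
      "(w 0 t has_vector_derivative w 1 t x) (at x)"
      using bx(1)[of 2 t x] Dx(1)[of 0 t x] wx(1)[of 0 t x] t by (auto simp: numeral_3_eq_3)
    show ?thesis unfolding bt_def[abs_def]
      by (rule has_vector_derivative_eq_rhs, (rule has_vector_derivative_diff has_vector_derivative_mult_right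
        has_vector_derivative_mult has_vector_derivative_of_real' 1 gx t)+)
         (simp add: bt1_def algebra_simps)
  qed
  have b1t: "((\<lambda>\<tau>. b 1 \<tau> x) has_vector_derivative bt1 t x) (at t within {0..T})" if "t \<in> {0..T}" for t x
    by (rule strip_mixed_derivative[OF btd _ btx cbt(1,2) that]) (use bx(1)[of 0] in auto)
  have n_eq: "2 * Re (cnj (D 0 t x) * D 1 t x) - 2 * Re (cnj (D' 0 t x) * D' 1 t x) = n t x" for t x
    unfolding n_def b_def by (simp add: algebra_simps)
  have qtd: "((\<lambda>\<tau>. q1 0 \<tau> x) has_vector_derivative q1t t x) (at t within {0..T})"
    "((\<lambda>\<tau>. q2 0 \<tau> x) has_vector_derivative q2t t x) (at t within {0..T})" if "t \<in> {0..T}" for t x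
    unfolding q1_def q2_def
    by (rule has_vector_derivative_eq_rhs[OF has_vector_derivative_diff[OF P1t[OF that] P1t'[OF that]]],
        simp add: q1t_def n_eq[symmetric] q1_def algebra_simps)
       (rule has_vector_derivative_eq_rhs[OF has_vector_derivative_diff[OF P2t[OF that] P2t'[OF that]]],
        simp add: q2t_def n_eq[symmetric] q2_def algebra_simps)
  have wtd: "((\<lambda>\<tau>. w 0 \<tau> x) has_vector_derivative wt t x) (at t within {0..T})" if "t \<in> {0..T}" for t x
    unfolding w_def wt_def
    by (intro has_vector_derivative_add has_vector_derivative_mult_right qtd that)
  have Bt: "((\<lambda>\<tau>. D 0 \<tau> x) has_vector_derivative Bt t x) (at t within {0..T})" if "t \<in> {0..T}" for t x
  proof -
    have "(cmod (D 0 t x))\<^sup>2 = Re (D 0 t x * cnj (D 0 t x))" by (simp only: cmod_power2) (simp add: power2_eq_square)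
    then show ?thesis using Dt[OF that, of x] by (simp only: Bt_def)
  qed

  obtain Cw where Cw: "Cw \<ge> 0" "\<And>t x. t \<in> {0..T} \<Longrightarrow> norm (D 0 t x) \<le> Cw"
    using bd[of 0] unfolding strip_O_def by auto
  \<comment> \<open>\<open>K - 1\<close> absorbs the mixed term, by the bound \<open>Cw\<close> for
    \<open>D 0\<close> and the arithmetic-geometric mean inequality; the remaining 1 keeps the
    energy coercive.\<close>
  define K where "K = Cw / \<bar>\<omega>\<bar> * (\<bar>A1\<bar> + \<bar>A2\<bar>) + 1"
  define d where "d = 2 / \<omega>"
  define e where "e t x = Re (cnj (b 1 t x) * b 1 t x) + d * Re (cnj (b 0 t x) * (of_real (w 0 t x) * D 0 t x))
     + K * Re (cnj (b 0 t x) * b 0 t x) + K * (q1 0 t x * q1 0 t x + q2 0 t x * q2 0 t x)" for t x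
  define e' where "e' t x = 2 * Re (cnj (b 1 t x) * bt1 t x)
     + d * Re (cnj (bt t x) * (of_real (w 0 t x) * D 0 t x) + cnj (b 0 t x) * (of_real (wt t x) * D 0 t x)
          + cnj (b 0 t x) * (of_real (w 0 t x) * Bt t x))
     + 2 * K * Re (cnj (b 0 t x) * bt t x) + 2 * K * (q1 0 t x * q1t t x + q2 0 t x * q2t t x)" for t x
  define F where "F t x = 2 * Re (cnj (b 1 t x) * bt t x) + 2 * Re (\<i> * (cnj (b 1 t x) * g t x))
     - d * ((c1 * A1 * q1 0 t x + c2 * A2 * q2 0 t x) * Re (cnj (b 0 t x) * D 0 t x))
     + 2 * K * \<omega> * Re (\<i> * (cnj (b 0 t x) * b 1 t x)) - K * (c1 * (q1 0 t x * q1 0 t x) + c2 * (q2 0 t x * q2 0 t x))" for t x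
  define F' where "F' t x = 2 * Re (cnj (b 2 t x) * bt t x + cnj (b 1 t x) * bt1 t x)
     + 2 * Re (\<i> * (cnj (b 2 t x) * g t x + cnj (b 1 t x) * g1 t x))
     - d * ((c1 * A1 * q1 1 t x + c2 * A2 * q2 1 t x) * Re (cnj (b 0 t x) * D 0 t x)
         + (c1 * A1 * q1 0 t x + c2 * A2 * q2 0 t x) * Re (cnj (b 1 t x) * D 0 t x + cnj (b 0 t x) * D 1 t x))
     + 2 * K * \<omega> * Re (\<i> * (cnj (b 1 t x) * b 1 t x + cnj (b 0 t x) * b 2 t x))
     - 2 * K * (c1 * (q1 0 t x * q1 1 t x) + c2 * (q2 0 t x * q2 1 t x))" for t x
  define R where "R t x = d * Re (\<i> * (cnj (g t x) * (of_real (w 0 t x) * D 0 t x))) - 2 * Re (\<i> * (cnj (b 1 t x) * g1 t x))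
     + d * (A1 * a1 + A2 * a2) * (n t x * Re (cnj (b 0 t x) * D 0 t x))
     + d * ((c1 * A1 * q1 0 t x + c2 * A2 * q2 0 t x) * Re (cnj (b 1 t x) * D 0 t x + cnj (b 0 t x) * D 1 t x))
     + d * Re (cnj (b 0 t x) * (of_real (w 0 t x) * Bt t x))
     - 2 * K * Re (\<i> * (cnj (b 0 t x) * (of_real (w 0 t x) * D 0 t x + g t x)))
     + 2 * K * ((a1 * q1 0 t x + a2 * q2 0 t x) * n t x)" for t x
  have R_eq: "e' t x - F' t x = R t x" for t x
    using energy_identity'[OF \<omega>, of "bt t x" "b 2 t x" A1 "q1 0 t x" A2 "q2 0 t x" "D 0 t x" "g t x"
        "b 1 t x" "bt1 t x" "b 0 t x" a1 "n t x" c1 "q1 1 t x" a2 c2 "q2 1 t x" "Bt t x" K "g1 t x" "D 1 t x"]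
    unfolding e'_def F'_def R_def wt_def q1t_def q2t_def d_def[symmetric]
    by (simp only: bt_def w_def)
  \<comment> \<open>Every term of \<open>R\<close> is a product of two factors of size
    \<open>\<rho>\<close> with bounded coefficients.\<close>
  have "strip_O T (\<lambda>t x. (\<rho> t x)\<^sup>2) R"
    unfolding R_def[abs_def] by (intro strip_O_rules l\<rho> bd0 bdBt)
  then obtain CR where CR: "CR \<ge> 0" "\<And>t x. t \<in> {0..T} \<Longrightarrow> norm (R t x) \<le> CR * (\<rho> t x)\<^sup>2"
    unfolding strip_O_def by auto
  have Oe: "strip_O T (\<lambda>t x. (s t x)\<^sup>2) e" "strip_O T (\<lambda>t x. (s t x)\<^sup>2) e'"
     "strip_O T (\<lambda>t x. (s t x)\<^sup>2) F" "strip_O T (\<lambda>t x. (s t x)\<^sup>2) F'"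
    unfolding e_def[abs_def] e'_def[abs_def] F_def[abs_def] F'_def[abs_def]
    by (intro strip_O_rules ls bd0 bdBt)+
  have sc: "strip_cont T e" "strip_cont T e'" "strip_cont T F'"
    unfolding e_def[abs_def] e'_def[abs_def] F'_def[abs_def]
    by (intro strip_cont_intros cc)+
  have et: "((\<lambda>\<tau>. e \<tau> x) has_vector_derivative e' t x) (at t within {0..T})" if t: "t \<in> {0..T}" for t x
    unfolding e_def
    by (rule has_vector_derivative_eq_rhs, (rule has_vector_derivative_add has_vector_derivative_mult_right
        has_vector_derivative_mult has_vector_derivative_cnj has_vector_derivative_Re' has_vector_derivative_of_real'
        btd b1t qtd wtd Bt t)+)
       (simp add: e'_def algebra_simps)
  have Fx: "(F t has_vector_derivative F' t x) (at x)" if t: "t \<in> {0..T}" for t x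
  proof -
    have 1: "(b 0 t has_vector_derivative b 1 t x) (at x)" "(b 1 t has_vector_derivative b 2 t x) (at x)"
      "(D 0 t has_vector_derivative D 1 t x) (at x)"
      "(q1 0 t has_vector_derivative q1 1 t x) (at x)" "(q2 0 t has_vector_derivative q2 1 t x) (at x)"
      using bx(1)[of 0 t x] bx(1)[of 1 t x] bx(2,3)[of 0 t x] Dx(1)[of 0 t x] t by (auto simp: numeral_2_eq_2)
    show ?thesis
      unfolding F_def[abs_def]
      by (rule has_vector_derivative_eq_rhs, (rule has_vector_derivative_add has_vector_derivative_diff has_vector_derivative_mult_right
          has_vector_derivative_mult has_vector_derivative_cnj has_vector_derivative_Re' has_vector_derivative_of_real'
          1 btx gx t)+)
         (simp add: F'_def algebra_simps)
  qed
  have e_ge: "(norm (b 0 t x))\<^sup>2 + (norm (b 1 t x))\<^sup>2 + (norm (q1 0 t x))\<^sup>2 + (norm (q2 0 t x))\<^sup>2 \<le> e t x" if t: "t \<in> {0..T}" for t x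
  proof -
    let ?b = "norm (b 0 t x)" and ?q1 = "\<bar>q1 0 t x\<bar>" and ?q2 = "\<bar>q2 0 t x\<bar>"
    have "\<bar>w 0 t x\<bar> \<le> \<bar>A1\<bar> * ?q1 + \<bar>A2\<bar> * ?q2"
      unfolding w_def by (rule order_trans[OF abs_triangle_ineq]) (simp add: abs_mult)
    then have "\<bar>w 0 t x\<bar> * norm (D 0 t x) \<le> (\<bar>A1\<bar> * ?q1 + \<bar>A2\<bar> * ?q2) * Cw"
      by (intro mult_mono Cw t) auto
    then have "?b * (\<bar>w 0 t x\<bar> * norm (D 0 t x)) \<le> ?b * ((\<bar>A1\<bar> * ?q1 + \<bar>A2\<bar> * ?q2) * Cw)"
      by (rule mult_left_mono) auto
    also have "\<dots> = Cw * (\<bar>A1\<bar> * (?b * ?q1) + \<bar>A2\<bar> * (?b * ?q2))" by (simp add: algebra_simps)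
    also have "\<dots> \<le> Cw * (\<bar>A1\<bar> * ((?b\<^sup>2 + ?q1\<^sup>2 + ?q2\<^sup>2) / 2) + \<bar>A2\<bar> * ((?b\<^sup>2 + ?q1\<^sup>2 + ?q2\<^sup>2) / 2))"
    proof (intro mult_left_mono add_mono)
      have g: "x * y \<le> (x\<^sup>2 + y\<^sup>2 + z\<^sup>2) / 2" for x y z :: real
      proof -
        have "p \<le> (u + v) / 2" if "2 * p \<le> u" "0 \<le> v" for p u v :: real using that by simp
        moreover have "2 * (x * y) \<le> x\<^sup>2 + y\<^sup>2" using sum_squares_bound[of x y] by (simp only: mult.assoc)
        ultimately show ?thesis using zero_le_power2[of z] by blast
      qed
      show "?b * ?q1 \<le> (?b\<^sup>2 + ?q1\<^sup>2 + ?q2\<^sup>2) / 2" by (rule g)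
      show "?b * ?q2 \<le> (?b\<^sup>2 + ?q1\<^sup>2 + ?q2\<^sup>2) / 2" using g[of ?b ?q2 ?q1] by (simp only: add_ac)
    qed (use Cw in auto)
    also have "\<dots> = Cw * (\<bar>A1\<bar> + \<bar>A2\<bar>) * (?b\<^sup>2 + ?q1\<^sup>2 + ?q2\<^sup>2) / 2"
    proof -
      have "Cw * (\<alpha> * (S / 2) + \<beta> * (S / 2)) = Cw * (\<alpha> + \<beta>) * S / 2" for \<alpha> \<beta> S by (simp add: field_simps)
      then show ?thesis .
    qed
    finally have 1: "?b * (\<bar>w 0 t x\<bar> * norm (D 0 t x)) \<le> Cw * (\<bar>A1\<bar> + \<bar>A2\<bar>) * (?b\<^sup>2 + ?q1\<^sup>2 + ?q2\<^sup>2) / 2" .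
    have "\<bar>d * Re (cnj (b 0 t x) * (of_real (w 0 t x) * D 0 t x))\<bar> \<le> \<bar>d\<bar> * (?b * (\<bar>w 0 t x\<bar> * norm (D 0 t x)))"
      unfolding abs_mult[of d] by (intro mult_left_mono order_trans[OF abs_Re_le_cmod]) (auto simp: norm_mult)
    also have "\<dots> \<le> \<bar>d\<bar> * (Cw * (\<bar>A1\<bar> + \<bar>A2\<bar>) * (?b\<^sup>2 + ?q1\<^sup>2 + ?q2\<^sup>2) / 2)"
      using 1 by (rule mult_left_mono) simp
    also have "\<dots> = (K - 1) * (?b\<^sup>2 + ?q1\<^sup>2 + ?q2\<^sup>2)"
      using \<omega> by (simp add: K_def d_def)
    finally have 2: "- ((K - 1) * (?b\<^sup>2 + ?q1\<^sup>2 + ?q2\<^sup>2)) \<le> d * Re (cnj (b 0 t x) * (of_real (w 0 t x) * D 0 t x))" by linarith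
    have "Re (cnj z * z) = (norm z)\<^sup>2" for z by (simp only: cmod_power2) (simp add: power2_eq_square)
    then have "e t x = (norm (b 1 t x))\<^sup>2 + d * Re (cnj (b 0 t x) * (of_real (w 0 t x) * D 0 t x)) + K * ?b\<^sup>2 + K * (?q1\<^sup>2 + ?q2\<^sup>2)"
      unfolding e_def by (simp only: power2_abs) (simp add: power2_eq_square)
    then show ?thesis using 2 by (simp add: algebra_simps)
  qed
  obtain C1 C2 C3 C4 where Cs: "\<And>t x. t \<in> {0..T} \<Longrightarrow> norm (e t x) \<le> C1 * (s t x)\<^sup>2" "\<And>t x. t \<in> {0..T} \<Longrightarrow> norm (e' t x) \<le> C2 * (s t x)\<^sup>2"
    "\<And>t x. t \<in> {0..T} \<Longrightarrow> norm (F t x) \<le> C3 * (s t x)\<^sup>2" "\<And>t x. t \<in> {0..T} \<Longrightarrow> norm (F' t x) \<le> C4 * (s t x)\<^sup>2"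
    "C1 \<ge> 0" "C2 \<ge> 0" "C3 \<ge> 0" "C4 \<ge> 0"
    using Oe unfolding strip_O_def by metis
  define SQ where "SQ t x = ((norm (b 0 t x))\<^sup>2 + (norm (b 1 t x))\<^sup>2 + (norm (q1 0 t x))\<^sup>2 + (norm (q2 0 t x))\<^sup>2)
    + ((norm (b 2 t x))\<^sup>2 + (norm (b 3 t x))\<^sup>2 + (norm (q1 1 t x))\<^sup>2 + (norm (q2 1 t x))\<^sup>2)" for t x
  have \<rho>4: "(\<rho> t x)\<^sup>2 \<le> 4 * ((norm (b 0 t x))\<^sup>2 + (norm (b 1 t x))\<^sup>2 + (norm (q1 0 t x))\<^sup>2 + (norm (q2 0 t x))\<^sup>2)" for t x
    unfolding \<rho>_def by (rule four_square_sum_le)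
  have sSQ: "(s t x)\<^sup>2 \<le> 8 * SQ t x" for t x
  proof -
    have "(s t x)\<^sup>2 \<le> 2 * (\<rho> t x)\<^sup>2 + 2 * (norm (b 2 t x) + norm (b 3 t x) + norm (q1 1 t x) + norm (q2 1 t x))\<^sup>2"
    proof -
      have "(x + y)\<^sup>2 \<le> 2 * x\<^sup>2 + 2 * y\<^sup>2" for x y :: real
        using sum_squares_bound[of x y] by (simp add: power2_sum)
      then show ?thesis unfolding s_def .
    qed
    also have "\<dots> \<le> 8 * SQ t x"
    proof -
      have "2 * x + 2 * y \<le> 8 * (u + v)" if "x \<le> 4 * u" "y \<le> 4 * v" for x y u v :: real using that by simp
      then show ?thesis unfolding SQ_def using \<rho>4 four_square_sum_le by blast
    qed
    finally show ?thesis .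
  qed
  \<comment> \<open>Eight squares of differences, each with integral at most
    \<open>4 * MM\<close>.\<close>
  have SQi: "integrable lborel (SQ t)" "(LINT x|lborel. SQ t x) \<le> 32 * MM" if t: "t \<in> {0..T}" for t
  proof -
    note I = regular_strip_diff_integrable[OF regM(1) regM(4) _ t, folded b_def]
      regular_strip_diff_integrable[OF regM(2) regM(5) _ t, folded q1_def]
      regular_strip_diff_integrable[OF regM(3) regM(6) _ t, folded q2_def]
    note II = I(1)[OF le3(1)] I(1)[OF le3(2)] I(1)[OF le3(3)] I(1)[OF le3(4)] I(3)[OF le3(1)] I(3)[OF le3(2)] I(5)[OF le3(1)] I(5)[OF le3(2)]
    note III = I(2)[OF le3(1)] I(2)[OF le3(2)] I(2)[OF le3(3)] I(2)[OF le3(4)] I(4)[OF le3(1)] I(4)[OF le3(2)] I(6)[OF le3(1)] I(6)[OF le3(2)]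
    show "integrable lborel (SQ t)" unfolding SQ_def[abs_def]
      by (intro Bochner_Integration.integrable_add II)
    have "(LINT x|lborel. SQ t x) = ((LINT x|lborel. (norm (b 0 t x))\<^sup>2) + (LINT x|lborel. (norm (b 1 t x))\<^sup>2) + (LINT x|lborel. (norm (q1 0 t x))\<^sup>2) + (LINT x|lborel. (norm (q2 0 t x))\<^sup>2))
    + ((LINT x|lborel. (norm (b 2 t x))\<^sup>2) + (LINT x|lborel. (norm (b 3 t x))\<^sup>2) + (LINT x|lborel. (norm (q1 1 t x))\<^sup>2) + (LINT x|lborel. (norm (q2 1 t x))\<^sup>2))"
      unfolding SQ_def by (simp only: Bochner_Integration.integral_add Bochner_Integration.integrable_add II)
    then show "(LINT x|lborel. SQ t x) \<le> 32 * MM" using III by linarith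
  qed
  define CC where "CC = (C1 + C2 + C3 + C4) * 8"
  have bound: "norm y \<le> CC * SQ t x" if "norm y \<le> C * (s t x)\<^sup>2" "C \<le> C1 + C2 + C3 + C4" for y C t x
  proof -
    have "norm y \<le> (C1 + C2 + C3 + C4) * (s t x)\<^sup>2"
      using that(1) mult_right_mono[OF that(2), of "(s t x)\<^sup>2"] by simp
    also have "\<dots> \<le> (C1 + C2 + C3 + C4) * (8 * SQ t x)" using Cs by (intro mult_left_mono sSQ) auto
    finally show ?thesis by (simp only: CC_def mult.assoc)
  qed
  have e0: "e t x = 0" if t: "t \<in> {0..T}" for t x
  proof (rule energy_zero[where e = e and e' = e' and F = F and F' = F' and \<sigma> = "\<lambda>t x. CC * SQ t x" and C = "4 * CR" and M = "CC * (32 * MM)", OF T _ et Fx])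
    show "e 0 x = 0" for x
    proof -
      have T0: "0 \<in> {0..T}" using T by simp
      have z: "b 0 0 = (\<lambda>x. 0)" "q1 0 0 = (\<lambda>x. 0)" "q2 0 0 = (\<lambda>x. 0)"
        using init regM[THEN regular_stripD(1), OF T0] by (simp_all add: b_def[abs_def] q1_def[abs_def] q2_def[abs_def])
      have "((\<lambda>x. 0) has_vector_derivative b (Suc 0) 0 x) (at x)" using bx(1)[of 0 0 x] T0 z by simp
      from vector_derivative_at[OF this] have "b 1 0 x = 0" by simp
      then show ?thesis by (simp add: e_def z)
    qed
    show "continuous_on ({0..T} \<times> UNIV) (\<lambda>z. e (fst z) (snd z))" "continuous_on ({0..T} \<times> UNIV) (\<lambda>z. e' (fst z) (snd z))"
      using sc by (simp_all add: strip_cont_def)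
    show "continuous_on UNIV (F' t)" if "t \<in> {0..T}" for t by (rule strip_cont_slice[OF sc(3) that])
    fix t x assume t: "t \<in> {0..T}"
    show "\<bar>e t x\<bar> \<le> CC * SQ t x" using bound[OF Cs(1)[OF t]] Cs by simp
    show "\<bar>e' t x\<bar> \<le> CC * SQ t x" using bound[OF Cs(2)[OF t]] Cs by simp
    show "\<bar>F t x\<bar> \<le> CC * SQ t x" using bound[OF Cs(3)[OF t]] Cs by simp
    show "\<bar>F' t x\<bar> \<le> CC * SQ t x" using bound[OF Cs(4)[OF t]] Cs by simp
    show "integrable lborel (\<lambda>x. CC * SQ t x)" using SQi[OF t] by simp
    show "(LINT x|lborel. CC * SQ t x) \<le> CC * (32 * MM)" using SQi[OF t] Cs by (simp add: CC_def mult_left_mono)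
    show "0 \<le> e t x" by (rule order_trans[OF _ e_ge[OF t]]) simp
    have "e' t x - F' t x \<le> CR * (\<rho> t x)\<^sup>2" using CR(2)[OF t, of x] R_eq by simp
    also have "\<dots> \<le> CR * (4 * e t x)"
      by (intro mult_left_mono CR(1) order_trans[OF \<rho>4] e_ge t) simp
    finally show "e' t x - F' t x \<le> 4 * CR * e t x" by simp
  qed (use CR t in auto)
  have "q1 0 t x = 0" for x
  proof -
    have "(norm (q1 0 t x))\<^sup>2 \<le> 0"
      using e_ge[OF t, of x] e0[OF t, of x] zero_le_power2[of "norm (b 0 t x)"] zero_le_power2[of "norm (b 1 t x)"] zero_le_power2[of "norm (q2 0 t x)"]
      by linarith
    then show ?thesis by simp
  qed
  then show ?thesis
    using regM[THEN regular_stripD(1), OF t] by (simp add: q1_def fun_eq_iff)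
qed

text \<open>Without dispersion the potential is real, so \<open>cmod (B t x)\<close> does not depend on \<open>t\<close> and the
  transport equation for \<open>p1\<close> decouples.\<close>

lemma zk_unique_no_dispersion:
  assumes T: "0 \<le> T"
    and sol: "zk_solution 0 A1 A2 Q c1 a1 c2 a2 T B p1 p2" and sol': "zk_solution 0 A1 A2 Q c1 a1 c2 a2 T B' p1' p2'"
    and init: "B 0 = B' 0" "p1 0 = p1' 0" and t: "t \<in> {0..T}"
  shows "p1 t = p1' t"
proof -
  obtain D P1 P2 M where reg: "regular_strip T B D M" "regular_strip T p1 P1 M" "regular_strip T p2 P2 M"
    and Dt: "\<And>t x. t \<in> {0..T} \<Longrightarrow> ((\<lambda>\<tau>. D 0 \<tau> x) has_vector_derivative \<i> * (of_real 0 * D 2 t x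
       - of_real (A1 * P1 0 t x + A2 * P2 0 t x + Q * (cmod (D 0 t x))\<^sup>2) * D 0 t x)) (at t within {0..T})"
    and P1t: "\<And>t x. t \<in> {0..T} \<Longrightarrow> ((\<lambda>\<tau>. P1 0 \<tau> x) has_vector_derivative a1 * (2 * Re (cnj (D 0 t x) * D 1 t x)) - c1 * P1 1 t x) (at t within {0..T})"
    and "\<And>t x. t \<in> {0..T} \<Longrightarrow> ((\<lambda>\<tau>. P2 0 \<tau> x) has_vector_derivative a2 * (2 * Re (cnj (D 0 t x) * D 1 t x)) - c2 * P2 1 t x) (at t within {0..T})"
    by (rule zk_solution_regular[OF sol T]) blast
  obtain D' P1' P2' M' where reg': "regular_strip T B' D' M'" "regular_strip T p1' P1' M'" "regular_strip T p2' P2' M'"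
    and Dt': "\<And>t x. t \<in> {0..T} \<Longrightarrow> ((\<lambda>\<tau>. D' 0 \<tau> x) has_vector_derivative \<i> * (of_real 0 * D' 2 t x
       - of_real (A1 * P1' 0 t x + A2 * P2' 0 t x + Q * (cmod (D' 0 t x))\<^sup>2) * D' 0 t x)) (at t within {0..T})"
    and P1t': "\<And>t x. t \<in> {0..T} \<Longrightarrow> ((\<lambda>\<tau>. P1' 0 \<tau> x) has_vector_derivative a1 * (2 * Re (cnj (D' 0 t x) * D' 1 t x)) - c1 * P1' 1 t x) (at t within {0..T})"
    and "\<And>t x. t \<in> {0..T} \<Longrightarrow> ((\<lambda>\<tau>. P2' 0 \<tau> x) has_vector_derivative a2 * (2 * Re (cnj (D' 0 t x) * D' 1 t x)) - c2 * P2' 1 t x) (at t within {0..T})"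
    by (rule zk_solution_regular[OF sol' T]) blast
  define MM where "MM = max M M'"
  have regM: "regular_strip T p1 P1 MM" "regular_strip T p1' P1' MM"
    by (rule regular_strip_mono[OF reg(2)] regular_strip_mono[OF reg'(2)], simp add: MM_def)+
  have T0: "0 \<in> {0..T}" using T by simp
  have const: "(cmod (E t x))\<^sup>2 = (cmod (E 0 x))\<^sup>2"
    if E: "\<And>t x. t \<in> {0..T} \<Longrightarrow> ((\<lambda>\<tau>. E \<tau> x) has_vector_derivative \<i> * (of_real 0 * E2 t x - of_real (V t x) * E t x)) (at t within {0..T})"
      and t: "t \<in> {0..T}" for E E2 :: "real \<Rightarrow> real \<Rightarrow> complex" and V t x
  proof -
    have "((\<lambda>\<tau>. (cmod (E \<tau> x))\<^sup>2) has_vector_derivative 0) (at s within {0..T})" if "s \<in> {0..T}" for s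
      by (rule has_vector_derivative_eq_rhs[OF vderiv_cmod_square[OF E[OF that]]]) (simp add: algebra_simps)
    then obtain c where "\<And>s. s \<in> {0..T} \<Longrightarrow> (cmod (E s x))\<^sup>2 = c"
      using has_vector_derivative_zero_constant[where s = "{0..T}" and f = "\<lambda>\<tau>. (cmod (E \<tau> x))\<^sup>2"]
        convex_real_interval(5)[of 0 T] by blast
    then show ?thesis using t T0 by simp
  qed
  have DD: "(cmod (D 0 t x))\<^sup>2 = (cmod (D' 0 t x))\<^sup>2" if t: "t \<in> {0..T}" for t x
  proof -
    have "(cmod (D 0 t x))\<^sup>2 = (cmod (D 0 0 x))\<^sup>2" by (rule const[OF _ t]) (rule Dt)
    moreover have "(cmod (D' 0 t x))\<^sup>2 = (cmod (D' 0 0 x))\<^sup>2" by (rule const[OF _ t]) (rule Dt')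
    ultimately show ?thesis
      using init(1) regular_stripD(1)[OF reg(1) T0] regular_stripD(1)[OF reg'(1) T0] by simp
  qed
  have nn: "2 * Re (cnj (D 0 t x) * D 1 t x) = 2 * Re (cnj (D' 0 t x) * D' 1 t x)" if t: "t \<in> {0..T}" for t x
  proof -
    have "(D 0 t has_vector_derivative D 1 t x) (at x)" "(D' 0 t has_vector_derivative D' 1 t x) (at x)"
      using regular_stripD(2)[OF reg(1) _ t, of 0 x] regular_stripD(2)[OF reg'(1) _ t, of 0 x] by simp_all
    from vderiv_eqI[OF vderiv_cmod_square[OF this(1)]] vderiv_eqI[OF vderiv_cmod_square[OF this(2)]]
    show ?thesis by (simp only: DD[OF t])
  qed
  define q where "q j t x = P1 j t x - P1' j t x" for j t x
  have qt: "((\<lambda>\<tau>. q 0 \<tau> x) has_vector_derivative - c1 * q 1 t x) (at t within {0..T})" if t: "t \<in> {0..T}" for t x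
    unfolding q_def
    by (rule has_vector_derivative_eq_rhs[OF has_vector_derivative_diff[OF P1t[OF that] P1t'[OF that]]])
       (simp only: nn[OF t], simp add: algebra_simps)
  have qx: "(q 0 t has_vector_derivative q 1 t x) (at x)" if t: "t \<in> {0..T}" for t x
    unfolding q_def[abs_def]
    using regular_stripD(2)[OF regM(1) _ t, of 0 x] regular_stripD(2)[OF regM(2) _ t, of 0 x]
    by (intro has_vector_derivative_diff) simp_all
  have le3: "(0::nat) \<le> 3" "(1::nat) \<le> 3" by auto
  have qc: "strip_cont T (q 0)" "strip_cont T (q 1)"
    unfolding q_def[abs_def] by (intro strip_cont_intros regular_stripD(3)[OF regM(1)] regular_stripD(3)[OF regM(2)]; simp)+
  note I = regular_strip_diff_integrable[OF regM(1) regM(2) _ , folded q_def]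
  have ab: "\<bar>x * y\<bar> \<le> x\<^sup>2 + y\<^sup>2" for x y :: real
  proof -
    have "2 * (\<bar>x\<bar> * \<bar>y\<bar>) \<le> x\<^sup>2 + y\<^sup>2" using sum_squares_bound[of "\<bar>x\<bar>" "\<bar>y\<bar>"] by (simp only: mult.assoc power2_abs)
    moreover have "0 \<le> \<bar>x\<bar> * \<bar>y\<bar>" by simp
    moreover have "p \<le> u" if "2 * p \<le> u" "0 \<le> p" for p u :: real using that by simp
    ultimately show ?thesis unfolding abs_mult by blast
  qed
  define \<sigma> where "\<sigma> t x = (1 + 2 * \<bar>c1\<bar>) * ((norm (q 0 t x))\<^sup>2 + (norm (q 1 t x))\<^sup>2)" for t x
  have c\<sigma>: "\<bar>k * z\<bar> \<le> \<sigma> t x" if "\<bar>k\<bar> \<le> 1 + 2 * \<bar>c1\<bar>" "\<bar>z\<bar> \<le> (norm (q 0 t x))\<^sup>2 + (norm (q 1 t x))\<^sup>2" for k z t x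
    unfolding abs_mult \<sigma>_def by (rule mult_mono[OF that]) auto
  have "q 0 t x * q 0 t x = 0" for x
  \<comment> \<open>Pure transport: the time derivative of the squared wave difference is exactly
    the derivative of a flux, so \<open>C = 0\<close>.\<close>
  proof (rule energy_zero[where e = "\<lambda>t x. q 0 t x * q 0 t x" and e' = "\<lambda>t x. (- 2 * c1) * (q 0 t x * q 1 t x)"
      and F = "\<lambda>t x. (- c1) * (q 0 t x * q 0 t x)" and F' = "\<lambda>t x. (- 2 * c1) * (q 0 t x * q 1 t x)" and \<sigma> = \<sigma>
      and C = 0 and M = "(1 + 2 * \<bar>c1\<bar>) * (8 * MM)" and T = T and t = t])
    show "q 0 0 x * q 0 0 x = 0" for x
      using init(2) regular_stripD(1)[OF regM(1) T0] regular_stripD(1)[OF regM(2) T0] by (simp add: q_def)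
    show "continuous_on ({0..T} \<times> UNIV) (\<lambda>z. q 0 (fst z) (snd z) * q 0 (fst z) (snd z))"
      "continuous_on ({0..T} \<times> UNIV) (\<lambda>z. (- 2 * c1) * (q 0 (fst z) (snd z) * q 1 (fst z) (snd z)))"
      using qc unfolding strip_cont_def by (auto intro!: continuous_intros)
    fix t assume t: "t \<in> {0..T}"
    show "continuous_on UNIV (\<lambda>x. (- 2 * c1) * (q 0 t x * q 1 t x))"
      using strip_cont_slice[OF qc(1) t] strip_cont_slice[OF qc(2) t] by (intro continuous_intros)
    show "integrable lborel (\<sigma> t)" unfolding \<sigma>_def[abs_def]
      using I(1)[OF le3(1) t] I(1)[OF le3(2) t] by simp
    have "(LINT x|lborel. \<sigma> t x) = (1 + 2 * \<bar>c1\<bar>) * ((LINT x|lborel. (norm (q 0 t x))\<^sup>2) + (LINT x|lborel. (norm (q 1 t x))\<^sup>2))"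
      unfolding \<sigma>_def using I(1)[OF le3(1) t] I(1)[OF le3(2) t] by simp
    also have "\<dots> \<le> (1 + 2 * \<bar>c1\<bar>) * (8 * MM)"
      using I(2)[OF le3(1) t] I(2)[OF le3(2) t] by (intro mult_left_mono) auto
    finally show "(LINT x|lborel. \<sigma> t x) \<le> (1 + 2 * \<bar>c1\<bar>) * (8 * MM)" .
    fix x
    show "((\<lambda>\<tau>. q 0 \<tau> x * q 0 \<tau> x) has_vector_derivative (- 2 * c1) * (q 0 t x * q 1 t x)) (at t within {0..T})"
      by (rule has_vector_derivative_eq_rhs[OF has_vector_derivative_mult[OF qt[OF t] qt[OF t]]]) simp
    show "((\<lambda>x. (- c1) * (q 0 t x * q 0 t x)) has_vector_derivative (- 2 * c1) * (q 0 t x * q 1 t x)) (at x)"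
      by (rule has_vector_derivative_eq_rhs[OF has_vector_derivative_mult_right[OF has_vector_derivative_mult[OF qx[OF t] qx[OF t]]]]) simp
    have q0: "\<bar>q 0 t x * q 0 t x\<bar> \<le> (norm (q 0 t x))\<^sup>2 + (norm (q 1 t x))\<^sup>2" by (simp add: power2_eq_square)
    have q01: "\<bar>q 0 t x * q 1 t x\<bar> \<le> (norm (q 0 t x))\<^sup>2 + (norm (q 1 t x))\<^sup>2" using ab by simp
    show "\<bar>q 0 t x * q 0 t x\<bar> \<le> \<sigma> t x" using c\<sigma>[OF _ q0, of 1] by simp
    show "\<bar>(- 2 * c1) * (q 0 t x * q 1 t x)\<bar> \<le> \<sigma> t x" "\<bar>(- 2 * c1) * (q 0 t x * q 1 t x)\<bar> \<le> \<sigma> t x"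
      by (rule c\<sigma>[OF _ q01]; simp add: abs_mult)+
    show "\<bar>(- c1) * (q 0 t x * q 0 t x)\<bar> \<le> \<sigma> t x" by (rule c\<sigma>[OF _ q0]) simp
  qed (use T t in auto)
  then show ?thesis
    using regular_stripD(1)[OF regM(1) t] regular_stripD(1)[OF regM(2) t] by (simp add: q_def fun_eq_iff)
qed

subsection \<open>Convolutions of functions with integrable majorants\<close>

text \<open>The factor \<open>1 / sqrt (2 * pi)\<close> matches the unitary transform, so that
  \<open>ift\<close> turns \<open>conv\<close> into a product without constants.\<close>

definition conv :: "(real \<Rightarrow> complex) \<Rightarrow> (real \<Rightarrow> complex) \<Rightarrow> real \<Rightarrow> complex" where
  "conv u v \<xi> = of_real (1 / sqrt (2 * pi)) * (LINT \<eta>|lborel. u (\<xi> - \<eta>) * v \<eta>)"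

text \<open>Complex conjugation seen on the transform side; its fixed points are the transforms of
  real functions.\<close>

definition cnj_refl :: "(real \<Rightarrow> complex) \<Rightarrow> real \<Rightarrow> complex" where
  "cnj_refl v \<xi> = cnj (v (- \<xi>))"

lemma inv_sqrt_2pi: "0 < 1 / sqrt (2 * pi)" "1 / sqrt (2 * pi) \<le> 1"
  using pi_ge_two by (auto simp: real_le_rsqrt)

lemma lborel_integral_reflect:
  fixes f :: "real \<Rightarrow> 'a::{banach, second_countable_topology}"
  shows "(LINT \<eta>|lborel. f (\<xi> - \<eta>)) = (LINT \<eta>|lborel. f \<eta>)"
  using lborel_integral_real_affine[of "-1" f \<xi>] by simp

lemma lborel_integrable_reflect:
  fixes f :: "real \<Rightarrow> 'a::{banach, second_countable_topology}"
  shows "integrable lborel f \<Longrightarrow> integrable lborel (\<lambda>\<eta>. f (\<xi> - \<eta>))"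
  using lborel_integrable_real_affine[of f "-1" \<xi>] by simp

lemma lborel_integral_shift:
  fixes f :: "real \<Rightarrow> 'a::{banach, second_countable_topology}"
  shows "(LINT \<xi>|lborel. f (\<xi> - \<eta>)) = (LINT \<xi>|lborel. f \<xi>)"
  using lborel_integral_real_affine[of 1 f "- \<eta>"] by simp

lemma lborel_integrable_shift:
  fixes f :: "real \<Rightarrow> 'a::{banach, second_countable_topology}"
  shows "integrable lborel f \<Longrightarrow> integrable lborel (\<lambda>\<xi>. f (\<xi> - \<eta>))"
  using lborel_integrable_real_affine[of f 1 "- \<eta>"] by simp

lemma conv_commute: "conv u v = conv v u"
proof
  fix \<xi>
  have "(LINT \<eta>|lborel. u (\<xi> - \<eta>) * v \<eta>) = (LINT \<eta>|lborel. (\<lambda>\<eta>. u (\<xi> - \<eta>) * v \<eta>) (\<xi> - \<eta>))"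
    by (rule lborel_integral_reflect[symmetric])
  then show "conv u v \<xi> = conv v u \<xi>" unfolding conv_def by (simp add: mult.commute)
qed

lemma convolution_integrable:
  fixes u v :: "real \<Rightarrow> 'a::{real_normed_field, banach, second_countable_topology}"
  assumes u: "integrable lborel u" and v: "integrable lborel v"
  shows "integrable (lborel \<Otimes>\<^sub>M lborel) (\<lambda>(\<eta>, \<xi>). u (\<xi> - \<eta>) * v \<eta>)"
proof (rule lborel_pair.Fubini_integrable)
  have [measurable]: "u \<in> borel_measurable borel" "v \<in> borel_measurable borel" using u v by auto
  show "(\<lambda>(\<eta>, \<xi>). u (\<xi> - \<eta>) * v \<eta>) \<in> borel_measurable (lborel \<Otimes>\<^sub>M lborel)" by measurable
  have "(LINT \<xi>|lborel. norm (u (\<xi> - \<eta>) * v \<eta>)) = (LINT \<xi>|lborel. norm (u \<xi>)) * norm (v \<eta>)" for \<eta>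
    using lborel_integral_shift[of "\<lambda>\<xi>. norm (u \<xi>)" \<eta>] by (simp add: norm_mult)
  then show "integrable lborel (\<lambda>\<eta>. LINT \<xi>|lborel. norm (case (\<eta>, \<xi>) of (\<eta>, \<xi>) \<Rightarrow> u (\<xi> - \<eta>) * v \<eta>))"
    using v by (simp only: prod.case) simp
  show "AE \<eta> in lborel. integrable lborel (\<lambda>\<xi>. case (\<eta>, \<xi>) of (\<eta>, \<xi>) \<Rightarrow> u (\<xi> - \<eta>) * v \<eta>)"
    using lborel_integrable_shift[OF u] by (auto intro!: AE_I2)
qed

lemma convolution_majorant:
  fixes M1 M2 :: "real \<Rightarrow> real"
  assumes M1: "integrable lborel M1" "\<And>\<xi>. 0 \<le> M1 \<xi>" "\<And>\<xi>. M1 \<xi> \<le> S"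
    and M2: "integrable lborel M2" "\<And>\<xi>. 0 \<le> M2 \<xi>"
  defines "M \<equiv> \<lambda>\<xi>. LINT \<eta>|lborel. M1 (\<xi> - \<eta>) * M2 \<eta>"
  shows "integrable lborel (\<lambda>\<eta>. M1 (\<xi> - \<eta>) * M2 \<eta>)"
    and "integrable lborel M" and "(LINT \<xi>|lborel. M \<xi>) = (LINT \<xi>|lborel. M1 \<xi>) * (LINT \<xi>|lborel. M2 \<xi>)"
    and "0 \<le> M \<xi>" and "M \<xi> \<le> S * (LINT \<xi>|lborel. M2 \<xi>)"
proof -
  have [measurable]: "M1 \<in> borel_measurable borel" "M2 \<in> borel_measurable borel" using M1 M2 by auto
  have S0: "0 \<le> S" using M1(2)[of 0] M1(3)[of 0] by simp
  have i: "integrable lborel (\<lambda>\<eta>. M1 (\<xi> - \<eta>) * M2 \<eta>)" for \<xi>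
    by (rule Bochner_Integration.integrable_bound[of lborel "\<lambda>\<eta>. S * M2 \<eta>"])
       (use M1 M2 S0 in \<open>auto simp: abs_mult intro!: AE_I2 mult_right_mono\<close>)
  then show "integrable lborel (\<lambda>\<eta>. M1 (\<xi> - \<eta>) * M2 \<eta>)" .
  note J = convolution_integrable[OF M1(1) M2(1)]
  show "integrable lborel M" unfolding M_def
    using lborel_pair.integrable_snd[OF J] by simp
  have "(LINT \<xi>|lborel. M \<xi>) = (LINT \<eta>|lborel. LINT \<xi>|lborel. M1 (\<xi> - \<eta>) * M2 \<eta>)"
    unfolding M_def by (rule lborel_pair.Fubini_integral[OF J])
  also have "\<dots> = (LINT \<xi>|lborel. M1 \<xi>) * (LINT \<xi>|lborel. M2 \<xi>)"
    by (simp add: lborel_integral_shift)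
  finally show "(LINT \<xi>|lborel. M \<xi>) = (LINT \<xi>|lborel. M1 \<xi>) * (LINT \<xi>|lborel. M2 \<xi>)" .
  show "0 \<le> M \<xi>" unfolding M_def by (rule integral_nonneg_AE) (use M1 M2 in auto)
  have "M \<xi> \<le> (LINT \<eta>|lborel. S * M2 \<eta>)"
    unfolding M_def by (intro integral_mono i) (use M1 M2 in \<open>auto intro: mult_right_mono\<close>)
  then show "M \<xi> \<le> S * (LINT \<xi>|lborel. M2 \<xi>)" by simp
qed

text \<open>Positivity allows division by the weight, boundedness keeps majorized functions
  integrable, and evenness makes the class invariant under \<open>cnj_refl\<close>.\<close>

definition weight :: "(real \<Rightarrow> real \<Rightarrow> real) \<Rightarrow> bool" where
  "weight W \<longleftrightarrow> jcont W \<and> (\<exists>c. \<forall>t \<xi>. W t \<xi> \<le> c) \<and> (\<forall>t \<xi>. 0 < W t \<xi>) \<and> (\<forall>t \<xi>. W t (- \<xi>) = W t \<xi>)"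

text \<open>\<open>R\<close> and \<open>S\<close> bound the \<open>L\<^sup>1\<close> and the supremum norm of a time-independent majorant of \<open>u / W\<close>.\<close>

definition majorized :: "(real \<Rightarrow> real \<Rightarrow> real) \<Rightarrow> real \<Rightarrow> real \<Rightarrow> (real \<Rightarrow> real \<Rightarrow> complex) \<Rightarrow> bool" where
  "majorized W R S u \<longleftrightarrow> jcont u \<and> (\<exists>M. integrable lborel M \<and> (\<forall>\<xi>. 0 \<le> M \<xi>) \<and> (\<forall>\<xi>. M \<xi> \<le> S) \<and>
     (LINT \<xi>|lborel. M \<xi>) \<le> R \<and> (\<forall>t \<xi>. norm (u t \<xi>) \<le> W t \<xi> * M \<xi>))"

lemma majorizedI:
  assumes "jcont u" "integrable lborel M" "\<And>\<xi>. 0 \<le> M \<xi>" "\<And>\<xi>. M \<xi> \<le> S" "(LINT \<xi>|lborel. M \<xi>) \<le> R"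
    "\<And>t \<xi>. norm (u t \<xi>) \<le> W t \<xi> * M \<xi>"
  shows "majorized W R S u"
  unfolding majorized_def using assms by blast

lemma majorizedE:
  assumes "majorized W R S u"
  obtains M where "jcont u" "integrable lborel M" "\<And>\<xi>. 0 \<le> M \<xi>" "\<And>\<xi>. M \<xi> \<le> S" "(LINT \<xi>|lborel. M \<xi>) \<le> R"
    "\<And>t \<xi>. norm (u t \<xi>) \<le> W t \<xi> * M \<xi>"
  using assms unfolding majorized_def by blast

lemma majorized_nonneg: assumes "majorized W R S u" shows "0 \<le> R" "0 \<le> S"
proof -
  obtain M where M: "jcont u" "integrable lborel M" "\<And>\<xi>. 0 \<le> M \<xi>" "\<And>\<xi>. M \<xi> \<le> S" "(LINT \<xi>|lborel. M \<xi>) \<le> R"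
    "\<And>t \<xi>. norm (u t \<xi>) \<le> W t \<xi> * M \<xi>" using assms by (rule majorizedE) blast
  show "0 \<le> S" using M(3)[of 0] M(4)[of 0] by linarith
  have "0 \<le> (LINT \<xi>|lborel. M \<xi>)" by (rule integral_nonneg_AE) (simp add: M(3))
  then show "0 \<le> R" using M(5) by linarith
qed

lemma majorized_mono: "majorized W R S u \<Longrightarrow> R \<le> R' \<Longrightarrow> S \<le> S' \<Longrightarrow> majorized W R' S' u"
  unfolding majorized_def by (meson order_trans)

lemma majorized_weight_mono:
  assumes "majorized W R S u" "\<And>t \<xi>. W t \<xi> \<le> W' t \<xi>" shows "majorized W' R S u"
proof -
  obtain M where "jcont u" "integrable lborel M" and M: "\<And>\<xi>. 0 \<le> M \<xi>" "\<And>\<xi>. M \<xi> \<le> S" "(LINT \<xi>|lborel. M \<xi>) \<le> R"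
    and b: "\<And>t \<xi>. norm (u t \<xi>) \<le> W t \<xi> * M \<xi>" using assms(1) by (rule majorizedE) blast
  then show ?thesis
    by (intro majorizedI[where M = M]) (auto intro: order_trans[OF b] mult_right_mono assms(2))
qed

text \<open>Cuts the majorant off at height \<open>D\<close>. In the contraction estimate, the
  difference of two functions keeps its crude L1 bound while its supremum bound becomes their
  distance.\<close>

lemma majorized_sup:
  assumes "majorized W R S u" "\<And>t \<xi>. norm (u t \<xi>) \<le> D * W t \<xi>" "0 \<le> D" shows "majorized W R D u"
proof -
  obtain M where "jcont u" and Mi: "integrable lborel M" and M: "\<And>\<xi>. 0 \<le> M \<xi>" "\<And>\<xi>. M \<xi> \<le> S" "(LINT \<xi>|lborel. M \<xi>) \<le> R"
    and b: "\<And>t \<xi>. norm (u t \<xi>) \<le> W t \<xi> * M \<xi>" using assms(1) by (rule majorizedE) blast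
  have i: "integrable lborel (\<lambda>\<xi>. min (M \<xi>) D)"
    by (rule Bochner_Integration.integrable_bound[OF Mi]) (use Mi M assms(3) in \<open>auto intro!: AE_I2\<close>)
  have le: "(LINT \<xi>|lborel. min (M \<xi>) D) \<le> (LINT \<xi>|lborel. M \<xi>)" by (intro integral_mono i Mi) auto
  show ?thesis
  proof (rule majorizedI[OF \<open>jcont u\<close> i])
    fix t \<xi>
    show "norm (u t \<xi>) \<le> W t \<xi> * min (M \<xi>) D"
      using b[of t \<xi>] assms(2)[of t \<xi>] by (simp add: min_def mult.commute)
  qed (use M le assms(3) in auto)
qed

lemma jcont_intros:
  fixes u v :: "real \<Rightarrow> real \<Rightarrow> 'a::real_normed_field"
  shows "jcont u \<Longrightarrow> jcont v \<Longrightarrow> jcont (\<lambda>t \<xi>. u t \<xi> + v t \<xi>)"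
    "jcont u \<Longrightarrow> jcont v \<Longrightarrow> jcont (\<lambda>t \<xi>. u t \<xi> - v t \<xi>)"
    "jcont u \<Longrightarrow> jcont v \<Longrightarrow> jcont (\<lambda>t \<xi>. u t \<xi> * v t \<xi>)"
    "jcont u \<Longrightarrow> jcont (\<lambda>t \<xi>. - u t \<xi>)"
    "jcont (\<lambda>t \<xi>. c :: 'a)"
  unfolding jcont_def by (auto simp: split_beta intro!: continuous_intros)

lemma majorized_add:
  assumes "majorized W R S u" "majorized W R' S' v" shows "majorized W (R + R') (S + S') (\<lambda>t \<xi>. u t \<xi> + v t \<xi>)"
proof -
  obtain M where u: "jcont u" "integrable lborel M" "\<And>\<xi>. 0 \<le> M \<xi>" "\<And>\<xi>. M \<xi> \<le> S" "(LINT \<xi>|lborel. M \<xi>) \<le> R"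
    "\<And>t \<xi>. norm (u t \<xi>) \<le> W t \<xi> * M \<xi>" using assms(1) by (rule majorizedE) blast
  obtain M' where v: "jcont v" "integrable lborel M'" "\<And>\<xi>. 0 \<le> M' \<xi>" "\<And>\<xi>. M' \<xi> \<le> S'" "(LINT \<xi>|lborel. M' \<xi>) \<le> R'"
    "\<And>t \<xi>. norm (v t \<xi>) \<le> W t \<xi> * M' \<xi>" using assms(2) by (rule majorizedE) blast
  show ?thesis
  proof (rule majorizedI[where M = "\<lambda>\<xi>. M \<xi> + M' \<xi>"])
    show "norm (u t \<xi> + v t \<xi>) \<le> W t \<xi> * (M \<xi> + M' \<xi>)" for t \<xi>
      using norm_triangle_mono[OF u(6) v(6), of t \<xi> t \<xi>] by (simp add: distrib_left)
  qed (use u v in \<open>auto intro: jcont_intros add_mono add_nonneg_nonneg\<close>)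
qed

lemma majorized_mult_bounded:
  assumes u: "majorized W R S u" and h: "jcont h" "\<And>t \<xi>. norm (h t \<xi>) \<le> c" "0 \<le> c"
  shows "majorized W (c * R) (c * S) (\<lambda>t \<xi>. h t \<xi> * u t \<xi>)"
proof -
  obtain M where u: "jcont u" "integrable lborel M" "\<And>\<xi>. 0 \<le> M \<xi>" "\<And>\<xi>. M \<xi> \<le> S" "(LINT \<xi>|lborel. M \<xi>) \<le> R"
    "\<And>t \<xi>. norm (u t \<xi>) \<le> W t \<xi> * M \<xi>" using assms(1) by (rule majorizedE) blast
  show ?thesis
  proof (rule majorizedI[where M = "\<lambda>\<xi>. c * M \<xi>"])
    show "norm (h t \<xi> * u t \<xi>) \<le> W t \<xi> * (c * M \<xi>)" for t \<xi>
      unfolding norm_mult using mult_mono[OF h(2) u(6) h(3)] by (simp add: mult.left_commute)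
  qed (use u h in \<open>auto intro: jcont_intros mult_left_mono\<close>)
qed

lemma majorized_cmult: "majorized W R S u \<Longrightarrow> majorized W (norm c * R) (norm c * S) (\<lambda>t \<xi>. c * u t \<xi>)"
  by (rule majorized_mult_bounded) (auto intro: jcont_intros)

lemma majorized_diff: "majorized W R S u \<Longrightarrow> majorized W R' S' v \<Longrightarrow> majorized W (R + R') (S + S') (\<lambda>t \<xi>. u t \<xi> - v t \<xi>)"
  using majorized_add[of W R S u R' S' "\<lambda>t \<xi>. (-1) * v t \<xi>"] majorized_cmult[of W R' S' v "-1"] by simp

lemma majorized_cnj_refl:
  assumes "majorized W R S u" "weight W" shows "majorized W R S (\<lambda>t. cnj_refl (u t))"
proof -
  obtain M where u: "jcont u" "integrable lborel M" "\<And>\<xi>. 0 \<le> M \<xi>" "\<And>\<xi>. M \<xi> \<le> S" "(LINT \<xi>|lborel. M \<xi>) \<le> R"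
    "\<And>t \<xi>. norm (u t \<xi>) \<le> W t \<xi> * M \<xi>" using assms(1) by (rule majorizedE) blast
  have "continuous_on UNIV (\<lambda>z. cnj (u (fst z) (- snd z)))"
    by (intro continuous_intros jcont_compose[OF u(1)])
  then have "jcont (\<lambda>t. cnj_refl (u t))" unfolding jcont_def cnj_refl_def by (simp add: split_beta)
  then show ?thesis
  proof (rule majorizedI[where M = "\<lambda>\<xi>. M (0 - \<xi>)"])
    show "norm (cnj_refl (u t) \<xi>) \<le> W t \<xi> * M (0 - \<xi>)" for t \<xi>
      using u(6)[of t "- \<xi>"] assms(2) by (simp add: cnj_refl_def weight_def)
  qed (use u lborel_integrable_reflect[OF u(2), of 0] lborel_integral_reflect[of M 0] in auto)
qed

text \<open>Young's inequality for the majorants: the L1 bounds multiply, and the supremum bound is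
  taken from the first factor. The weights pass through because \<open>le\<close> is a
  submultiplicativity condition.\<close>

lemma majorized_conv:
  assumes u: "majorized W1 R1 S1 u" and v: "majorized W2 R2 S2 v" and W: "weight W1" "weight W2"
    and le: "\<And>t \<xi> \<eta>. W1 t (\<xi> - \<eta>) * W2 t \<eta> \<le> W3 t \<xi>"
  shows "majorized W3 (R1 * R2) (S1 * R2) (\<lambda>t. conv (u t) (v t))"
proof -
  obtain M1 where u: "jcont u" "integrable lborel M1" "\<And>\<xi>. 0 \<le> M1 \<xi>" "\<And>\<xi>. M1 \<xi> \<le> S1" "(LINT \<xi>|lborel. M1 \<xi>) \<le> R1"
    "\<And>t \<xi>. norm (u t \<xi>) \<le> W1 t \<xi> * M1 \<xi>" using assms(1) by (rule majorizedE) blast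
  obtain M2 where v: "jcont v" "integrable lborel M2" "\<And>\<xi>. 0 \<le> M2 \<xi>" "\<And>\<xi>. M2 \<xi> \<le> S2" "(LINT \<xi>|lborel. M2 \<xi>) \<le> R2"
    "\<And>t \<xi>. norm (v t \<xi>) \<le> W2 t \<xi> * M2 \<xi>" using assms(2) by (rule majorizedE) blast
  note nn = majorized_nonneg[OF assms(1)] majorized_nonneg[OF assms(2)]
  obtain c1 c2 where c: "\<And>t \<xi>. W1 t \<xi> \<le> c1" "\<And>t \<xi>. W2 t \<xi> \<le> c2" and W0: "\<And>t \<xi>. 0 < W1 t \<xi>" "\<And>t \<xi>. 0 < W2 t \<xi>"
    using W unfolding weight_def by blast
  note C = convolution_majorant[OF u(2,3,4) v(2,3)]
  define M where "M \<xi> = (LINT \<eta>|lborel. M1 (\<xi> - \<eta>) * M2 \<eta>)" for \<xi>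
  have pt: "norm (u t (\<xi> - \<eta>) * v t \<eta>) \<le> W3 t \<xi> * (M1 (\<xi> - \<eta>) * M2 \<eta>)" for t \<xi> \<eta>
  proof -
    have "norm (u t (\<xi> - \<eta>) * v t \<eta>) \<le> (W1 t (\<xi> - \<eta>) * M1 (\<xi> - \<eta>)) * (W2 t \<eta> * M2 \<eta>)"
      unfolding norm_mult by (rule mult_mono[OF u(6) v(6) order_trans[OF norm_ge_zero u(6)] norm_ge_zero])
    also have "\<dots> = (W1 t (\<xi> - \<eta>) * W2 t \<eta>) * (M1 (\<xi> - \<eta>) * M2 \<eta>)" by (simp add: mult_ac)
    also have "\<dots> \<le> W3 t \<xi> * (M1 (\<xi> - \<eta>) * M2 \<eta>)" by (intro mult_right_mono le) (simp add: u v)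
    finally show ?thesis .
  qed
  have meas: "(\<lambda>\<eta>. u t (\<xi> - \<eta>) * v t \<eta>) \<in> borel_measurable lborel" for t \<xi>
  proof -
    have [measurable]: "u t \<in> borel_measurable borel" "v t \<in> borel_measurable borel" using u v by (auto intro: jcont_measurable)
    show ?thesis by measurable
  qed
  have b: "norm (conv (u t) (v t) \<xi>) \<le> W3 t \<xi> * M \<xi>" for t \<xi>
  proof -
    have i: "integrable lborel (\<lambda>\<eta>. W3 t \<xi> * (M1 (\<xi> - \<eta>) * M2 \<eta>))" using C(1) by simp
    have i2: "integrable lborel (\<lambda>\<eta>. u t (\<xi> - \<eta>) * v t \<eta>)"
      by (rule Bochner_Integration.integrable_bound[OF i meas]) (auto intro!: AE_I2 order_trans[OF pt])
    have "norm (conv (u t) (v t) \<xi>) \<le> 1 * norm (LINT \<eta>|lborel. u t (\<xi> - \<eta>) * v t \<eta>)"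
      unfolding conv_def norm_mult norm_of_real using inv_sqrt_2pi by (intro mult_right_mono) auto
    also have "\<dots> \<le> (LINT \<eta>|lborel. norm (u t (\<xi> - \<eta>) * v t \<eta>))" using integral_norm_bound by simp
    also have "\<dots> \<le> (LINT \<eta>|lborel. W3 t \<xi> * (M1 (\<xi> - \<eta>) * M2 \<eta>))"
      by (intro integral_mono integrable_norm i i2 pt)
    finally show ?thesis by (simp add: M_def)
  qed
  have jc: "jcont (\<lambda>t. conv (u t) (v t))"
    unfolding jcont_def continuous_on_sequentially comp_def
  proof (intro allI ballI impI)
    fix X and a :: "real \<times> real" assume "(\<forall>n. X n \<in> UNIV) \<and> X \<longlonglongrightarrow> a"
    then have Xa: "X \<longlonglongrightarrow> a" by simp
    then have X: "(\<lambda>n. fst (X n)) \<longlonglongrightarrow> fst a" "(\<lambda>n. snd (X n)) \<longlonglongrightarrow> snd a"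
      by (auto intro: tendsto_fst tendsto_snd)
    have lim: "(\<lambda>n. g (fst (X n)) (snd (X n) - k)) \<longlonglongrightarrow> g (fst a) (snd a - k)"
      "(\<lambda>n. g (fst (X n)) k) \<longlonglongrightarrow> g (fst a) k" if g: "jcont g" for g :: "real \<Rightarrow> real \<Rightarrow> complex" and k
    proof -
      have c: "continuous_on UNIV (\<lambda>z. g (fst z) (snd z - k))" "continuous_on UNIV (\<lambda>z. g (fst z) k)"
        by (intro continuous_intros jcont_compose[OF g])+
      show "(\<lambda>n. g (fst (X n)) (snd (X n) - k)) \<longlonglongrightarrow> g (fst a) (snd a - k)" "(\<lambda>n. g (fst (X n)) k) \<longlonglongrightarrow> g (fst a) k"
        using continuous_on_tendsto_compose[OF c(1) Xa] continuous_on_tendsto_compose[OF c(2) Xa] by simp_all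
    qed
    have "(\<lambda>n. LINT \<eta>|lborel. u (fst (X n)) (snd (X n) - \<eta>) * v (fst (X n)) \<eta>) \<longlonglongrightarrow> (LINT \<eta>|lborel. u (fst a) (snd a - \<eta>) * v (fst a) \<eta>)"
    proof (rule integral_dominated_convergence[where w = "\<lambda>\<eta>. (c1 * S1) * (c2 * M2 \<eta>)"])
      show "integrable lborel (\<lambda>\<eta>. (c1 * S1) * (c2 * M2 \<eta>))" using v(2) by simp
      show "AE \<eta> in lborel. (\<lambda>n. u (fst (X n)) (snd (X n) - \<eta>) * v (fst (X n)) \<eta>) \<longlonglongrightarrow> u (fst a) (snd a - \<eta>) * v (fst a) \<eta>"
        by (intro AE_I2 tendsto_mult lim u(1) v(1))
      show "AE \<eta> in lborel. norm (u (fst (X n)) (snd (X n) - \<eta>) * v (fst (X n)) \<eta>) \<le> (c1 * S1) * (c2 * M2 \<eta>)" for n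
      proof (rule AE_I2)
        fix \<eta>
        have nu: "norm (u t \<zeta>) \<le> c1 * S1" for t \<zeta>
          by (rule order_trans[OF u(6) mult_mono[OF c(1) u(4)]]) (use c(1)[of t \<zeta>] W0(1)[of t \<zeta>] u(3) in auto)
        have nv: "norm (v t \<zeta>) \<le> c2 * M2 \<zeta>" for t \<zeta>
          by (rule order_trans[OF v(6) mult_right_mono[OF c(2) v(3)]])
        show "norm (u (fst (X n)) (snd (X n) - \<eta>) * v (fst (X n)) \<eta>) \<le> (c1 * S1) * (c2 * M2 \<eta>)"
          unfolding norm_mult by (rule mult_mono[OF nu nv order_trans[OF norm_ge_zero nu] norm_ge_zero])
      qed
    qed (rule meas)+
    then show "(\<lambda>n. case X n of (t, x) \<Rightarrow> conv (u t) (v t) x) \<longlonglongrightarrow> (case a of (t, x) \<Rightarrow> conv (u t) (v t) x)"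
      unfolding conv_def split_beta by (intro tendsto_mult tendsto_const)
  qed
  show ?thesis
  proof (rule majorizedI[OF jc, where M = M])
    show "integrable lborel M" "\<And>\<xi>. 0 \<le> M \<xi>" using C(2,4) by (auto simp: M_def[abs_def])
    show "M \<xi> \<le> S1 * R2" for \<xi>
      using C(5)[of \<xi>] mult_left_mono[OF v(5) nn(2)] by (simp add: M_def)
    have "0 \<le> (LINT \<xi>|lborel. M1 \<xi>)" "0 \<le> (LINT \<xi>|lborel. M2 \<xi>)" by (rule integral_nonneg_AE, simp add: u v)+
    then show "(LINT \<xi>|lborel. M \<xi>) \<le> R1 * R2"
      using C(3) u(5) v(5) nn by (auto simp: M_def[abs_def] intro: mult_mono)
  qed (rule b)
qed

text \<open>Commuted form, with the supremum bound taken from the second factor.\<close>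

lemma majorized_conv':
  assumes "majorized W1 R1 S1 u" "majorized W2 R2 S2 v" "weight W1" "weight W2"
    "\<And>t \<xi> \<eta>. W1 t (\<xi> - \<eta>) * W2 t \<eta> \<le> W3 t \<xi>"
  shows "majorized W3 (R1 * R2) (R1 * S2) (\<lambda>t. conv (u t) (v t))"
proof -
  have "W2 t (\<xi> - \<eta>) * W1 t \<eta> \<le> W3 t \<xi>" for t \<xi> \<eta>
    using assms(5)[of t \<xi> "\<xi> - \<eta>"] by (simp add: mult.commute)
  from majorized_conv[OF assms(2,1,4,3) this] show ?thesis
    by (simp add: conv_commute[of "v _"] mult.commute)
qed

subsection \<open>Duhamel integrals\<close>

text \<open>Freezing time outside [0,T] turns all functions into functions on the whole plane, where
  the bounded continuous ones form a Banach space.\<close>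

definition tclamp :: "real \<Rightarrow> real \<Rightarrow> real" where "tclamp T t = max 0 (min T t)"

lemma tclamp_simps: "0 \<le> tclamp T t" "0 \<le> T \<Longrightarrow> tclamp T t \<le> T" "t \<in> {0..T} \<Longrightarrow> tclamp T t = t"
    "0 \<le> T \<Longrightarrow> tclamp T (tclamp T t) = tclamp T t"
  by (auto simp: tclamp_def)

lemma continuous_on_tclamp: "continuous_on A f \<Longrightarrow> continuous_on A (\<lambda>x. tclamp T (f x))"
  unfolding tclamp_def by (intro continuous_intros)

text \<open>On the transform side, the solution \<open>v\<close> of
  \<open>v_t + i \<mu> v = u\<close> with \<open>v = 0\<close> at time 0, frozen outside
  [0,T].\<close>

definition duhamel :: "real \<Rightarrow> (real \<Rightarrow> real) \<Rightarrow> (real \<Rightarrow> real \<Rightarrow> complex) \<Rightarrow> real \<Rightarrow> real \<Rightarrow> complex" where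
  "duhamel T \<mu> u t \<xi> = cis (- (\<mu> \<xi> * tclamp T t)) * integral {0..tclamp T t} (\<lambda>s. cis (\<mu> \<xi> * s) * u s \<xi>)"

lemma jcont_integral:
  fixes h :: "real \<Rightarrow> real \<Rightarrow> complex"
  assumes h: "jcont h"
  shows "jcont (\<lambda>t \<xi>. integral {0..tclamp T t} (\<lambda>s. h s \<xi>))"
proof -
  \<comment> \<open>Rescaling to the unit interval moves the variable upper limit into the
    integrand, where continuity in parameters applies.\<close>
  have eq: "integral {0..m} (\<lambda>s. h s \<xi>) = m *\<^sub>R integral (cbox 0 1) (\<lambda>\<sigma>. h (m * \<sigma>) \<xi>)" if "m \<ge> 0" for m \<xi>
  proof (cases "m = 0")
    case False
    with that have m: "m > 0" by simp
    have "(\<lambda>x. x / m) ` {0..m} = {0..1}" using m image_divide_atLeastAtMost[of m 0 m] by (auto simp: mult.commute)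
    then show ?thesis using integral_stretch_real[of m 0 m "\<lambda>s. h s \<xi>"] m by simp
  qed simp
  have "continuous_on (UNIV \<times> cbox 0 1) (\<lambda>(z, \<sigma>). h (tclamp T (fst z) * \<sigma>) (snd z))"
    unfolding split_beta by (intro jcont_compose[OF h] continuous_intros continuous_on_tclamp)
  from integral_continuous_on_param[OF this]
  have "continuous_on UNIV (\<lambda>z. tclamp T (fst z) *\<^sub>R integral (cbox 0 1) (\<lambda>\<sigma>. h (tclamp T (fst z) * \<sigma>) (snd z)))"
    by (intro continuous_intros continuous_on_tclamp)
  then show ?thesis unfolding jcont_def split_beta using eq[OF tclamp_simps(1)] by simp
qed

lemma jcont_duhamel:
  assumes u: "jcont u" and \<mu>: "continuous_on UNIV \<mu>"
  shows "jcont (duhamel T \<mu> u)"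
proof -
  have c: "continuous_on UNIV (\<lambda>z::real\<times>real. \<mu> (snd z))"
    by (rule continuous_on_compose2[OF \<mu>]) (auto intro: continuous_intros)
  have "jcont (\<lambda>s \<xi>. cis (\<mu> \<xi> * s) * u s \<xi>)" unfolding jcont_def split_beta
    by (intro continuous_intros c jcont_compose[OF u])
  from jcont_integral[OF this, of T] show ?thesis
    unfolding duhamel_def jcont_def split_beta
    by (intro continuous_intros c continuous_on_tclamp)
qed

lemma duhamel_diff:
  assumes "jcont u" "jcont v"
  shows "duhamel T \<mu> (\<lambda>t \<xi>. u t \<xi> - v t \<xi>) t \<xi> = duhamel T \<mu> u t \<xi> - duhamel T \<mu> v t \<xi>"
proof -
  have i: "(\<lambda>s. cis (\<mu> \<xi> * s) * w s \<xi>) integrable_on {0..tclamp T t}" if "jcont w" for w :: "real \<Rightarrow> real \<Rightarrow> complex"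
    by (intro integrable_continuous_real continuous_intros jcont_slice(2)[OF that])
  show ?thesis unfolding duhamel_def
    by (simp add: right_diff_distrib integral_diff[OF i[OF assms(1)] i[OF assms(2)]])
qed

text \<open>\<open>gain\<close> compares the time integral of the weight, multiplied by the symbol
  \<open>\<kappa>\<close>, with the weight itself. For \<open>\<kappa> \<xi> = \<xi>\<close> it says
  that integration in time pays for one x-derivative.\<close>

lemma majorized_duhamel:
  assumes u: "majorized W R S u" and \<mu>: "continuous_on UNIV \<mu>" and \<kappa>: "continuous_on UNIV \<kappa>" and W: "weight W" and \<gamma>: "0 \<le> \<gamma>"
    and gain: "\<And>t \<xi>. \<bar>\<kappa> \<xi>\<bar> * integral {0..tclamp T t} (\<lambda>s. W s \<xi>) \<le> \<gamma> * W t \<xi>"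
  shows "majorized W (\<gamma> * R) (\<gamma> * S) (\<lambda>t \<xi>. of_real (\<kappa> \<xi>) * duhamel T \<mu> u t \<xi>)"
proof -
  obtain M where u: "jcont u" "integrable lborel M" "\<And>\<xi>. 0 \<le> M \<xi>" "\<And>\<xi>. M \<xi> \<le> S" "(LINT \<xi>|lborel. M \<xi>) \<le> R"
    "\<And>t \<xi>. norm (u t \<xi>) \<le> W t \<xi> * M \<xi>" using assms(1) by (rule majorizedE) blast
  have jW: "jcont W" using W by (simp add: weight_def)
  have c: "continuous_on UNIV (\<lambda>z::real\<times>real. \<kappa> (snd z))"
    by (rule continuous_on_compose2[OF \<kappa>]) (auto intro: continuous_intros)
  have "jcont (\<lambda>t \<xi>. of_real (\<kappa> \<xi>) * duhamel T \<mu> u t \<xi>)"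
    using jcont_duhamel[OF u(1) \<mu>, of T] unfolding jcont_def split_beta by (intro continuous_intros c)
  then show ?thesis
  proof (rule majorizedI[where M = "\<lambda>\<xi>. \<gamma> * M \<xi>"])
    fix t \<xi>
    have "norm (duhamel T \<mu> u t \<xi>) = norm (integral {0..tclamp T t} (\<lambda>s. cis (\<mu> \<xi> * s) * u s \<xi>))"
      by (simp add: duhamel_def norm_mult)
    also have "\<dots> \<le> integral {0..tclamp T t} (\<lambda>s. W s \<xi> * M \<xi>)"
    proof (rule integral_norm_bound_integral)
      show "(\<lambda>s. cis (\<mu> \<xi> * s) * u s \<xi>) integrable_on {0..tclamp T t}"
        by (intro integrable_continuous_real continuous_intros jcont_slice(2)[OF u(1)])
      show "(\<lambda>s. W s \<xi> * M \<xi>) integrable_on {0..tclamp T t}"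
        by (intro integrable_continuous_real continuous_intros jcont_slice(2)[OF jW])
    qed (simp add: norm_mult u(6))
    also have "\<dots> = integral {0..tclamp T t} (\<lambda>s. W s \<xi>) * M \<xi>" by simp
    finally have "\<bar>\<kappa> \<xi>\<bar> * norm (duhamel T \<mu> u t \<xi>) \<le> \<bar>\<kappa> \<xi>\<bar> * (integral {0..tclamp T t} (\<lambda>s. W s \<xi>) * M \<xi>)"
      by (rule mult_left_mono) simp
    also have "\<dots> = (\<bar>\<kappa> \<xi>\<bar> * integral {0..tclamp T t} (\<lambda>s. W s \<xi>)) * M \<xi>" by simp
    also have "\<dots> \<le> (\<gamma> * W t \<xi>) * M \<xi>" by (intro mult_right_mono gain u(3))
    finally show "norm (of_real (\<kappa> \<xi>) * duhamel T \<mu> u t \<xi>) \<le> W t \<xi> * (\<gamma> * M \<xi>)" by (simp add: norm_mult mult_ac)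
  qed (use u \<gamma> in \<open>auto intro: mult_left_mono\<close>)
qed

subsection \<open>The contraction argument\<close>

text \<open>Banach's theorem for the weighted supremum distance: division by \<open>W\<close> embeds
  the class into the bounded continuous functions on the plane. The class is closed although
  convergence in this distance does not control L1 norms, because the lower limit of the majorants
  along a convergent sequence majorizes the limit and Fatou's lemma bounds its integral.\<close>

lemma majorized_fixpoint:
  assumes W: "weight W" and RS: "0 \<le> R" "0 \<le> S"
    and \<Psi>: "\<And>u. majorized W R S u \<Longrightarrow> majorized W R S (\<Psi> u)"
    and contr: "\<And>u v D t \<xi>. majorized W R S u \<Longrightarrow> majorized W R S v \<Longrightarrow> 0 \<le> D \<Longrightarrow> (\<And>t \<xi>. norm (u t \<xi> - v t \<xi>) \<le> D * W t \<xi>) \<Longrightarrow>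
       norm (\<Psi> u t \<xi> - \<Psi> v t \<xi>) \<le> D / 2 * W t \<xi>"
  obtains u where "majorized W R S u" "\<And>t \<xi>. u t \<xi> = \<Psi> u t \<xi>"
proof -
  have jW: "jcont W" and W0: "\<And>t \<xi>. 0 < W t \<xi>" using W by (auto simp: weight_def)
  define E where "E U t \<xi> = of_real (W t \<xi>) * apply_bcontfun U (t, \<xi>)" for U :: "(real \<times> real) \<Rightarrow>\<^sub>C complex" and t \<xi>
  define X where "X = {U. majorized W R S (E U)}"
  define f where "f U = Bcontfun (\<lambda>z. \<Psi> (E U) (fst z) (snd z) / of_real (W (fst z) (snd z)))" for U
  have bc: "(\<lambda>z. u (fst z) (snd z) / of_real (W (fst z) (snd z))) \<in> bcontfun" if du: "majorized W R S u" for u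
  proof -
    obtain M where u: "jcont u" "integrable lborel M" "\<And>\<xi>. 0 \<le> M \<xi>" "\<And>\<xi>. M \<xi> \<le> S" "(LINT \<xi>|lborel. M \<xi>) \<le> R"
      "\<And>t \<xi>. norm (u t \<xi>) \<le> W t \<xi> * M \<xi>" using du by (rule majorizedE) blast
    show ?thesis
    proof (rule bcontfun_normI)
      show "continuous_on UNIV (\<lambda>z. u (fst z) (snd z) / of_real (W (fst z) (snd z)))"
        using W0 by (intro continuous_intros jcont_compose[OF u(1)] jcont_compose[OF jW]) (simp add: less_imp_neq[THEN not_sym])
      fix z
      have "norm (u (fst z) (snd z)) \<le> W (fst z) (snd z) * S"
        by (rule order_trans[OF u(6) mult_left_mono[OF u(4)]]) (simp add: W0 less_imp_le)
      then show "norm (u (fst z) (snd z) / of_real (W (fst z) (snd z))) \<le> S"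
        using W0[of "fst z" "snd z"] by (simp add: norm_divide pos_divide_le_eq mult.commute)
    qed
  qed
  have Ef: "E (f U) t \<xi> = \<Psi> (E U) t \<xi>" if "U \<in> X" for U t \<xi>
    unfolding E_def[of "f U"] using bc[OF \<Psi>, of "E U"] that W0[of t \<xi>] by (simp add: f_def Bcontfun_inverse X_def)
  have fX: "f ` X \<subseteq> X"
  proof
    fix V assume "V \<in> f ` X"
    then obtain U where U: "U \<in> X" "V = f U" by auto
    then have "E V = \<Psi> (E U)" using Ef by (auto simp: fun_eq_iff)
    then show "V \<in> X" using \<Psi>[of "E U"] U by (simp add: X_def)
  qed
  have "majorized W R S (E 0)"
    by (rule majorizedI[where M = "\<lambda>_. 0"]) (use RS in \<open>auto simp: E_def[abs_def] intro: jcont_intros\<close>)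
  then have ne: "X \<noteq> {}" by (auto simp: X_def)
  have "closed X"
  proof (unfold closed_sequential_limits, intro allI impI, elim conjE)
    fix U l assume U: "\<forall>n. U n \<in> X" and l: "U \<longlonglongrightarrow> l"
    then have "\<forall>n. \<exists>M. integrable lborel M \<and> (\<forall>\<xi>. 0 \<le> M \<xi>) \<and> (\<forall>\<xi>. M \<xi> \<le> S) \<and>
       (LINT \<xi>|lborel. M \<xi>) \<le> R \<and> (\<forall>t \<xi>. norm (E (U n) t \<xi>) \<le> W t \<xi> * M \<xi>)"
      unfolding X_def majorized_def by blast
    then obtain M where M: "\<And>n. integrable lborel (M n)" "\<And>n \<xi>. 0 \<le> M n \<xi>" "\<And>n \<xi>. M n \<xi> \<le> S"
      "\<And>n. (LINT \<xi>|lborel. M n \<xi>) \<le> R" "\<And>n t \<xi>. norm (E (U n) t \<xi>) \<le> W t \<xi> * M n \<xi>"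
      by metis
    have [measurable]: "M n \<in> borel_measurable borel" for n using M(1)[of n] by auto
    define N where "N \<xi> = liminf (\<lambda>n. ennreal (M n \<xi>))" for \<xi>
    have [measurable]: "N \<in> borel_measurable borel" unfolding N_def[abs_def] by measurable
    have NS: "N \<xi> \<le> ennreal S" for \<xi>
      unfolding N_def using M(3) by (intro Liminf_le always_eventually allI ennreal_leI) auto
    then have Nf: "N \<xi> < \<top>" for \<xi> by (rule le_less_trans) simp
    have "(\<integral>\<^sup>+ \<xi>. N \<xi> \<partial>lborel) \<le> liminf (\<lambda>n. \<integral>\<^sup>+ \<xi>. ennreal (M n \<xi>) \<partial>lborel)"
      unfolding N_def by (rule nn_integral_liminf) measurable
    also have "\<dots> \<le> ennreal R"
      using M by (intro Liminf_le always_eventually allI) (auto simp: nn_integral_eq_integral intro!: ennreal_leI)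
    finally have NR: "(\<integral>\<^sup>+ \<xi>. N \<xi> \<partial>lborel) \<le> ennreal R" .
    have Ne: "(\<integral>\<^sup>+ \<xi>. ennreal (enn2real (N \<xi>)) \<partial>lborel) = (\<integral>\<^sup>+ \<xi>. N \<xi> \<partial>lborel)"
      using Nf by (intro nn_integral_cong) simp
    have Ni: "integrable lborel (\<lambda>\<xi>. enn2real (N \<xi>))"
    proof (rule integrableI_bounded)
      have "(\<integral>\<^sup>+ \<xi>. ennreal (enn2real (N \<xi>)) \<partial>lborel) < \<infinity>" unfolding Ne using NR by (rule le_less_trans) simp
      then show "(\<integral>\<^sup>+ \<xi>. ennreal (norm (enn2real (N \<xi>))) \<partial>lborel) < \<infinity>" by simp
    qed measurable
    have "majorized W R S (E l)"
    proof (rule majorizedI[where M = "\<lambda>\<xi>. enn2real (N \<xi>)"])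
      show "jcont (E l)" unfolding jcont_def E_def split_beta
        by (intro continuous_intros jcont_compose[OF jW]) auto
      show "enn2real (N \<xi>) \<le> S" for \<xi> using enn2real_mono[OF NS, of \<xi>] RS by simp
      have "ennreal (LINT \<xi>|lborel. enn2real (N \<xi>)) \<le> ennreal R"
        using NR unfolding Ne[symmetric] by (subst (asm) nn_integral_eq_integral[OF Ni]) auto
      then show "(LINT \<xi>|lborel. enn2real (N \<xi>)) \<le> R" using RS by (simp add: ennreal_le_iff)
      fix t \<xi>
      have "(\<lambda>n. apply_bcontfun (U n) (t, \<xi>)) \<longlonglongrightarrow> apply_bcontfun l (t, \<xi>)"
        using tendsto_bcontfun_uniform_limit[OF l] by (rule tendsto_uniform_limitI) simp
      then have lim: "(\<lambda>n. ennreal (norm (apply_bcontfun (U n) (t, \<xi>)))) \<longlonglongrightarrow> ennreal (norm (apply_bcontfun l (t, \<xi>)))"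
        by (intro tendsto_intros)
      have "norm (apply_bcontfun (U n) (t, \<xi>)) \<le> M n \<xi>" for n
        using M(5)[of n t \<xi>] W0[of t \<xi>] by (simp add: E_def norm_mult)
      then have "ennreal (norm (apply_bcontfun l (t, \<xi>))) \<le> N \<xi>"
        unfolding N_def lim_imp_Liminf[OF trivial_limit_sequentially lim, symmetric]
        by (intro Liminf_mono always_eventually allI ennreal_leI)
      then have "norm (apply_bcontfun l (t, \<xi>)) \<le> enn2real (N \<xi>)"
        using enn2real_mono[of _ "N \<xi>"] Nf[of \<xi>] by fastforce
      then show "norm (E l t \<xi>) \<le> W t \<xi> * enn2real (N \<xi>)" using W0[of t \<xi>] by (simp add: E_def norm_mult)
    qed (use Ni in simp_all)
    then show "l \<in> X" by (simp add: X_def)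
  qed
  note cX = iffD2[OF complete_eq_closed this]
  have "dist (f U) (f V) \<le> 1 / 2 * dist U V" if UV: "U \<in> X" "V \<in> X" for U V
  proof (rule dist_bound)
    fix z :: "real \<times> real"
    obtain t \<xi> where z: "z = (t, \<xi>)" by fastforce
    have "norm (E U t \<xi> - E V t \<xi>) \<le> dist U V * W t \<xi>" for t \<xi>
    proof -
      have "norm (E U t \<xi> - E V t \<xi>) = W t \<xi> * dist (apply_bcontfun U (t, \<xi>)) (apply_bcontfun V (t, \<xi>))"
        using W0[of t \<xi>] by (simp add: E_def dist_norm right_diff_distrib[symmetric] norm_mult)
      also have "\<dots> \<le> W t \<xi> * dist U V" by (intro mult_left_mono dist_bounded) (simp add: W0 less_imp_le)
      finally show ?thesis by (simp add: mult.commute)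
    qed
    then have "norm (\<Psi> (E U) t \<xi> - \<Psi> (E V) t \<xi>) \<le> dist U V / 2 * W t \<xi>"
      using UV by (intro contr) (auto simp: X_def)
    then have "norm (E (f U) t \<xi> - E (f V) t \<xi>) \<le> dist U V / 2 * W t \<xi>" using UV by (simp add: Ef)
    moreover have "norm (E (f U) t \<xi> - E (f V) t \<xi>) = W t \<xi> * dist (apply_bcontfun (f U) z) (apply_bcontfun (f V) z)"
      using W0[of t \<xi>] by (simp add: E_def dist_norm right_diff_distrib[symmetric] norm_mult z)
    ultimately show "dist (apply_bcontfun (f U) z) (apply_bcontfun (f V) z) \<le> 1 / 2 * dist U V"
      using W0[of t \<xi>] by (simp add: mult.commute)
  qed
  then obtain U where U: "U \<in> X" "f U = U"
    using Banach_fix[OF cX ne, of "1 / 2" f] fX by auto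
  show thesis
  proof (rule that[of "E U"])
    show "majorized W R S (E U)" using U by (simp add: X_def)
    show "E U t \<xi> = \<Psi> (E U) t \<xi>" for t \<xi> using Ef[OF U(1), of t \<xi>] U(2) by simp
  qed
qed

lemma majorized_slice:
  assumes u: "majorized W R S u" and W: "weight W"
  shows "integrable lborel (u t)" "\<exists>c. \<forall>\<xi>. norm (u t \<xi>) \<le> c"
proof -
  obtain M where M: "jcont u" "integrable lborel M" "\<And>\<xi>. 0 \<le> M \<xi>" "\<And>\<xi>. M \<xi> \<le> S" "(LINT \<xi>|lborel. M \<xi>) \<le> R"
    "\<And>t \<xi>. norm (u t \<xi>) \<le> W t \<xi> * M \<xi>" using u by (rule majorizedE) blast
  obtain c where c: "\<forall>t \<xi>. W t \<xi> \<le> c" "\<forall>t \<xi>. 0 < W t \<xi>" using W unfolding weight_def by blast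
  have b: "norm (u t \<xi>) \<le> c * M \<xi>" for \<xi>
    by (rule order_trans[OF M(6) mult_right_mono[OF c(1)[rule_format] M(3)]])
  have i: "integrable lborel (\<lambda>\<xi>. c * M \<xi>)" using M(2) by simp
  show "integrable lborel (u t)"
    by (rule Bochner_Integration.integrable_bound[OF i])
       (use b jcont_measurable[OF M(1)] in \<open>auto intro!: AE_I2 order_trans[OF b]\<close>)
  have c0: "0 \<le> c" using c(1)[rule_format, of 0 0] c(2)[rule_format, of 0 0] by linarith
  have "norm (u t \<xi>) \<le> c * S" for \<xi>
    by (rule order_trans[OF b mult_left_mono[OF M(4) c0]])
  then show "\<exists>c. \<forall>\<xi>. norm (u t \<xi>) \<le> c" by blast
qed

lemma conv_integrable:
  fixes u v :: "real \<Rightarrow> complex"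
  assumes "integrable lborel u" "\<forall>\<xi>. norm (u \<xi>) \<le> c" "integrable lborel v"
  shows "integrable lborel (\<lambda>\<eta>. u (\<xi> - \<eta>) * v \<eta>)"
proof -
  have [measurable]: "u \<in> borel_measurable borel" "v \<in> borel_measurable borel" using assms by auto
  have "integrable lborel (\<lambda>\<eta>. c * norm (v \<eta>))" using integrable_norm[OF assms(3)] by simp
  then show ?thesis
  proof (rule Bochner_Integration.integrable_bound)
    show "AE \<eta> in lborel. norm (u (\<xi> - \<eta>) * v \<eta>) \<le> norm (c * norm (v \<eta>))"
    proof (rule AE_I2)
      fix \<eta>
      have "norm (u (\<xi> - \<eta>) * v \<eta>) \<le> c * norm (v \<eta>)"
        unfolding norm_mult using assms(2) by (intro mult_right_mono) auto
      then show "norm (u (\<xi> - \<eta>) * v \<eta>) \<le> norm (c * norm (v \<eta>))" by simp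
    qed
  qed measurable
qed

lemma conv_diff_left:
  assumes "majorized W R S u" "majorized W R' S' u'" "majorized W2 R2 S2 v" "weight W" "weight W2"
  shows "conv (\<lambda>\<xi>. u t \<xi> - u' t \<xi>) (v t) \<xi> = conv (u t) (v t) \<xi> - conv (u' t) (v t) \<xi>"
proof -
  obtain c c' where c: "\<forall>\<xi>. norm (u t \<xi>) \<le> c" "\<forall>\<xi>. norm (u' t \<xi>) \<le> c'"
    using majorized_slice(2)[OF assms(1,4)] majorized_slice(2)[OF assms(2,4)] by blast
  show ?thesis unfolding conv_def left_diff_distrib right_diff_distrib[symmetric]
    using conv_integrable[OF majorized_slice(1)[OF assms(1,4)] c(1) majorized_slice(1)[OF assms(3,5)]]
      conv_integrable[OF majorized_slice(1)[OF assms(2,4)] c(2) majorized_slice(1)[OF assms(3,5)]]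
    by simp
qed

lemma conv_diff_right:
  assumes "majorized W R S u" "majorized W R' S' u'" "majorized W2 R2 S2 v" "weight W" "weight W2"
  shows "conv (v t) (\<lambda>\<xi>. u t \<xi> - u' t \<xi>) \<xi> = conv (v t) (u t) \<xi> - conv (v t) (u' t) \<xi>"
  using conv_diff_left[OF assms] by (simp only: conv_commute[of "v t"])

subsection \<open>Exponential weights of shrinking width\<close>

text \<open>\<open>\<rho> - \<delta> * t\<close> is the analyticity radius, shrinking at speed
  \<open>\<delta>\<close>; \<open>\<Lambda>\<close> adds exponential growth in time, as in
  Bielecki's norm for linear equations.\<close>

definition wgt :: "real \<Rightarrow> real \<Rightarrow> real \<Rightarrow> real \<Rightarrow> real \<Rightarrow> real \<Rightarrow> real" where
  "wgt \<rho> \<delta> \<Lambda> T t \<xi> = exp (\<Lambda> * tclamp T t - (\<rho> - \<delta> * tclamp T t) * \<bar>\<xi>\<bar>)"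

lemma wgt_weight:
  assumes "0 \<le> T" "0 \<le> \<delta>" "\<delta> * T \<le> \<rho>" "0 \<le> \<Lambda>"
  shows "weight (wgt \<rho> \<delta> \<Lambda> T)"
proof -
  have "jcont (wgt \<rho> \<delta> \<Lambda> T)" unfolding jcont_def wgt_def split_beta
    by (intro continuous_intros continuous_on_tclamp)
  moreover have "wgt \<rho> \<delta> \<Lambda> T t \<xi> \<le> exp (\<Lambda> * T)" for t \<xi>
  proof -
    have "\<delta> * tclamp T t \<le> \<delta> * T" using assms tclamp_simps(2) by (intro mult_left_mono) auto
    then have "0 \<le> (\<rho> - \<delta> * tclamp T t) * \<bar>\<xi>\<bar>" using assms by (intro mult_nonneg_nonneg) auto
    moreover have "\<Lambda> * tclamp T t \<le> \<Lambda> * T" using assms tclamp_simps(2) by (intro mult_left_mono) auto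
    ultimately show ?thesis by (simp add: wgt_def)
  qed
  moreover have "0 < wgt \<rho> \<delta> \<Lambda> T t \<xi>" "wgt \<rho> \<delta> \<Lambda> T t (- \<xi>) = wgt \<rho> \<delta> \<Lambda> T t \<xi>" for t \<xi>
    by (simp_all add: wgt_def)
  ultimately show ?thesis unfolding weight_def by blast
qed

text \<open>Triangle inequality for \<open>|\<xi>|\<close>. Only one factor carries the growth
  \<open>\<Lambda>\<close>, since growth in both would add up.\<close>

lemma wgt_mult_le:
  assumes "0 \<le> T" "0 \<le> \<delta>" "\<delta> * T \<le> \<rho>"
  shows "wgt \<rho> \<delta> 0 T t (\<xi> - \<eta>) * wgt \<rho> \<delta> \<Lambda> T t \<eta> \<le> wgt \<rho> \<delta> \<Lambda> T t \<xi>"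
proof -
  have "\<delta> * tclamp T t \<le> \<delta> * T" using assms tclamp_simps(2) by (intro mult_left_mono) auto
  then have "(\<rho> - \<delta> * tclamp T t) * \<bar>\<xi>\<bar> \<le> (\<rho> - \<delta> * tclamp T t) * (\<bar>\<xi> - \<eta>\<bar> + \<bar>\<eta>\<bar>)"
    using assms by (intro mult_left_mono) auto
  then show ?thesis by (simp add: wgt_def exp_add[symmetric] distrib_left)
qed

text \<open>On [0,T] the time derivative of the weight is
  \<open>\<Lambda> + \<delta> * |\<xi>|\<close> times the weight, so the left side is a difference
  of two of its values. With \<open>\<Lambda> = 0\<close> this gains a derivative at the price
  \<open>1 / \<delta>\<close>; with \<open>\<delta> = 0\<close> it gains the factor
  \<open>1 / \<Lambda>\<close>.\<close>

lemma wgt_integral: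
  assumes "0 \<le> T"
  shows "(\<Lambda> + \<delta> * \<bar>\<xi>\<bar>) * integral {0..tclamp T t} (\<lambda>s. wgt \<rho> \<delta> \<Lambda> T s \<xi>) \<le> wgt \<rho> \<delta> \<Lambda> T t \<xi>"
proof -
  let ?G = "\<lambda>s. exp (\<Lambda> * s - (\<rho> - \<delta> * s) * \<bar>\<xi>\<bar>)"
  have "((\<lambda>s. (\<Lambda> + \<delta> * \<bar>\<xi>\<bar>) * ?G s) has_integral ?G (tclamp T t) - ?G 0) {0..tclamp T t}"
  proof (rule fundamental_theorem_of_calculus)
    show "(?G has_vector_derivative (\<Lambda> + \<delta> * \<bar>\<xi>\<bar>) * ?G s) (at s within {0..tclamp T t})" for s
      unfolding has_real_derivative_iff_has_vector_derivative[symmetric]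
      by (auto intro!: derivative_eq_intros simp: algebra_simps)
  qed (simp add: tclamp_simps)
  moreover have "integral {0..tclamp T t} (\<lambda>s. (\<Lambda> + \<delta> * \<bar>\<xi>\<bar>) * ?G s) = integral {0..tclamp T t} (\<lambda>s. (\<Lambda> + \<delta> * \<bar>\<xi>\<bar>) * wgt \<rho> \<delta> \<Lambda> T s \<xi>)"
  proof (rule Henstock_Kurzweil_Integration.integral_cong)
    fix s assume "s \<in> {0..tclamp T t}"
    then have "tclamp T s = s" using tclamp_simps(2)[OF assms, of t] by (intro tclamp_simps(3)) auto
    then show "(\<Lambda> + \<delta> * \<bar>\<xi>\<bar>) * ?G s = (\<Lambda> + \<delta> * \<bar>\<xi>\<bar>) * wgt \<rho> \<delta> \<Lambda> T s \<xi>" by (simp add: wgt_def)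
  qed
  ultimately have "integral {0..tclamp T t} (\<lambda>s. (\<Lambda> + \<delta> * \<bar>\<xi>\<bar>) * wgt \<rho> \<delta> \<Lambda> T s \<xi>) = ?G (tclamp T t) - ?G 0"
    by (simp only: integral_unique)
  then have "(\<Lambda> + \<delta> * \<bar>\<xi>\<bar>) * integral {0..tclamp T t} (\<lambda>s. wgt \<rho> \<delta> \<Lambda> T s \<xi>) = ?G (tclamp T t) - ?G 0"
    by (simp only: integral_mult_right)
  then show ?thesis by (simp add: wgt_def)
qed

text \<open>The weight is nondecreasing in time, so its integral is at most the length of the
  interval times the final value.\<close>

lemma wgt_integral':
  assumes "0 \<le> T" "0 \<le> \<delta>" "0 \<le> \<Lambda>"
  shows "integral {0..tclamp T t} (\<lambda>s. wgt \<rho> \<delta> \<Lambda> T s \<xi>) \<le> T * wgt \<rho> \<delta> \<Lambda> T t \<xi>"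
proof -
  have jc: "jcont (wgt \<rho> \<delta> \<Lambda> T)" unfolding jcont_def wgt_def split_beta
    by (intro continuous_intros continuous_on_tclamp)
  have "integral {0..tclamp T t} (\<lambda>s. wgt \<rho> \<delta> \<Lambda> T s \<xi>) \<le> integral {0..tclamp T t} (\<lambda>s. wgt \<rho> \<delta> \<Lambda> T t \<xi>)"
  proof (rule integral_le)
    show "(\<lambda>s. wgt \<rho> \<delta> \<Lambda> T s \<xi>) integrable_on {0..tclamp T t}"
      by (intro integrable_continuous_real jcont_slice(2)[OF jc])
    fix s assume s: "s \<in> {0..tclamp T t}"
    then have "tclamp T s = s" using tclamp_simps(2)[OF assms(1), of t] by (intro tclamp_simps(3)) auto
    then have "tclamp T s \<le> tclamp T t" using s by simp
    then have "\<Lambda> * tclamp T s \<le> \<Lambda> * tclamp T t" "\<delta> * tclamp T s * \<bar>\<xi>\<bar> \<le> \<delta> * tclamp T t * \<bar>\<xi>\<bar>"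
      using assms by (auto intro!: mult_left_mono mult_right_mono)
    then show "wgt \<rho> \<delta> \<Lambda> T s \<xi> \<le> wgt \<rho> \<delta> \<Lambda> T t \<xi>" by (simp add: wgt_def left_diff_distrib)
  qed (simp add: integrable_const_ivl)
  also have "\<dots> = tclamp T t * wgt \<rho> \<delta> \<Lambda> T t \<xi>" by (simp add: tclamp_simps)
  also have "\<dots> \<le> T * wgt \<rho> \<delta> \<Lambda> T t \<xi>" using tclamp_simps(2)[OF assms(1)] by (intro mult_right_mono) (auto simp: wgt_def)
  finally show ?thesis .
qed

subsection \<open>The system in Fourier variables\<close>

text \<open>Transform of \<open>|B|^2\<close> when \<open>u t\<close> is the transform of
  \<open>B t\<close>.\<close>

definition intensity :: "(real \<Rightarrow> real \<Rightarrow> complex) \<Rightarrow> real \<Rightarrow> real \<Rightarrow> complex" where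
  "intensity u t = conv (u t) (cnj_refl (u t))"

text \<open>Transform of the mild solution of \<open>p_t + c p_x = a n_x\<close> with zero initial
  value, where \<open>w\<close> is the transform of \<open>n\<close>.\<close>

definition wave :: "real \<Rightarrow> real \<Rightarrow> real \<Rightarrow> (real \<Rightarrow> real \<Rightarrow> complex) \<Rightarrow> real \<Rightarrow> real \<Rightarrow> complex" where
  "wave T a c w t \<xi> = \<i> * of_real a * (of_real \<xi> * duhamel T (\<lambda>\<xi>. c * \<xi>) w t \<xi>)"

definition potential :: "real \<Rightarrow> real \<Rightarrow> real \<Rightarrow> real \<Rightarrow> real \<Rightarrow> real \<Rightarrow> real \<Rightarrow> real \<Rightarrow>
    (real \<Rightarrow> real \<Rightarrow> complex) \<Rightarrow> real \<Rightarrow> real \<Rightarrow> complex" where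
  "potential T A1 A2 Q c1 a1 c2 a2 w t \<xi> =
     (of_real A1 * wave T a1 c1 w t \<xi> + of_real A2 * wave T a2 c2 w t \<xi>) + of_real Q * w t \<xi>"

text \<open>Right-hand side of the Duhamel formula with initial transform \<open>f\<close> and
  potential transform \<open>V\<close>; a fixed point in \<open>u\<close> is a mild
  solution.\<close>

definition schroedinger :: "real \<Rightarrow> real \<Rightarrow> (real \<Rightarrow> complex) \<Rightarrow> (real \<Rightarrow> real \<Rightarrow> complex) \<Rightarrow>
    (real \<Rightarrow> real \<Rightarrow> complex) \<Rightarrow> real \<Rightarrow> real \<Rightarrow> complex" where
  "schroedinger T \<omega> f V u t \<xi> = cis (- (\<omega> * \<xi>\<^sup>2 * tclamp T t)) * f \<xi>
     - \<i> * duhamel T (\<lambda>\<xi>. \<omega> * \<xi>\<^sup>2) (\<lambda>t. conv (V t) (u t)) t \<xi>"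

lemma majorized_wave:
  assumes w: "majorized (wgt \<rho> \<delta> 0 T) R S w" and T: "0 \<le> T" and \<delta>: "0 < \<delta>" "\<delta> * T \<le> \<rho>"
  shows "majorized (wgt \<rho> \<delta> 0 T) (\<bar>a\<bar> * (1 / \<delta> * R)) (\<bar>a\<bar> * (1 / \<delta> * S)) (wave T a c w)"
proof -
  have "\<bar>\<xi>\<bar> * integral {0..tclamp T t} (\<lambda>s. wgt \<rho> \<delta> 0 T s \<xi>) \<le> 1 / \<delta> * wgt \<rho> \<delta> 0 T t \<xi>" for t \<xi>
    using wgt_integral[OF T, of 0 \<delta> \<xi> t \<rho>] \<delta> by (simp add: field_simps)
  then have "majorized (wgt \<rho> \<delta> 0 T) (1 / \<delta> * R) (1 / \<delta> * S) (\<lambda>t \<xi>. of_real \<xi> * duhamel T (\<lambda>\<xi>. c * \<xi>) w t \<xi>)"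
    using wgt_weight[OF T _ \<delta>(2), of 0] \<delta> by (intro majorized_duhamel[OF w]) (auto intro!: continuous_intros)
  from majorized_cmult[OF this, of "\<i> * of_real a"] show ?thesis
    unfolding wave_def[abs_def] by (simp add: norm_mult)
qed

lemma majorized_potential:
  assumes w: "majorized (wgt \<rho> \<delta> 0 T) R S w" and T: "0 \<le> T" and \<delta>: "0 < \<delta>" "\<delta> * T \<le> \<rho>"
    and K: "K = (\<bar>A1 * a1\<bar> + \<bar>A2 * a2\<bar>) * (1 / \<delta>) + \<bar>Q\<bar>"
  shows "majorized (wgt \<rho> \<delta> 0 T) (K * R) (K * S) (potential T A1 A2 Q c1 a1 c2 a2 w)"
proof -
  note w1 = majorized_cmult[OF majorized_wave[OF w T \<delta>, of a1 c1], of "of_real A1"]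
  note w2 = majorized_cmult[OF majorized_wave[OF w T \<delta>, of a2 c2], of "of_real A2"]
  note w3 = majorized_cmult[OF w, of "of_real Q"]
  from majorized_add[OF majorized_add[OF w1 w2] w3] show ?thesis
    unfolding potential_def[abs_def] K norm_of_real abs_mult
    by (rule majorized_mono) (simp_all add: algebra_simps)
qed

lemma wave_diff:
  assumes "jcont w" "jcont w'"
  shows "wave T a c (\<lambda>t \<xi>. w t \<xi> - w' t \<xi>) t \<xi> = wave T a c w t \<xi> - wave T a c w' t \<xi>"
  unfolding wave_def duhamel_diff[OF assms] by (simp add: right_diff_distrib)

lemma potential_diff:
  assumes "jcont w" "jcont w'"
  shows "potential T A1 A2 Q c1 a1 c2 a2 (\<lambda>t \<xi>. w t \<xi> - w' t \<xi>) t \<xi>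
     = potential T A1 A2 Q c1 a1 c2 a2 w t \<xi> - potential T A1 A2 Q c1 a1 c2 a2 w' t \<xi>"
  unfolding potential_def wave_diff[OF assms] by (simp add: right_diff_distrib)

lemma majorized_jcont: "majorized W R S u \<Longrightarrow> jcont u"
  by (simp add: majorized_def)

lemma majorized_bound: "majorized W R S u \<Longrightarrow> weight W \<Longrightarrow> norm (u t \<xi>) \<le> S * W t \<xi>"
proof -
  assume u: "majorized W R S u" and W: "weight W"
  obtain M where M: "jcont u" "integrable lborel M" "\<And>\<xi>. 0 \<le> M \<xi>" "\<And>\<xi>. M \<xi> \<le> S" "(LINT \<xi>|lborel. M \<xi>) \<le> R"
    "\<And>t \<xi>. norm (u t \<xi>) \<le> W t \<xi> * M \<xi>" using u by (rule majorizedE) blast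
  have "W t \<xi> * M \<xi> \<le> W t \<xi> * S" using W by (intro mult_left_mono M(4)) (auto simp: weight_def less_imp_le)
  then show ?thesis using M(6)[of t \<xi>] by (simp add: mult.commute)
qed

lemma majorized_free:
  assumes f: "continuous_on UNIV f" "integrable lborel (\<lambda>\<xi>. exp (\<rho> * \<bar>\<xi>\<bar>) * cmod (f \<xi>))"
      "(LINT \<xi>|lborel. exp (\<rho> * \<bar>\<xi>\<bar>) * cmod (f \<xi>)) \<le> R" "\<And>\<xi>. exp (\<rho> * \<bar>\<xi>\<bar>) * cmod (f \<xi>) \<le> S"
    and T: "0 \<le> T" "0 \<le> \<delta>" "0 \<le> \<Lambda>"
  shows "majorized (wgt \<rho> \<delta> \<Lambda> T) R S (\<lambda>t \<xi>. cis (- (\<omega> * \<xi>\<^sup>2 * tclamp T t)) * f \<xi>)"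
proof (rule majorizedI[where M = "\<lambda>\<xi>. exp (\<rho> * \<bar>\<xi>\<bar>) * cmod (f \<xi>)"])
  have "continuous_on UNIV (\<lambda>z::real \<times> real. f (snd z))"
    by (rule continuous_on_compose2[OF f(1)]) (auto intro: continuous_intros)
  then show "jcont (\<lambda>t \<xi>. cis (- (\<omega> * \<xi>\<^sup>2 * tclamp T t)) * f \<xi>)"
    unfolding jcont_def split_beta by (intro continuous_intros continuous_on_tclamp)
  fix t \<xi>
  have "1 \<le> exp (\<Lambda> * tclamp T t + \<delta> * tclamp T t * \<bar>\<xi>\<bar>)"
    using T tclamp_simps(1)[of T t] by (simp add: add_nonneg_nonneg mult_nonneg_nonneg)
  also have "\<dots> = wgt \<rho> \<delta> \<Lambda> T t \<xi> * exp (\<rho> * \<bar>\<xi>\<bar>)"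
    by (simp add: wgt_def exp_add[symmetric] algebra_simps)
  finally have "1 * cmod (f \<xi>) \<le> wgt \<rho> \<delta> \<Lambda> T t \<xi> * exp (\<rho> * \<bar>\<xi>\<bar>) * cmod (f \<xi>)"
    by (rule mult_right_mono) simp
  then show "norm (cis (- (\<omega> * \<xi>\<^sup>2 * tclamp T t)) * f \<xi>) \<le> wgt \<rho> \<delta> \<Lambda> T t \<xi> * (exp (\<rho> * \<bar>\<xi>\<bar>) * cmod (f \<xi>))"
    by (simp add: norm_mult mult.assoc)
qed (use f in auto)

text \<open>The derivative in the wave equations costs only a factor \<open>2 T / \<rho>\<close> because the width of the weight
  shrinks at speed \<open>\<rho> / (2 T)\<close>; this is where the analyticity of the data is used.\<close>

lemma small_data_solution:
  assumes T: "0 < T" and \<rho>: "0 < \<rho>"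
    and f: "continuous_on UNIV f" "integrable lborel (\<lambda>\<xi>. exp (\<rho> * \<bar>\<xi>\<bar>) * cmod (f \<xi>))"
      "(LINT \<xi>|lborel. exp (\<rho> * \<bar>\<xi>\<bar>) * cmod (f \<xi>)) \<le> R / 2" "\<And>\<xi>. exp (\<rho> * \<bar>\<xi>\<bar>) * cmod (f \<xi>) \<le> S / 2"
    and RS: "0 \<le> R" "0 \<le> S"
    and K: "K = (\<bar>A1 * a1\<bar> + \<bar>A2 * a2\<bar>) * (2 * T / \<rho>) + \<bar>Q\<bar>" and small: "6 * T * K * R\<^sup>2 \<le> 1"
  defines "W \<equiv> wgt \<rho> (\<rho> / (2 * T)) 0 T"
  obtains b where "majorized W R S b"
    "\<And>t \<xi>. b t \<xi> = schroedinger T \<omega> f (potential T A1 A2 Q c1 a1 c2 a2 (intensity b)) b t \<xi>"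
    "majorized W (T * (K * R ^ 3)) (T * (K * R\<^sup>2 * S)) (\<lambda>t \<xi>. b t \<xi> - cis (- (\<omega> * \<xi>\<^sup>2 * tclamp T t)) * f \<xi>)"
proof -
  define \<delta> where "\<delta> = \<rho> / (2 * T)"
  have \<delta>: "0 < \<delta>" "\<delta> * T \<le> \<rho>" "1 / \<delta> = 2 * T / \<rho>" using T \<rho> by (auto simp: \<delta>_def)
  have K': "K = (\<bar>A1 * a1\<bar> + \<bar>A2 * a2\<bar>) * (1 / \<delta>) + \<bar>Q\<bar>" using K \<delta>(3) by simp
  have K0: "0 \<le> K" unfolding K' using \<delta>(1) by (intro add_nonneg_nonneg mult_nonneg_nonneg) auto
  have T0: "0 \<le> T" using T by simp
  have W: "weight W" unfolding W_def \<delta>_def[symmetric] by (rule wgt_weight) (use \<delta> T0 in auto)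
  have WW: "W t (\<xi> - \<eta>) * W t \<eta> \<le> W t \<xi>" for t \<xi> \<eta>
    unfolding W_def \<delta>_def[symmetric] by (rule wgt_mult_le) (use \<delta> T0 in auto)
  let ?P = "potential T A1 A2 Q c1 a1 c2 a2"
  have pot: "majorized W (K * r) (K * s) (?P w)" if "majorized W r s w" for r s w
    using majorized_potential[OF _ T0 \<delta>(1,2) K'] that unfolding W_def \<delta>_def[symmetric] by blast
  have duh: "majorized W (T * r) (T * s) (duhamel T (\<lambda>\<xi>. \<omega> * \<xi>\<^sup>2) u)" if "majorized W r s u" for r s u
  proof -
    have "majorized W (T * r) (T * s) (\<lambda>t \<xi>. of_real 1 * duhamel T (\<lambda>\<xi>. \<omega> * \<xi>\<^sup>2) u t \<xi>)"
    proof (rule majorized_duhamel[OF that _ _ W T0])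
      show "\<bar>1\<bar> * integral {0..tclamp T t} (\<lambda>s. W s \<xi>) \<le> T * W t \<xi>" for t \<xi>
        using wgt_integral'[OF T0, of \<delta> 0 t \<rho> \<xi>] \<delta> unfolding W_def \<delta>_def[symmetric] by simp
    qed (auto intro!: continuous_intros)
    then show ?thesis by simp
  qed
  note mconv = majorized_conv[OF _ _ W W WW] and mconv' = majorized_conv'[OF _ _ W W WW]
  note mrefl = majorized_cnj_refl[OF _ W]
  define free where "free t \<xi> = cis (- (\<omega> * \<xi>\<^sup>2 * tclamp T t)) * f \<xi>" for t \<xi>
  have free: "majorized W (R / 2) (S / 2) free"
    unfolding W_def \<delta>_def[symmetric] free_def[abs_def] by (rule majorized_free) (use f T0 \<delta> in auto)
  define G where "G u t = conv (?P (intensity u) t) (u t)" for u t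
  define \<Psi> where "\<Psi> u t \<xi> = schroedinger T \<omega> f (?P (intensity u)) u t \<xi>" for u t \<xi>
  have \<Psi>_eq: "\<Psi> u t \<xi> = free t \<xi> - \<i> * duhamel T (\<lambda>\<xi>. \<omega> * \<xi>\<^sup>2) (G u) t \<xi>" for u t \<xi>
    by (simp add: \<Psi>_def schroedinger_def free_def G_def[abs_def])
  have dens: "majorized W (R * R) (R * S) (intensity u)" if "majorized W R S u" for u
    unfolding intensity_def[abs_def] using mconv'[OF that mrefl[OF that]] .
  have Gm: "majorized W (K * R ^ 3) (K * R\<^sup>2 * S) (G u)" if "majorized W R S u" for u
    unfolding G_def[abs_def]
    by (rule majorized_mono[OF mconv'[OF pot[OF dens[OF that]] that]]) (auto simp: power2_eq_square power3_eq_cube)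
  have rem: "majorized W (T * (K * R ^ 3)) (T * (K * R\<^sup>2 * S)) (\<lambda>t \<xi>. \<Psi> u t \<xi> - free t \<xi>)" if "majorized W R S u" for u
    using majorized_cmult[OF duh[OF Gm[OF that]], of "- \<i>"] by (simp add: \<Psi>_eq)
  \<comment> \<open>At most 1/2 is enough for the self-map and 1/6 for the contraction: the
    nonlinearity is trilinear, so its Lipschitz constant has three such summands.\<close>
  have TK: "T * (K * R\<^sup>2) \<le> 1 / 6" using small by simp
  have \<Psi>m: "majorized W R S (\<Psi> u)" if "majorized W R S u" for u
  proof -
    have "T * (K * R ^ 3) = T * (K * R\<^sup>2) * R" "T * (K * R\<^sup>2 * S) = T * (K * R\<^sup>2) * S"
      by (simp_all add: power2_eq_square power3_eq_cube)
    then have "T * (K * R ^ 3) \<le> R / 2" "T * (K * R\<^sup>2 * S) \<le> S / 2"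
      using mult_right_mono[OF TK RS(1)] mult_right_mono[OF TK RS(2)] RS by auto
    then show ?thesis
      using majorized_mono[OF majorized_add[OF rem[OF that] free], of R S] by simp
  qed
  have contr: "norm (\<Psi> u t \<xi> - \<Psi> v t \<xi>) \<le> D / 2 * W t \<xi>"
    if u: "majorized W R S u" and v: "majorized W R S v" and D: "0 \<le> D" and le: "\<And>t \<xi>. norm (u t \<xi> - v t \<xi>) \<le> D * W t \<xi>" for u v D t \<xi>
  proof -
    define h where "h t \<xi> = u t \<xi> - v t \<xi>" for t \<xi>
    have h: "majorized W (R + R) D h" unfolding h_def[abs_def]
      by (rule majorized_sup[OF majorized_diff[OF u v] le D])
    have dd: "intensity u t \<xi> - intensity v t \<xi> = conv (h t) (cnj_refl (u t)) \<xi> + conv (v t) (cnj_refl (h t)) \<xi>" for t \<xi>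
    proof -
      have "cnj_refl (h t) = (\<lambda>\<xi>. cnj_refl (u t) \<xi> - cnj_refl (v t) \<xi>)" by (auto simp: cnj_refl_def h_def)
      then show ?thesis
        unfolding intensity_def h_def[abs_def]
        using conv_diff_left[OF u v mrefl[OF u] W W, of t \<xi>] conv_diff_right[OF mrefl[OF u] mrefl[OF v] v W W, of t \<xi>]
        by (simp add: h_def[abs_def])
    qed
    \<comment> \<open>The two forms of Young's inequality are chosen so that the supremum bound
      always falls on the factor with \<open>h\<close>; only this bound enters the final
      estimate.\<close>
    have dm: "majorized W ((R + R) * R + R * (R + R)) (D * R + R * D) (\<lambda>t \<xi>. intensity u t \<xi> - intensity v t \<xi>)"
      unfolding dd by (rule majorized_add[OF mconv[OF h mrefl[OF u]] mconv'[OF v mrefl[OF h]]])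
    have Pd: "majorized W (K * ((R + R) * R + R * (R + R))) (K * (D * R + R * D)) (\<lambda>t \<xi>. ?P (intensity u) t \<xi> - ?P (intensity v) t \<xi>)"
      using pot[OF dm] unfolding potential_diff[OF majorized_jcont[OF dens[OF u]] majorized_jcont[OF dens[OF v]], abs_def]
      by simp
    have Gd: "G u t \<xi> - G v t \<xi> = conv (\<lambda>\<xi>. ?P (intensity u) t \<xi> - ?P (intensity v) t \<xi>) (u t) \<xi> + conv (?P (intensity v) t) (h t) \<xi>" for t \<xi>
      unfolding G_def h_def
      using conv_diff_left[OF pot[OF dens[OF u]] pot[OF dens[OF v]] u W W, of t \<xi>]
        conv_diff_right[OF u v pot[OF dens[OF v]] W W, of t \<xi>] by simp
    have "majorized W (K * ((R + R) * R + R * (R + R)) * R + K * (R * R) * (R + R)) (K * (D * R + R * D) * R + K * (R * R) * D)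
       (\<lambda>t \<xi>. G u t \<xi> - G v t \<xi>)"
      unfolding Gd by (rule majorized_add[OF mconv[OF Pd u] mconv'[OF pot[OF dens[OF v]] h]])
    from majorized_bound[OF duh[OF this] W, of t \<xi>]
    have "norm (\<Psi> u t \<xi> - \<Psi> v t \<xi>) \<le> T * (K * (D * R + R * D) * R + K * (R * R) * D) * W t \<xi>"
      unfolding \<Psi>_eq duhamel_diff[OF majorized_jcont[OF Gm[OF u]] majorized_jcont[OF Gm[OF v]]]
      by (simp add: norm_minus_commute norm_mult right_diff_distrib[symmetric])
    also have "T * (K * (D * R + R * D) * R + K * (R * R) * D) = (3 * (T * (K * R\<^sup>2))) * D"
      by (simp add: power2_eq_square algebra_simps)
    also have "\<dots> * W t \<xi> \<le> (1 / 2) * D * W t \<xi>"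
      using TK D W by (intro mult_right_mono) (auto simp: weight_def less_imp_le)
    finally show ?thesis by simp
  qed
  obtain b where b: "majorized W R S b" "\<And>t \<xi>. b t \<xi> = \<Psi> b t \<xi>"
    by (rule majorized_fixpoint[OF W RS \<Psi>m contr]) blast+
  show thesis
  proof (rule that[OF b(1)])
    show "b t \<xi> = schroedinger T \<omega> f (?P (intensity b)) b t \<xi>" for t \<xi> using b(2) by (simp add: \<Psi>_def)
    show "majorized W (T * (K * R ^ 3)) (T * (K * R\<^sup>2 * S)) (\<lambda>t \<xi>. b t \<xi> - cis (- (\<omega> * \<xi>\<^sup>2 * tclamp T t)) * f \<xi>)"
      using rem[OF b(1)] unfolding b(2)[symmetric] free_def .
  qed
qed

text \<open>With a prescribed potential the equation is linear, and the growth rate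
  \<open>2 * Rv + 1\<close> in the weight takes the place of smallness: the Duhamel term has norm at
  most \<open>Rv / (2 * Rv + 1) \<le> 1 / 2\<close>. It serves the case \<open>\<omega> = 0\<close>,
  where the potential is known in advance.\<close>

lemma linear_solution:
  assumes T: "0 < T" and r: "0 < r"
    and f: "continuous_on UNIV f" "integrable lborel (\<lambda>\<xi>. exp (r * \<bar>\<xi>\<bar>) * cmod (f \<xi>))"
      "(LINT \<xi>|lborel. exp (r * \<bar>\<xi>\<bar>) * cmod (f \<xi>)) \<le> R / 2" "\<And>\<xi>. exp (r * \<bar>\<xi>\<bar>) * cmod (f \<xi>) \<le> S / 2"
    and RS: "0 \<le> R" "0 \<le> S" and V: "majorized (wgt r 0 0 T) Rv Sv V"
  obtains b where "majorized (wgt r 0 (2 * Rv + 1) T) R S b" "\<And>t \<xi>. b t \<xi> = schroedinger T \<omega> f V b t \<xi>"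
    "jcont (\<lambda>t. conv (V t) (b t))" "\<And>t \<xi>. norm (conv (V t) (b t) \<xi>) \<le> Rv * S * wgt r 0 (2 * Rv + 1) T t \<xi>"
proof -
  define \<Lambda> where "\<Lambda> = 2 * Rv + 1"
  have Rv: "0 \<le> Rv" using majorized_nonneg[OF V] by simp
  then have \<Lambda>: "0 < \<Lambda>" "Rv / \<Lambda> \<le> 1 / 2" by (auto simp: \<Lambda>_def field_simps)
  have T0: "0 \<le> T" using T by simp
  define W where "W = wgt r 0 \<Lambda> T"
  have W: "weight W" unfolding W_def by (rule wgt_weight) (use \<Lambda> r T0 in auto)
  have W0: "weight (wgt r 0 0 T)" by (rule wgt_weight) (use r T0 in auto)
  have WW: "wgt r 0 0 T t (\<xi> - \<eta>) * W t \<eta> \<le> W t \<xi>" for t \<xi> \<eta>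
    unfolding W_def by (rule wgt_mult_le) (use r T0 in auto)
  have duh: "majorized W (1 / \<Lambda> * r') (1 / \<Lambda> * s) (duhamel T (\<lambda>\<xi>. \<omega> * \<xi>\<^sup>2) u)" if "majorized W r' s u" for r' s u
  proof -
    have "majorized W (1 / \<Lambda> * r') (1 / \<Lambda> * s) (\<lambda>t \<xi>. of_real 1 * duhamel T (\<lambda>\<xi>. \<omega> * \<xi>\<^sup>2) u t \<xi>)"
    proof (rule majorized_duhamel[OF that _ _ W])
      show "\<bar>1\<bar> * integral {0..tclamp T t} (\<lambda>s. W s \<xi>) \<le> 1 / \<Lambda> * W t \<xi>" for t \<xi>
        using wgt_integral[OF T0, of \<Lambda> 0 \<xi> t r] \<Lambda> unfolding W_def by (simp add: field_simps)
    qed (use \<Lambda> in \<open>auto intro!: continuous_intros\<close>)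
    then show ?thesis by simp
  qed
  note mconv = majorized_conv'[OF V _ W0 W WW]
  define free where "free t \<xi> = cis (- (\<omega> * \<xi>\<^sup>2 * tclamp T t)) * f \<xi>" for t \<xi>
  have free: "majorized W (R / 2) (S / 2) free"
    unfolding W_def free_def[abs_def] by (rule majorized_free) (use f T0 \<Lambda> in auto)
  define \<Psi> where "\<Psi> u t \<xi> = schroedinger T \<omega> f V u t \<xi>" for u t \<xi>
  have \<Psi>_eq: "\<Psi> u t \<xi> = free t \<xi> - \<i> * duhamel T (\<lambda>\<xi>. \<omega> * \<xi>\<^sup>2) (\<lambda>t. conv (V t) (u t)) t \<xi>" for u t \<xi>
    by (simp add: \<Psi>_def schroedinger_def free_def)
  have half: "1 / \<Lambda> * (Rv * x) \<le> x / 2" if "0 \<le> x" for x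
    using mult_right_mono[OF \<Lambda>(2) that] by simp
  have \<Psi>m: "majorized W R S (\<Psi> u)" if u: "majorized W R S u" for u
    unfolding \<Psi>_eq[abs_def]
    by (rule majorized_mono[OF majorized_diff[OF free majorized_cmult[OF duh[OF mconv[OF u]], of \<i>]]];
        insert half[OF RS(1)] half[OF RS(2)]; simp only: norm_ii mult_1_left; linarith)
  have contr: "norm (\<Psi> u t \<xi> - \<Psi> v t \<xi>) \<le> D / 2 * W t \<xi>"
    if u: "majorized W R S u" and v: "majorized W R S v" and D: "0 \<le> D" and le: "\<And>t \<xi>. norm (u t \<xi> - v t \<xi>) \<le> D * W t \<xi>" for u v D t \<xi>
  proof -
    have h: "majorized W (R + R) D (\<lambda>t \<xi>. u t \<xi> - v t \<xi>)"
      by (rule majorized_sup[OF majorized_diff[OF u v] le D])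
    have eq: "conv (V t) (u t) \<xi> - conv (V t) (v t) \<xi> = conv (V t) (\<lambda>\<xi>. u t \<xi> - v t \<xi>) \<xi>" for t \<xi>
      using conv_diff_right[OF u v V W W0, of t \<xi>] by simp
    have "majorized W (Rv * (R + R)) (Rv * D) (\<lambda>t \<xi>. conv (V t) (u t) \<xi> - conv (V t) (v t) \<xi>)"
      unfolding eq by (rule mconv[OF h])
    from majorized_bound[OF duh[OF this] W, of t \<xi>]
    have "norm (\<Psi> u t \<xi> - \<Psi> v t \<xi>) \<le> 1 / \<Lambda> * (Rv * D) * W t \<xi>"
      unfolding \<Psi>_eq duhamel_diff[OF majorized_jcont[OF mconv[OF u]] majorized_jcont[OF mconv[OF v]]]
      by (simp add: norm_minus_commute norm_mult right_diff_distrib[symmetric])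
    also have "\<dots> \<le> D / 2 * W t \<xi>"
      using half[OF D] W by (intro mult_right_mono) (auto simp: weight_def less_imp_le)
    finally show ?thesis .
  qed
  obtain b where b: "majorized W R S b" "\<And>t \<xi>. b t \<xi> = \<Psi> b t \<xi>"
    by (rule majorized_fixpoint[OF W RS \<Psi>m contr]) blast+
  show thesis
    by (rule that[of b]) (use b majorized_jcont[OF mconv[OF b(1)]] majorized_bound[OF mconv[OF b(1)] W] in
      \<open>auto simp: \<Psi>_def W_def \<Lambda>_def\<close>)
qed

subsection \<open>From Fourier variables back to the system\<close>

lemma ift_add: "integrable lborel u \<Longrightarrow> integrable lborel v \<Longrightarrow> ift (\<lambda>\<xi>. u \<xi> + v \<xi>) x = ift u x + ift v x"
  unfolding ift_eq using integrable_cis_mult[of u x] integrable_cis_mult[of v x] by (simp add: distrib_left)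

lemma ift_diff: "integrable lborel u \<Longrightarrow> integrable lborel v \<Longrightarrow> ift (\<lambda>\<xi>. u \<xi> - v \<xi>) x = ift u x - ift v x"
  unfolding ift_eq using integrable_cis_mult[of u x] integrable_cis_mult[of v x] by (simp add: right_diff_distrib)

lemma ift_cmult: "ift (\<lambda>\<xi>. c * u \<xi>) x = c * ift u x"
  unfolding ift_eq by (simp add: mult.left_commute)

lemma ift_cnj_refl: "ift (cnj_refl u) x = cnj (ift u x)"
proof -
  have "(LINT \<xi>|lborel. cis (x * \<xi>) * cnj (u (- \<xi>))) = (LINT \<xi>|lborel. (\<lambda>\<eta>. cnj (cis (x * \<eta>) * u \<eta>)) (0 - \<xi>))"
    by (simp add: cis_cnj)
  also have "\<dots> = (LINT \<eta>|lborel. cnj (cis (x * \<eta>) * u \<eta>))" by (rule lborel_integral_reflect)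
  also have "\<dots> = cnj (LINT \<eta>|lborel. cis (x * \<eta>) * u \<eta>)" by (rule Bochner_Integration.integral_cnj)
  finally show ?thesis unfolding ift_eq cnj_refl_def by simp
qed

lemma ift_conv:
  assumes u: "integrable lborel u" and v: "integrable lborel v"
  shows "ift (conv u v) x = ift u x * ift v x"
proof -
  let ?k = "complex_of_real (1 / sqrt (2 * pi))"
  let ?u = "\<lambda>\<xi>. cis (x * \<xi>) * u \<xi>" and ?v = "\<lambda>\<xi>. cis (x * \<xi>) * v \<xi>"
  have J: "integrable (lborel \<Otimes>\<^sub>M lborel) (\<lambda>(\<eta>, \<xi>). ?u (\<xi> - \<eta>) * ?v \<eta>)"
    by (rule convolution_integrable[OF integrable_cis_mult[OF u] integrable_cis_mult[OF v]])
  have "ift (conv u v) x = ?k * (LINT \<xi>|lborel. LINT \<eta>|lborel. ?k * (?u (\<xi> - \<eta>) * ?v \<eta>))"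
  proof -
    have "cis (x * \<xi>) * conv u v \<xi> = (LINT \<eta>|lborel. ?k * (?u (\<xi> - \<eta>) * ?v \<eta>))" for \<xi>
    proof -
      have "?k * (?u (\<xi> - \<eta>) * ?v \<eta>) = (cis (x * \<xi>) * ?k) * (u (\<xi> - \<eta>) * v \<eta>)" for \<eta>
      proof -
        have "cis (x * \<xi>) = cis (x * (\<xi> - \<eta>)) * cis (x * \<eta>)" by (simp add: cis_mult algebra_simps)
        then show ?thesis by (simp only: mult_ac)
      qed
      then show ?thesis unfolding conv_def by (simp only: integral_mult_right_zero mult.assoc)
    qed
    then show ?thesis by (simp only: ift_eq)
  qed
  also have "\<dots> = ?k * (?k * (LINT \<eta>|lborel. LINT \<xi>|lborel. ?u (\<xi> - \<eta>) * ?v \<eta>))"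
    by (simp only: integral_mult_right_zero lborel_pair.Fubini_integral[OF J])
  also have "(LINT \<eta>|lborel. LINT \<xi>|lborel. ?u (\<xi> - \<eta>) * ?v \<eta>) = (LINT \<xi>|lborel. ?u \<xi>) * (LINT \<eta>|lborel. ?v \<eta>)"
    using lborel_integral_shift[of ?u] by simp
  finally show ?thesis unfolding ift_eq by (simp only: mult_ac)
qed

lemma expdec_moment:
  assumes "expdec r C u" "r > 0" "j \<le> 3"
  shows "integrable lborel (\<lambda>\<xi>. (\<i> * of_real \<xi>) ^ j * u t \<xi>)"
  by (rule weighted_moment_bound(1)[OF _ expdec_square_integrable[OF assms(1,2)] assms(3)])
     (use assms(1) in \<open>auto simp: expdec_def intro: jcont_measurable\<close>)

lemma majorized_expdec:
  assumes "majorized W R S u" "weight W" "\<And>t \<xi>. W t \<xi> \<le> c * exp (- r * \<bar>\<xi>\<bar>)"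
  shows "expdec r (S * c) u"
  unfolding expdec_def
proof (intro conjI allI)
  show "jcont u" using assms(1) by (rule majorized_jcont)
  fix t \<xi>
  have "norm (u t \<xi>) \<le> S * W t \<xi>" by (rule majorized_bound[OF assms(1,2)])
  also have "\<dots> \<le> S * (c * exp (- r * \<bar>\<xi>\<bar>))" by (intro mult_left_mono assms(3) majorized_nonneg(2)[OF assms(1)])
  finally show "norm (u t \<xi>) \<le> S * c * exp (- r * \<bar>\<xi>\<bar>)" by (simp add: mult.assoc)
qed

lemma duhamel_has_vector_derivative:
  assumes u: "jcont u" and t: "t \<in> {0..T}"
  shows "((\<lambda>\<tau>. duhamel T \<mu> u \<tau> \<xi>) has_vector_derivative u t \<xi> - \<i> * of_real (\<mu> \<xi>) * duhamel T \<mu> u t \<xi>) (at t within {0..T})"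
proof -
  let ?I = "\<lambda>\<tau>. integral {0..\<tau>} (\<lambda>s. cis (\<mu> \<xi> * s) * u s \<xi>)"
  have e: "cis (- (\<mu> \<xi> * s)) = exp (- (\<i> * of_real (\<mu> \<xi>)) * of_real s)" for s
    by (simp add: cis_conv_exp mult_ac)
  have "((\<lambda>z. exp (- (\<i> * of_real (\<mu> \<xi>)) * z)) has_field_derivative
      - \<i> * of_real (\<mu> \<xi>) * exp (- (\<i> * of_real (\<mu> \<xi>)) * of_real t)) (at (of_real t))"
    by (auto intro!: derivative_eq_intros)
  from has_vector_derivative_real_field[OF this, of "{0..T}"]
  have 1: "((\<lambda>s. cis (- (\<mu> \<xi> * s))) has_vector_derivative - \<i> * of_real (\<mu> \<xi>) * cis (- (\<mu> \<xi> * t))) (at t within {0..T})"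
    unfolding e .
  have 2: "(?I has_vector_derivative cis (\<mu> \<xi> * t) * u t \<xi>) (at t within {0..T})"
    by (rule integral_has_vector_derivative[OF _ t]) (intro continuous_intros jcont_slice(2)[OF u])
  have "cis (- (\<mu> \<xi> * t)) * (cis (\<mu> \<xi> * t) * u t \<xi>) = u t \<xi>"
    by (simp add: mult.assoc[symmetric] cis_mult)
  then have "((\<lambda>\<tau>. cis (- (\<mu> \<xi> * \<tau>)) * ?I \<tau>) has_vector_derivative
      u t \<xi> - \<i> * of_real (\<mu> \<xi>) * (cis (- (\<mu> \<xi> * t)) * ?I t)) (at t within {0..T})"
    by (intro has_vector_derivative_eq_rhs[OF has_vector_derivative_mult[OF 1 2]]) (simp add: mult.assoc)
  moreover have "duhamel T \<mu> u \<tau> \<xi> = cis (- (\<mu> \<xi> * \<tau>)) * ?I \<tau>" if "\<tau> \<in> {0..T}" for \<tau>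
    by (simp add: duhamel_def tclamp_simps(3)[OF that])
  ultimately show ?thesis using t by (auto intro: has_vector_derivative_transform)
qed

lemma ift_has_time_derivative:
  assumes r: "r > 0" and u: "expdec r C u" and t: "t \<in> {0..T}"
    and d: "\<And>t \<xi>. t \<in> {0..T} \<Longrightarrow> ((\<lambda>\<tau>. u \<tau> \<xi>) has_vector_derivative u' t \<xi>) (at t within {0..T})"
    and b: "\<And>t \<xi>. t \<in> {0..T} \<Longrightarrow> norm (u' t \<xi>) \<le> K * ((1 + \<xi>\<^sup>2) powr 1 * exp (- r * \<bar>\<xi>\<bar>))"
    and m: "u' t \<in> borel_measurable borel"
  shows "((\<lambda>\<tau>. ift (u \<tau>) x) has_vector_derivative ift (u' t) x) (at t within {0..T})"
proof -
  have "((\<lambda>\<tau>. LINT \<xi>|lborel. cis (x * \<xi>) * u \<tau> \<xi>) has_vector_derivative (LINT \<xi>|lborel. cis (x * \<xi>) * u' t \<xi>)) (at t within {0..T})"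
  proof (rule has_vector_derivative_integral[where g = "\<lambda>\<xi>. K * ((1 + \<xi>\<^sup>2) powr 1 * exp (- r * \<bar>\<xi>\<bar>))"])
    show "integrable lborel (\<lambda>\<xi>. K * ((1 + \<xi>\<^sup>2) powr 1 * exp (- r * \<bar>\<xi>\<bar>)))"
      by (intro integrable_mult_right impI integrable_weight_exp r)
    show "(\<lambda>\<xi>. cis (x * \<xi>) * u' t \<xi>) \<in> borel_measurable lborel" using m by measurable
    show "integrable lborel (\<lambda>\<xi>. cis (x * \<xi>) * u s \<xi>)" for s
      by (intro integrable_cis_mult expdec_integrable[OF u r])
    fix s \<xi> assume s: "s \<in> {0..T}"
    show "((\<lambda>\<tau>. cis (x * \<xi>) * u \<tau> \<xi>) has_vector_derivative cis (x * \<xi>) * u' s \<xi>) (at s within {0..T})"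
      by (intro has_vector_derivative_mult_right d s)
    show "norm (cis (x * \<xi>) * u' s \<xi>) \<le> K * ((1 + \<xi>\<^sup>2) powr 1 * exp (- r * \<bar>\<xi>\<bar>))"
      using b[OF s, of \<xi>] by (simp add: norm_mult)
  qed (use t in auto)
  then show ?thesis unfolding ift_eq by (intro has_vector_derivative_mult_right)
qed

text \<open>Hermitian symmetry is inherited from \<open>w\<close>, since the symbol of the wave
  propagator is odd; the wave is therefore the transform of a real function.\<close>

lemma wave_cnj_refl:
  assumes w: "\<And>t. cnj_refl (w t) = w t" shows "cnj_refl (wave T a c w t) = wave T a c w t"
proof
  fix \<xi>
  have ws: "w s (- \<xi>) = cnj (w s \<xi>)" for s using fun_cong[OF w[of s], of "- \<xi>"] by (simp add: cnj_refl_def)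
  have "integral {0..tclamp T t} (\<lambda>s. cis (c * (- \<xi>) * s) * w s (- \<xi>)) = cnj (integral {0..tclamp T t} (\<lambda>s. cis (c * \<xi> * s) * w s \<xi>))"
    unfolding Henstock_Kurzweil_Integration.integral_cnj by (simp add: ws cis_cnj)
  then have "wave T a c w t (- \<xi>) = cnj (wave T a c w t \<xi>)"
    by (simp add: wave_def duhamel_def cis_cnj)
  then show "cnj_refl (wave T a c w t) \<xi> = wave T a c w t \<xi>" by (simp add: cnj_refl_def)
qed

lemma intensity_cnj_refl: "cnj_refl (intensity u t) = intensity u t"
proof
  fix \<xi>
  let ?g = "\<lambda>\<eta>. cnj (u t (- \<xi> - \<eta>) * cnj_refl (u t) \<eta>)"
  have "cnj_refl (intensity u t) \<xi> = of_real (1 / sqrt (2 * pi)) * (LINT \<eta>|lborel. ?g \<eta>)"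
    unfolding intensity_def cnj_refl_def[of "conv _ _"] conv_def complex_cnj_mult[of "of_real _"] Bochner_Integration.integral_cnj by simp
  also have "(LINT \<eta>|lborel. ?g \<eta>) = (LINT \<eta>|lborel. ?g (0 - \<eta>))" by (rule lborel_integral_reflect[symmetric])
  also have "\<dots> = (LINT \<eta>|lborel. cnj_refl (u t) (\<xi> - \<eta>) * u t \<eta>)" by (simp add: cnj_refl_def)
  finally have "cnj_refl (intensity u t) \<xi> = conv (cnj_refl (u t)) (u t) \<xi>" unfolding conv_def .
  then show "cnj_refl (intensity u t) \<xi> = intensity u t \<xi>" unfolding intensity_def[of u t] conv_commute[of "u t"] .
qed

text \<open>Brings a quadratic polynomial times an exponential into the form of majorant that
  \<open>ift_has_time_derivative\<close> expects.\<close>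

lemma quadratic_exp_bound:
  fixes z :: complex
  assumes "norm z \<le> (p * \<xi>\<^sup>2 + q * \<bar>\<xi>\<bar> + s) * exp (- r * \<bar>\<xi>\<bar>)" and n: "0 \<le> p" "0 \<le> q" "0 \<le> s"
  shows "norm z \<le> (p + q + s) * ((1 + \<xi>\<^sup>2) powr 1 * exp (- r * \<bar>\<xi>\<bar>))"
proof -
  have "\<bar>\<xi>\<bar> * 2 \<le> 1 + \<xi>\<^sup>2" using zero_le_power2[of "\<bar>\<xi>\<bar> - 1"] by (simp add: power2_diff)
  then have "\<bar>\<xi>\<bar> \<le> 1 + \<xi>\<^sup>2" using zero_le_power2[of \<xi>] by linarith
  then have "p * \<xi>\<^sup>2 + q * \<bar>\<xi>\<bar> + s * 1 \<le> p * (1 + \<xi>\<^sup>2) + q * (1 + \<xi>\<^sup>2) + s * (1 + \<xi>\<^sup>2)"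
    using n by (intro add_mono mult_left_mono) auto
  moreover have "(p + q + s) * (1 + \<xi>\<^sup>2) = p * (1 + \<xi>\<^sup>2) + q * (1 + \<xi>\<^sup>2) + s * (1 + \<xi>\<^sup>2)" by (simp only: distrib_right)
  moreover have "(1 + \<xi>\<^sup>2) powr 1 = 1 + \<xi>\<^sup>2" by (rule powr_one) (rule add_nonneg_nonneg; simp)
  ultimately have "p * \<xi>\<^sup>2 + q * \<bar>\<xi>\<bar> + s \<le> (p + q + s) * (1 + \<xi>\<^sup>2) powr 1" by simp
  from mult_right_mono[OF this, of "exp (- r * \<bar>\<xi>\<bar>)"]
  show ?thesis by (intro order_trans[OF assms(1)]) (simp only: mult.assoc exp_ge_zero)
qed

lemma expdecD:
  assumes "expdec r C u"
  shows "norm (u t \<xi>) \<le> C * exp (- r * \<bar>\<xi>\<bar>)" and "0 \<le> C"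
proof -
  show *: "norm (u t \<xi>) \<le> C * exp (- r * \<bar>\<xi>\<bar>)" for t \<xi> using assms by (simp add: expdec_def)
  have "0 \<le> C * exp (- r * \<bar>0\<bar>)" by (rule order_trans[OF norm_ge_zero *])
  then show "0 \<le> C" by simp
qed

lemma ift_expdec_has_vector_derivative:
  assumes r: "0 < r" and u: "expdec r C u"
  shows "(ift (u t) has_vector_derivative ift (\<lambda>\<xi>. \<i> * of_real \<xi> * u t \<xi>) x) (at x)"
    and "(vderiv (ift (u t)) has_vector_derivative ift (\<lambda>\<xi>. (\<i> * of_real \<xi>)\<^sup>2 * u t \<xi>) x) (at x)"
proof -
  have xd: "(ift (\<lambda>\<xi>. (\<i> * of_real \<xi>) ^ j * u t \<xi>) has_vector_derivative ift (\<lambda>\<xi>. (\<i> * of_real \<xi>) ^ Suc j * u t \<xi>) x) (at x)"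
    if "j < 3" for j x
    using ift_has_vector_derivative[OF expdec_moment[OF u r, of j t], of x] expdec_moment[OF u r, of "Suc j" t] that
    by (simp add: mult.assoc)
  show 0: "(ift (u t) has_vector_derivative ift (\<lambda>\<xi>. \<i> * of_real \<xi> * u t \<xi>) x) (at x)" for x using xd[of 0 x] by simp
  have "vderiv (ift (u t)) = ift (\<lambda>\<xi>. \<i> * of_real \<xi> * u t \<xi>)" by (rule ext, rule vderiv_eqI, rule 0)
  then show "(vderiv (ift (u t)) has_vector_derivative ift (\<lambda>\<xi>. (\<i> * of_real \<xi>)\<^sup>2 * u t \<xi>) x) (at x)"
    using xd[of 1 x] by (simp add: numeral_2_eq_2)
qed

text \<open>At fixed frequency the Duhamel formula is an ordinary differential equation; exponential
  decay allows its time derivative to be taken under the inverse transform, where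
  \<open>conv\<close> becomes the product of potential and solution.\<close>

lemma fourier_schroedinger:
  assumes r: "0 < r" and b: "expdec r Cb b" and G: "expdec r CG (\<lambda>t. conv (V t) (b t))"
    and eq: "\<And>t \<xi>. b t \<xi> = schroedinger T \<omega> f V b t \<xi>" and t: "t \<in> {0..T}" and V: "integrable lborel (V t)"
  shows "((\<lambda>\<tau>. ift (b \<tau>) x) has_vector_derivative
    \<i> * (of_real \<omega> * vderiv (vderiv (ift (b t))) x - ift (V t) x * ift (b t) x)) (at t within {0..T})"
proof -
  have jG: "jcont (\<lambda>t. conv (V t) (b t))" using G by (simp add: expdec_def)
  have bxx: "vderiv (vderiv (ift (b t))) x = ift (\<lambda>\<xi>. (\<i> * of_real \<xi>)\<^sup>2 * b t \<xi>) x"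
    by (rule vderiv_eqI, rule ift_expdec_has_vector_derivative[OF r b])
  define b' where "b' t \<xi> = \<i> * of_real \<omega> * ((\<i> * of_real \<xi>)\<^sup>2 * b t \<xi>) - \<i> * conv (V t) (b t) \<xi>" for t \<xi>
  have d: "((\<lambda>\<tau>. b \<tau> \<xi>) has_vector_derivative b' t \<xi>) (at t within {0..T})" if t: "t \<in> {0..T}" for t \<xi>
  proof -
    let ?\<mu> = "\<lambda>\<xi>. \<omega> * \<xi>\<^sup>2" and ?G = "\<lambda>t. conv (V t) (b t)"
    have e: "cis (- (\<omega> * \<xi>\<^sup>2 * s)) = exp (- (\<i> * of_real (\<omega> * \<xi>\<^sup>2)) * of_real s)" for s
      by (simp add: cis_conv_exp mult_ac)
    have "((\<lambda>z. exp (- (\<i> * of_real (\<omega> * \<xi>\<^sup>2)) * z)) has_field_derivative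
        - \<i> * of_real (\<omega> * \<xi>\<^sup>2) * exp (- (\<i> * of_real (\<omega> * \<xi>\<^sup>2)) * of_real t)) (at (of_real t))"
      by (auto intro!: derivative_eq_intros)
    from has_vector_derivative_real_field[OF this, of "{0..T}"]
    have 1: "((\<lambda>s. cis (- (\<omega> * \<xi>\<^sup>2 * s))) has_vector_derivative - \<i> * of_real (\<omega> * \<xi>\<^sup>2) * cis (- (\<omega> * \<xi>\<^sup>2 * t))) (at t within {0..T})"
      unfolding e .
    note 2 = duhamel_has_vector_derivative[OF jG t, of ?\<mu> \<xi>]
    have bb: "b \<tau> \<xi> = cis (- (\<omega> * \<xi>\<^sup>2 * \<tau>)) * f \<xi> - \<i> * duhamel T ?\<mu> ?G \<tau> \<xi>" if "\<tau> \<in> {0..T}" for \<tau>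
      by (subst eq) (simp add: schroedinger_def tclamp_simps(3)[OF that])
    have "((\<lambda>\<tau>. cis (- (\<omega> * \<xi>\<^sup>2 * \<tau>)) * f \<xi> - \<i> * duhamel T ?\<mu> ?G \<tau> \<xi>) has_vector_derivative b' t \<xi>) (at t within {0..T})"
      by (rule has_vector_derivative_eq_rhs[OF has_vector_derivative_diff[OF has_vector_derivative_mult_left[OF 1] has_vector_derivative_mult_right[OF 2]]])
         (simp add: b'_def bb[OF t] power_mult_distrib algebra_simps)
    then show ?thesis by (rule has_vector_derivative_transform[OF t, rotated]) (rule bb)
  qed
  have "((\<lambda>\<tau>. ift (b \<tau>) x) has_vector_derivative ift (b' t) x) (at t within {0..T})"
  proof (rule ift_has_time_derivative[OF r b t d])
    show "b' t \<in> borel_measurable borel"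
    proof -
      have [measurable]: "b t \<in> borel_measurable borel" "conv (V t) (b t) \<in> borel_measurable borel"
        using b jcont_measurable[OF jG] by (auto simp: expdec_def intro: jcont_measurable)
      show ?thesis unfolding b'_def[abs_def] by measurable
    qed
    fix t \<xi>
    have "norm (b' t \<xi>) \<le> norm (\<i> * of_real \<omega> * ((\<i> * of_real \<xi>)\<^sup>2 * b t \<xi>)) + norm (\<i> * conv (V t) (b t) \<xi>)"
      unfolding b'_def by (rule norm_triangle_ineq4)
    also have "\<dots> = \<bar>\<omega>\<bar> * (\<xi>\<^sup>2 * norm (b t \<xi>)) + norm (conv (V t) (b t) \<xi>)"
      by (simp add: norm_mult norm_power)
    also have "\<dots> \<le> \<bar>\<omega>\<bar> * (\<xi>\<^sup>2 * (Cb * exp (- r * \<bar>\<xi>\<bar>))) + CG * exp (- r * \<bar>\<xi>\<bar>)"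
      by (intro add_mono mult_left_mono expdecD(1)[OF b] expdecD(1)[OF G]) auto
    also have "\<dots> = (\<bar>\<omega>\<bar> * Cb * \<xi>\<^sup>2 + 0 * \<bar>\<xi>\<bar> + CG) * exp (- r * \<bar>\<xi>\<bar>)" by (simp add: algebra_simps)
    finally show "norm (b' t \<xi>) \<le> (\<bar>\<omega>\<bar> * Cb + 0 + CG) * ((1 + \<xi>\<^sup>2) powr 1 * exp (- r * \<bar>\<xi>\<bar>))"
      by (rule quadratic_exp_bound) (use expdecD(2)[OF b] expdecD(2)[OF G] in auto)
  qed
  also have "ift (b' t) x = \<i> * (of_real \<omega> * ift (\<lambda>\<xi>. (\<i> * of_real \<xi>)\<^sup>2 * b t \<xi>) x - ift (V t) x * ift (b t) x)"
  proof -
    have "ift (b' t) x = \<i> * of_real \<omega> * ift (\<lambda>\<xi>. (\<i> * of_real \<xi>)\<^sup>2 * b t \<xi>) x - \<i> * ift (conv (V t) (b t)) x"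
      unfolding b'_def[abs_def]
      using expdec_moment[OF b r, of 2 t] expdec_integrable[OF G r, of t] by (subst ift_diff) (auto simp: ift_cmult)
    then show ?thesis by (simp add: ift_conv[OF V expdec_integrable[OF b r]] right_diff_distrib)
  qed
  finally show ?thesis unfolding bxx .
qed

text \<open>\<open>w\<close> is tied to \<open>b\<close> only through \<open>dens\<close>, that is,
  for times in [0,T] and after inversion. With dispersion \<open>w\<close> is
  \<open>intensity b\<close>; without it \<open>w\<close> is the intensity of the data, constant in
  time, and \<open>dens\<close> comes from the conservation of \<open>|B|\<close>.\<close>

lemma fourier_solution:
  assumes r: "0 < r"
    and b: "expdec r Cb b" and w: "expdec r Cw w"
    and p1: "expdec r Cp1 (wave T a1 c1 w)" and p2: "expdec r Cp2 (wave T a2 c2 w)"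
    and G: "expdec r CG (\<lambda>t. conv (potential T A1 A2 Q c1 a1 c2 a2 w t) (b t))"
    and eq: "\<And>t \<xi>. b t \<xi> = schroedinger T \<omega> f (potential T A1 A2 Q c1 a1 c2 a2 w) b t \<xi>"
    and sym: "\<And>t. cnj_refl (w t) = w t"
    and dens: "\<And>t x. t \<in> {0..T} \<Longrightarrow> ift (w t) x = of_real ((cmod (ift (b t) x))\<^sup>2)"
  shows "zk_solution \<omega> A1 A2 Q c1 a1 c2 a2 T (\<lambda>t. ift (b t)) (\<lambda>t x. Re (ift (wave T a1 c1 w t) x)) (\<lambda>t x. Re (ift (wave T a2 c2 w t) x))"
proof -
  let ?V = "potential T A1 A2 Q c1 a1 c2 a2 w"
  have real: "of_real (Re (ift (wave T a c w t) x)) = ift (wave T a c w t) x" for a c t x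
    using ift_cnj_refl[of "wave T a c w t" x] unfolding wave_cnj_refl[OF sym]
    by (metis Reals_cnj_iff of_real_Re)
  have paths: "sobolev_path s T (\<lambda>t. ift (b t))" "sobolev_path s T (\<lambda>t x. of_real (Re (ift (wave T a1 c1 w t) x)))"
    "sobolev_path s T (\<lambda>t x. of_real (Re (ift (wave T a2 c2 w t) x)))" for s
    unfolding real using expdec_sobolev_path[OF b r] expdec_sobolev_path[OF p1 r] expdec_sobolev_path[OF p2 r] by auto
  note xd0 = ift_expdec_has_vector_derivative(1)[OF r]
  note bxx = ift_expdec_has_vector_derivative(2)[OF r b]
  have re: "((\<lambda>x. Re (g x)) has_vector_derivative Re g') F" if "(g has_vector_derivative g') F" for g :: "real \<Rightarrow> complex" and g' F
    by (rule has_vector_derivative_Re'[OF that])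
  have jw: "jcont w" using w by (auto simp: expdec_def)
  have px: "vderiv (\<lambda>x. Re (ift (wave T a c w t) x)) x = Re (ift (\<lambda>\<xi>. \<i> * of_real \<xi> * wave T a c w t \<xi>) x)"
    if "expdec r C (wave T a c w)" for C a c t x
    by (rule vderiv_eqI, rule re, rule xd0[OF that])
  show ?thesis
    unfolding zk_solution_def
  proof (intro conjI allI ballI paths)
    fix t x assume t: "t \<in> {0..T}"
    show "ift (b t) differentiable at x" using xd0[OF b] by (rule differentiableI_vector)
    show "vderiv (ift (b t)) differentiable at x" using bxx by (rule differentiableI_vector)
    show "(\<lambda>x. Re (ift (wave T a1 c1 w t) x)) differentiable at x" using re[OF xd0[OF p1]] by (rule differentiableI_vector)
    show "(\<lambda>x. Re (ift (wave T a2 c2 w t) x)) differentiable at x" using re[OF xd0[OF p2]] by (rule differentiableI_vector)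
    show "((\<lambda>\<tau>. ift (b \<tau>) x) has_vector_derivative
       \<i> * (of_real \<omega> * vderiv (vderiv (ift (b t))) x
         - of_real (A1 * Re (ift (wave T a1 c1 w t) x) + A2 * Re (ift (wave T a2 c2 w t) x) + Q * (cmod (ift (b t) x))\<^sup>2) * ift (b t) x)) (at t within {0..T})"
    proof -
      have iV: "integrable lborel (?V t)"
        and eV: "ift (?V t) x = of_real (A1 * Re (ift (wave T a1 c1 w t) x) + A2 * Re (ift (wave T a2 c2 w t) x) + Q * (cmod (ift (b t) x))\<^sup>2)"
        unfolding potential_def[abs_def]
        using expdec_integrable[OF p1 r, of t] expdec_integrable[OF p2 r, of t] expdec_integrable[OF w r, of t]
        by (simp_all add: ift_add ift_cmult real dens[OF t])
      show ?thesis using fourier_schroedinger[OF r b G eq t iV, of x] unfolding eV .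
    qed
    have waves: "((\<lambda>\<tau>. Re (ift (wave T a c w \<tau>) x)) has_vector_derivative
        a * vderiv (\<lambda>y. (cmod (ift (b t) y))\<^sup>2) x - c * vderiv (\<lambda>x. Re (ift (wave T a c w t) x)) x) (at t within {0..T})"
      if p: "expdec r C (wave T a c w)" for a c C
    proof -
      define p' where "p' t \<xi> = of_real a * (\<i> * of_real \<xi> * w t \<xi>) - of_real c * (\<i> * of_real \<xi> * wave T a c w t \<xi>)" for t \<xi>
      have alg: "\<i> * of_real a * (of_real \<xi> * (w t \<xi> - \<i> * of_real (c * \<xi>) * D)) =
          of_real a * (\<i> * of_real \<xi> * w t \<xi>) - of_real c * (\<i> * of_real \<xi> * (\<i> * of_real a * (of_real \<xi> * D)))" for D :: complex and t \<xi>
        by (simp add: algebra_simps)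
      have d: "((\<lambda>\<tau>. wave T a c w \<tau> \<xi>) has_vector_derivative p' t \<xi>) (at t within {0..T})" if t: "t \<in> {0..T}" for t \<xi>
        unfolding wave_def[abs_def]
        by (rule has_vector_derivative_eq_rhs[OF has_vector_derivative_mult_right[OF has_vector_derivative_mult_right[OF duhamel_has_vector_derivative[OF jw t]]]])
           (simp only: p'_def wave_def alg)
      have "((\<lambda>\<tau>. ift (wave T a c w \<tau>) x) has_vector_derivative ift (p' t) x) (at t within {0..T})"
      proof (rule ift_has_time_derivative[OF r p t d])
        show "p' t \<in> borel_measurable borel"
        proof -
          have [measurable]: "w t \<in> borel_measurable borel" "wave T a c w t \<in> borel_measurable borel"
            using p jcont_measurable[OF jw] by (auto simp: expdec_def intro: jcont_measurable)
          show ?thesis unfolding p'_def[abs_def] by measurable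
        qed
        fix t \<xi>
        have "norm (p' t \<xi>) \<le> norm (of_real a * (\<i> * of_real \<xi> * w t \<xi>)) + norm (of_real c * (\<i> * of_real \<xi> * wave T a c w t \<xi>))"
          unfolding p'_def by (rule norm_triangle_ineq4)
        also have "\<dots> = \<bar>a\<bar> * (\<bar>\<xi>\<bar> * norm (w t \<xi>)) + \<bar>c\<bar> * (\<bar>\<xi>\<bar> * norm (wave T a c w t \<xi>))"
          by (simp add: norm_mult)
        also have "\<dots> \<le> \<bar>a\<bar> * (\<bar>\<xi>\<bar> * (Cw * exp (- r * \<bar>\<xi>\<bar>))) + \<bar>c\<bar> * (\<bar>\<xi>\<bar> * (C * exp (- r * \<bar>\<xi>\<bar>)))"
          by (intro add_mono mult_left_mono expdecD(1)[OF w] expdecD(1)[OF p]) auto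
        also have "\<dots> = (0 * \<xi>\<^sup>2 + (\<bar>a\<bar> * Cw + \<bar>c\<bar> * C) * \<bar>\<xi>\<bar> + 0) * exp (- r * \<bar>\<xi>\<bar>)" by (simp add: algebra_simps)
        finally show "norm (p' t \<xi>) \<le> (0 + (\<bar>a\<bar> * Cw + \<bar>c\<bar> * C) + 0) * ((1 + \<xi>\<^sup>2) powr 1 * exp (- r * \<bar>\<xi>\<bar>))"
          by (rule quadratic_exp_bound) (use expdecD(2)[OF w] expdecD(2)[OF p] in auto)
      qed
      also have "ift (p' t) x = of_real a * ift (\<lambda>\<xi>. \<i> * of_real \<xi> * w t \<xi>) x - of_real c * ift (\<lambda>\<xi>. \<i> * of_real \<xi> * wave T a c w t \<xi>) x"
        unfolding p'_def[abs_def]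
        using expdec_moment[OF w r, of 1 t] expdec_moment[OF p r, of 1 t] by (subst ift_diff) (auto simp: ift_cmult)
      finally have "((\<lambda>\<tau>. Re (ift (wave T a c w \<tau>) x)) has_vector_derivative
          Re (of_real a * ift (\<lambda>\<xi>. \<i> * of_real \<xi> * w t \<xi>) x - of_real c * ift (\<lambda>\<xi>. \<i> * of_real \<xi> * wave T a c w t \<xi>) x)) (at t within {0..T})"
        by (rule re)
      moreover have "vderiv (\<lambda>y. (cmod (ift (b t) y))\<^sup>2) x = Re (ift (\<lambda>\<xi>. \<i> * of_real \<xi> * w t \<xi>) x)"
      proof (rule vderiv_eqI)
        have "((\<lambda>y. Re (ift (w t) y)) has_vector_derivative Re (ift (\<lambda>\<xi>. \<i> * of_real \<xi> * w t \<xi>) x)) (at x)"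
          by (rule re, rule xd0[OF w])
        then show "((\<lambda>y. (cmod (ift (b t) y))\<^sup>2) has_vector_derivative Re (ift (\<lambda>\<xi>. \<i> * of_real \<xi> * w t \<xi>) x)) (at x)"
          by (simp add: dens[OF t])
      qed
      ultimately show ?thesis unfolding px[OF p] by simp
    qed
    show "((\<lambda>\<tau>. Re (ift (wave T a1 c1 w \<tau>) x)) has_vector_derivative
        a1 * vderiv (\<lambda>y. (cmod (ift (b t) y))\<^sup>2) x - c1 * vderiv (\<lambda>x. Re (ift (wave T a1 c1 w t) x)) x) (at t within {0..T})"
      by (rule waves[OF p1])
    show "((\<lambda>\<tau>. Re (ift (wave T a2 c2 w \<tau>) x)) has_vector_derivative
        a2 * vderiv (\<lambda>y. (cmod (ift (b t) y))\<^sup>2) x - c2 * vderiv (\<lambda>x. Re (ift (wave T a2 c2 w t) x)) x) (at t within {0..T})"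
      by (rule waves[OF p2])
  qed
qed

subsection \<open>Norm inflation with dispersion\<close>

definition zk_ivp ::
  "real \<Rightarrow> real \<Rightarrow> real \<Rightarrow> real \<Rightarrow> real \<Rightarrow> real \<Rightarrow> real \<Rightarrow> real \<Rightarrow> real \<Rightarrow> (real \<Rightarrow> complex) \<Rightarrow>
   (real \<Rightarrow> real \<Rightarrow> complex) \<Rightarrow> (real \<Rightarrow> real \<Rightarrow> real) \<Rightarrow> (real \<Rightarrow> real \<Rightarrow> real) \<Rightarrow> bool" where
  "zk_ivp \<omega> A1 A2 Q c1 a1 c2 a2 T f B p1 p2 \<longleftrightarrow>
     zk_solution \<omega> A1 A2 Q c1 a1 c2 a2 T B p1 p2 \<and> B 0 = f \<and> p1 0 = (\<lambda>_. 0) \<and> p2 0 = (\<lambda>_. 0)"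

lemma wave_sobolev_norm:
  assumes p: "expdec r C (wave T a c w)" and r: "0 < r" and sym: "\<And>t. cnj_refl (w t) = w t"
  shows "sobolev_norm l (\<lambda>x. of_real (Re (ift (wave T a c w t) x))) = sqrt (LINT \<xi>|lborel. (1 + \<xi>\<^sup>2) powr l * (cmod (wave T a c w t \<xi>))\<^sup>2)"
proof -
  have "of_real (Re (ift (wave T a c w t) x)) = ift (wave T a c w t) x" for x
    using ift_cnj_refl[of "wave T a c w t" x] unfolding wave_cnj_refl[OF sym]
    by (metis Reals_cnj_iff of_real_Re)
  then show ?thesis by (simp add: sobolev_norm_eq[OF has_fourier_ift[OF expdec_integrable[OF p r]]])
qed

lemma fourier_initial_data:
  assumes "0 \<le> T"
  shows "schroedinger T \<omega> f V b 0 = f" "ift (wave T a c w 0) x = 0"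
  using assms by (auto simp: schroedinger_def duhamel_def tclamp_def wave_def ift_eq)

lemma wgt_le:
  assumes "0 \<le> T" "0 \<le> \<delta>" "\<delta> * T \<le> \<rho> / 2" "0 \<le> \<Lambda>"
  shows "wgt \<rho> \<delta> \<Lambda> T t \<xi> \<le> exp (\<Lambda> * T) * exp (- (\<rho> / 2) * \<bar>\<xi>\<bar>)"
proof -
  have "\<delta> * tclamp T t \<le> \<rho> / 2" using mult_left_mono[OF tclamp_simps(2)[OF assms(1), of t] assms(2)] assms(3) by linarith
  then have "(\<rho> / 2) * \<bar>\<xi>\<bar> \<le> (\<rho> - \<delta> * tclamp T t) * \<bar>\<xi>\<bar>" by (intro mult_right_mono) auto
  moreover have "\<Lambda> * tclamp T t \<le> \<Lambda> * T" by (intro mult_left_mono tclamp_simps(2) assms)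
  ultimately show ?thesis unfolding wgt_def exp_add[symmetric] exp_le_cancel_iff by (simp add: minus_mult_left)
qed

lemma mult_right_le: "0 \<le> a \<Longrightarrow> b \<le> 1 \<Longrightarrow> a * b \<le> (a :: real)"
  by (simp add: mult_left_le)

text \<open>Telescoping of a bilinear expression. A supremum bound is wanted because the lower bound
  for the wave is pointwise in frequency.\<close>

lemma intensity_difference:
  assumes b: "majorized W R S b" and l: "majorized W R S l" and d: "majorized W R' S' (\<lambda>t \<xi>. b t \<xi> - l t \<xi>)"
    and W: "weight W" and W2: "\<And>t \<xi> \<eta>. W t (\<xi> - \<eta>) * W t \<eta> \<le> W t \<xi>" and W1: "\<And>t \<xi>. W t \<xi> \<le> 1"
  shows "cmod (intensity b t \<xi> - intensity l t \<xi>) \<le> S' * R + S * R'"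
proof -
  note cb = majorized_cnj_refl[OF b W] and cl = majorized_cnj_refl[OF l W] and cd = majorized_cnj_refl[OF d W]
  have e: "cnj_refl (\<lambda>\<xi>. b t \<xi> - l t \<xi>) = (\<lambda>\<xi>. cnj_refl (b t) \<xi> - cnj_refl (l t) \<xi>)" by (auto simp: cnj_refl_def)
  have "intensity b t \<xi> - intensity l t \<xi>
      = conv (\<lambda>\<xi>. b t \<xi> - l t \<xi>) (cnj_refl (b t)) \<xi> + conv (l t) (cnj_refl (\<lambda>\<xi>. b t \<xi> - l t \<xi>)) \<xi>"
  proof -
    have "conv (\<lambda>\<xi>. b t \<xi> - l t \<xi>) (cnj_refl (b t)) \<xi> = conv (b t) (cnj_refl (b t)) \<xi> - conv (l t) (cnj_refl (b t)) \<xi>"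
      by (rule conv_diff_left[OF b l cb W W])
    moreover have "conv (l t) (cnj_refl (\<lambda>\<xi>. b t \<xi> - l t \<xi>)) \<xi> = conv (l t) (cnj_refl (b t)) \<xi> - conv (l t) (cnj_refl (l t)) \<xi>"
      unfolding e by (rule conv_diff_right[OF cb cl l W W])
    ultimately show ?thesis unfolding intensity_def by simp
  qed
  then have "cmod (intensity b t \<xi> - intensity l t \<xi>) \<le> cmod (conv (\<lambda>\<xi>. b t \<xi> - l t \<xi>) (cnj_refl (b t)) \<xi>) + cmod (conv (l t) (cnj_refl (\<lambda>\<xi>. b t \<xi> - l t \<xi>)) \<xi>)"
    by (simp only: norm_triangle_ineq)
  moreover have "cmod (conv (\<lambda>\<xi>. b t \<xi> - l t \<xi>) (cnj_refl (b t)) \<xi>) \<le> S' * R"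
    by (rule order_trans[OF majorized_bound[OF majorized_conv[OF d cb W W W2] W] mult_right_le[OF mult_nonneg_nonneg[OF majorized_nonneg(2)[OF d] majorized_nonneg(1)[OF b]] W1]])
  moreover have "cmod (conv (l t) (cnj_refl (\<lambda>\<xi>. b t \<xi> - l t \<xi>)) \<xi>) \<le> S * R'"
    by (rule order_trans[OF majorized_bound[OF majorized_conv[OF l cd W W W2] W] mult_right_le[OF mult_nonneg_nonneg[OF majorized_nonneg(2)[OF l] majorized_nonneg(1)[OF d]] W1]])
  ultimately show ?thesis by linarith
qed

lemma ift_intensity:
  assumes "integrable lborel (b t)" shows "ift (intensity b t) x = of_real ((cmod (ift (b t) x))\<^sup>2)"
proof -
  have "integrable lborel (cnj_refl (b t))"
  proof -
    have "integrable lborel (\<lambda>\<eta>. cnj (b t (0 - \<eta>)))" by (intro integrable_cnj lborel_integrable_reflect assms)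
    then show ?thesis by (simp add: cnj_refl_def[abs_def])
  qed
  then show ?thesis unfolding intensity_def by (simp only: ift_conv[OF assms] ift_cnj_refl complex_norm_square)
qed

text \<open>Specialised to the interval [0,1]. \<open>K\<close> grows like
  \<open>1 / \<rho>\<close>, so a small analyticity radius must be paid for by small
  \<open>R\<close>. The closeness of \<open>w\<close> to the free intensity is what the lower bound
  for the wave requires.\<close>

lemma small_data_ivp:
  assumes \<rho>: "0 < \<rho>"
    and f: "continuous_on UNIV f" "integrable lborel (\<lambda>\<xi>. exp (\<rho> * \<bar>\<xi>\<bar>) * cmod (f \<xi>))"
      "(LINT \<xi>|lborel. exp (\<rho> * \<bar>\<xi>\<bar>) * cmod (f \<xi>)) \<le> R / 2" "\<And>\<xi>. exp (\<rho> * \<bar>\<xi>\<bar>) * cmod (f \<xi>) \<le> S / 2"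
    and RS: "0 \<le> R" "0 \<le> S"
    and K: "K = (\<bar>A1 * a1\<bar> + \<bar>A2 * a2\<bar>) * (2 / \<rho>) + \<bar>Q\<bar>" and small: "6 * K * R\<^sup>2 \<le> 1"
  obtains B p1 p2 w where "zk_ivp \<omega> A1 A2 Q c1 a1 c2 a2 1 (ift f) B p1 p2" "jcont w"
    "\<And>l t. integrable lborel (\<lambda>\<xi>. (1 + \<xi>\<^sup>2) powr l * (cmod (wave 1 a1 c1 w t \<xi>))\<^sup>2)"
    "\<And>l t. sobolev_norm l (\<lambda>x. of_real (p1 t x)) = sqrt (LINT \<xi>|lborel. (1 + \<xi>\<^sup>2) powr l * (cmod (wave 1 a1 c1 w t \<xi>))\<^sup>2)"
    "\<And>t \<xi>. cmod (w t \<xi> - intensity (\<lambda>t \<xi>. cis (- (\<omega> * \<xi>\<^sup>2 * tclamp 1 t)) * f \<xi>) t \<xi>) \<le> 2 * (K * R ^ 3 * S)"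
proof -
  let ?W = "wgt \<rho> (\<rho> / (2 * 1)) 0 1" and ?l = "\<lambda>t \<xi>. cis (- (\<omega> * \<xi>\<^sup>2 * tclamp 1 t)) * f \<xi>"
  have W: "weight ?W" using \<rho> by (intro wgt_weight) auto
  have W2: "?W t (\<xi> - \<eta>) * ?W t \<eta> \<le> ?W t \<xi>" for t \<xi> \<eta> using \<rho> by (intro wgt_mult_le) auto
  have We: "?W t \<xi> \<le> 1 * exp (- (\<rho> / 2) * \<bar>\<xi>\<bar>)" for t \<xi> using wgt_le[of 1 "\<rho> / (2 * 1)" \<rho> 0 t \<xi>] \<rho> by simp
  have W1: "?W t \<xi> \<le> 1" for t \<xi>
  proof -
    have "exp (- (\<rho> / 2) * \<bar>\<xi>\<bar>) \<le> 1" using \<rho> by simp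
    then show ?thesis using We[of t \<xi>] by linarith
  qed
  have K': "K = (\<bar>A1 * a1\<bar> + \<bar>A2 * a2\<bar>) * (2 * 1 / \<rho>) + \<bar>Q\<bar>" using K by simp
  have small': "6 * 1 * K * R\<^sup>2 \<le> 1" using small by simp
  obtain b where b: "majorized ?W R S b"
    and eq: "\<And>t \<xi>. b t \<xi> = schroedinger 1 \<omega> f (potential 1 A1 A2 Q c1 a1 c2 a2 (intensity b)) b t \<xi>"
    and rem: "majorized ?W (1 * (K * R ^ 3)) (1 * (K * R\<^sup>2 * S)) (\<lambda>t \<xi>. b t \<xi> - ?l t \<xi>)"
    by (rule small_data_solution[where \<omega> = \<omega> and ?c1.0 = c1 and ?c2.0 = c2, OF zero_less_one \<rho> f RS K' small']) (rule that)
  have l: "majorized ?W R S ?l"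
    using f RS \<rho> by (intro majorized_free) (auto intro: order_trans[OF f(3)] order_trans[OF f(4)])
  have w: "majorized ?W (R * R) (S * R) (intensity b)"
    unfolding intensity_def[abs_def] by (rule majorized_conv[OF b majorized_cnj_refl[OF b W] W W W2])
  have \<delta>: "0 < \<rho> / (2 * 1)" "\<rho> / (2 * 1) * 1 \<le> \<rho>" using \<rho> by auto
  note wv = majorized_wave[OF w zero_le_one \<delta>]
  note V = majorized_potential[OF w zero_le_one \<delta> refl]
  note G = majorized_conv[OF V b W W W2]
  note ed = majorized_expdec[OF _ W We]
  have r: "0 < \<rho> / 2" using \<rho> by simp
  note sym = intensity_cnj_refl[of b]
  have sol: "zk_solution \<omega> A1 A2 Q c1 a1 c2 a2 1 (\<lambda>t. ift (b t)) (\<lambda>t x. Re (ift (wave 1 a1 c1 (intensity b) t) x)) (\<lambda>t x. Re (ift (wave 1 a2 c2 (intensity b) t) x))"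
    by (rule fourier_solution[OF r ed[OF b] ed[OF w] ed[OF wv] ed[OF wv] ed[OF G] eq sym ift_intensity])
       (rule expdec_integrable[OF ed[OF b] r])
  have "b 0 = f" using fourier_initial_data(1)[OF zero_le_one] eq[of 0] by auto
  with sol have "zk_ivp \<omega> A1 A2 Q c1 a1 c2 a2 1 (ift f) (\<lambda>t. ift (b t)) (\<lambda>t x. Re (ift (wave 1 a1 c1 (intensity b) t) x)) (\<lambda>t x. Re (ift (wave 1 a2 c2 (intensity b) t) x))"
    by (simp add: zk_ivp_def fourier_initial_data)
  \<comment> \<open>Each of the two telescoping terms is at most \<open>K * R ^ 3 * S\<close>, from
    the two bounds in \<open>rem\<close>.\<close>
  moreover have "cmod (intensity b t \<xi> - intensity ?l t \<xi>) \<le> 2 * (K * R ^ 3 * S)" for t \<xi>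
    using intensity_difference[OF b l rem W W2 W1, of t \<xi>] by (simp add: power2_eq_square power3_eq_cube algebra_simps)
  ultimately show ?thesis
    by (intro that[of "\<lambda>t. ift (b t)" "\<lambda>t x. Re (ift (wave 1 a1 c1 (intensity b) t) x)" "\<lambda>t x. Re (ift (wave 1 a2 c2 (intensity b) t) x)" "intensity b"]
        majorized_jcont[OF w] expdec_square_integrable[OF ed[OF wv] r] wave_sobolev_norm[OF ed[OF wv] r sym])
qed

text \<open>The factor \<open>cis (c * \<xi> * s)\<close> undoes the propagation of the wave. If
  what remains has real part at least \<open>m\<close> throughout, the contributions of all times
  add up without cancellation, which gives linear growth in \<open>t\<close>.\<close>

lemma wave_lower_bound:
  assumes w: "jcont w" and t: "t \<in> {0..T}" and m: "\<And>s. s \<in> {0..t} \<Longrightarrow> m \<le> Re (cis (c * \<xi> * s) * w s \<xi>)"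
  shows "\<bar>a\<bar> * \<bar>\<xi>\<bar> * (t * m) \<le> cmod (wave T a c w t \<xi>)"
proof -
  let ?h = "\<lambda>s. cis (c * \<xi> * s) * w s \<xi>"
  have i: "?h integrable_on {0..t}"
    by (intro integrable_continuous_interval continuous_intros jcont_slice(2)[OF w])
  have "t * m = integral {0..t} (\<lambda>s. m)" using t by simp
  also have "\<dots> \<le> integral {0..t} (\<lambda>s. Re (?h s))"
    using m integrable_linear[OF i bounded_linear_Re] by (intro integral_le) (auto simp: o_def)
  also have "\<dots> = Re (integral {0..t} ?h)" using integral_linear[OF i bounded_linear_Re] by (simp add: o_def)
  also have "\<dots> \<le> cmod (integral {0..t} ?h)" by (rule complex_Re_le_cmod)
  finally have "\<bar>a\<bar> * \<bar>\<xi>\<bar> * (t * m) \<le> \<bar>a\<bar> * \<bar>\<xi>\<bar> * cmod (integral {0..t} ?h)" by (intro mult_left_mono) auto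
  then show ?thesis by (simp add: wave_def duhamel_def tclamp_simps(3)[OF t] norm_mult mult.assoc)
qed

lemma weighted_lower_bound:
  fixes a b :: real
  assumes i: "integrable lborel (\<lambda>\<xi>. (1 + \<xi>\<^sup>2) powr l * (cmod (u \<xi>))\<^sup>2)" and ab: "a \<le> b" and m: "0 \<le> m" "0 \<le> p"
    and u: "\<And>\<xi>. \<xi> \<in> {a..b} \<Longrightarrow> m \<le> cmod (u \<xi>)" and p: "\<And>\<xi>. \<xi> \<in> {a..b} \<Longrightarrow> p \<le> (1 + \<xi>\<^sup>2) powr l"
  shows "sqrt ((b - a) * p) * m \<le> sqrt (LINT \<xi>|lborel. (1 + \<xi>\<^sup>2) powr l * (cmod (u \<xi>))\<^sup>2)"
proof -
  have "(b - a) * p * m\<^sup>2 = (LINT \<xi>|lborel. indicator {a..b} \<xi> * (p * m\<^sup>2))" using ab by simp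
  also have "\<dots> \<le> (LINT \<xi>|lborel. (1 + \<xi>\<^sup>2) powr l * (cmod (u \<xi>))\<^sup>2)"
  proof (rule integral_mono[OF _ i])
    show "integrable lborel (\<lambda>\<xi>. indicator {a..b} \<xi> * (p * m\<^sup>2))"
      by (intro integrable_mult_left impI integrable_real_indicator) (auto simp: emeasure_lborel_Icc_eq)
    show "indicator {a..b} \<xi> * (p * m\<^sup>2) \<le> (1 + \<xi>\<^sup>2) powr l * (cmod (u \<xi>))\<^sup>2" for \<xi>
      using m p[of \<xi>] u[of \<xi>] by (auto simp: indicator_def intro!: mult_mono power_mono)
  qed
  finally have "sqrt ((b - a) * p * m\<^sup>2) \<le> sqrt (LINT \<xi>|lborel. (1 + \<xi>\<^sup>2) powr l * (cmod (u \<xi>))\<^sup>2)" by simp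
  then show ?thesis using m(1) by (simp add: real_sqrt_mult)
qed

section \<open>Gaussian bumps and their interaction\<close>

definition bump :: "real \<Rightarrow> real \<Rightarrow> real \<Rightarrow> real" where
  "bump L c \<xi> = exp (- ((L * (\<xi> - c))\<^sup>2 / 2))"

lemma bump_nonneg: "0 \<le> bump L c \<xi>" and bump_le_1: "bump L c \<xi> \<le> 1"
  by (auto simp: bump_def)

lemma bump_continuous: "continuous_on A (bump L c)"
  unfolding bump_def[abs_def] by (intro continuous_intros) simp

lemma bump_measurable [measurable]: "bump L c \<in> borel_measurable borel"
  by (intro borel_measurable_continuous_onI bump_continuous)

lemma bump_integrable: "0 < L \<Longrightarrow> integrable lborel (bump L c)"
  and bump_integral: "0 < L \<Longrightarrow> (LINT \<xi>|lborel. bump L c \<xi>) = sqrt (2 * pi) / L"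
  unfolding bump_def[abs_def] by (rule gauss_scaled_integrable; assumption)+

lemma ift_bump:
  assumes "0 < L" shows "ift (\<lambda>\<xi>. of_real (bump L c \<xi>)) = pgauss [:of_real (1 / L):] (1 / (2 * L\<^sup>2)) (\<i> * of_real c)"
proof
  fix x
  have "- of_real (1 / (2 * L\<^sup>2)) * (of_real x)\<^sup>2 = complex_of_real (- ((x / L)\<^sup>2 / 2))"
    by (simp add: power_divide)
  then have "exp (- of_real (1 / (2 * L\<^sup>2)) * (of_real x)\<^sup>2) = complex_of_real (exp (- ((x / L)\<^sup>2 / 2)))"
    by (simp only: exp_of_real)
  moreover have "exp (\<i> * of_real c * of_real x) = cis (x * c)" by (simp add: cis_conv_exp mult_ac)
  moreover have "ift (\<lambda>\<xi>. of_real (bump L c \<xi>)) x = of_real (1 / L) * of_real (exp (- ((x / L)\<^sup>2 / 2))) * cis (x * c)"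
    unfolding ift_eq bump_def gauss_cis_scaled[OF assms] by (simp add: field_simps)
  ultimately show "ift (\<lambda>\<xi>. of_real (bump L c \<xi>)) x = pgauss [:of_real (1 / L):] (1 / (2 * L\<^sup>2)) (\<i> * of_real c) x"
    unfolding pgauss_def exp_add by (simp only: poly_pCons poly_0 mult_zero_right add_0_right mult.assoc)
qed

text \<open>A bound linear in the phase is used because the phase is unbounded and only its first
  moment against the Gaussians is estimated.\<close>

lemma cos_ge_1_minus_abs: "1 - \<bar>x\<bar> \<le> cos (x :: real)"
proof -
  have "cos x = 1 - 2 * (sin (x / 2))\<^sup>2" using cos_double_sin[of "x / 2"] by simp
  moreover have "(sin (x / 2))\<^sup>2 \<le> \<bar>x\<bar> / 2"
  proof -
    have "(sin (x / 2))\<^sup>2 = \<bar>sin (x / 2)\<bar> * \<bar>sin (x / 2)\<bar>" by (simp add: power2_eq_square)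
    also have "\<dots> \<le> \<bar>sin (x / 2)\<bar> * 1" by (intro mult_left_mono) auto
    also have "\<dots> \<le> \<bar>x\<bar> / 2" using abs_sin_x_le_abs_x[of "x / 2"] by simp
    finally show ?thesis .
  qed
  ultimately show ?thesis by linarith
qed

text \<open>\<open>|x| * exp (- (x\<^sup>2 / 2)) \<le> 1\<close>, applied to one Gaussian at a time:
  the linear factor costs one of the two Gaussians, and the other one keeps the bound
  integrable.\<close>

lemma gauss_moment:
  fixes u v z :: real
  assumes z: "\<bar>z\<bar> \<le> 2 * (\<bar>u\<bar> + \<bar>v\<bar>)"
  shows "\<bar>z\<bar> * (exp (- (u\<^sup>2 / 2)) * exp (- (v\<^sup>2 / 2))) \<le> 2 * (exp (- (u\<^sup>2 / 2)) + exp (- (v\<^sup>2 / 2)))"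
proof -
  have m: "\<bar>x\<bar> * exp (- (x\<^sup>2 / 2)) \<le> 1" for x :: real
  proof -
    have "2 * \<bar>x\<bar> \<le> 1 + x\<^sup>2" using zero_le_power2[of "\<bar>x\<bar> - 1"] by (simp add: power2_diff)
    then have "\<bar>x\<bar> \<le> exp (x\<^sup>2 / 2)" using exp_ge_add_one_self[of "x\<^sup>2 / 2"] by linarith
    then have "\<bar>x\<bar> * exp (- (x\<^sup>2 / 2)) \<le> exp (x\<^sup>2 / 2) * exp (- (x\<^sup>2 / 2))" by (intro mult_right_mono) auto
    then show ?thesis by (simp flip: exp_add)
  qed
  have "\<bar>z\<bar> * (exp (- (u\<^sup>2 / 2)) * exp (- (v\<^sup>2 / 2))) \<le> (2 * (\<bar>u\<bar> + \<bar>v\<bar>)) * (exp (- (u\<^sup>2 / 2)) * exp (- (v\<^sup>2 / 2)))"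
    by (intro mult_right_mono z) auto
  also have "\<dots> = 2 * ((\<bar>u\<bar> * exp (- (u\<^sup>2 / 2))) * exp (- (v\<^sup>2 / 2)) + exp (- (u\<^sup>2 / 2)) * (\<bar>v\<bar> * exp (- (v\<^sup>2 / 2))))"
    by (simp add: algebra_simps)
  also have "\<dots> \<le> 2 * (1 * exp (- (v\<^sup>2 / 2)) + exp (- (u\<^sup>2 / 2)) * 1)"
    by (intro mult_left_mono add_mono mult_right_mono m) auto
  finally show ?thesis by simp
qed

text \<open>\<open>p\<close> and \<open>m\<close> are the rescaled offsets of the two factors of a
  convolution from the bump centres that interact resonantly; they differ by at most 1, and
  \<open>2 * X\<close> is the rescaled distance between the bumps. The main term is
  \<open>g p * g m\<close>. The phase is small where this product lives, and
  \<open>cos \<phi> \<ge> 1 - |\<phi>|\<close> together with \<open>gauss_moment\<close> bounds the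
  error over all four products.\<close>

lemma gauss_interaction:
  fixes p m X \<beta> \<phi> :: real
  defines "g \<equiv> \<lambda>x. exp (- (x\<^sup>2 / 2))"
  assumes pm: "0 \<le> p - m" "p - m \<le> 1" and X: "0 \<le> X" and \<phi>: "\<bar>\<phi>\<bar> \<le> \<beta> * \<bar>p + m\<bar>" and \<beta>: "0 \<le> \<beta>"
  shows "exp (- 1) * g (2 * m) - 4 * \<beta> * (g p + g (p + 2 * X) + g (m - 2 * X) + g m)
    \<le> cos \<phi> * ((g p + g (p + 2 * X)) * (g (m - 2 * X) + g m))"
proof -
  have g0: "0 \<le> g x" for x by (simp add: g_def)
  let ?G = "(g p + g (p + 2 * X)) * (g (m - 2 * X) + g m)"
  have G0: "0 \<le> ?G" by (intro mult_nonneg_nonneg add_nonneg_nonneg g0)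
  have pair: "\<bar>p + m\<bar> * (g u * g v) \<le> 2 * (g u + g v)" if "\<bar>p + m\<bar> \<le> 2 * (\<bar>u\<bar> + \<bar>v\<bar>)" for u v
    unfolding g_def by (rule gauss_moment[OF that])
  have "\<bar>p + m\<bar> * ?G = \<bar>p + m\<bar> * (g p * g (m - 2 * X)) + \<bar>p + m\<bar> * (g p * g m)
      + \<bar>p + m\<bar> * (g (p + 2 * X) * g (m - 2 * X)) + \<bar>p + m\<bar> * (g (p + 2 * X) * g m)"
    by (simp only: distrib_left distrib_right add.assoc)
  \<comment> \<open>\<open>m \<le> p\<close> and \<open>X \<ge> 0\<close> give the condition of
    \<open>gauss_moment\<close> for each pair: shifting \<open>p\<close> up or \<open>m\<close> down
    never makes the larger of the two magnitudes smaller.\<close>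
  also have "\<dots> \<le> 2 * (g p + g (m - 2 * X)) + 2 * (g p + g m) + 2 * (g (p + 2 * X) + g (m - 2 * X)) + 2 * (g (p + 2 * X) + g m)"
    using pm X by (intro add_mono pair) (auto simp: abs_if split: if_splits)
  finally have 1: "\<bar>p + m\<bar> * ?G \<le> 4 * (g p + g (p + 2 * X) + g (m - 2 * X) + g m)" by simp
  have "\<bar>\<phi>\<bar> * ?G \<le> (\<beta> * \<bar>p + m\<bar>) * ?G" by (rule mult_right_mono[OF \<phi> G0])
  also have "\<dots> \<le> \<beta> * (4 * (g p + g (p + 2 * X) + g (m - 2 * X) + g m))"
    unfolding mult.assoc using 1 \<beta> by (intro mult_left_mono) auto
  finally have 2: "\<bar>\<phi>\<bar> * ?G \<le> 4 * \<beta> * (g p + g (p + 2 * X) + g (m - 2 * X) + g m)" by (simp add: algebra_simps)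
  \<comment> \<open>\<open>|p - m| \<le> 1\<close> gives
    \<open>p\<^sup>2 \<le> 2 * m\<^sup>2 + 2\<close>, so the product is bounded below by a single
    Gaussian, whose integral is known.\<close>
  have 3: "exp (- 1) * g (2 * m) \<le> g p * g m"
  proof -
    have "(p - m)\<^sup>2 \<le> 1" using pm by (simp add: power_le_one)
    moreover have "2 * m\<^sup>2 + 2 * (p - m)\<^sup>2 - p\<^sup>2 = (p - 2 * m)\<^sup>2" by (simp add: power2_eq_square algebra_simps)
    ultimately have "p\<^sup>2 \<le> 2 * m\<^sup>2 + 2" using zero_le_power2[of "p - 2 * m"] by linarith
    moreover have "(2 * m)\<^sup>2 = 4 * m\<^sup>2" by (simp add: power2_eq_square)
    ultimately show ?thesis unfolding g_def exp_add[symmetric] exp_le_cancel_iff using zero_le_power2[of m] by linarith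
  qed
  have "g p * g m \<le> ?G" using g0[of p] g0[of m] g0[of "p + 2 * X"] g0[of "m - 2 * X"]
    by (intro mult_mono) auto
  moreover have "(1 - \<bar>\<phi>\<bar>) * ?G \<le> cos \<phi> * ?G" by (intro mult_right_mono cos_ge_1_minus_abs G0)
  moreover have "(1 - \<bar>\<phi>\<bar>) * ?G = ?G - \<bar>\<phi>\<bar> * ?G" by (simp add: left_diff_distrib)
  ultimately show ?thesis using 2 3 by linarith
qed

text \<open>Up to constants, \<open>A\<close> is the L1 norm, \<open>A * L\<close> the height, and
  \<open>1 / L\<close> the width of each bump.\<close>

definition packet :: "real \<Rightarrow> real \<Rightarrow> real \<Rightarrow> real \<Rightarrow> real \<Rightarrow> real" where
  "packet A L \<kappa> N \<xi> = A * L * (bump L (\<kappa> + N) \<xi> + bump L (\<kappa> - N) \<xi>)"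

lemma bump_reflect: "bump L c (\<xi> - \<eta>) = bump L (\<xi> - c) \<eta>"
proof -
  have "(L * (\<xi> - \<eta> - c))\<^sup>2 = (L * (\<eta> - (\<xi> - c)))\<^sup>2" by (simp add: power2_eq_square algebra_simps)
  then show ?thesis by (simp add: bump_def)
qed

text \<open>The two spectral bumps sit at \<open>\<kappa> \<plusminus> N\<close>, so that the phase \<open>s \<omega> \<xi> (2 \<kappa> - \<xi> + 2 \<eta>)\<close> of the integrand vanishes
  where their product concentrates.\<close>

lemma packet_intensity_lower_bound:
  assumes A: "0 \<le> A" and L: "1 \<le> L" and N: "1 \<le> N" and \<xi>: "\<xi> \<in> {2 * N..2 * N + 1 / L}" and s: "s \<in> {0..1}"
  shows "A\<^sup>2 * L * (exp (- 1) / 2 - 48 * \<bar>\<omega>\<bar> * N / L)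
    \<le> Re (cis (2 * \<omega> * \<kappa> * \<xi> * s) * intensity (\<lambda>t \<xi>. cis (- (\<omega> * \<xi>\<^sup>2 * tclamp 1 t)) * of_real (packet A L \<kappa> N \<xi>)) s \<xi>)"
proof -
  let ?F = "packet A L \<kappa> N" and ?k = "1 / sqrt (2 * pi)"
  define \<phi> where "\<phi> \<eta> = \<omega> * \<xi> * s * (2 * \<kappa> - \<xi> + 2 * \<eta>)" for \<eta>
  define G where "G \<eta> = ?F (\<xi> - \<eta>) * ?F (0 - \<eta>)" for \<eta>
  have L0: "0 < L" using L by simp
  have F0: "0 \<le> ?F \<eta>" for \<eta> unfolding packet_def using A L0 by (intro mult_nonneg_nonneg add_nonneg_nonneg bump_nonneg) auto
  have F1: "?F \<eta> \<le> A * L * (1 + 1)" for \<eta> unfolding packet_def using A L0 by (intro mult_left_mono add_mono bump_le_1) auto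
  have Fi: "integrable lborel ?F" unfolding packet_def[abs_def]
    by (intro integrable_mult_right impI Bochner_Integration.integrable_add bump_integrable L0)
  have Fm [measurable]: "?F \<in> borel_measurable borel" unfolding packet_def[abs_def] by measurable
  have Gi: "integrable lborel G"
  proof (rule Bochner_Integration.integrable_bound)
    show "integrable lborel (\<lambda>\<eta>. A * L * (1 + 1) * ?F (0 - \<eta>))"
      by (intro integrable_mult_right impI lborel_integrable_reflect Fi)
    show "G \<in> borel_measurable lborel" unfolding G_def[abs_def] by measurable
    show "AE \<eta> in lborel. norm (G \<eta>) \<le> norm (A * L * (1 + 1) * ?F (0 - \<eta>))"
      unfolding G_def using F0 F1 A L0 by (intro AE_I2) (auto simp: abs_mult intro!: mult_right_mono)
  qed
  have ci: "integrable lborel (\<lambda>\<eta>. cis (\<phi> \<eta>) * of_real (G \<eta>))"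
  proof (rule Bochner_Integration.integrable_bound[OF Gi])
    show "(\<lambda>\<eta>. cis (\<phi> \<eta>) * of_real (G \<eta>)) \<in> borel_measurable lborel"
      unfolding G_def \<phi>_def by (intro borel_measurable_times borel_measurable_of_real borel_measurable_continuous_onI continuous_intros) measurable
  qed (auto simp: norm_mult)
  \<comment> \<open>The terms quadratic in \<open>\<eta>\<close> cancel between the two free
    propagators, so the phase is affine in \<open>\<eta>\<close>.\<close>
  have int: "cis (2 * \<omega> * \<kappa> * \<xi> * s) * ((cis (- (\<omega> * (\<xi> - \<eta>)\<^sup>2 * tclamp 1 s)) * of_real (?F (\<xi> - \<eta>)))
      * cnj (cis (- (\<omega> * (- \<eta>)\<^sup>2 * tclamp 1 s)) * of_real (?F (- \<eta>)))) = cis (\<phi> \<eta>) * of_real (G \<eta>)" for \<eta>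
  proof -
    have "\<phi> \<eta> = 2 * \<omega> * \<kappa> * \<xi> * s + (- (\<omega> * (\<xi> - \<eta>)\<^sup>2 * s) + \<omega> * (- \<eta>)\<^sup>2 * s)"
      by (simp add: \<phi>_def power2_eq_square algebra_simps)
    then have "cis (\<phi> \<eta>) = cis (2 * \<omega> * \<kappa> * \<xi> * s) * (cis (- (\<omega> * (\<xi> - \<eta>)\<^sup>2 * s)) * cis (\<omega> * (- \<eta>)\<^sup>2 * s))"
      by (simp only: cis_mult)
    then show ?thesis
      by (simp add: G_def tclamp_simps(3)[OF s] cis_cnj mult_ac)
  qed
  have "cis (2 * \<omega> * \<kappa> * \<xi> * s) * intensity (\<lambda>t \<xi>. cis (- (\<omega> * \<xi>\<^sup>2 * tclamp 1 t)) * of_real (packet A L \<kappa> N \<xi>)) s \<xi>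
      = of_real ?k * (LINT \<eta>|lborel. cis (\<phi> \<eta>) * of_real (G \<eta>))"
    unfolding intensity_def conv_def cnj_refl_def int[symmetric] integral_mult_right_zero by (simp only: mult_ac)
  then have "Re (cis (2 * \<omega> * \<kappa> * \<xi> * s) * intensity (\<lambda>t \<xi>. cis (- (\<omega> * \<xi>\<^sup>2 * tclamp 1 t)) * of_real (packet A L \<kappa> N \<xi>)) s \<xi>)
      = ?k * Re (LINT \<eta>|lborel. cis (\<phi> \<eta>) * of_real (G \<eta>))" by simp
  also have "Re (LINT \<eta>|lborel. cis (\<phi> \<eta>) * of_real (G \<eta>)) = (LINT \<eta>|lborel. cos (\<phi> \<eta>) * G \<eta>)"
    using integral_Re[OF ci] by simp
  finally have Re: "Re (cis (2 * \<omega> * \<kappa> * \<xi> * s) * intensity (\<lambda>t \<xi>. cis (- (\<omega> * \<xi>\<^sup>2 * tclamp 1 t)) * of_real (packet A L \<kappa> N \<xi>)) s \<xi>)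
      = ?k * (LINT \<eta>|lborel. cos (\<phi> \<eta>) * G \<eta>)" .
  have cGi: "integrable lborel (\<lambda>\<eta>. cos (\<phi> \<eta>) * G \<eta>)" using integrable_Re[OF ci] by simp
  \<comment> \<open>\<open>\<xi> \<le> 3 * N\<close> and \<open>s \<le> 1\<close> bound the phase by
    \<open>3 * N * |\<omega>|\<close> times \<open>|2 * \<kappa> - \<xi> + 2 * \<eta>|\<close>, and
    the latter equals \<open>|p + m| / L\<close>.\<close>
  define \<beta> where "\<beta> = 3 * N * \<bar>\<omega>\<bar> / L"
  define H where "H \<eta> = exp (- 1) * bump (2 * L) (N - \<kappa>) \<eta> - 4 * \<beta> * (bump L (\<xi> - (\<kappa> + N)) \<eta> + bump L (\<xi> - (\<kappa> - N)) \<eta>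
      + bump L (0 - (\<kappa> + N)) \<eta> + bump L (0 - (\<kappa> - N)) \<eta>)" for \<eta>
  have Hi: "integrable lborel (\<lambda>\<eta>. A\<^sup>2 * L\<^sup>2 * H \<eta>)" unfolding H_def using L0
    by (intro integrable_mult_right impI Bochner_Integration.integrable_add Bochner_Integration.integrable_diff bump_integrable) auto
  have "A\<^sup>2 * L\<^sup>2 * H \<eta> \<le> cos (\<phi> \<eta>) * G \<eta>" for \<eta>
  proof -
    define p m where "p = L * (\<xi> - \<eta> - (\<kappa> + N))" and "m = L * (0 - \<eta> - (\<kappa> - N))"
    have pm: "p - m = L * (\<xi> - 2 * N)" "p + m = - (L * (2 * \<kappa> - \<xi> + 2 * \<eta>))" by (simp_all add: p_def m_def algebra_simps)
    have p2: "p + 2 * (L * N) = L * (\<xi> - \<eta> - (\<kappa> - N))" and m2: "m - 2 * (L * N) = L * (0 - \<eta> - (\<kappa> + N))"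
      by (simp_all add: p_def m_def algebra_simps)
    have "0 \<le> p - m" unfolding pm using L0 \<xi> by (intro mult_nonneg_nonneg) auto
    moreover have "p - m \<le> 1"
    proof -
      have "L * (\<xi> - 2 * N) \<le> L * (1 / L)" using L0 \<xi> by (intro mult_left_mono) auto
      then show ?thesis unfolding pm using L0 by simp
    qed
    moreover have "0 \<le> L * N" using L0 N by simp
    moreover have "\<bar>\<phi> \<eta>\<bar> \<le> \<beta> * \<bar>p + m\<bar>"
    proof -
      have "1 / L \<le> 1" using L by simp
      then have "\<bar>\<xi>\<bar> \<le> 3 * N" using \<xi> N by auto
      then have "\<bar>\<xi>\<bar> * \<bar>s\<bar> \<le> 3 * N * 1" using s by (intro mult_mono) auto
      then have "\<bar>\<omega>\<bar> * (\<bar>\<xi>\<bar> * \<bar>s\<bar>) * \<bar>2 * \<kappa> - \<xi> + 2 * \<eta>\<bar> \<le> \<bar>\<omega>\<bar> * (3 * N * 1) * \<bar>2 * \<kappa> - \<xi> + 2 * \<eta>\<bar>"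
        by (intro mult_right_mono mult_left_mono) auto
      moreover have "\<bar>\<phi> \<eta>\<bar> = \<bar>\<omega>\<bar> * (\<bar>\<xi>\<bar> * \<bar>s\<bar>) * \<bar>2 * \<kappa> - \<xi> + 2 * \<eta>\<bar>" by (simp add: \<phi>_def abs_mult mult.assoc)
      moreover have "\<beta> * \<bar>p + m\<bar> = \<bar>\<omega>\<bar> * (3 * N * 1) * \<bar>2 * \<kappa> - \<xi> + 2 * \<eta>\<bar>" unfolding pm \<beta>_def using L0 by (simp add: abs_mult)
      ultimately show ?thesis by simp
    qed
    moreover have "0 \<le> \<beta>" unfolding \<beta>_def using L0 N by simp
    ultimately have "exp (- 1) * exp (- ((2 * m)\<^sup>2 / 2)) - 4 * \<beta> * (exp (- (p\<^sup>2 / 2)) + exp (- ((p + 2 * (L * N))\<^sup>2 / 2)) + exp (- ((m - 2 * (L * N))\<^sup>2 / 2)) + exp (- (m\<^sup>2 / 2)))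
      \<le> cos (\<phi> \<eta>) * ((exp (- (p\<^sup>2 / 2)) + exp (- ((p + 2 * (L * N))\<^sup>2 / 2))) * (exp (- ((m - 2 * (L * N))\<^sup>2 / 2)) + exp (- (m\<^sup>2 / 2))))"
      by (rule gauss_interaction)
    moreover have "exp (- ((2 * m)\<^sup>2 / 2)) = bump (2 * L) (N - \<kappa>) \<eta>"
    proof -
      have "(2 * m)\<^sup>2 = (2 * L * (\<eta> - (N - \<kappa>)))\<^sup>2" by (simp add: m_def power2_eq_square algebra_simps)
      then show ?thesis by (simp add: bump_def)
    qed
    ultimately have "H \<eta> \<le> cos (\<phi> \<eta>) * ((bump L (\<xi> - (\<kappa> + N)) \<eta> + bump L (\<xi> - (\<kappa> - N)) \<eta>) * (bump L (0 - (\<kappa> + N)) \<eta> + bump L (0 - (\<kappa> - N)) \<eta>))"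
      unfolding H_def p2 m2 unfolding p_def m_def unfolding bump_def[symmetric] bump_reflect by simp
    then have "A\<^sup>2 * L\<^sup>2 * H \<eta> \<le> A\<^sup>2 * L\<^sup>2 * (cos (\<phi> \<eta>) * ((bump L (\<xi> - (\<kappa> + N)) \<eta> + bump L (\<xi> - (\<kappa> - N)) \<eta>) * (bump L (0 - (\<kappa> + N)) \<eta> + bump L (0 - (\<kappa> - N)) \<eta>)))"
      by (intro mult_left_mono) auto
    also have "\<dots> = cos (\<phi> \<eta>) * G \<eta>" unfolding G_def packet_def bump_reflect by (simp add: power2_eq_square mult_ac)
    finally show ?thesis .
  qed
  then have "(LINT \<eta>|lborel. A\<^sup>2 * L\<^sup>2 * H \<eta>) \<le> (LINT \<eta>|lborel. cos (\<phi> \<eta>) * G \<eta>)" by (intro integral_mono Hi cGi)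
  moreover have "(LINT \<eta>|lborel. A\<^sup>2 * L\<^sup>2 * H \<eta>) = A\<^sup>2 * L\<^sup>2 * (exp (- 1) * (sqrt (2 * pi) / (2 * L)) - 4 * \<beta> * (4 * (sqrt (2 * pi) / L)))"
    unfolding H_def using L0
    by (simp add: bump_integrable bump_integral)
  \<comment> \<open>48 is \<open>4 * 4 * 3\<close>: the factor 4 of
    \<open>gauss_interaction\<close>, four Gaussians, and the 3 in \<open>\<beta>\<close>. The
    \<open>1 / 2\<close> comes from the bump of scale \<open>2 * L\<close>.\<close>
  moreover have "?k * (A\<^sup>2 * L\<^sup>2 * (exp (- 1) * (sqrt (2 * pi) / (2 * L)) - 4 * \<beta> * (4 * (sqrt (2 * pi) / L)))) = A\<^sup>2 * L * (exp (- 1) / 2 - 48 * \<bar>\<omega>\<bar> * N / L)"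
    unfolding \<beta>_def using L0 by (simp add: power2_eq_square divide_simps algebra_simps)
  ultimately show ?thesis
    unfolding Re using mult_left_mono[of "LINT \<eta>|lborel. A\<^sup>2 * L\<^sup>2 * H \<eta>" "LINT \<eta>|lborel. cos (\<phi> \<eta>) * G \<eta>" ?k] inv_sqrt_2pi(1)
    by (simp only: less_imp_le)
qed

text \<open>Near bump centres at distance about \<open>N\<close> from the origin,
  \<open>exp (|\<xi>| / N)\<close> is bounded; its growth away from them is absorbed by replacing
  the scale \<open>L\<close> by \<open>L / 2\<close>. This is why the analyticity radius is taken as
  \<open>1 / N\<close>.\<close>

lemma packet_weighted_bound:
  assumes A: "0 \<le> A" and L: "1 \<le> L" and N: "1 \<le> N" and \<kappa>: "\<bar>\<kappa>\<bar> \<le> M"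
  shows "integrable lborel (\<lambda>\<xi>. exp (1 / N * \<bar>\<xi>\<bar>) * cmod (of_real (packet A L \<kappa> N \<xi>)))"
    and "(LINT \<xi>|lborel. exp (1 / N * \<bar>\<xi>\<bar>) * cmod (of_real (packet A L \<kappa> N \<xi>))) \<le> 16 * exp (M + 2) * A"
    and "exp (1 / N * \<bar>\<xi>\<bar>) * cmod (of_real (packet A L \<kappa> N \<xi>)) \<le> 16 * exp (M + 2) * A * L"
proof -
  have L0: "0 < L" using L by simp
  have sh: "exp (1 / N * \<bar>\<xi>\<bar>) * bump L (\<kappa> + n) \<xi> \<le> exp (M + 2) * bump (L / 2) (\<kappa> + n) \<xi>" if n: "\<bar>n\<bar> = N" for n \<xi>
  proof -
    let ?y = "L * (\<xi> - (\<kappa> + n))"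
    have "\<bar>\<xi>\<bar> \<le> \<bar>\<xi> - (\<kappa> + n)\<bar> + M + N" using \<kappa> n by linarith
    also have "\<dots> \<le> N * (\<bar>?y\<bar> + M + 1)"
    proof -
      have "\<bar>\<xi> - (\<kappa> + n)\<bar> * 1 \<le> \<bar>\<xi> - (\<kappa> + n)\<bar> * L" using L by (intro mult_left_mono) auto
      moreover have "1 * (\<bar>?y\<bar> + M) \<le> N * (\<bar>?y\<bar> + M)" using N \<kappa> by (intro mult_right_mono) auto
      ultimately show ?thesis using L0 by (simp add: abs_mult distrib_left mult.commute)
    qed
    finally have "1 / N * \<bar>\<xi>\<bar> \<le> \<bar>?y\<bar> + M + 1" using N by (simp add: field_simps)
    moreover have "\<bar>?y\<bar> - ?y\<^sup>2 / 2 \<le> 1 - ?y\<^sup>2 / 4" using zero_le_power2[of "\<bar>?y\<bar> / 2 - 1"] by (simp add: power2_diff power_divide)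
    moreover have "(L / 2 * (\<xi> - (\<kappa> + n)))\<^sup>2 / 2 = ?y\<^sup>2 / 8" by (simp add: power_mult_distrib power_divide)
    ultimately have "1 / N * \<bar>\<xi>\<bar> + - (?y\<^sup>2 / 2) \<le> (M + 2) + - ((L / 2 * (\<xi> - (\<kappa> + n)))\<^sup>2 / 2)"
      using zero_le_power2[of ?y] by linarith
    then show ?thesis unfolding bump_def by (simp flip: exp_add)
  qed
  have AL: "0 \<le> A * L" using A L0 by simp
  let ?h = "\<lambda>\<xi>. A * L * (exp (M + 2) * (bump (L / 2) (\<kappa> + N) \<xi> + bump (L / 2) (\<kappa> - N) \<xi>))"
  have hi: "integrable lborel ?h" using L0
    by (intro integrable_mult_right impI Bochner_Integration.integrable_add bump_integrable) auto
  have P0: "0 \<le> packet A L \<kappa> N \<xi>" for \<xi> unfolding packet_def by (intro mult_nonneg_nonneg[OF AL] add_nonneg_nonneg bump_nonneg)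
  have le: "exp (1 / N * \<bar>\<xi>\<bar>) * cmod (of_real (packet A L \<kappa> N \<xi>)) \<le> ?h \<xi>" for \<xi>
  proof -
    have "A * L * (exp (1 / N * \<bar>\<xi>\<bar>) * bump L (\<kappa> + N) \<xi> + exp (1 / N * \<bar>\<xi>\<bar>) * bump L (\<kappa> + - N) \<xi>)
        \<le> A * L * (exp (M + 2) * bump (L / 2) (\<kappa> + N) \<xi> + exp (M + 2) * bump (L / 2) (\<kappa> + - N) \<xi>)"
      using N by (intro mult_left_mono[OF _ AL] add_mono sh) auto
    then show ?thesis unfolding norm_of_real abs_of_nonneg[OF P0] by (simp add: packet_def algebra_simps)
  qed
  show i: "integrable lborel (\<lambda>\<xi>. exp (1 / N * \<bar>\<xi>\<bar>) * cmod (of_real (packet A L \<kappa> N \<xi>)))"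
    by (rule Bochner_Integration.integrable_bound[OF hi])
       (use le P0 order_trans[OF le abs_ge_self] in \<open>auto simp: packet_def\<close>)
  have "(LINT \<xi>|lborel. exp (1 / N * \<bar>\<xi>\<bar>) * cmod (of_real (packet A L \<kappa> N \<xi>))) \<le> (LINT \<xi>|lborel. ?h \<xi>)"
    by (intro integral_mono i hi le)
  also have "\<dots> = 4 * sqrt (2 * pi) * (exp (M + 2) * A)" using L0 by (simp add: bump_integrable bump_integral)
  also have "\<dots> \<le> 16 * (exp (M + 2) * A)"
  proof -
    have "sqrt (2 * pi) \<le> 4" using pi_less_4 by (intro real_le_lsqrt) auto
    then show ?thesis using A by (intro mult_right_mono) auto
  qed
  finally show "(LINT \<xi>|lborel. exp (1 / N * \<bar>\<xi>\<bar>) * cmod (of_real (packet A L \<kappa> N \<xi>))) \<le> 16 * exp (M + 2) * A" by simp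
  have "?h \<xi> \<le> A * L * (exp (M + 2) * (1 + 1))" using AL by (intro mult_left_mono add_mono bump_le_1) auto
  with le[of \<xi>] have "exp (1 / N * \<bar>\<xi>\<bar>) * cmod (of_real (packet A L \<kappa> N \<xi>)) \<le> 2 * (exp (M + 2) * A * L)" by (simp add: mult_ac)
  also have "\<dots> \<le> 16 * (exp (M + 2) * A * L)" using A L0 by simp
  finally show "exp (1 / N * \<bar>\<xi>\<bar>) * cmod (of_real (packet A L \<kappa> N \<xi>)) \<le> 16 * exp (M + 2) * A * L" by (simp add: mult.assoc)
qed

text \<open>At the bumps the weight is at most of order \<open>N powr (2 * k)\<close>; away from the
  centre it grows at most like \<open>1 + y\<^sup>2\<close> in the rescaled distance
  \<open>y\<close>, because \<open>k \<le> 1\<close>, and one of the two Gaussian factors absorbs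
  this. The variable order \<open>k' \<le> k\<close> lets \<open>k = 0\<close> cover all negative
  orders.\<close>

lemma packet_sobolev_norm:
  assumes A: "0 \<le> A" and L: "1 \<le> L" and N: "1 \<le> N" and k: "0 \<le> k" "k \<le> 1" "k' \<le> k"
  shows "sobolev_norm k' (ift (\<lambda>\<xi>. of_real (packet A L \<kappa> N \<xi>))) \<le> sqrt (48 * (4 + 3 * \<kappa>\<^sup>2) * (A\<^sup>2 * L * N powr (2 * k)))"
proof -
  let ?C = "4 + 3 * \<kappa>\<^sup>2"
  have L0: "0 < L" using L by simp
  have C1: "1 \<le> ?C" using zero_le_power2[of \<kappa>] by linarith
  have w: "(1 + \<xi>\<^sup>2) powr k' * (bump L (\<kappa> + n) \<xi>)\<^sup>2 \<le> (?C * N powr (2 * k)) * (2 * bump L (\<kappa> + n) \<xi>)" if n: "\<bar>n\<bar> = N" for n \<xi>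
  proof -
    let ?z = "\<xi> - (\<kappa> + n)"
    define y where "y = L * ?z"
    have z: "?z\<^sup>2 \<le> y\<^sup>2"
    proof -
      have "1 * ?z\<^sup>2 \<le> L\<^sup>2 * ?z\<^sup>2" using L by (intro mult_right_mono) (auto intro: one_le_power)
      then show ?thesis by (simp add: y_def power_mult_distrib)
    qed
    have n2: "n\<^sup>2 = N\<^sup>2" using n by (metis power2_abs)
    have N1: "1 \<le> N\<^sup>2" using N by (simp add: one_le_power)
    \<comment> \<open>Cauchy-Schwarz for three summands, as an explicit sum of squares.\<close>
    have "3 * (\<kappa>\<^sup>2 + n\<^sup>2 + ?z\<^sup>2) - \<xi>\<^sup>2 = (\<kappa> - n)\<^sup>2 + (\<kappa> - ?z)\<^sup>2 + (n - ?z)\<^sup>2" by (simp add: power2_eq_square algebra_simps)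
    moreover have "0 \<le> (\<kappa> - n)\<^sup>2 + (\<kappa> - ?z)\<^sup>2 + (n - ?z)\<^sup>2" by (intro add_nonneg_nonneg) auto
    ultimately have "1 + \<xi>\<^sup>2 \<le> 1 + 3 * (\<kappa>\<^sup>2 + n\<^sup>2 + ?z\<^sup>2)" by linarith
    also have "\<dots> \<le> (1 + 3 * \<kappa>\<^sup>2) * 1 + 3 * N\<^sup>2 + 3 * y\<^sup>2 * 1" using z n2 by simp
    also have "\<dots> \<le> (1 + 3 * \<kappa>\<^sup>2) * N\<^sup>2 + 3 * N\<^sup>2 + 3 * y\<^sup>2 * N\<^sup>2" using N1 by (intro add_mono mult_left_mono) auto
    also have "\<dots> \<le> ?C * N\<^sup>2 * (1 + y\<^sup>2)"
    proof -
      have "0 \<le> (1 + 3 * \<kappa>\<^sup>2) * (N\<^sup>2 * y\<^sup>2)" by simp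
      then show ?thesis by (simp add: algebra_simps)
    qed
    finally have le: "1 + \<xi>\<^sup>2 \<le> ?C * N\<^sup>2 * (1 + y\<^sup>2)" .
    have "(1 + \<xi>\<^sup>2) powr k' \<le> (1 + \<xi>\<^sup>2) powr k" using k by (intro powr_mono) auto
    also have "\<dots> \<le> (?C * N\<^sup>2 * (1 + y\<^sup>2)) powr k" using le k by (intro powr_mono2) auto
    also have "\<dots> = ?C powr k * (N powr (2 * k)) * (1 + y\<^sup>2) powr k"
      using C1 N by (simp add: powr_mult powr_powr flip: powr_numeral)
    also have "\<dots> \<le> ?C * (N powr (2 * k)) * (1 + y\<^sup>2)"
      using powr_mono[of k 1 ?C] powr_mono[of k 1 "1 + y\<^sup>2"] k C1 by (intro mult_mono) auto
    finally have "(1 + \<xi>\<^sup>2) powr k' * (bump L (\<kappa> + n) \<xi>)\<^sup>2 \<le> ?C * (N powr (2 * k)) * (1 + y\<^sup>2) * (bump L (\<kappa> + n) \<xi>)\<^sup>2"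
      by (intro mult_right_mono) auto
    also have "\<dots> = ?C * (N powr (2 * k)) * (((1 + y\<^sup>2) * bump L (\<kappa> + n) \<xi>) * bump L (\<kappa> + n) \<xi>)" by (simp add: power2_eq_square mult_ac)
    also have "\<dots> \<le> ?C * (N powr (2 * k)) * (2 * bump L (\<kappa> + n) \<xi>)"
    proof -
      have "1 + y\<^sup>2 \<le> 2 * exp (y\<^sup>2 / 2)" using exp_ge_add_one_self[of "y\<^sup>2 / 2"] by linarith
      then have "(1 + y\<^sup>2) * bump L (\<kappa> + n) \<xi> \<le> 2 * exp (y\<^sup>2 / 2) * bump L (\<kappa> + n) \<xi>" by (intro mult_right_mono bump_nonneg)
      also have "\<dots> = 2" unfolding bump_def y_def by (simp flip: exp_add)
      finally show ?thesis using C1 by (intro mult_left_mono mult_right_mono bump_nonneg) auto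
    qed
    finally show ?thesis by (simp add: mult.assoc)
  qed
  let ?b = "\<lambda>n \<xi>. bump L (\<kappa> + n) \<xi>"
  let ?h = "\<lambda>\<xi>. 4 * (A * L)\<^sup>2 * (?C * N powr (2 * k)) * (?b N \<xi> + ?b (- N) \<xi>)"
  have hi: "integrable lborel ?h" using L0
    by (intro integrable_mult_right impI Bochner_Integration.integrable_add bump_integrable) auto
  have le: "(1 + \<xi>\<^sup>2) powr k' * (packet A L \<kappa> N \<xi>)\<^sup>2 \<le> ?h \<xi>" for \<xi>
  proof -
    have "(?b N \<xi> + ?b (- N) \<xi>)\<^sup>2 \<le> 2 * ((?b N \<xi>)\<^sup>2 + (?b (- N) \<xi>)\<^sup>2)"
      using zero_le_power2[of "?b N \<xi> - ?b (- N) \<xi>"] by (simp add: power2_sum power2_diff)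
    then have "(1 + \<xi>\<^sup>2) powr k' * (packet A L \<kappa> N \<xi>)\<^sup>2 \<le> (1 + \<xi>\<^sup>2) powr k' * ((A * L)\<^sup>2 * (2 * ((?b N \<xi>)\<^sup>2 + (?b (- N) \<xi>)\<^sup>2)))"
      unfolding packet_def power_mult_distrib by (intro mult_left_mono) (auto simp: power_mult_distrib)
    also have "\<dots> = 2 * (A * L)\<^sup>2 * ((1 + \<xi>\<^sup>2) powr k' * (?b N \<xi>)\<^sup>2 + (1 + \<xi>\<^sup>2) powr k' * (?b (- N) \<xi>)\<^sup>2)" by (simp add: algebra_simps)
    also have "\<dots> \<le> 2 * (A * L)\<^sup>2 * ((?C * N powr (2 * k)) * (2 * ?b N \<xi>) + (?C * N powr (2 * k)) * (2 * ?b (- N) \<xi>))"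
      using N by (intro mult_left_mono add_mono w) auto
    finally show ?thesis by (simp add: algebra_simps)
  qed
  have ii: "integrable lborel (\<lambda>\<xi>. complex_of_real (packet A L \<kappa> N \<xi>))" unfolding packet_def
    by (intro integrable_of_real integrable_mult_right impI Bochner_Integration.integrable_add bump_integrable L0)
  have "(LINT \<xi>|lborel. (1 + \<xi>\<^sup>2) powr k' * (cmod (of_real (packet A L \<kappa> N \<xi>)))\<^sup>2) \<le> (LINT \<xi>|lborel. ?h \<xi>)"
  proof (rule integral_mono'[OF hi])
    show "0 \<le> ?h \<xi>" for \<xi> using C1 by (intro mult_nonneg_nonneg add_nonneg_nonneg bump_nonneg) auto
  qed (use le in auto)
  also have "\<dots> = 8 * (A * L)\<^sup>2 * (?C * N powr (2 * k)) * (sqrt (2 * pi) / L)" using L0 by (simp add: bump_integrable bump_integral)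
  also have "\<dots> = 8 * ?C * (A\<^sup>2 * L * N powr (2 * k)) * sqrt (2 * pi)" using L0 by (simp add: power2_eq_square)
  also have "\<dots> \<le> 8 * ?C * (A\<^sup>2 * L * N powr (2 * k)) * 6"
  proof -
    have "sqrt (2 * pi) \<le> 6" using pi_less_4 by (intro real_le_lsqrt) auto
    then show ?thesis using L0 C1 by (intro mult_left_mono mult_nonneg_nonneg) auto
  qed
  also have "\<dots> = 48 * ?C * (A\<^sup>2 * L * N powr (2 * k))" by algebra
  finally show ?thesis unfolding sobolev_norm_eq[OF has_fourier_ift[OF ii]] by simp
qed

lemma packet_schwartz:
  assumes L: "0 < L" shows "ift (\<lambda>\<xi>. of_real (packet A L \<kappa> N \<xi>)) \<in> schwartz"
proof -
  have i: "integrable lborel (\<lambda>\<xi>. complex_of_real (A * L) * of_real (bump L c \<xi>))" for c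
    using bump_integrable[OF L, of c] by (intro integrable_mult_right impI) simp
  have e: "ift (\<lambda>\<xi>. of_real (A * L) * of_real (bump L c \<xi>)) = pgauss [:of_real A:] (1 / (2 * L\<^sup>2)) (\<i> * of_real c)" for c
    using L by (auto simp: ift_cmult ift_bump[OF L] pgauss_def fun_eq_iff)
  have "ift (\<lambda>\<xi>. of_real (packet A L \<kappa> N \<xi>)) =
     (\<lambda>x. pgauss [:of_real A:] (1 / (2 * L\<^sup>2)) (\<i> * of_real (\<kappa> + N)) x + pgauss [:of_real A:] (1 / (2 * L\<^sup>2)) (\<i> * of_real (\<kappa> - N)) x)"
    using ift_add[OF i i, of "\<kappa> + N" "\<kappa> - N"] unfolding e[symmetric] packet_def by (auto simp: distrib_left fun_eq_iff)
  moreover have "\<dots> \<in> schwartz" using L by (intro schwartz_add schwartz_pgauss) auto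
  ultimately show ?thesis by simp
qed

text \<open>\<open>N\<close> is real and starts at \<open>N0\<close>, where the asymptotic estimates
  begin to hold. Existence is required next to the bound for all solutions, so that the latter is
  not vacuous. The same data serve all orders \<open>k' \<le> k\<close>.\<close>

definition norm_inflation ::
  "real \<Rightarrow> real \<Rightarrow> real \<Rightarrow> real \<Rightarrow> real \<Rightarrow> real \<Rightarrow> real \<Rightarrow> real \<Rightarrow> real \<Rightarrow> real \<Rightarrow> bool" where
  "norm_inflation \<omega> A1 A2 Q c1 a1 c2 a2 k l \<longleftrightarrow>
     (\<exists>N0\<ge>1. \<exists>\<alpha>>0. \<exists>c>0. \<exists>C>0. \<exists>F. \<forall>N\<ge>N0. F N \<in> schwartz \<and> (\<forall>k'\<le>k. sobolev_norm k' (F N) \<le> 1) \<and>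
        (\<exists>B p1 p2. zk_ivp \<omega> A1 A2 Q c1 a1 c2 a2 1 (F N) B p1 p2) \<and>
        (\<forall>B p1 p2 t. zk_ivp \<omega> A1 A2 Q c1 a1 c2 a2 1 (F N) B p1 p2 \<longrightarrow> 0 < t \<and> t \<le> 1 \<and> C / t \<le> N \<longrightarrow>
           c * t * N powr \<alpha> \<le> sobolev_norm l (\<lambda>x. of_real (p1 t x))))"

section \<open>Choice of the parameters in the dispersive case\<close>

lemma weight_lower_bound:
  fixes N \<xi> l :: real
  assumes N: "1 \<le> N" and \<xi>: "N \<le> \<xi>" "\<xi> \<le> 3 * N"
  shows "10 powr (- \<bar>l\<bar>) * N powr (2 * l) \<le> (1 + \<xi>\<^sup>2) powr l"
proof -
  define y where "y = (1 + \<xi>\<^sup>2) / N\<^sup>2"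
  have N2: "1 \<le> N\<^sup>2" using N by (simp add: one_le_power)
  have "N\<^sup>2 \<le> \<xi>\<^sup>2" using N \<xi> by (intro power_mono) auto
  then have y1: "1 \<le> y" unfolding y_def using N2 by (subst le_divide_eq_1_pos) linarith+
  have "\<xi>\<^sup>2 \<le> (3 * N)\<^sup>2" using N \<xi> by (intro power_mono) auto
  then have y2: "y \<le> 10" unfolding y_def using N2 by (subst pos_divide_le_eq) (auto simp: power_mult_distrib)
  \<comment> \<open>\<open>y\<close> lies in [1,10]; which end matters depends on the sign of
    \<open>l\<close>, hence the exponent with \<open>- |l|\<close>.\<close>
  have "10 powr (- \<bar>l\<bar>) \<le> y powr l"
  proof (cases "0 \<le> l")
    case True
    have "10 powr (- \<bar>l\<bar>) \<le> 10 powr (0 :: real)" using True by (intro powr_mono) auto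
    also have "\<dots> \<le> y powr l" using ge_one_powr_ge_zero[OF y1 True] by simp
    finally show ?thesis .
  next
    case False
    then show ?thesis using powr_mono2'[of l y 10] y1 y2 by simp
  qed
  then have "10 powr (- \<bar>l\<bar>) * N powr (2 * l) \<le> y powr l * N powr (2 * l)" by (intro mult_right_mono) auto
  also have "\<dots> = (y * N\<^sup>2) powr l" using N y1 by (simp add: powr_mult powr_powr flip: powr_numeral)
  also have "y * N\<^sup>2 = 1 + \<xi>\<^sup>2" unfolding y_def using N by simp
  finally show ?thesis .
qed

lemma large_frequency:
  assumes "0 < e" "0 \<le> X" "0 < d"
  obtains N0 where "1 \<le> N0" "\<And>N. N0 \<le> N \<Longrightarrow> X * N powr (- e) \<le> (d :: real)"
proof (rule that[of "max 1 ((X / d) powr (1 / e))"])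
  fix N assume N: "max 1 ((X / d) powr (1 / e)) \<le> N"
  have "X / d = ((X / d) powr (1 / e)) powr e" using assms by (simp add: powr_powr)
  also have "\<dots> \<le> N powr e" using N assms by (intro powr_mono2) auto
  finally have "X \<le> d * N powr e" using assms by (simp add: field_simps)
  then have "X * N powr (- e) \<le> d * N powr e * N powr (- e)" by (intro mult_right_mono) auto
  also have "\<dots> = d" using N by (simp add: mult.assoc flip: powr_add)
  finally show "X * N powr (- e) \<le> d" .
qed simp

text \<open>Relative to the main term, the phase drift, the distance to the free evolution and the
  contraction constant are all of order at most \<open>N powr (- e)\<close>. Past some
  \<open>N0\<close> a fixed fraction of the main term survives on a frequency interval of length
  \<open>1 / L N\<close> next to \<open>2 * N\<close>, which already carries the claimed
  norm.\<close>

lemma dispersive_norm_inflation: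
  assumes \<omega>: "\<omega> \<noteq> 0" and a1: "a1 \<noteq> 0" and k: "0 \<le> k" "k \<le> 1" and l: "2 * k - 1 / 2 < l"
  shows "norm_inflation \<omega> A1 A2 Q c1 a1 c2 a2 k l"
proof -
  \<comment> \<open>\<open>e\<close> is the distance of \<open>l\<close> from the critical line
    \<open>l = 2 * k - 1 / 2\<close>.\<close>
  define e \<kappa> C1 K0 where "e = l - 2 * k + 1 / 2" and "\<kappa> = c1 / (2 * \<omega>)" and "C1 = 32 * exp (\<bar>\<kappa>\<bar> + 2)"
    and "K0 = (\<bar>A1 * a1\<bar> + \<bar>A2 * a2\<bar>) * 2 + \<bar>Q\<bar>"
  \<comment> \<open>\<open>P\<close> is the constant of \<open>packet_sobolev_norm\<close>, so
    \<open>a0\<close> normalises the data to norm at most 1.\<close>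
  define P a0 where "P = 48 * (4 + 3 * \<kappa>\<^sup>2)" and "a0 = 1 / sqrt P"
  have e: "0 < e" using l by (simp add: e_def)
  have c1: "c1 = 2 * \<omega> * \<kappa>" using \<omega> by (simp add: \<kappa>_def)
  have C1: "0 \<le> C1" and K0: "0 \<le> K0" by (simp_all add: C1_def K0_def)
  have "1 \<le> 4 + 3 * \<kappa>\<^sup>2" using zero_le_power2[of \<kappa>] by linarith
  then have pos: "1 \<le> P" by (simp add: P_def)
  then have a0: "0 < a0" unfolding a0_def by simp
  have a02: "a0\<^sup>2 = 1 / P" unfolding a0_def using pos by (simp add: power_divide)
  then have a01: "a0\<^sup>2 \<le> 1" using pos by simp
  \<comment> \<open>The three summands are the coefficients of the phase error, of the nonlinear
    error and of the contraction condition; one \<open>N0\<close> handles them together.\<close>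
  define X where "X = 48 * \<bar>\<omega>\<bar> + 2 * K0 * C1 ^ 4 + 6 * K0 * C1\<^sup>2"
  have X0: "0 \<le> 2 * K0 * C1 ^ 4" "0 \<le> 6 * K0 * C1\<^sup>2" using C1 K0 by auto
  then have X: "0 \<le> X" unfolding X_def by linarith
  obtain N0 where N0: "1 \<le> N0" "\<And>N. N0 \<le> N \<Longrightarrow> X * N powr (- e) \<le> 1 / 24" using large_frequency[OF e X, of "1 / 24"] by auto
  \<comment> \<open>A scale beyond \<open>N\<close>, so that the phase drift \<open>N / L N\<close>
    is a negative power of \<open>N\<close>.\<close>
  define L where "L N = N powr (1 + e)" for N :: real
  \<comment> \<open>Solves \<open>(A N)\<^sup>2 * L N * N powr (2 * k) = a0\<^sup>2\<close>, the
    normalisation of the data.\<close>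
  define A where "A N = a0 * N powr (- (1 + e) / 2 - k)" for N :: real
  define F where "F N = ift (\<lambda>\<xi>. of_real (packet (A N) (L N) \<kappa> N \<xi>))" for N
  define c where "c = sqrt (10 powr (- \<bar>l\<bar>)) * \<bar>a1\<bar> * a0\<^sup>2 / 4"
  have "F N \<in> schwartz \<and> (\<forall>k'\<le>k. sobolev_norm k' (F N) \<le> 1) \<and>
        (\<exists>B p1 p2. zk_ivp \<omega> A1 A2 Q c1 a1 c2 a2 1 (F N) B p1 p2) \<and>
        (\<forall>B p1 p2 t. zk_ivp \<omega> A1 A2 Q c1 a1 c2 a2 1 (F N) B p1 p2 \<longrightarrow> 0 < t \<and> t \<le> 1 \<and> 1 / t \<le> N \<longrightarrow>
           c * t * N powr (e / 2) \<le> sobolev_norm l (\<lambda>x. of_real (p1 t x)))" if NN: "N0 \<le> N" for N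
  proof -
    have N: "1 \<le> N" using N0(1) NN by linarith
    have A0: "0 \<le> A N" using a0 by (simp add: A_def)
    have L1: "1 \<le> L N" unfolding L_def using N e by (intro ge_one_powr_ge_zero) auto
    have A2: "(A N)\<^sup>2 = a0\<^sup>2 * N powr (- 1 - e - 2 * k)"
    proof -
      have "N powr (- (1 + e) / 2 - k) * N powr (- (1 + e) / 2 - k) = N powr (- 1 - e - 2 * k)"
        by (simp add: algebra_simps flip: powr_add)
      then show ?thesis by (simp add: A_def power2_eq_square mult_ac)
    qed
    have A2L: "(A N)\<^sup>2 * L N = a0\<^sup>2 * N powr (- 2 * k)" unfolding A2 L_def by (simp add: mult.assoc flip: powr_add)
    have NL: "N / L N = N powr (- e)" unfolding L_def using N by (simp add: powr_diff[symmetric] powr_minus powr_add divide_simps)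
    have NA: "N * (A N)\<^sup>2 \<le> N powr (- e)"
    proof -
      have "N * (A N)\<^sup>2 = a0\<^sup>2 * N powr (- e - 2 * k)" unfolding A2 using N powr_add[of N 1 "- 1 - e - 2 * k"] by simp
      also have "\<dots> \<le> 1 * N powr (- e)" using a01 N k by (intro mult_mono powr_mono) auto
      finally show ?thesis by simp
    qed
    have Xe: "48 * \<bar>\<omega>\<bar> * N powr (- e) + 2 * K0 * C1 ^ 4 * N powr (- e) + 6 * K0 * C1\<^sup>2 * N powr (- e) \<le> 1 / 24"
      using N0(2)[OF NN] unfolding X_def by (simp only: distrib_right)
    have Xn: "0 \<le> 48 * \<bar>\<omega>\<bar> * N powr (- e)" "0 \<le> 2 * K0 * C1 ^ 4 * N powr (- e)" "0 \<le> 6 * K0 * C1\<^sup>2 * N powr (- e)"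
      using X0 by (auto intro!: mult_nonneg_nonneg)
    \<comment> \<open>The analyticity radius \<open>1 / N\<close> makes each wave cost a factor
      \<open>2 * N\<close>.\<close>
    define K where "K = (\<bar>A1 * a1\<bar> + \<bar>A2 * a2\<bar>) * (2 / (1 / N)) + \<bar>Q\<bar>"
    have KN: "K \<le> K0 * N"
    proof -
      have "\<bar>Q\<bar> * 1 \<le> \<bar>Q\<bar> * N" using N by (intro mult_left_mono) auto
      then show ?thesis unfolding K_def K0_def by (simp add: algebra_simps)
    qed
    define R S where "R = C1 * A N" and "S = C1 * A N * L N"
    have RS: "0 \<le> R" "0 \<le> S" unfolding R_def S_def using C1 A0 L1 by auto
    have small: "6 * K * R\<^sup>2 \<le> 1"
    proof -
      have "6 * K * R\<^sup>2 \<le> 6 * (K0 * N) * R\<^sup>2" using KN by (intro mult_right_mono mult_left_mono) auto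
      also have "\<dots> = 6 * K0 * C1\<^sup>2 * (N * (A N)\<^sup>2)" by (simp add: R_def power_mult_distrib mult_ac)
      also have "\<dots> \<le> 6 * K0 * C1\<^sup>2 * N powr (- e)" by (intro mult_left_mono NA X0)
      finally show ?thesis using Xe Xn by linarith
    qed
    have diff: "2 * (K * R ^ 3 * S) \<le> 2 * K0 * C1 ^ 4 * N powr (- e) * ((A N)\<^sup>2 * L N)"
    proof -
      have "2 * (K * R ^ 3 * S) \<le> 2 * ((K0 * N) * R ^ 3 * S)" using KN RS by (intro mult_left_mono mult_right_mono) auto
      also have "\<dots> = 2 * K0 * C1 ^ 4 * (N * (A N)\<^sup>2) * ((A N)\<^sup>2 * L N)"
        by (simp add: R_def S_def power2_eq_square power3_eq_cube power4_eq_xxxx mult_ac)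
      also have "\<dots> \<le> 2 * K0 * C1 ^ 4 * N powr (- e) * ((A N)\<^sup>2 * L N)"
        using L1 by (intro mult_right_mono mult_left_mono NA X0) auto
      finally show ?thesis .
    qed
    note pw = packet_weighted_bound[where \<kappa> = \<kappa>, OF A0 L1 N order_refl]
    have f: "continuous_on UNIV (\<lambda>\<xi>. complex_of_real (packet (A N) (L N) \<kappa> N \<xi>))"
      unfolding packet_def by (intro continuous_intros bump_continuous)
    have N1: "0 < 1 / N" using N by simp
    have h1: "(LINT \<xi>|lborel. exp (1 / N * \<bar>\<xi>\<bar>) * cmod (of_real (packet (A N) (L N) \<kappa> N \<xi>))) \<le> R / 2"
      using pw(2) by (simp add: R_def C1_def mult_ac)
    have h2: "exp (1 / N * \<bar>\<xi>\<bar>) * cmod (of_real (packet (A N) (L N) \<kappa> N \<xi>)) \<le> S / 2" for \<xi>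
      using pw(3)[of \<xi>] by (simp add: S_def C1_def mult_ac)
    obtain B p1 p2 w where sol: "zk_ivp \<omega> A1 A2 Q c1 a1 c2 a2 1 (F N) B p1 p2" and jw: "jcont w"
      and wi: "\<And>l t. integrable lborel (\<lambda>\<xi>. (1 + \<xi>\<^sup>2) powr l * (cmod (wave 1 a1 c1 w t \<xi>))\<^sup>2)"
      and pn: "\<And>l t. sobolev_norm l (\<lambda>x. of_real (p1 t x)) = sqrt (LINT \<xi>|lborel. (1 + \<xi>\<^sup>2) powr l * (cmod (wave 1 a1 c1 w t \<xi>))\<^sup>2)"
      and wd: "\<And>t \<xi>. cmod (w t \<xi> - intensity (\<lambda>t \<xi>. cis (- (\<omega> * \<xi>\<^sup>2 * tclamp 1 t)) * of_real (packet (A N) (L N) \<kappa> N \<xi>)) t \<xi>) \<le> 2 * (K * R ^ 3 * S)"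
      by (rule small_data_ivp[where \<omega> = \<omega> and ?c1.0 = c1 and ?c2.0 = c2, OF N1 f pw(1) h1 h2 RS K_def small, folded F_def]) (rule that)
    have "(A N)\<^sup>2 * L N / 8 \<le> Re (cis (c1 * \<xi> * s) * w s \<xi>)" if s: "s \<in> {0..1}" and \<xi>: "\<xi> \<in> {2 * N..2 * N + 1 / L N}" for s \<xi>
    proof -
      let ?d = "intensity (\<lambda>t \<xi>. cis (- (\<omega> * \<xi>\<^sup>2 * tclamp 1 t)) * of_real (packet (A N) (L N) \<kappa> N \<xi>)) s \<xi>"
      have "- Re (cis (c1 * \<xi> * s) * (w s \<xi> - ?d)) \<le> cmod (cis (c1 * \<xi> * s) * (w s \<xi> - ?d))"
        using abs_Re_le_cmod[of "cis (c1 * \<xi> * s) * (w s \<xi> - ?d)"] by linarith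
      then have "- Re (cis (c1 * \<xi> * s) * (w s \<xi> - ?d)) \<le> 2 * K0 * C1 ^ 4 * N powr (- e) * ((A N)\<^sup>2 * L N)"
        using wd[of s \<xi>] diff by (simp add: norm_mult)
      moreover have "Re (cis (c1 * \<xi> * s) * (w s \<xi> - ?d)) = Re (cis (c1 * \<xi> * s) * w s \<xi>) - Re (cis (c1 * \<xi> * s) * ?d)"
        by (simp only: right_diff_distrib minus_complex.simps)
      moreover have "(A N)\<^sup>2 * L N * (exp (- 1) / 2 - 48 * \<bar>\<omega>\<bar> * N powr (- e)) \<le> Re (cis (c1 * \<xi> * s) * ?d)"
        using packet_intensity_lower_bound[OF A0 L1 N \<xi> s, of \<omega> \<kappa>] unfolding c1[symmetric] times_divide_eq_right[symmetric] NL .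
      moreover have "(A N)\<^sup>2 * L N / 8 \<le> (A N)\<^sup>2 * L N * (exp (- 1) / 2 - 48 * \<bar>\<omega>\<bar> * N powr (- e)) - 2 * K0 * C1 ^ 4 * N powr (- e) * ((A N)\<^sup>2 * L N)"
      proof -
        have "1 / 3 \<le> exp (- 1 :: real)" using exp_le by (simp add: exp_minus inverse_eq_divide field_simps)
        \<comment> \<open>\<open>exp (- 1) / 2 \<ge> 1 / 6\<close>, the errors use up at most
          \<open>1 / 24\<close>, and \<open>1 / 8\<close> is left.\<close>
        then have "1 / 8 \<le> (exp (- 1) / 2 - 48 * \<bar>\<omega>\<bar> * N powr (- e)) - 2 * K0 * C1 ^ 4 * N powr (- e)" using Xe Xn(3) by linarith
        then have "((A N)\<^sup>2 * L N) * (1 / 8) \<le> ((A N)\<^sup>2 * L N) * ((exp (- 1) / 2 - 48 * \<bar>\<omega>\<bar> * N powr (- e)) - 2 * K0 * C1 ^ 4 * N powr (- e))"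
          using L1 by (intro mult_left_mono) auto
        then show ?thesis by (simp add: right_diff_distrib mult_ac)
      qed
      ultimately show ?thesis by linarith
    qed note low = this
    have bound: "c * t * N powr (e / 2) \<le> sobolev_norm l (\<lambda>x. of_real (p1 t x))" if t: "0 < t" "t \<le> 1" for t
    proof -
      \<comment> \<open>\<open>2 * N\<close> bounds \<open>|\<xi>|\<close> from below on the
        interval, and \<open>(A N)\<^sup>2 * L N / 8\<close> is the bound \<open>low\<close> for the
        integrand.\<close>
      let ?m = "\<bar>a1\<bar> * (2 * N) * (t * ((A N)\<^sup>2 * L N / 8))"
      have iL: "0 \<le> 1 / L N" "1 / L N \<le> 1" using L1 by auto
      have m: "?m \<le> cmod (wave 1 a1 c1 w t \<xi>)" if \<xi>: "\<xi> \<in> {2 * N..2 * N + 1 / L N}" for \<xi>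
      proof -
        have "?m \<le> \<bar>a1\<bar> * \<bar>\<xi>\<bar> * (t * ((A N)\<^sup>2 * L N / 8))"
          using \<xi> N t L1 by (intro mult_right_mono mult_left_mono) auto
        also have "\<dots> \<le> cmod (wave 1 a1 c1 w t \<xi>)"
          using t low[OF _ \<xi>] by (intro wave_lower_bound[OF jw]) auto
        finally show ?thesis .
      qed
      have p: "10 powr (- \<bar>l\<bar>) * N powr (2 * l) \<le> (1 + \<xi>\<^sup>2) powr l" if \<xi>: "\<xi> \<in> {2 * N..2 * N + 1 / L N}" for \<xi>
      proof (rule weight_lower_bound[OF N])
        show "N \<le> \<xi>" "\<xi> \<le> 3 * N" using \<xi> N iL unfolding atLeastAtMost_iff by linarith+
      qed
      have "sqrt ((2 * N + 1 / L N - 2 * N) * (10 powr (- \<bar>l\<bar>) * N powr (2 * l))) * ?m \<le> sobolev_norm l (\<lambda>x. of_real (p1 t x))"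
        unfolding pn
        using N t L1 by (intro weighted_lower_bound[OF wi _ _ _ m p]) auto
      also have "sqrt ((2 * N + 1 / L N - 2 * N) * (10 powr (- \<bar>l\<bar>) * N powr (2 * l))) = sqrt (10 powr (- \<bar>l\<bar>)) * N powr (l - (1 + e) / 2)"
      proof -
        have "(2 * N + 1 / L N - 2 * N) * (10 powr (- \<bar>l\<bar>) * N powr (2 * l)) = 10 powr (- \<bar>l\<bar>) * (N powr (l - (1 + e) / 2))\<^sup>2"
        proof -
          have "(N powr (l - (1 + e) / 2))\<^sup>2 = N powr (2 * l - (1 + e))"
            unfolding power2_eq_square by (simp add: algebra_simps flip: powr_add)
          then show ?thesis unfolding L_def by (simp add: powr_diff)
        qed
        then show ?thesis by (simp add: real_sqrt_mult)
      qed
      also have "sqrt (10 powr (- \<bar>l\<bar>)) * N powr (l - (1 + e) / 2) * ?m = c * t * N powr (e / 2)"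
      proof -
        have "N powr (l - (1 + e) / 2) * (N powr 1 * N powr (- 2 * k)) = N powr (e / 2)"
          unfolding powr_add[symmetric] by (rule arg_cong[where f = "\<lambda>x. N powr x"]) (simp add: e_def field_simps)
        then have pe: "N powr (e / 2) = N powr (l - (1 + e) / 2) * (N * N powr (- 2 * k))" using N by simp
        show ?thesis unfolding A2L c_def pe by (simp add: field_simps)
      qed
      finally show ?thesis .
    qed
    have "sobolev_norm k' (F N) \<le> 1" if "k' \<le> k" for k'
    proof -
      have "P * ((A N)\<^sup>2 * L N * N powr (2 * k)) = P * a0\<^sup>2"
        unfolding A2L using N by (simp add: mult.assoc flip: powr_add)
      also have "\<dots> = 1" unfolding a02 using pos by simp
      finally show ?thesis using packet_sobolev_norm[OF A0 L1 N k that, of \<kappa>] unfolding P_def[symmetric] by (simp add: F_def)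
    qed
    moreover have "F N \<in> schwartz" unfolding F_def using L1 by (intro packet_schwartz) auto
    moreover have "c * t * N powr (e / 2) \<le> sobolev_norm l (\<lambda>x. of_real (p1' t x))"
      if "zk_ivp \<omega> A1 A2 Q c1 a1 c2 a2 1 (F N) B' p1' p2'" "0 < t" "t \<le> 1" for B' p1' p2' t
    proof -
      \<comment> \<open>The bound is known for the constructed solution; uniqueness transfers it to
        any other.\<close>
      have "p1' t = p1 t"
      proof (rule zk_unique[OF \<omega> zero_le_one])
        show "zk_solution \<omega> A1 A2 Q c1 a1 c2 a2 1 B' p1' p2'" "zk_solution \<omega> A1 A2 Q c1 a1 c2 a2 1 B p1 p2"
          using that(1) sol by (simp_all only: zk_ivp_def)
        show "B' 0 = B 0" "p1' 0 = p1 0" "p2' 0 = p2 0" using that(1) sol by (simp_all only: zk_ivp_def)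
        show "t \<in> {0..1}" using that by simp
      qed
      then show ?thesis using bound[OF that(2,3)] by simp
    qed
    moreover have "\<exists>B p1 p2. zk_ivp \<omega> A1 A2 Q c1 a1 c2 a2 1 (F N) B p1 p2" by (intro exI) (rule sol)
    ultimately show ?thesis by (intro conjI allI impI) simp_all
  qed
  moreover have "0 < c" unfolding c_def using a1 a0 by simp
  moreover have "0 < e / 2" using e by simp
  ultimately show ?thesis unfolding norm_inflation_def
    by (intro exI[of _ N0] exI[of _ "e / 2"] exI[of _ c] exI[of _ 1] exI[of _ F] conjI[OF N0(1)] conjI[OF zero_less_one] conjI) simp_all
qed

subsection \<open>Norm inflation without dispersion\<close>

text \<open>Part of the Gaussian exponent absorbs the linear one by completing the square; what is
  left is bounded by a Gaussian of scale \<open>L / 2\<close>.\<close>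

lemma exp_bump_bound:
  assumes "0 < L" shows "exp (\<rho> * \<bar>\<xi>\<bar>) * bump L 0 \<xi> \<le> exp (\<rho>\<^sup>2 / L\<^sup>2) * bump (L / 2) 0 \<xi>"
proof -
  have "\<rho> / L * (L * \<bar>\<xi>\<bar>) = \<rho> * \<bar>\<xi>\<bar>" using assms by simp
  moreover have "(\<rho> / L - L * \<bar>\<xi>\<bar> / 2)\<^sup>2 = \<rho>\<^sup>2 / L\<^sup>2 - \<rho> / L * (L * \<bar>\<xi>\<bar>) + (L * \<xi>)\<^sup>2 / 4"
    by (simp add: power2_diff power_divide power_mult_distrib)
  moreover have "(L / 2 * \<xi>)\<^sup>2 / 2 = (L * \<xi>)\<^sup>2 / 8" by (simp add: power_mult_distrib power_divide)
  moreover have "a + - (s / 2) \<le> d + - u" if "x = a" "z = d - x + s / 4" "u = s / 8" "0 \<le> z" "0 \<le> s" for a s d u x z :: real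
    using that by linarith
  ultimately have "\<rho> * \<bar>\<xi>\<bar> + - ((L * \<xi>)\<^sup>2 / 2) \<le> \<rho>\<^sup>2 / L\<^sup>2 + - ((L / 2 * \<xi>)\<^sup>2 / 2)"
    using zero_le_power2[of "\<rho> / L - L * \<bar>\<xi>\<bar> / 2"] zero_le_power2[of "L * \<xi>"] by blast
  then show ?thesis unfolding bump_def by (simp flip: exp_add)
qed

lemma exp_bump:
  assumes L: "0 < L" and m: "0 \<le> m"
  shows "integrable lborel (\<lambda>\<xi>. exp (\<rho> * \<bar>\<xi>\<bar>) * cmod (of_real (m * bump L 0 \<xi>)))"
    and "exp (\<rho> * \<bar>\<xi>\<bar>) * cmod (of_real (m * bump L 0 \<xi>)) \<le> m * exp (\<rho>\<^sup>2 / L\<^sup>2)"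
proof -
  have e: "exp (\<rho> * \<bar>\<xi>\<bar>) * cmod (of_real (m * bump L 0 \<xi>)) = m * (exp (\<rho> * \<bar>\<xi>\<bar>) * bump L 0 \<xi>)" for \<xi>
    unfolding norm_of_real using m bump_nonneg[of L 0 \<xi>] by (simp add: abs_mult)
  have le: "exp (\<rho> * \<bar>\<xi>\<bar>) * cmod (of_real (m * bump L 0 \<xi>)) \<le> m * (exp (\<rho>\<^sup>2 / L\<^sup>2) * bump (L / 2) 0 \<xi>)" for \<xi>
    unfolding e by (intro mult_left_mono exp_bump_bound L m)
  show "integrable lborel (\<lambda>\<xi>. exp (\<rho> * \<bar>\<xi>\<bar>) * cmod (of_real (m * bump L 0 \<xi>)))"
  proof (rule Bochner_Integration.integrable_bound)
    show "integrable lborel (\<lambda>\<xi>. m * (exp (\<rho>\<^sup>2 / L\<^sup>2) * bump (L / 2) 0 \<xi>))"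
      using L by (intro integrable_mult_right impI bump_integrable) auto
    show "(\<lambda>\<xi>. exp (\<rho> * \<bar>\<xi>\<bar>) * cmod (of_real (m * bump L 0 \<xi>))) \<in> borel_measurable lborel" by measurable
  qed (use le order_trans[OF le abs_ge_self] in auto)
  have "m * (exp (\<rho>\<^sup>2 / L\<^sup>2) * bump (L / 2) 0 \<xi>) \<le> m * (exp (\<rho>\<^sup>2 / L\<^sup>2) * 1)"
    using m by (intro mult_left_mono bump_le_1) auto
  with le[of \<xi>] show "exp (\<rho> * \<bar>\<xi>\<bar>) * cmod (of_real (m * bump L 0 \<xi>)) \<le> m * exp (\<rho>\<^sup>2 / L\<^sup>2)" by simp
qed

text \<open>The product of the two Gaussians is Gaussian in the integration variable, centred at the
  midpoint \<open>\<xi> / 2\<close>; integrating it out leaves a Gaussian in \<open>\<xi>\<close>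
  that is wider by the factor \<open>sqrt 2\<close>.\<close>

lemma conv_bump:
  assumes L: "0 < L"
  shows "conv (\<lambda>\<xi>. of_real (m * bump L 0 \<xi>)) (cnj_refl (\<lambda>\<xi>. of_real (m * bump L 0 \<xi>))) \<xi>
    = of_real (m\<^sup>2 / (sqrt 2 * L) * bump (L / sqrt 2) 0 \<xi>)"
proof -
  have "bump L 0 (\<xi> - \<eta>) * bump L 0 (- \<eta>) = bump (L / sqrt 2) 0 \<xi> * bump (sqrt 2 * L) (\<xi> / 2) \<eta>" for \<eta>
  proof -
    have s: "(L / sqrt 2 * \<xi>)\<^sup>2 = L\<^sup>2 * \<xi>\<^sup>2 / 2" "(sqrt 2 * L * (\<eta> - \<xi> / 2))\<^sup>2 = 2 * L\<^sup>2 * (\<eta> - \<xi> / 2)\<^sup>2"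
      by (simp_all add: power_mult_distrib power_divide)
    have "L\<^sup>2 * (\<xi> - \<eta>)\<^sup>2 + L\<^sup>2 * \<eta>\<^sup>2 = L\<^sup>2 * \<xi>\<^sup>2 / 2 + 2 * L\<^sup>2 * (\<eta> - \<xi> / 2)\<^sup>2" by (simp add: power2_eq_square field_simps)
    then have "- ((L * (\<xi> - \<eta> - 0))\<^sup>2 / 2) + - ((L * (- \<eta> - 0))\<^sup>2 / 2) = - ((L / sqrt 2 * (\<xi> - 0))\<^sup>2 / 2) + - ((sqrt 2 * L * (\<eta> - \<xi> / 2))\<^sup>2 / 2)"
      unfolding diff_0_right s by (simp add: power_mult_distrib)
    then show ?thesis unfolding bump_def exp_add[symmetric] by simp
  qed
  then have e: "complex_of_real (m * bump L 0 (\<xi> - \<eta>)) * cnj (of_real (m * bump L 0 (- \<eta>)))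
      = of_real (m\<^sup>2 * bump (L / sqrt 2) 0 \<xi> * bump (sqrt 2 * L) (\<xi> / 2) \<eta>)" for \<eta>
    unfolding complex_cnj_complex_of_real of_real_mult[symmetric] by (simp add: power2_eq_square mult_ac)
  have "(LINT \<eta>|lborel. complex_of_real (m * bump L 0 (\<xi> - \<eta>)) * cnj (of_real (m * bump L 0 (- \<eta>))))
      = of_real (m\<^sup>2 * bump (L / sqrt 2) 0 \<xi> * (sqrt (2 * pi) / (sqrt 2 * L)))"
    unfolding e integral_of_real using L by (simp add: bump_integral)
  moreover have "1 / sqrt (2 * pi) * (m\<^sup>2 * bump (L / sqrt 2) 0 \<xi> * (sqrt (2 * pi) / (sqrt 2 * L))) = m\<^sup>2 / (sqrt 2 * L) * bump (L / sqrt 2) 0 \<xi>"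
    by simp
  ultimately show ?thesis unfolding conv_def cnj_refl_def by (simp only: of_real_mult[symmetric])
qed

text \<open>For a source that is constant in time the Duhamel integral is explicit, and the squared
  distance of \<open>cis x\<close> from 1 is \<open>2 - 2 * cos x\<close>.\<close>

lemma wave_constant:
  assumes t: "t \<in> {0..T}" and c: "c \<noteq> 0" and \<xi>: "\<xi> \<noteq> 0"
  shows "(cmod (wave T a c (\<lambda>t. w) t \<xi>))\<^sup>2 = (a / c)\<^sup>2 * (2 - 2 * cos (c * t * \<xi>)) * (cmod (w \<xi>))\<^sup>2"
proof -
  let ?\<theta> = "c * \<xi>"
  have \<theta>: "?\<theta> \<noteq> 0" using c \<xi> by simp
  have d: "((\<lambda>s. cis (?\<theta> * s) * w \<xi> / (\<i> * of_real ?\<theta>)) has_vector_derivative cis (?\<theta> * s) * w \<xi>) (at s within {0..t})" for s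
  proof -
    have e: "cis (?\<theta> * s) = exp ((\<i> * of_real ?\<theta>) * of_real s)" for s by (simp add: cis_conv_exp mult_ac)
    have "((\<lambda>z. exp ((\<i> * of_real ?\<theta>) * z) * w \<xi> / (\<i> * of_real ?\<theta>)) has_field_derivative
        exp ((\<i> * of_real ?\<theta>) * of_real s) * w \<xi>) (at (of_real s))"
      using \<theta> by (auto intro!: derivative_eq_intros)
    from has_vector_derivative_real_field[OF this] show ?thesis unfolding e .
  qed
  have "((\<lambda>s. cis (?\<theta> * s) * w \<xi>) has_integral (cis (?\<theta> * t) * w \<xi> / (\<i> * of_real ?\<theta>) - cis (?\<theta> * 0) * w \<xi> / (\<i> * of_real ?\<theta>))) {0..t}"
    by (rule fundamental_theorem_of_calculus) (use t d in auto)
  then have "integral {0..t} (\<lambda>s. cis (?\<theta> * s) * w \<xi>) = cis (?\<theta> * t) * w \<xi> / (\<i> * of_real ?\<theta>) - cis (?\<theta> * 0) * w \<xi> / (\<i> * of_real ?\<theta>)"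
    by (rule integral_unique)
  also have "\<dots> = (cis (?\<theta> * t) - 1) * w \<xi> / (\<i> * of_real ?\<theta>)"
    by (simp add: diff_divide_distrib left_diff_distrib)
  finally have i: "integral {0..t} (\<lambda>s. cis (?\<theta> * s) * w \<xi>) = (cis (?\<theta> * t) - 1) * w \<xi> / (\<i> * of_real ?\<theta>)" .
  have "cmod (wave T a c (\<lambda>t. w) t \<xi>) = \<bar>a / c\<bar> * cmod (cis (?\<theta> * t) - 1) * cmod (w \<xi>)"
    unfolding wave_def duhamel_def tclamp_simps(3)[OF t] i using c \<xi> by (simp add: norm_mult norm_divide abs_mult)
  moreover have "(cmod (cis (?\<theta> * t) - 1))\<^sup>2 = 2 - 2 * cos (c * t * \<xi>)"
  proof -
    have "(cmod (cis (?\<theta> * t) - 1))\<^sup>2 = (cos (?\<theta> * t) - 1)\<^sup>2 + (sin (?\<theta> * t))\<^sup>2" by (simp add: cmod_power2)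
    also have "\<dots> = 2 - 2 * cos (?\<theta> * t)" using sin_cos_squared_add[of "?\<theta> * t"] by (simp add: power2_diff)
    finally show ?thesis by (simp add: mult_ac)
  qed
  ultimately show ?thesis by (simp add: power_mult_distrib power_divide)
qed

text \<open>An average takes the place of resonance: the oscillating factor has mean close to 2 over
  [N, 2N] once \<open>N\<close> is large compared with \<open>1 / |b|\<close>. With
  \<open>b = c1 * t\<close> this is the origin of the condition
  \<open>N \<ge> C / t\<close>.\<close>

lemma oscillation_integral:
  fixes N b :: real
  assumes N: "0 \<le> N" and b: "b \<noteq> 0" "4 / \<bar>b\<bar> \<le> N"
  shows "N \<le> (LINT \<xi>|lborel. (2 - 2 * cos (b * \<xi>)) * indicator {N..2 * N} \<xi>)"
proof -
  have "(LINT \<xi>|lborel. (2 - 2 * cos (b * \<xi>)) * indicator {N..2 * N} \<xi>)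
      = (2 * (2 * N) - 2 * sin (b * (2 * N)) / b) - (2 * N - 2 * sin (b * N) / b)"
    by (rule integral_FTC_Icc_real) (use N b in \<open>auto intro!: derivative_eq_intros continuous_intros\<close>)
  moreover have s: "\<bar>2 * sin x / b\<bar> \<le> 2 / \<bar>b\<bar>" for x
    using abs_sin_le_one[of x] by (simp add: abs_mult divide_right_mono)
  moreover have "2 / \<bar>b\<bar> + 2 / \<bar>b\<bar> \<le> N" using b(2) by simp
  ultimately show ?thesis using s[of "b * (2 * N)"] s[of "b * N"] by linarith
qed

text \<open>As \<open>|B|\<close> is conserved, the waves and with them the potential are known
  before \<open>B\<close>, which then solves a linear equation. Afterwards it is verified that this
  solution does conserve its modulus, which holds because the potential is real.\<close>

lemma nondispersive_ivp:
  assumes L: "0 < L" and m: "0 \<le> m"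
  defines "f \<equiv> \<lambda>\<xi>. complex_of_real (m * bump L 0 \<xi>)" and "w \<equiv> \<lambda>\<xi>. complex_of_real (m\<^sup>2 / (sqrt 2 * L) * bump (L / sqrt 2) 0 \<xi>)"
  obtains B p1 p2 where "zk_ivp 0 A1 A2 Q c1 a1 c2 a2 1 (ift f) B p1 p2"
    "\<And>l t. integrable lborel (\<lambda>\<xi>. (1 + \<xi>\<^sup>2) powr l * (cmod (wave 1 a1 c1 (\<lambda>t. w) t \<xi>))\<^sup>2)"
    "\<And>l t. sobolev_norm l (\<lambda>x. of_real (p1 t x)) = sqrt (LINT \<xi>|lborel. (1 + \<xi>\<^sup>2) powr l * (cmod (wave 1 a1 c1 (\<lambda>t. w) t \<xi>))\<^sup>2)"
proof -
  let ?m = "m\<^sup>2 / (sqrt 2 * L)" and ?L = "L / sqrt 2"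
  have L': "0 < ?L" and m': "0 \<le> ?m" using L by simp_all
  have cw: "continuous_on UNIV w" and cf: "continuous_on UNIV f" unfolding w_def f_def by (intro continuous_intros bump_continuous)+
  have wf: "conv f (cnj_refl f) = w" unfolding f_def w_def using conv_bump[OF L] by (intro ext) simp
  have sym: "cnj_refl w = w" by (simp add: cnj_refl_def w_def bump_def fun_eq_iff)
  have fi: "integrable lborel f" unfolding f_def using bump_integrable[OF L] by (intro integrable_of_real integrable_mult_right impI)
  have w1: "integrable lborel (\<lambda>\<xi>. exp (2 * \<bar>\<xi>\<bar>) * cmod (w \<xi>))" "\<And>\<xi>. exp (2 * \<bar>\<xi>\<bar>) * cmod (w \<xi>) \<le> ?m * exp (2\<^sup>2 / ?L\<^sup>2)"
    unfolding w_def by (rule exp_bump[OF L' m'])+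
  have f1: "integrable lborel (\<lambda>\<xi>. exp (1 * \<bar>\<xi>\<bar>) * cmod (f \<xi>))" unfolding f_def by (rule exp_bump[OF L m])
  \<comment> \<open>Width 2 shrinking at speed 1: the waves keep width at least 1 on the unit time
    interval, which leaves a constant width for the linear equation.\<close>
  have mw: "majorized (wgt 2 1 0 1) (LINT \<xi>|lborel. exp (2 * \<bar>\<xi>\<bar>) * cmod (w \<xi>)) (?m * exp (2\<^sup>2 / ?L\<^sup>2)) (\<lambda>t. w)"
    using majorized_free[where \<omega> = 0 and \<delta> = 1 and \<Lambda> = 0 and T = 1, OF cw w1(1) order_refl w1(2)]
    by simp
  let ?W = "wgt 2 1 0 1"
  have W: "weight ?W" by (intro wgt_weight) auto
  have We: "?W t \<xi> \<le> 1 * exp (- (1 / 2) * \<bar>\<xi>\<bar>)" for t \<xi>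
    using wgt_le[of 1 1 2 0 t \<xi>] by (simp add: order_trans)
  note ed = majorized_expdec[OF _ W We]
  have \<delta>: "(0 :: real) < 1" "1 * 1 \<le> (2 :: real)" by auto
  note wv = majorized_wave[OF mw zero_le_one \<delta>]
  let ?V = "potential 1 A1 A2 Q c1 a1 c2 a2 (\<lambda>t. w)"
  have "?W t \<xi> \<le> wgt 1 0 0 1 t \<xi>" for t \<xi>
  proof -
    have "1 * \<bar>\<xi>\<bar> \<le> (2 - 1 * tclamp 1 t) * \<bar>\<xi>\<bar>" using tclamp_simps(2)[OF zero_le_one, of t] by (intro mult_right_mono) auto
    then show ?thesis unfolding wgt_def by simp
  qed
  from majorized_weight_mono[OF majorized_potential[OF mw zero_le_one \<delta> refl] this]
  obtain Rv Sv where V: "majorized (wgt 1 0 0 1) Rv Sv ?V" by (rule that)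
  define Sf where "Sf = 2 * (m * exp (1\<^sup>2 / L\<^sup>2))"
  define Rf where "Rf = 2 * (LINT \<xi>|lborel. exp (1 * \<bar>\<xi>\<bar>) * cmod (f \<xi>))"
  have "0 \<le> (LINT \<xi>|lborel. exp (1 * \<bar>\<xi>\<bar>) * cmod (f \<xi>))" by (intro Bochner_Integration.integral_nonneg) auto
  then have n: "0 \<le> Rf" "0 \<le> Sf" using m by (auto simp: Rf_def Sf_def)
  have f2: "(LINT \<xi>|lborel. exp (1 * \<bar>\<xi>\<bar>) * cmod (f \<xi>)) \<le> Rf / 2" by (simp add: Rf_def)
  have f3: "exp (1 * \<bar>\<xi>\<bar>) * cmod (f \<xi>) \<le> Sf / 2" for \<xi>
    using exp_bump(2)[OF L m, of 1 \<xi>] unfolding f_def Sf_def by simp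
  obtain b where b: "majorized (wgt 1 0 (2 * Rv + 1) 1) Rf Sf b" and eq: "\<And>t \<xi>. b t \<xi> = schroedinger 1 0 f ?V b t \<xi>"
    and G: "jcont (\<lambda>t. conv (?V t) (b t))" "\<And>t \<xi>. norm (conv (?V t) (b t) \<xi>) \<le> Rv * Sf * wgt 1 0 (2 * Rv + 1) 1 t \<xi>"
    by (rule linear_solution[where \<omega> = 0, OF zero_less_one zero_less_one cf f1 f2 f3 n V]) (rule that)
  have Rv: "0 \<le> Rv" by (rule majorized_nonneg(1)[OF V])
  have W': "weight (wgt 1 0 (2 * Rv + 1) 1)" using Rv by (intro wgt_weight) auto
  have We': "wgt 1 0 (2 * Rv + 1) 1 t \<xi> \<le> exp ((2 * Rv + 1) * 1) * exp (- (1 / 2) * \<bar>\<xi>\<bar>)" for t \<xi>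
    using Rv by (intro wgt_le) auto
  have r: "(0 :: real) < 1 / 2" by simp
  note eb = majorized_expdec[OF b W' We']
  have eG: "expdec (1 / 2) (Rv * Sf * exp ((2 * Rv + 1) * 1)) (\<lambda>t. conv (?V t) (b t))"
    unfolding expdec_def
  proof (intro conjI allI G(1))
    fix t \<xi>
    have "Rv * Sf * wgt 1 0 (2 * Rv + 1) 1 t \<xi> \<le> Rv * Sf * (exp ((2 * Rv + 1) * 1) * exp (- (1 / 2) * \<bar>\<xi>\<bar>))"
      using Rv n by (intro mult_left_mono We') auto
    with G(2)[of t \<xi>] show "norm (conv (?V t) (b t) \<xi>) \<le> Rv * Sf * exp ((2 * Rv + 1) * 1) * exp (- (1 / 2) * \<bar>\<xi>\<bar>)"
      unfolding mult.assoc by (rule order_trans)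
  qed
  have b0: "b 0 = f" using fourier_initial_data(1)[OF zero_le_one] eq[of 0] by auto
  have iV: "integrable lborel (?V t)" for t by (rule majorized_slice[OF V wgt_weight]) auto
  have Vsym: "cnj_refl (?V t) = ?V t" for t
  proof
    fix \<xi>
    have s: "cnj (u (- \<xi>)) = u \<xi>" if "cnj_refl u = u" for u using fun_cong[OF that, of \<xi>] by (simp add: cnj_refl_def)
    show "cnj_refl (?V t) \<xi> = ?V t \<xi>"
      unfolding cnj_refl_def[of "?V t"] potential_def
      by (simp add: s[OF sym] s[OF wave_cnj_refl[of "\<lambda>t. w", OF sym]])
  qed
  have Vreal: "Im (ift (?V t) x) = 0" for t x
    using ift_cnj_refl[of "?V t" x] unfolding Vsym by (simp add: complex_eq_iff)
  have const: "(cmod (ift (b t) x))\<^sup>2 = (cmod (ift f x))\<^sup>2" if t: "t \<in> {0..1}" for t x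
  proof -
    have "((\<lambda>\<tau>. (cmod (ift (b \<tau>) x))\<^sup>2) has_vector_derivative 0) (at \<tau> within {0..1})" if "\<tau> \<in> {0..1}" for \<tau>
      using vderiv_cmod_square[OF fourier_schroedinger[OF r eb eG eq that iV, of x]]
      by (rule has_vector_derivative_eq_rhs) (simp add: Vreal algebra_simps)
    then obtain y where "\<And>\<tau>. \<tau> \<in> {0..1} \<Longrightarrow> (cmod (ift (b \<tau>) x))\<^sup>2 = y"
      using has_vector_derivative_zero_constant[of "{0..1::real}" "\<lambda>\<tau>. (cmod (ift (b \<tau>) x))\<^sup>2"] by auto
    from this[of t] this[of 0] show ?thesis using t b0 by simp
  qed
  have dens: "ift w x = of_real ((cmod (ift (b t) x))\<^sup>2)" if "t \<in> {0..1}" for t x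
    using ift_intensity[where b = "\<lambda>t. f" and t = 0, OF fi, of x] const[OF that, of x] unfolding intensity_def wf by simp
  have sol: "zk_solution 0 A1 A2 Q c1 a1 c2 a2 1 (\<lambda>t. ift (b t)) (\<lambda>t x. Re (ift (wave 1 a1 c1 (\<lambda>t. w) t) x)) (\<lambda>t x. Re (ift (wave 1 a2 c2 (\<lambda>t. w) t) x))"
    by (rule fourier_solution[where w = "\<lambda>t. w", OF r eb ed[OF mw] ed[OF wv] ed[OF wv] eG eq sym dens])
  then have "zk_ivp 0 A1 A2 Q c1 a1 c2 a2 1 (ift f) (\<lambda>t. ift (b t)) (\<lambda>t x. Re (ift (wave 1 a1 c1 (\<lambda>t. w) t) x)) (\<lambda>t x. Re (ift (wave 1 a2 c2 (\<lambda>t. w) t) x))"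
    by (simp add: zk_ivp_def fourier_initial_data b0)
  then show thesis
    by (rule that[OF _ expdec_square_integrable[OF ed[OF wv] r] wave_sobolev_norm[where w = "\<lambda>t. w", OF ed[OF wv] r sym]])
qed

text \<open>The transform of the data is a Gaussian of width \<open>N\<close>, that is, of scale
  \<open>1 / N\<close> in \<open>bump\<close>. Averaging the oscillation gives a lower bound
  independent of \<open>t\<close>, which for \<open>t \<le> 1\<close> is stronger than one linear in
  \<open>t\<close>; the exponent is the full distance to the critical line.\<close>

lemma nondispersive_norm_inflation:
  assumes c1: "c1 \<noteq> 0" and a1: "a1 \<noteq> 0" and k: "0 \<le> k" "k \<le> 1" and l: "2 * k - 1 / 2 < l"
  shows "norm_inflation 0 A1 A2 Q c1 a1 c2 a2 k l"
proof -
  \<comment> \<open>Makes \<open>(m N)\<^sup>2 * N * N powr (2 * k)\<close> equal to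
    \<open>1 / 16\<close>, which normalises the data.\<close>
  define m where "m N = N powr (- 1 / 2 - k) / 4" for N :: real
  define F where "F N = ift (\<lambda>\<xi>. complex_of_real (m N * bump (1 / N) 0 \<xi>))" for N
  define w where "w N \<xi> = complex_of_real ((m N)\<^sup>2 / (sqrt 2 * (1 / N)) * bump (1 / N / sqrt 2) 0 \<xi>)" for N \<xi>
  define e c where "e = l + 1 / 2 - 2 * k" and "c = sqrt (10 powr (- \<bar>l\<bar>)) * \<bar>a1 / c1\<bar> / 72"
  have "F N \<in> schwartz \<and> (\<forall>k'\<le>k. sobolev_norm k' (F N) \<le> 1) \<and>
        (\<exists>B p1 p2. zk_ivp 0 A1 A2 Q c1 a1 c2 a2 1 (F N) B p1 p2) \<and>
        (\<forall>B p1 p2 t. zk_ivp 0 A1 A2 Q c1 a1 c2 a2 1 (F N) B p1 p2 \<longrightarrow> 0 < t \<and> t \<le> 1 \<and> (4 / \<bar>c1\<bar>) / t \<le> N \<longrightarrow>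
           c * t * N powr e \<le> sobolev_norm l (\<lambda>x. of_real (p1 t x)))" if N: "1 \<le> N" for N
  proof -
    have L: "0 < 1 / N" using N by simp
    have m0: "0 \<le> m N" by (simp add: m_def)
    have m2: "(m N)\<^sup>2 * N = N powr (- 2 * k) / 16"
    proof -
      have "N powr (- 1 / 2 - k) * N powr (- 1 / 2 - k) * N powr 1 = N powr (- 2 * k)"
        unfolding powr_add[symmetric] by (rule arg_cong[where f = "\<lambda>x. N powr x"]) simp
      then show ?thesis using N by (simp add: m_def power2_eq_square)
    qed
    have wl: "N powr (- 2 * k) / 72 \<le> cmod (w N \<xi>)" if \<xi>: "\<xi> \<in> {N..2 * N}" for \<xi>
    proof -
      have "\<xi>\<^sup>2 \<le> (2 * N)\<^sup>2" using \<xi> N by (intro power_mono) auto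
      then have "(1 / N / sqrt 2 * (\<xi> - 0))\<^sup>2 / 2 \<le> 1" using N by (simp add: power_mult_distrib power_divide divide_simps)
      then have "exp (- 1) \<le> bump (1 / N / sqrt 2) 0 \<xi>" unfolding bump_def by simp
      moreover have "1 / 3 \<le> exp (- 1 :: real)" using exp_le by (simp add: exp_minus inverse_eq_divide field_simps)
      ultimately have b: "1 / 3 \<le> bump (1 / N / sqrt 2) 0 \<xi>" by linarith
      have "sqrt 2 \<le> 3 / 2" by (intro real_le_lsqrt) (auto simp: power2_eq_square)
      then have "2 / 3 \<le> 1 / sqrt 2" by (simp add: field_simps)
      \<comment> \<open>The product \<open>1 / 16 * (2 / 3) * (1 / 3)\<close> is the constant
        \<open>1 / 72\<close>.\<close>
      then have "N powr (- 2 * k) / 16 * (2 / 3 * (1 / 3)) \<le> N powr (- 2 * k) / 16 * (1 / sqrt 2 * bump (1 / N / sqrt 2) 0 \<xi>)"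
        using b by (intro mult_left_mono mult_mono) auto
      also have "\<dots> = (m N)\<^sup>2 / (sqrt 2 * (1 / N)) * bump (1 / N / sqrt 2) 0 \<xi>" unfolding m2[symmetric] using N by simp
      also have "\<dots> \<le> cmod (w N \<xi>)" unfolding w_def norm_of_real by (rule abs_ge_self)
      finally show ?thesis by simp
    qed
    have wN: "w N = (\<lambda>\<xi>. complex_of_real ((m N)\<^sup>2 / (sqrt 2 * (1 / N)) * bump (1 / N / sqrt 2) 0 \<xi>))"
      by (simp add: w_def fun_eq_iff)
    obtain B p1 p2 where sol: "zk_ivp 0 A1 A2 Q c1 a1 c2 a2 1 (F N) B p1 p2"
      and wi: "\<And>l t. integrable lborel (\<lambda>\<xi>. (1 + \<xi>\<^sup>2) powr l * (cmod (wave 1 a1 c1 (\<lambda>t. w N) t \<xi>))\<^sup>2)"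
      and pn: "\<And>l t. sobolev_norm l (\<lambda>x. of_real (p1 t x)) = sqrt (LINT \<xi>|lborel. (1 + \<xi>\<^sup>2) powr l * (cmod (wave 1 a1 c1 (\<lambda>t. w N) t \<xi>))\<^sup>2)"
      by (rule nondispersive_ivp[where ?A1.0 = A1 and ?A2.0 = A2 and Q = Q and ?c1.0 = c1 and ?a1.0 = a1 and ?c2.0 = c2 and ?a2.0 = a2, OF L m0, folded F_def wN]) (rule that)
    have bound: "c * t * N powr e \<le> sobolev_norm l (\<lambda>x. of_real (p1 t x))" if t: "0 < t" "t \<le> 1" "(4 / \<bar>c1\<bar>) / t \<le> N" for t
    proof -
      define H where "H = 10 powr (- \<bar>l\<bar>) * N powr (2 * l) * ((a1 / c1)\<^sup>2 * (N powr (- 2 * k) / 72)\<^sup>2)"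
      have H0: "0 \<le> H" unfolding H_def by (intro mult_nonneg_nonneg) auto
      have ct: "c1 * t \<noteq> 0" "4 / \<bar>c1 * t\<bar> \<le> N" using t c1 by (auto simp: abs_mult)
      have "H * N \<le> H * (LINT \<xi>|lborel. (2 - 2 * cos (c1 * t * \<xi>)) * indicator {N..2 * N} \<xi>)"
        using N by (intro mult_left_mono oscillation_integral ct H0) auto
      also have "\<dots> = (LINT \<xi>|lborel. H * ((2 - 2 * cos (c1 * t * \<xi>)) * indicator {N..2 * N} \<xi>))" by simp
      also have "\<dots> \<le> (LINT \<xi>|lborel. (1 + \<xi>\<^sup>2) powr l * (cmod (wave 1 a1 c1 (\<lambda>t. w N) t \<xi>))\<^sup>2)"
      proof (rule integral_mono'[OF wi])
        fix \<xi>
        show "H * ((2 - 2 * cos (c1 * t * \<xi>)) * indicator {N..2 * N} \<xi>) \<le> (1 + \<xi>\<^sup>2) powr l * (cmod (wave 1 a1 c1 (\<lambda>t. w N) t \<xi>))\<^sup>2"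
        proof (cases "\<xi> \<in> {N..2 * N}")
          case True
          have nz: "\<xi> \<noteq> 0" and t1: "t \<in> {0..1}" using True N t by auto
          have cos: "0 \<le> 2 - 2 * cos (c1 * t * \<xi>)" using cos_le_one[of "c1 * t * \<xi>"] by linarith
          have "(10 powr (- \<bar>l\<bar>) * N powr (2 * l)) * ((a1 / c1)\<^sup>2 * (2 - 2 * cos (c1 * t * \<xi>)) * (N powr (- 2 * k) / 72)\<^sup>2)
              \<le> (1 + \<xi>\<^sup>2) powr l * ((a1 / c1)\<^sup>2 * (2 - 2 * cos (c1 * t * \<xi>)) * (cmod (w N \<xi>))\<^sup>2)"
            using True N cos by (intro mult_mono weight_lower_bound mult_left_mono power_mono wl mult_nonneg_nonneg) auto
          then show ?thesis unfolding wave_constant[OF t1 c1 nz] H_def using True by (simp add: mult_ac)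
        qed simp
      qed simp
      finally have "sqrt (H * N) \<le> sobolev_norm l (\<lambda>x. of_real (p1 t x))" unfolding pn by simp
      moreover have "sqrt (H * N) = c * N powr e"
      proof -
        have "N powr (2 * l) * (N powr (- 2 * k) * N powr (- 2 * k)) * N powr 1 = N powr e * N powr e"
          unfolding powr_add[symmetric] by (rule arg_cong[where f = "\<lambda>x. N powr x"]) (simp add: e_def)
        then have pe: "(N powr e)\<^sup>2 = N powr (2 * l) * (N powr (- 2 * k))\<^sup>2 * N" using N by (simp add: power2_eq_square)
        have "H * N = 10 powr (- \<bar>l\<bar>) * (\<bar>a1 / c1\<bar> / 72)\<^sup>2 * (N powr e)\<^sup>2"
          unfolding H_def pe power_divide power2_abs by simp
        then show ?thesis by (simp add: real_sqrt_mult c_def)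
      qed
      moreover have "c * t * N powr e \<le> c * 1 * N powr e"
        using t by (intro mult_right_mono mult_left_mono) (auto simp: c_def)
      ultimately show ?thesis by simp
    qed
    have "sobolev_norm k' (F N) \<le> 1" if k': "k' \<le> k" for k'
    proof -
      let ?b = "bump (1 / N) 0"
      have le: "(1 + \<xi>\<^sup>2) powr k' * (m N * ?b \<xi>)\<^sup>2 \<le> (m N)\<^sup>2 * N powr (2 * k) * (2 * ?b \<xi>)" for \<xi>
      proof -
        define y where "y = 1 / N * (\<xi> - 0)"
        have "1 \<le> N\<^sup>2" using N by (simp add: one_le_power)
        then have le: "1 + \<xi>\<^sup>2 \<le> N\<^sup>2 * (1 + y\<^sup>2)" using N by (simp add: y_def power_divide distrib_left)
        have "(1 + \<xi>\<^sup>2) powr k' \<le> (1 + \<xi>\<^sup>2) powr k" using k' by (intro powr_mono) auto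
        also have "\<dots> \<le> (N\<^sup>2 * (1 + y\<^sup>2)) powr k" using le k by (intro powr_mono2) auto
        also have "\<dots> = N powr (2 * k) * (1 + y\<^sup>2) powr k"
          using N by (simp add: powr_mult powr_powr flip: powr_numeral)
        also have "\<dots> \<le> N powr (2 * k) * (1 + y\<^sup>2)"
          using powr_mono[of k 1 "1 + y\<^sup>2"] k by (intro mult_left_mono) auto
        finally have "(1 + \<xi>\<^sup>2) powr k' * (m N * ?b \<xi>)\<^sup>2 \<le> (N powr (2 * k) * (1 + y\<^sup>2)) * (m N * ?b \<xi>)\<^sup>2"
          by (intro mult_right_mono) auto
        also have "\<dots> = (m N)\<^sup>2 * N powr (2 * k) * (((1 + y\<^sup>2) * ?b \<xi>) * ?b \<xi>)" by (simp add: power2_eq_square mult_ac)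
        also have "\<dots> \<le> (m N)\<^sup>2 * N powr (2 * k) * (2 * ?b \<xi>)"
        proof -
          have "1 + y\<^sup>2 \<le> 2 * exp (y\<^sup>2 / 2)" using exp_ge_add_one_self[of "y\<^sup>2 / 2"] by linarith
          then have "(1 + y\<^sup>2) * ?b \<xi> \<le> 2 * exp (y\<^sup>2 / 2) * ?b \<xi>" by (intro mult_right_mono bump_nonneg)
          also have "\<dots> = 2" unfolding bump_def y_def by (simp flip: exp_add)
          finally show ?thesis by (intro mult_left_mono mult_right_mono bump_nonneg) auto
        qed
        finally show ?thesis .
      qed
      have hi: "integrable lborel (\<lambda>\<xi>. (m N)\<^sup>2 * N powr (2 * k) * (2 * ?b \<xi>))"
        by (intro integrable_mult_right impI bump_integrable L)
      have ii: "integrable lborel (\<lambda>\<xi>. complex_of_real (m N * ?b \<xi>))"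
        by (intro integrable_of_real integrable_mult_right impI bump_integrable L)
      have "(LINT \<xi>|lborel. (1 + \<xi>\<^sup>2) powr k' * (cmod (of_real (m N * ?b \<xi>)))\<^sup>2) \<le> (LINT \<xi>|lborel. (m N)\<^sup>2 * N powr (2 * k) * (2 * ?b \<xi>))"
      proof (rule integral_mono'[OF hi])
        show "0 \<le> (m N)\<^sup>2 * N powr (2 * k) * (2 * ?b \<xi>)" for \<xi> using bump_nonneg[of "1 / N" 0 \<xi>] by (intro mult_nonneg_nonneg) auto
      qed (use le in \<open>auto simp: norm_mult power_mult_distrib\<close>)
      also have "\<dots> = 2 * sqrt (2 * pi) * (N powr (2 * k) * ((m N)\<^sup>2 * N))" using L by (simp add: bump_integral)
      also have "\<dots> = 2 * sqrt (2 * pi) / 16" unfolding m2 using N by (simp flip: powr_add)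
      also have "\<dots> \<le> 1"
      proof -
        have "sqrt (2 * pi) \<le> 6" using pi_less_4 by (intro real_le_lsqrt) auto
        then show ?thesis by simp
      qed
      finally show ?thesis unfolding F_def sobolev_norm_eq[OF has_fourier_ift[OF ii]] by simp
    qed
    moreover have "F N \<in> schwartz"
    proof -
      have "F N = pgauss [:of_real (m N * N):] (1 / (2 * (1 / N)\<^sup>2)) (\<i> * of_real 0)"
        unfolding F_def of_real_mult ift_cmult[abs_def] ift_bump[OF L] by (simp add: pgauss_def fun_eq_iff)
      then show ?thesis using N by (simp add: schwartz_pgauss)
    qed
    moreover have "c * t * N powr e \<le> sobolev_norm l (\<lambda>x. of_real (p1' t x))"
      if "zk_ivp 0 A1 A2 Q c1 a1 c2 a2 1 (F N) B' p1' p2'" "0 < t" "t \<le> 1" "(4 / \<bar>c1\<bar>) / t \<le> N" for B' p1' p2' t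
    proof -
      have "p1' t = p1 t"
      proof (rule zk_unique_no_dispersion[OF zero_le_one])
        show "zk_solution 0 A1 A2 Q c1 a1 c2 a2 1 B' p1' p2'" "zk_solution 0 A1 A2 Q c1 a1 c2 a2 1 B p1 p2"
          using that(1) sol by (simp_all only: zk_ivp_def)
        show "B' 0 = B 0" "p1' 0 = p1 0" using that(1) sol by (simp_all only: zk_ivp_def)
        show "t \<in> {0..1}" using that by simp
      qed
      then show ?thesis using bound[OF that(2-4)] by simp
    qed
    moreover have "\<exists>B p1 p2. zk_ivp 0 A1 A2 Q c1 a1 c2 a2 1 (F N) B p1 p2" by (intro exI) (rule sol)
    ultimately show ?thesis by (intro conjI allI impI) simp_all
  qed
  moreover have "0 < c" unfolding c_def using a1 c1 by simp
  moreover have "0 < e" using l by (simp add: e_def)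
  moreover have "0 < 4 / \<bar>c1\<bar>" using c1 by simp
  ultimately show ?thesis unfolding norm_inflation_def
    by (intro exI[of _ 1] exI[of _ e] exI[of _ c] exI[of _ "4 / \<bar>c1\<bar>"] exI[of _ F] conjI[OF order_refl] conjI) simp_all
qed

lemma norm_inflation_holds:
  assumes "c1 \<noteq> 0" "a1 \<noteq> 0" "0 \<le> k" "k \<le> 1" "2 * k - 1 / 2 < l"
  shows "norm_inflation \<omega> A1 A2 Q c1 a1 c2 a2 k l"
  using assms dispersive_norm_inflation nondispersive_norm_inflation by (cases "\<omega> = 0") auto

text \<open>Passage from real \<open>N \<ge> N0\<close> to a sequence: small indices repeat the
  datum of \<open>N0\<close>, and enlarging \<open>C\<close> to \<open>max C N0\<close> excludes
  them from the bound, since \<open>t \<le> 1\<close>. The predicate \<open>P\<close> stands for the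
  initial value problem of the original system with the waves in either order.\<close>

lemma norm_inflation_sequence:
  assumes iff: "\<And>f B p1 p2. P f B p1 p2 \<longleftrightarrow> zk_ivp \<omega> A1 A2 Q c1 a1 c2 a2 1 f B p1 p2"
    and inflation: "norm_inflation \<omega> A1 A2 Q c1 a1 c2 a2 k l" and k': "k' \<le> k"
  obtains \<alpha> c C and f :: "nat \<Rightarrow> real \<Rightarrow> complex" where "0 < \<alpha>" "0 < c" "0 < C"
    "\<And>N. f N \<in> schwartz" "\<And>N. sobolev_norm k' (f N) \<le> 1" "\<And>N. \<exists>B p1 p2. P (f N) B p1 p2"
    "\<And>N B p1 p2 t. P (f N) B p1 p2 \<Longrightarrow> 0 < t \<Longrightarrow> t \<le> 1 \<Longrightarrow> C / t \<le> real N \<Longrightarrow>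
       c * t * real N powr \<alpha> \<le> sobolev_norm l (\<lambda>x. of_real (p1 t x))"
proof -
  obtain N0 \<alpha> c C F where *: "1 \<le> N0" "0 < \<alpha>" "0 < c" "0 < C" and F: "\<And>N. N0 \<le> N \<Longrightarrow> F N \<in> schwartz \<and> (\<forall>k'\<le>k. sobolev_norm k' (F N) \<le> 1) \<and>
        (\<exists>B p1 p2. P (F N) B p1 p2) \<and>
        (\<forall>B p1 p2 t. P (F N) B p1 p2 \<longrightarrow> 0 < t \<and> t \<le> 1 \<and> C / t \<le> N \<longrightarrow>
           c * t * N powr \<alpha> \<le> sobolev_norm l (\<lambda>x. of_real (p1 t x)))"
    using inflation unfolding norm_inflation_def iff[symmetric] by metis
  let ?f = "\<lambda>N. F (max (real N) N0)"
  have m: "N0 \<le> max (real N) N0" for N by simp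
  have ge: "max (real N) N0 = real N \<and> C / t \<le> real N" if t: "0 < t" "t \<le> 1" "max C N0 / t \<le> real N" for N t
  proof -
    have "max C N0 \<le> max C N0 / t" using t * by (subst pos_le_divide_eq) (auto intro!: mult_right_le)
    moreover have "C / t \<le> max C N0 / t" using t by (intro divide_right_mono) auto
    ultimately show ?thesis using t(3) by linarith
  qed
  show thesis
  proof (rule that[of \<alpha> c "max C N0" ?f])
    show "0 < max C N0" using * by simp
    show "?f N \<in> schwartz" "sobolev_norm k' (?f N) \<le> 1" "\<exists>B p1 p2. P (?f N) B p1 p2" for N
      using F[OF m, of N] k' by simp_all
    fix N B p1 p2 t
    assume z: "P (?f N) B p1 p2" and t: "0 < t" "t \<le> 1" "max C N0 / t \<le> real N"
    show "c * t * real N powr \<alpha> \<le> sobolev_norm l (\<lambda>x. of_real (p1 t x))"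
    proof -
      have "\<forall>B p1 p2 t. P (?f N) B p1 p2 \<longrightarrow> 0 < t \<and> t \<le> 1 \<and> C / t \<le> max (real N) N0 \<longrightarrow>
           c * t * max (real N) N0 powr \<alpha> \<le> sobolev_norm l (\<lambda>x. of_real (p1 t x))"
        by (rule conjunct2[OF conjunct2[OF conjunct2[OF F[OF m, of N]]]])
      from this[rule_format, OF z, of t] show ?thesis using t ge[OF t] by simp
    qed
  qed (use * in auto)
qed

subsection \<open>The Zakharov-Rubenchik system\<close>

lemma has_vector_derivative_iff_vector_derivative:
  fixes f :: "real \<Rightarrow> 'a::euclidean_space"
  assumes "0 < T" "t \<in> {0..T}"
  shows "(f has_vector_derivative d) (at t within {0..T}) \<longleftrightarrow>
    f differentiable (at t within {0..T}) \<and> vector_derivative f (at t within {0..T}) = d"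
  using vector_derivative_within_closed_interval[OF assms, of f d] vector_derivative_works[of f "at t within {0..T}"]
  by (auto intro: differentiableI_vector)

text \<open>Multiplication by \<open>- \<i>\<close> in the first equation and division by
  \<open>\<theta>\<close> in the others solve for the time derivative; the sign of the second wave's
  speed and coupling is moved into the coefficients.\<close>

lemma ZR_ivp_iff:
  assumes \<theta>: "\<theta> \<noteq> 0" and T: "0 < T"
  shows "ZR_ivp \<theta> \<gamma> \<omega> \<nu> \<beta> q T f B \<psi>1 \<psi>2 \<longleftrightarrow>
    zk_ivp \<omega> (\<gamma> * (sqrt \<beta> - \<nu> / 2)) (- (\<gamma> * (sqrt \<beta> + \<nu> / 2))) (\<gamma> * q)
      ((sqrt \<beta> - \<nu>) / \<theta>) (\<gamma> / 2 * (- 1 + \<nu> / (2 * sqrt \<beta>)) / \<theta>)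
      (- ((\<nu> + sqrt \<beta>) / \<theta>)) (\<gamma> / 2 * (- 1 - \<nu> / (2 * sqrt \<beta>)) / \<theta>) T f B \<psi>1 \<psi>2"
proof -
  have e1: "\<i> * d + of_real \<omega> * b2 = of_real (\<gamma> * (sqrt \<beta> - \<nu> / 2) * u) * b - of_real (\<gamma> * (sqrt \<beta> + \<nu> / 2) * v) * b + of_real (\<gamma> * q * n) * b
    \<longleftrightarrow> d = \<i> * (of_real \<omega> * b2 - of_real (\<gamma> * (sqrt \<beta> - \<nu> / 2) * u + - (\<gamma> * (sqrt \<beta> + \<nu> / 2)) * v + \<gamma> * q * n) * b)" for d b2 b :: complex and u v n
  proof -
    have i: "\<i> * d + x = y \<longleftrightarrow> d = \<i> * (x - y)" for x y by (auto simp: complex_eq_iff)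
    show ?thesis unfolding i by (simp add: algebra_simps)
  qed
  have e2: "\<theta> * d + a * u = g * n \<longleftrightarrow> d = g / \<theta> * n - a / \<theta> * u" "\<theta> * d - a * u = g * n \<longleftrightarrow> d = g / \<theta> * n - (- (a / \<theta>)) * u" for d a u g n
    using \<theta> by (auto simp: field_simps)
  have body: "(\<lambda>\<tau>. B \<tau> x) differentiable (at t within {0..T}) \<and>
        (\<lambda>\<tau>. \<psi>1 \<tau> x) differentiable (at t within {0..T}) \<and>
        (\<lambda>\<tau>. \<psi>2 \<tau> x) differentiable (at t within {0..T}) \<and>
        B t differentiable (at x) \<and> vderiv (B t) differentiable (at x) \<and>
        \<psi>1 t differentiable (at x) \<and> \<psi>2 t differentiable (at x) \<and>
        \<i> * vector_derivative (\<lambda>\<tau>. B \<tau> x) (at t within {0..T})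
            + complex_of_real \<omega> * vderiv (vderiv (B t)) x
          = complex_of_real (\<gamma> * (sqrt \<beta> - \<nu> / 2) * \<psi>1 t x) * B t x
            - complex_of_real (\<gamma> * (sqrt \<beta> + \<nu> / 2) * \<psi>2 t x) * B t x
            + complex_of_real (\<gamma> * q * (cmod (B t x))\<^sup>2) * B t x \<and>
        \<theta> * vector_derivative (\<lambda>\<tau>. \<psi>1 \<tau> x) (at t within {0..T})
            + (sqrt \<beta> - \<nu>) * vderiv (\<psi>1 t) x
          = \<gamma> / 2 * (- 1 + \<nu> / (2 * sqrt \<beta>)) * vderiv (\<lambda>y. (cmod (B t y))\<^sup>2) x \<and>
        \<theta> * vector_derivative (\<lambda>\<tau>. \<psi>2 \<tau> x) (at t within {0..T})
            - (\<nu> + sqrt \<beta>) * vderiv (\<psi>2 t) x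
          = \<gamma> / 2 * (- 1 - \<nu> / (2 * sqrt \<beta>)) * vderiv (\<lambda>y. (cmod (B t y))\<^sup>2) x \<longleftrightarrow>
        B t differentiable (at x) \<and> vderiv (B t) differentiable (at x) \<and>
        \<psi>1 t differentiable (at x) \<and> \<psi>2 t differentiable (at x) \<and>
        ((\<lambda>\<tau>. B \<tau> x) has_vector_derivative
          \<i> * (of_real \<omega> * vderiv (vderiv (B t)) x
             - of_real (\<gamma> * (sqrt \<beta> - \<nu> / 2) * \<psi>1 t x + - (\<gamma> * (sqrt \<beta> + \<nu> / 2)) * \<psi>2 t x + \<gamma> * q * (cmod (B t x))\<^sup>2) * B t x)) (at t within {0..T}) \<and>
        ((\<lambda>\<tau>. \<psi>1 \<tau> x) has_vector_derivative
          \<gamma> / 2 * (- 1 + \<nu> / (2 * sqrt \<beta>)) / \<theta> * vderiv (\<lambda>y. (cmod (B t y))\<^sup>2) x - (sqrt \<beta> - \<nu>) / \<theta> * vderiv (\<psi>1 t) x) (at t within {0..T}) \<and>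
        ((\<lambda>\<tau>. \<psi>2 \<tau> x) has_vector_derivative
          \<gamma> / 2 * (- 1 - \<nu> / (2 * sqrt \<beta>)) / \<theta> * vderiv (\<lambda>y. (cmod (B t y))\<^sup>2) x - - ((\<nu> + sqrt \<beta>) / \<theta>) * vderiv (\<psi>2 t) x) (at t within {0..T})"
    if t: "t \<in> {0..T}" for t x
    unfolding has_vector_derivative_iff_vector_derivative[OF T t] e1 e2 by blast
  show ?thesis
    unfolding ZR_ivp_def zk_ivp_def ZR_solution_def zk_solution_def
    by (intro arg_cong2[where f = "(\<and>)"] ball_cong refl iff_allI body)
qed

lemma zk_ivp_swap:
  "zk_ivp \<omega> A1 A2 Q c1 a1 c2 a2 T f B p1 p2 \<longleftrightarrow> zk_ivp \<omega> A2 A1 Q c2 a2 c1 a1 T f B p2 p1"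
proof -
  have "zk_ivp \<omega> A2 A1 Q c2 a2 c1 a1 T f B p2 p1" if "zk_ivp \<omega> A1 A2 Q c1 a1 c2 a2 T f B p1 p2"
    for A1 A2 c1 a1 c2 a2 p1 p2
    using that unfolding zk_ivp_def zk_solution_def by (simp add: add.commute)
  then show ?thesis by blast
qed

text \<open>If \<open>\<gamma> = 0\<close>, or if \<open>\<nu> = 2 * sqrt \<beta>\<close> in the
  first part or \<open>\<nu> = - 2 * sqrt \<beta>\<close> in the second, the forcing coefficient of
  the wave in question vanishes; with zero initial value that wave stays zero and no growth is
  possible. These cases are excluded.\<close>

theorem theorem1p3:
  fixes \<theta> \<gamma> \<omega> \<nu> \<beta> q :: real
  assumes "\<theta> \<noteq> 0" and "\<beta> > 0" and "\<beta> - \<nu>\<^sup>2 \<noteq> 0"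
    and "q = \<gamma> + \<nu> * (\<gamma> * \<nu> - 1) / (2 * (\<beta> - \<nu>\<^sup>2))"
    and "\<gamma> \<noteq> 0"
  shows
    "(\<nu> \<noteq> 2 * sqrt \<beta> \<longrightarrow>
       (\<forall>k l :: real. (0 < k \<and> k < 1 \<and> l > 2 * k - 1 / 2) \<or> (k \<le> 0 \<and> l > - 1 / 2) \<longrightarrow>
         (\<exists>T > 0. \<exists>\<alpha> > 0. \<exists>f :: nat \<Rightarrow> real \<Rightarrow> complex.
            (\<forall>N. f N \<in> schwartz \<and> sobolev_norm k (f N) \<le> 1) \<and>
            (\<forall>N. \<exists>B \<psi>1 \<psi>2. ZR_ivp \<theta> \<gamma> \<omega> \<nu> \<beta> q T (f N) B \<psi>1 \<psi>2) \<and>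
            (\<exists>c > 0. \<exists>C > 0. \<forall>N B \<psi>1 \<psi>2. ZR_ivp \<theta> \<gamma> \<omega> \<nu> \<beta> q T (f N) B \<psi>1 \<psi>2 \<longrightarrow>
               (\<forall>t. 0 < t \<and> t \<le> T \<and> real N \<ge> C / t \<longrightarrow>
                  sobolev_norm l (\<lambda>x. complex_of_real (\<psi>1 t x)) \<ge> c * t * real N powr \<alpha>)))))
     \<and>
     (\<nu> \<noteq> - 2 * sqrt \<beta> \<longrightarrow>
       (\<forall>k s :: real. (0 < k \<and> k < 1 \<and> s > 2 * k - 1 / 2) \<or> (k \<le> 0 \<and> s > - 1 / 2) \<longrightarrow>
         (\<exists>T > 0. \<exists>\<alpha> > 0. \<exists>g :: nat \<Rightarrow> real \<Rightarrow> complex.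
            (\<forall>N. g N \<in> schwartz \<and> sobolev_norm k (g N) \<le> 1) \<and>
            (\<forall>N. \<exists>B \<psi>1 \<psi>2. ZR_ivp \<theta> \<gamma> \<omega> \<nu> \<beta> q T (g N) B \<psi>1 \<psi>2) \<and>
            (\<exists>c > 0. \<exists>C > 0. \<forall>N B \<psi>1 \<psi>2. ZR_ivp \<theta> \<gamma> \<omega> \<nu> \<beta> q T (g N) B \<psi>1 \<psi>2 \<longrightarrow>
               (\<forall>t. 0 < t \<and> t \<le> T \<and> real N \<ge> C / t \<longrightarrow>
                  sobolev_norm s (\<lambda>x. complex_of_real (\<psi>2 t x)) \<ge> c * t * real N powr \<alpha>)))))"
proof (intro conjI impI allI)
  have sq: "0 < sqrt \<beta>" "(sqrt \<beta>)\<^sup>2 = \<beta>" using assms(2) by simp_all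
  \<comment> \<open>Both speeds are nonzero, since \<open>\<nu> = sqrt \<beta>\<close> or
    \<open>\<nu> = - sqrt \<beta>\<close> would give \<open>\<beta> = \<nu>\<^sup>2\<close>.\<close>
  have c: "(sqrt \<beta> - \<nu>) / \<theta> \<noteq> 0" "- ((\<nu> + sqrt \<beta>) / \<theta>) \<noteq> 0"
  proof -
    have "\<nu> \<noteq> sqrt \<beta>" using assms(3) sq(2) by auto
    moreover have "\<nu> + sqrt \<beta> \<noteq> 0"
    proof
      assume "\<nu> + sqrt \<beta> = 0"
      then have "\<nu> = - sqrt \<beta>" by linarith
      then show False using assms(3) sq(2) by simp
    qed
    ultimately show "(sqrt \<beta> - \<nu>) / \<theta> \<noteq> 0" "- ((\<nu> + sqrt \<beta>) / \<theta>) \<noteq> 0" using assms(1) by auto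
  qed
  note iff = ZR_ivp_iff[OF assms(1) zero_less_one]
  fix k l :: real
  assume kl: "(0 < k \<and> k < 1 \<and> l > 2 * k - 1 / 2) \<or> (k \<le> 0 \<and> l > - 1 / 2)"
  \<comment> \<open>For \<open>k \<le> 0\<close> the data are built for order 0, which controls the
    norms of all lower orders.\<close>
  then have k: "0 \<le> max k 0" "max k 0 \<le> 1" "2 * max k 0 - 1 / 2 < l" by auto
  {
    assume "\<nu> \<noteq> 2 * sqrt \<beta>"
    then have "\<gamma> / 2 * (- 1 + \<nu> / (2 * sqrt \<beta>)) / \<theta> \<noteq> 0" using assms(1,5) sq(1) by (simp add: field_simps)
    note infl = norm_inflation_holds[OF c(1) this k]
    obtain \<alpha> d C and f :: "nat \<Rightarrow> real \<Rightarrow> complex" where *: "0 < \<alpha>" "0 < d" "0 < C" "\<And>N. f N \<in> schwartz" "\<And>N. sobolev_norm k (f N) \<le> 1"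
      "\<And>N. \<exists>B p1 p2. ZR_ivp \<theta> \<gamma> \<omega> \<nu> \<beta> q 1 (f N) B p1 p2"
      "\<And>N B p1 p2 t. ZR_ivp \<theta> \<gamma> \<omega> \<nu> \<beta> q 1 (f N) B p1 p2 \<Longrightarrow> 0 < t \<Longrightarrow> t \<le> 1 \<Longrightarrow> C / t \<le> real N \<Longrightarrow>
         d * t * real N powr \<alpha> \<le> sobolev_norm l (\<lambda>x. of_real (p1 t x))"
      by (rule norm_inflation_sequence[where P = "ZR_ivp \<theta> \<gamma> \<omega> \<nu> \<beta> q 1", OF iff infl max.cobounded1]) (rule that)
    show "\<exists>T > 0. \<exists>\<alpha> > 0. \<exists>f :: nat \<Rightarrow> real \<Rightarrow> complex.
            (\<forall>N. f N \<in> schwartz \<and> sobolev_norm k (f N) \<le> 1) \<and>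
            (\<forall>N. \<exists>B \<psi>1 \<psi>2. ZR_ivp \<theta> \<gamma> \<omega> \<nu> \<beta> q T (f N) B \<psi>1 \<psi>2) \<and>
            (\<exists>c > 0. \<exists>C > 0. \<forall>N B \<psi>1 \<psi>2. ZR_ivp \<theta> \<gamma> \<omega> \<nu> \<beta> q T (f N) B \<psi>1 \<psi>2 \<longrightarrow>
               (\<forall>t. 0 < t \<and> t \<le> T \<and> real N \<ge> C / t \<longrightarrow>
                  sobolev_norm l (\<lambda>x. complex_of_real (\<psi>1 t x)) \<ge> c * t * real N powr \<alpha>))"
      by (rule exI[of _ 1], rule conjI[OF zero_less_one], rule exI[of _ \<alpha>], rule conjI[OF *(1)], rule exI[of _ f],
          intro conjI allI *(4,5,6), rule exI[of _ d], rule conjI[OF *(2)], rule exI[of _ C], rule conjI[OF *(3)])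
         (intro allI impI, elim conjE, rule *(7))
  }
  {
    assume "\<nu> \<noteq> - 2 * sqrt \<beta>"
    then have "- 1 - \<nu> / (2 * sqrt \<beta>) \<noteq> 0" using sq(1) by (auto simp: field_simps)
    then have "\<gamma> / 2 * (- 1 - \<nu> / (2 * sqrt \<beta>)) / \<theta> \<noteq> 0" using assms(1,5) by simp
    note infl = norm_inflation_holds[OF c(2) this k]
    obtain \<alpha> d C and f :: "nat \<Rightarrow> real \<Rightarrow> complex" where *: "0 < \<alpha>" "0 < d" "0 < C" "\<And>N. f N \<in> schwartz" "\<And>N. sobolev_norm k (f N) \<le> 1"
      "\<And>N. \<exists>B p2 p1. ZR_ivp \<theta> \<gamma> \<omega> \<nu> \<beta> q 1 (f N) B p1 p2"
      "\<And>N B p2 p1 t. ZR_ivp \<theta> \<gamma> \<omega> \<nu> \<beta> q 1 (f N) B p1 p2 \<Longrightarrow> 0 < t \<Longrightarrow> t \<le> 1 \<Longrightarrow> C / t \<le> real N \<Longrightarrow>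
         d * t * real N powr \<alpha> \<le> sobolev_norm l (\<lambda>x. of_real (p2 t x))"
      by (rule norm_inflation_sequence[where P = "\<lambda>f B p2 p1. ZR_ivp \<theta> \<gamma> \<omega> \<nu> \<beta> q 1 f B p1 p2",
            OF trans[OF iff zk_ivp_swap] infl max.cobounded1]) (rule that)
    have ex: "\<exists>B \<psi>1 \<psi>2. ZR_ivp \<theta> \<gamma> \<omega> \<nu> \<beta> q 1 (f N) B \<psi>1 \<psi>2" for N using *(6)[of N] by blast
    show "\<exists>T > 0. \<exists>\<alpha> > 0. \<exists>g :: nat \<Rightarrow> real \<Rightarrow> complex.
            (\<forall>N. g N \<in> schwartz \<and> sobolev_norm k (g N) \<le> 1) \<and>
            (\<forall>N. \<exists>B \<psi>1 \<psi>2. ZR_ivp \<theta> \<gamma> \<omega> \<nu> \<beta> q T (g N) B \<psi>1 \<psi>2) \<and>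
            (\<exists>c > 0. \<exists>C > 0. \<forall>N B \<psi>1 \<psi>2. ZR_ivp \<theta> \<gamma> \<omega> \<nu> \<beta> q T (g N) B \<psi>1 \<psi>2 \<longrightarrow>
               (\<forall>t. 0 < t \<and> t \<le> T \<and> real N \<ge> C / t \<longrightarrow>
                  sobolev_norm l (\<lambda>x. complex_of_real (\<psi>2 t x)) \<ge> c * t * real N powr \<alpha>))"
      by (rule exI[of _ 1], rule conjI[OF zero_less_one], rule exI[of _ \<alpha>], rule conjI[OF *(1)], rule exI[of _ f],
          intro conjI allI *(4,5) ex, rule exI[of _ d], rule conjI[OF *(2)], rule exI[of _ C], rule conjI[OF *(3)])
         (intro allI impI, elim conjE, rule *(7))
  }
qed

end
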